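(* 1) Let $\lambda,\mu$ be 2-part partitions of $n$, let $\mathfrak s\in\mathrm{RStd}(\lambda)$, $\mathfrak t\in\mathrm{RStd}(\mu)$, and let $e_A\in\mathcal E_{J(\mathfrak s)}$ and $e_B\in\mathcal E_{J(\mathfrak t)}$ be verge lidempotents. Then $\mathbb C\mathcal O_A^{J(\mathfrak s)}\cong\mathbb C\mathcal O_B^{J(\mathfrak t)}$ as $\mathbb CU$-modules if and only if $A=B$ (in $M_n(q)$). 2) Let $\lambda=(n-m,m)$ be a composition of $n$ and $\mathfrak s\in\mathrm{RStd}(\lambda)$. Then the $\mathbb CU$-module $M_{\mathfrak s}$ is multiplicity free, its irreducible constituents being of the form $\mathbb C\mathcal O_A^{J}$, $J=J(\mathfrak s)$, where $A\in V_J$ is such that $\mathfrak p=\mathrm{supp}(A)$ is a main condition set with $\mathfrak p_{\mathcal I}\subseteq\underline{\mathfrak s}$ and $\mathfrak p_{\mathcal J}\cap\underline{\mathfrak s}=\emptyset$. The dimension $\dim_{\mathbb C}\mathbb C\mathcal O_A^J=|\mathcal O_A^J|$ depends only on $\mathfrak p$, not on $A\in V_J$ with $\mathrm{supp}(A)=\mathfrak p$, and hence there are $(q-1)^{|\mathfrak p|}$ many orbits $\mathcal O_A^J\subseteq\mathcal E_J$ with $\mathrm{supp}(A)=\mathfrak p$ ($e_A$ a verge) for a given completely hook disconnected main condition set $\mathfrak p$ fitting $\mathfrak s$. As a consequence, the number of irreducible constituents of $M_{\mathfrak s}$ of fixed dimension $q^c$ is a polynomial in $(q-1)$ with integral, non-negative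 coefficients independent of $q$. 3) Each permutation representation of $GL_n(q)$ on the cosets of a maximal parabolic subgroup is isomorphic to $M(\lambda)$ for some partition $\lambda=(n-m,m)$ of $n$. Let $\mathfrak M_\lambda$ be the set of completely hook disconnected main condition sets $\mathfrak p$ which fit at least one row standard $\lambda$-tableau, and for $\mathfrak p\in\mathfrak M_\lambda$ let $k_{\lambda,\mathfrak p}$ be the number of distinct $\mathfrak s\in\mathrm{RStd}(\lambda)$ such that $\mathfrak p$ fits $\mathfrak s$. Then $k_{\lambda,\mathfrak p}$ is independent of $q$ and $$\mathrm{Res}^{GL_n(q)}_U M(\lambda)\cong\bigoplus_{\mathfrak p\in\mathfrak M_\lambda}\ \bigoplus_{A\in M_n(q),\ \mathrm{supp}(A)=\mathfrak p}\bigl([A]\epsilon_A\mathbb CU\bigr)^{k_{\lambda,\mathfrak p}},$$ where the exponent denotes the multiplicity (a direct sum of $k_{\lambda,\mathfrak p}$ copies).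
   Context: Throughout, $q$ is a power of a prime, $\mathbb F_q$ is the field with $q$ elements, $n\in\mathbb N$, $M_n(q)$ is the algebra of $n\times n$-matrices over $\mathbb F_q$, $E$ the identity matrix, $e_{ij}$ the matrix units, $\Phi^-=\{(i,j): 1\leq j<i\leq n\}$, $x_{ij}(\alpha)=E+\alpha e_{ij}$, $X_{ij}=\{x_{ij}(\alpha):\alpha\in\mathbb F_q\}$, and $U=U_n(q)$ is the group of lower unitriangular matrices in $GL_n(q)$. For $A\in M_n(q)$, $\mathrm{supp}(A)=\{(i,j): A_{ij}\neq 0\}$. For $S\subseteq\Phi^-$ let $V_S=\{A\in M_n(q): \mathrm{supp}(A)\subseteq S\}$; $S$ is closed if $(i,j),(j,k)\in S$ implies $(i,k)\in S$, and then $U_S=\{E+A: A\in V_S\}$ is a subgroup of $U$. Fix a nontrivial linear character $\theta:(\mathbb F_q,+)\to\mathbb C^*$; for $A,B\in V_S$ put $\chi_A(B)=\theta(\sum_{(i,j)\in S}A_{ij}B_{ij})$. A bar over a complex number denotes complex conjugation. Main condition sets. A main condition set is a (possibly empty) subset $\mathfrak p=\{(i_1,j_1),\dots,(i_k,j_k)\}\subseteq\Phi^-$ with $i_1,\dots,i_k$ pairwise different and $j_1,\dots,j_k$ pairwise different; $\mathfrak p_{\mathcal I}=\{i_1,\dots,i_k\}$, $\mathfrak p_{\mathcal J}=\{j_1,\dots,j_k\}$. It is completely hook disconnected if $\mathfrak p_{\mathcal I}\cap\mathfrak p_{\mathcal J}=\emptyset$. Lidempotents of $U$. For $A\in V_{\Phi^-}$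 let $[A]=q^{-|\Phi^-|}\sum_{u\in U}\overline{\chi_A(u-E)}\,u\in\mathbb CU$. If $\mathrm{supp}(A)=\mathfrak p$ is a completely hook disconnected main condition set, define $\mathcal R=\{(r,s)\in\Phi^-: s\notin\mathfrak p_{\mathcal J}\}\cup\{(r,j_\nu): 1\leq\nu\leq k,\ i_\nu\leq r\leq n\}$, $\hat{\mathcal R}=\mathcal R\cup\{(b,j)\in\Phi^-: \text{there are } (i,j),(r,b)\in\mathfrak p \text{ with } j<b<i<r\}$, $\hat{\mathcal R}^-=\hat{\mathcal R}\setminus\mathfrak p$. These sets are closed, $U_{\hat{\mathcal R}^-}\trianglelefteq U_{\hat{\mathcal R}}$ and $U_{\hat{\mathcal R}}/U_{\hat{\mathcal R}^-}\cong X_{i_1j_1}\times\dots\times X_{i_kj_k}$. Let $\psi_A$ be the linear character of $U_{\hat{\mathcal R}}$ which is trivial on $U_{\hat{\mathcal R}^-}$ and sends $x_{i_\nu j_\nu}(\alpha)$ to $\theta(\alpha A_{i_\nu j_\nu})$, and let $\epsilon_A=|U_{\hat{\mathcal R}}|^{-1}\sum_{u}\psi_A(u^{-1})u\in\mathbb CU_{\hat{\mathcal R}}$ be the corresponding primitive idempotent. Then $[A]\epsilon_A\mathbb CU$ is an irreducible $\mathbb CU$-module isomorphic to $\mathrm{Ind}_{U_{\hat{\mathcal R}}}^U\psi_A$. Two part compositions. Let $\lambda=(n-m,m)$, $1\leq m\leq n-1$, be a 2-part composition of $n$; it is a (2-part) partition if $m\leq n-m$. A row standard $\lambda$-tableau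 $\mathfrak s$ is an arrangement of $1,\dots,n$ (each used once) into a first row of length $n-m$ and a second row of length $m$, increasing along rows; $\mathrm{RStd}(\lambda)$ is the set of these, and $\underline{\mathfrak s}$ denotes the set of entries of the second row. A main condition set $\mathfrak p$ fits $\mathfrak s$ if $\mathfrak p_{\mathcal I}\subseteq\underline{\mathfrak s}$ and $\mathfrak p_{\mathcal J}\cap\underline{\mathfrak s}=\emptyset$. Let $s_1,\dots,s_n$ be the entries of $\mathfrak s$ read along the rows, first row first, and let $d=d(\mathfrak s)$ be the permutation matrix with entry $1$ at the positions $(a,s_a)$. Put $J=J(\mathfrak s)=\{(i,j)\in\Phi^-: i\in\underline{\mathfrak s},\ j\notin\underline{\mathfrak s}\}$, $L=L(\mathfrak s)=\{(i,j)\in\Phi^-: i,j\in\underline{\mathfrak s}\text{ or } i,j\notin\underline{\mathfrak s}\}$, $K=J\cup L$; these are closed. Let $P_\lambda$ be the subgroup of all $g\in GL_n(q)$ with $g_{ab}=0$ whenever $a>n-m\geq b$, $\overline{P_\lambda}=\sum_{h\in P_\lambda}h$, $M(\lambda)=\overline{P_\lambda}\,\mathbb CGL_n(q)\cong\mathrm{Ind}_{P_\lambda}^{GL_n(q)}\mathbb C$ (the permutation module on the cosets of $P_\lambda$), and $M_{\mathfrak s}=\overline{P_\lambda}\,d\,\mathbb CU\subseteq M(\lambda)$, a right $\mathbb CU$-module with basis $\{\overline{P_\lambda}du: u\in U_J\}$. For $A\in V_J$ let $e_A\in M_{\mathfrak s}$ be (up to a fixed nonzero scalar, the same for all $A$)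 the element $q^{-|J|}\sum_{u\in U_J}\overline{\chi_A(u-E)}\,\overline{P_\lambda}du$. The set $\mathcal E_J=\{e_A: A\in V_J\}$ ("lidempotents") is a basis of $M_{\mathfrak s}$ which is permuted by $U_K$ up to nonzero scalars. $\mathcal O_A^J$ denotes the $U_K$-orbit of $e_A$, i.e. the set of all $e_B$ such that $e_Ag$ is a scalar multiple of $e_B$ for some $g\in U_K$; its span $\mathbb C\mathcal O_A^J$ is a $\mathbb CU$-submodule of $M_{\mathfrak s}$. $e_A$ ($A\in V_J$) is called a verge if each row and each column of $A$ contains at most one nonzero entry; every orbit contains exactly one verge. *)

theory Defs
  imports Complex_Main "HOL-Library.FuncSet" "HOL-Library.Function_Algebras"
    "HOL-Algebra.Ring" "HOL-Algebra.Coset" "HOL-Computational_Algebra.Polynomial"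
begin

text \<open>
  All complex vector spaces are subspaces of function spaces \<open>'x \<Rightarrow> complex\<close>.  The element
  \<open>\<Sum>g. a\<^sub>g g\<close> of \<open>\<complex>G\<close> is the function \<open>a\<close>, which vanishes outside \<open>carrier G\<close>.  Hence
  \<open>\<complex>H \<subseteq> \<complex>G\<close> for a subgroup \<open>H\<close> of \<open>G\<close>, and the restriction to \<open>H\<close> of a \<open>\<complex>G\<close>-module is the same
  record, considered over the group \<open>H\<close>.
\<close>

global_interpretation cfun: vector_space "\<lambda>(c::complex) (f::'x \<Rightarrow> complex). (\<lambda>x. c * f x)"
  by unfold_locales (auto simp: fun_eq_iff algebra_simps)

definition group_algebra :: "('g, 'm) monoid_scheme \<Rightarrow> ('g \<Rightarrow> complex) set" where
  "group_algebra G = {a. \<forall>g. g \<notin> carrier G \<longrightarrow> a g = 0}"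

definition ga_single :: "'g \<Rightarrow> 'g \<Rightarrow> complex" where
  "ga_single h = (\<lambda>g. if g = h then 1 else 0)"

definition ga_mult :: "('g, 'm) monoid_scheme \<Rightarrow> ('g \<Rightarrow> complex) \<Rightarrow> ('g \<Rightarrow> complex) \<Rightarrow> 'g \<Rightarrow> complex" where
  "ga_mult G a b = (\<lambda>g. if g \<in> carrier G
      then \<Sum>h\<in>carrier G. a h * b (inv\<^bsub>G\<^esub> h \<otimes>\<^bsub>G\<^esub> g) else 0)"

record ('g, 'x) cg_mod =
  mspace :: "('x \<Rightarrow> complex) set"
  mact :: "('x \<Rightarrow> complex) \<Rightarrow> ('g \<Rightarrow> complex) \<Rightarrow> ('x \<Rightarrow> complex)"

definition cg_module :: "('g, 'm) monoid_scheme \<Rightarrow> ('g, 'x) cg_mod \<Rightarrow> bool" where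
  "cg_module G M \<longleftrightarrow>
     cfun.subspace (mspace M) \<and>
     (\<forall>v\<in>mspace M. \<forall>a\<in>group_algebra G. mact M v a \<in> mspace M) \<and>
     (\<forall>v\<in>mspace M. \<forall>w\<in>mspace M. \<forall>a\<in>group_algebra G.
        mact M (v + w) a = mact M v a + mact M w a) \<and>
     (\<forall>v\<in>mspace M. \<forall>a\<in>group_algebra G. \<forall>b\<in>group_algebra G.
        mact M v (a + b) = mact M v a + mact M v b) \<and>
     (\<forall>v\<in>mspace M. \<forall>a\<in>group_algebra G. \<forall>c.
        mact M (\<lambda>x. c * v x) a = (\<lambda>x. c * mact M v a x) \<and>
        mact M v (\<lambda>g. c * a g) = (\<lambda>x. c * mact M v a x)) \<and>
     (\<forall>v\<in>mspace M. mact M v (ga_single \<one>\<^bsub>G\<^esub>) = v) \<and>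
     (\<forall>v\<in>mspace M. \<forall>a\<in>group_algebra G. \<forall>b\<in>group_algebra G.
        mact M (mact M v a) b = mact M v (ga_mult G a b))"

definition mod_iso :: "('g, 'm) monoid_scheme \<Rightarrow> ('g, 'x) cg_mod \<Rightarrow> ('g, 'y) cg_mod \<Rightarrow> bool" where
  "mod_iso G M N \<longleftrightarrow> cg_module G M \<and> cg_module G N \<and>
     (\<exists>\<phi>. bij_betw \<phi> (mspace M) (mspace N) \<and>
        (\<forall>v\<in>mspace M. \<forall>w\<in>mspace M. \<phi> (v + w) = \<phi> v + \<phi> w) \<and>
        (\<forall>v\<in>mspace M. \<forall>c. \<phi> (\<lambda>x. c * v x) = (\<lambda>y. c * \<phi> v y)) \<and>
        (\<forall>v\<in>mspace M. \<forall>a\<in>group_algebra G. \<phi> (mact M v a) = mact N (\<phi> v) a))"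

definition submod :: "('g, 'm) monoid_scheme \<Rightarrow> ('g, 'x) cg_mod \<Rightarrow> ('x \<Rightarrow> complex) set \<Rightarrow> bool" where
  "submod G M W \<longleftrightarrow> W \<subseteq> mspace M \<and> cfun.subspace W \<and>
     (\<forall>v\<in>W. \<forall>a\<in>group_algebra G. mact M v a \<in> W)"

definition irreducible_mod :: "('g, 'm) monoid_scheme \<Rightarrow> ('g, 'x) cg_mod \<Rightarrow> bool" where
  "irreducible_mod G M \<longleftrightarrow> cg_module G M \<and> mspace M \<noteq> {0} \<and>
     (\<forall>W. submod G M W \<longrightarrow> W = {0} \<or> W = mspace M)"

text \<open>\<open>M\<close> is the internal direct sum of the finite set \<open>D\<close> of irreducible submodules.\<close>

definition irreducible_decomposition ::
  "('g, 'm) monoid_scheme \<Rightarrow> ('g, 'x) cg_mod \<Rightarrow> ('x \<Rightarrow> complex) set set \<Rightarrow> bool" where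
  "irreducible_decomposition G M D \<longleftrightarrow> cg_module G M \<and> finite D \<and>
     (\<forall>W\<in>D. submod G M W \<and> irreducible_mod G (M\<lparr>mspace := W\<rparr>)) \<and>
     (\<forall>v\<in>mspace M. \<exists>!f. f \<in> (\<Pi>\<^sub>E W\<in>D. W) \<and> v = (\<Sum>W\<in>D. f W))"

definition multiplicity_free :: "('g, 'm) monoid_scheme \<Rightarrow> ('g, 'x) cg_mod \<Rightarrow> bool" where
  "multiplicity_free G M \<longleftrightarrow> (\<exists>D. irreducible_decomposition G M D) \<and>
     (\<forall>D. irreducible_decomposition G M D \<longrightarrow>
        (\<forall>V\<in>D. \<forall>W\<in>D. mod_iso G (M\<lparr>mspace := V\<rparr>) (M\<lparr>mspace := W\<rparr>) \<longrightarrow> V = W))"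

definition irreducible_constituent ::
  "('g, 'm) monoid_scheme \<Rightarrow> ('g, 'x) cg_mod \<Rightarrow> ('g, 'y) cg_mod \<Rightarrow> bool" where
  "irreducible_constituent G M S \<longleftrightarrow>
     (\<exists>D. irreducible_decomposition G M D \<and> (\<exists>W\<in>D. mod_iso G S (M\<lparr>mspace := W\<rparr>)))"

definition direct_sum :: "'i set \<Rightarrow> ('i \<Rightarrow> ('g, 'x) cg_mod) \<Rightarrow> ('g, 'i \<times> 'x) cg_mod" where
  "direct_sum I M = \<lparr>
     mspace = {f. (\<forall>i\<in>I. (\<lambda>x. f (i, x)) \<in> mspace (M i)) \<and> (\<forall>i x. i \<notin> I \<longrightarrow> f (i, x) = 0)},
     mact = (\<lambda>f a (i, x). if i \<in> I then mact (M i) (\<lambda>y. f (i, y)) a x else 0)\<rparr>"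

definition mod_copies :: "nat \<Rightarrow> ('g, 'x) cg_mod \<Rightarrow> ('g, nat \<times> 'x) cg_mod" where
  "mod_copies k M = direct_sum {..<k} (\<lambda>_. M)"

text \<open>The right submodule \<open>x \<complex>H\<close> of \<open>\<complex>G\<close>, for a subgroup \<open>H\<close> of \<open>G\<close>.\<close>

definition cyclic_mod ::
  "('g, 'm) monoid_scheme \<Rightarrow> ('g, 'k) monoid_scheme \<Rightarrow> ('g \<Rightarrow> complex) \<Rightarrow> ('g, 'g) cg_mod" where
  "cyclic_mod G H x = \<lparr>mspace = ga_mult G x ` group_algebra H, mact = ga_mult G\<rparr>"

text \<open>The permutation module on the right cosets of \<open>P\<close>: the coset \<open>X\<close> times \<open>g\<close> is \<open>X g\<close>.\<close>

definition coset_perm_mod :: "('g, 'm) monoid_scheme \<Rightarrow> 'g set \<Rightarrow> ('g, 'g set) cg_mod" where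
  "coset_perm_mod G P = \<lparr>
     mspace = {f. \<forall>X. X \<notin> rcosets\<^bsub>G\<^esub> P \<longrightarrow> f X = 0},
     mact = (\<lambda>f a X. if X \<in> rcosets\<^bsub>G\<^esub> P
        then \<Sum>g\<in>carrier G. a g * f (X #>\<^bsub>G\<^esub> inv\<^bsub>G\<^esub> g) else 0)\<rparr>"

text \<open>
  The field is a ring record and not a type of class \<open>field\<close>, so that a single formula can
  quantify over all finite fields (needed to say "independent of \<open>q\<close>").
\<close>

definition finite_field :: "'f ring \<Rightarrow> bool" where
  "finite_field F \<longleftrightarrow> field F \<and> finite (carrier F)"

definition nontrivial_add_character :: "'f ring \<Rightarrow> ('f \<Rightarrow> complex) \<Rightarrow> bool" where
  "nontrivial_add_character F \<theta> \<longleftrightarrow>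
     (\<forall>x\<in>carrier F. \<theta> x \<noteq> 0) \<and>
     (\<forall>x\<in>carrier F. \<forall>y\<in>carrier F. \<theta> (x \<oplus>\<^bsub>F\<^esub> y) = \<theta> x * \<theta> y) \<and>
     (\<exists>x\<in>carrier F. \<theta> x \<noteq> 1)"

type_synonym 'f matrix = "nat \<times> nat \<Rightarrow> 'f"

definition mat_ring :: "'f ring \<Rightarrow> nat \<Rightarrow> 'f matrix ring" where
  "mat_ring F n = \<lparr>
     carrier = ({1..n} \<times> {1..n}) \<rightarrow>\<^sub>E carrier F,
     monoid.mult = (\<lambda>A B. \<lambda>(i, j)\<in>{1..n} \<times> {1..n}. \<Oplus>\<^bsub>F\<^esub>k\<in>{1..n}. A (i, k) \<otimes>\<^bsub>F\<^esub> B (k, j)),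
     monoid.one = (\<lambda>(i, j)\<in>{1..n} \<times> {1..n}. if i = j then \<one>\<^bsub>F\<^esub> else \<zero>\<^bsub>F\<^esub>),
     ring.zero = (\<lambda>(i, j)\<in>{1..n} \<times> {1..n}. \<zero>\<^bsub>F\<^esub>),
     ring.add = (\<lambda>A B. \<lambda>(i, j)\<in>{1..n} \<times> {1..n}. A (i, j) \<oplus>\<^bsub>F\<^esub> B (i, j))\<rparr>"

definition GL :: "'f ring \<Rightarrow> nat \<Rightarrow> 'f matrix monoid" where
  "GL F n = units_of (mat_ring F n)"

definition scaled_unit :: "'f ring \<Rightarrow> nat \<Rightarrow> nat \<times> nat \<Rightarrow> 'f \<Rightarrow> 'f matrix" where
  "scaled_unit F n e \<alpha> = (\<lambda>e'\<in>{1..n} \<times> {1..n}. if e' = e then \<alpha> else \<zero>\<^bsub>F\<^esub>)"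

definition root_elem :: "'f ring \<Rightarrow> nat \<Rightarrow> nat \<times> nat \<Rightarrow> 'f \<Rightarrow> 'f matrix" where
  "root_elem F n e \<alpha> = \<one>\<^bsub>mat_ring F n\<^esub> \<oplus>\<^bsub>mat_ring F n\<^esub> scaled_unit F n e \<alpha>"

definition neg_roots :: "nat \<Rightarrow> (nat \<times> nat) set" where
  "neg_roots n = {(i, j). 1 \<le> j \<and> j < i \<and> i \<le> n}"

definition supp :: "'f ring \<Rightarrow> nat \<Rightarrow> 'f matrix \<Rightarrow> (nat \<times> nat) set" where
  "supp F n A = {e \<in> {1..n} \<times> {1..n}. A e \<noteq> \<zero>\<^bsub>F\<^esub>}"

definition VS :: "'f ring \<Rightarrow> nat \<Rightarrow> (nat \<times> nat) set \<Rightarrow> 'f matrix set" where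
  "VS F n S = {A \<in> carrier (mat_ring F n). supp F n A \<subseteq> S}"

definition US :: "'f ring \<Rightarrow> nat \<Rightarrow> (nat \<times> nat) set \<Rightarrow> 'f matrix set" where
  "US F n S = {\<one>\<^bsub>mat_ring F n\<^esub> \<oplus>\<^bsub>mat_ring F n\<^esub> A | A. A \<in> VS F n S}"

definition U :: "'f ring \<Rightarrow> nat \<Rightarrow> 'f matrix monoid" where
  "U F n = (GL F n)\<lparr>carrier := US F n (neg_roots n)\<rparr>"

definition chi :: "'f ring \<Rightarrow> ('f \<Rightarrow> complex) \<Rightarrow> (nat \<times> nat) set \<Rightarrow> 'f matrix \<Rightarrow> 'f matrix \<Rightarrow> complex" where
  "chi F \<theta> S A B = \<theta> (\<Oplus>\<^bsub>F\<^esub>e\<in>S. A e \<otimes>\<^bsub>F\<^esub> B e)"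

text \<open>The element \<open>q\<^bsup>-|S|\<^esup> \<Sum>u\<in>U\<^sub>S. cnj (\<chi>\<^sub>A (u - E)) u\<close>; for \<open>S = neg_roots n\<close> this is \<open>[A]\<close>.\<close>

definition lidem :: "'f ring \<Rightarrow> ('f \<Rightarrow> complex) \<Rightarrow> nat \<Rightarrow> (nat \<times> nat) set \<Rightarrow> 'f matrix \<Rightarrow> 'f matrix \<Rightarrow> complex" where
  "lidem F \<theta> n S A = (\<lambda>u. if u \<in> US F n S
     then cnj (chi F \<theta> S A (u \<ominus>\<^bsub>mat_ring F n\<^esub> \<one>\<^bsub>mat_ring F n\<^esub>)) / of_nat (card (carrier F)) ^ card S
     else 0)"

definition main_condition_set :: "nat \<Rightarrow> (nat \<times> nat) set \<Rightarrow> bool" where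
  "main_condition_set n p \<longleftrightarrow> p \<subseteq> neg_roots n \<and> inj_on fst p \<and> inj_on snd p"

definition completely_hook_disconnected :: "(nat \<times> nat) set \<Rightarrow> bool" where
  "completely_hook_disconnected p \<longleftrightarrow> fst ` p \<inter> snd ` p = {}"

definition R_set :: "nat \<Rightarrow> (nat \<times> nat) set \<Rightarrow> (nat \<times> nat) set" where
  "R_set n p = {(r, s). (r, s) \<in> neg_roots n \<and> s \<notin> snd ` p} \<union>
     {(r, j) | r i j. (i, j) \<in> p \<and> i \<le> r \<and> r \<le> n}"

definition R_hat :: "nat \<Rightarrow> (nat \<times> nat) set \<Rightarrow> (nat \<times> nat) set" where
  "R_hat n p = R_set n p \<union>
     {(b, j). (b, j) \<in> neg_roots n \<and>
        (\<exists>i r. (i, j) \<in> p \<and> (r, b) \<in> p \<and> j < b \<and> b < i \<and> i < r)}"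

definition is_psi :: "'f ring \<Rightarrow> ('f \<Rightarrow> complex) \<Rightarrow> nat \<Rightarrow> 'f matrix \<Rightarrow> ('f matrix \<Rightarrow> complex) \<Rightarrow> bool" where
  "is_psi F \<theta> n A \<psi> \<longleftrightarrow> (let p = supp F n A; H = US F n (R_hat n p) in
     \<psi> \<in> H \<rightarrow>\<^sub>E (UNIV - {0}) \<and>
     (\<forall>u\<in>H. \<forall>v\<in>H. \<psi> (u \<otimes>\<^bsub>GL F n\<^esub> v) = \<psi> u * \<psi> v) \<and>
     (\<forall>u\<in>US F n (R_hat n p - p). \<psi> u = 1) \<and>
     (\<forall>e\<in>p. \<forall>\<alpha>\<in>carrier F. \<psi> (root_elem F n e \<alpha>) = \<theta> (\<alpha> \<otimes>\<^bsub>F\<^esub> A e)))"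

text \<open>
  \<open>is_psi\<close> determines \<open>\<psi>\<close> only if \<open>supp F n A\<close> is a completely hook disconnected main condition
  set; \<open>psi\<close> is not used for other \<open>A\<close>.
\<close>

definition psi :: "'f ring \<Rightarrow> ('f \<Rightarrow> complex) \<Rightarrow> nat \<Rightarrow> 'f matrix \<Rightarrow> 'f matrix \<Rightarrow> complex" where
  "psi F \<theta> n A = (THE \<psi>. is_psi F \<theta> n A \<psi>)"

definition eps :: "'f ring \<Rightarrow> ('f \<Rightarrow> complex) \<Rightarrow> nat \<Rightarrow> 'f matrix \<Rightarrow> 'f matrix \<Rightarrow> complex" where
  "eps F \<theta> n A = (let H = US F n (R_hat n (supp F n A)) in
     (\<lambda>u. if u \<in> H then psi F \<theta> n A (inv\<^bsub>GL F n\<^esub> u) / of_nat (card H) else 0))"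

text \<open>The right ideal \<open>[A] \<epsilon>\<^sub>A \<complex>U\<close> of \<open>\<complex>U\<close>.\<close>

definition hook_mod :: "'f ring \<Rightarrow> ('f \<Rightarrow> complex) \<Rightarrow> nat \<Rightarrow> 'f matrix \<Rightarrow> ('f matrix, 'f matrix) cg_mod" where
  "hook_mod F \<theta> n A = cyclic_mod (U F n) (U F n)
     (ga_mult (U F n) (lidem F \<theta> n (neg_roots n) A) (eps F \<theta> n A))"

text \<open>A 2-part composition \<open>(n - m, m)\<close> is given by \<open>n\<close> and \<open>m\<close>; a tableau is its pair of rows.\<close>

type_synonym tableau = "nat list \<times> nat list"

definition RStd :: "nat \<Rightarrow> nat \<Rightarrow> tableau set" where
  "RStd n m = {(xs, ys). length xs = n - m \<and> length ys = m \<and>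
     sorted_wrt (<) xs \<and> sorted_wrt (<) ys \<and> distinct (xs @ ys) \<and> set (xs @ ys) = {1..n}}"

definition second_row :: "tableau \<Rightarrow> nat set" where
  "second_row s = set (snd s)"

definition fits :: "(nat \<times> nat) set \<Rightarrow> tableau \<Rightarrow> bool" where
  "fits p s \<longleftrightarrow> fst ` p \<subseteq> second_row s \<and> snd ` p \<inter> second_row s = {}"

definition tab_perm :: "'f ring \<Rightarrow> nat \<Rightarrow> tableau \<Rightarrow> 'f matrix" where
  "tab_perm F n s = (\<lambda>(a, b)\<in>{1..n} \<times> {1..n}.
     if b = (fst s @ snd s) ! (a - 1) then \<one>\<^bsub>F\<^esub> else \<zero>\<^bsub>F\<^esub>)"

definition J_set :: "nat \<Rightarrow> tableau \<Rightarrow> (nat \<times> nat) set" where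
  "J_set n s = {(i, j). (i, j) \<in> neg_roots n \<and> i \<in> second_row s \<and> j \<notin> second_row s}"

definition L_set :: "nat \<Rightarrow> tableau \<Rightarrow> (nat \<times> nat) set" where
  "L_set n s = {(i, j). (i, j) \<in> neg_roots n \<and> (i \<in> second_row s \<longleftrightarrow> j \<in> second_row s)}"

definition K_set :: "nat \<Rightarrow> tableau \<Rightarrow> (nat \<times> nat) set" where
  "K_set n s = J_set n s \<union> L_set n s"

definition P_lam :: "'f ring \<Rightarrow> nat \<Rightarrow> nat \<Rightarrow> 'f matrix set" where
  "P_lam F n m = {g \<in> carrier (GL F n).
     \<forall>a\<in>{1..n}. \<forall>b\<in>{1..n}. n - m < a \<and> b \<le> n - m \<longrightarrow> g (a, b) = \<zero>\<^bsub>F\<^esub>}"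

definition P_bar :: "'f ring \<Rightarrow> nat \<Rightarrow> nat \<Rightarrow> 'f matrix \<Rightarrow> complex" where
  "P_bar F n m = (\<lambda>g. if g \<in> P_lam F n m then 1 else 0)"

definition M_lam :: "'f ring \<Rightarrow> nat \<Rightarrow> nat \<Rightarrow> ('f matrix, 'f matrix) cg_mod" where
  "M_lam F n m = cyclic_mod (GL F n) (GL F n) (P_bar F n m)"

text \<open>The element \<open>P_bar d\<close> of \<open>M(\<lambda>)\<close>, for \<open>\<lambda> = (n - m, m)\<close> the shape of \<open>s\<close>.\<close>

definition P_bar_d :: "'f ring \<Rightarrow> nat \<Rightarrow> tableau \<Rightarrow> 'f matrix \<Rightarrow> complex" where
  "P_bar_d F n s =
     ga_mult (GL F n) (P_bar F n (length (snd s))) (ga_single (tab_perm F n s))"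

definition M_tab :: "'f ring \<Rightarrow> nat \<Rightarrow> tableau \<Rightarrow> ('f matrix, 'f matrix) cg_mod" where
  "M_tab F n s = cyclic_mod (GL F n) (U F n) (P_bar_d F n s)"

text \<open>The fixed nonzero scalar in \<open>e\<^sub>A\<close> is taken to be \<open>1\<close>.\<close>

definition e_lidem :: "'f ring \<Rightarrow> ('f \<Rightarrow> complex) \<Rightarrow> nat \<Rightarrow> tableau \<Rightarrow> 'f matrix \<Rightarrow> 'f matrix \<Rightarrow> complex" where
  "e_lidem F \<theta> n s A = ga_mult (GL F n) (P_bar_d F n s) (lidem F \<theta> n (J_set n s) A)"

definition orbit :: "'f ring \<Rightarrow> ('f \<Rightarrow> complex) \<Rightarrow> nat \<Rightarrow> tableau \<Rightarrow> 'f matrix \<Rightarrow> ('f matrix \<Rightarrow> complex) set" where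
  "orbit F \<theta> n s A = {e_lidem F \<theta> n s B | B. B \<in> VS F n (J_set n s) \<and>
     (\<exists>g\<in>US F n (K_set n s). \<exists>c.
        ga_mult (GL F n) (e_lidem F \<theta> n s A) (ga_single g) = (\<lambda>x. c * e_lidem F \<theta> n s B x))}"

definition orbit_mod :: "'f ring \<Rightarrow> ('f \<Rightarrow> complex) \<Rightarrow> nat \<Rightarrow> tableau \<Rightarrow> 'f matrix \<Rightarrow> ('f matrix, 'f matrix) cg_mod" where
  "orbit_mod F \<theta> n s A = \<lparr>mspace = cfun.span (orbit F \<theta> n s A), mact = ga_mult (GL F n)\<rparr>"

definition verge :: "'f ring \<Rightarrow> nat \<Rightarrow> 'f matrix \<Rightarrow> bool" where
  "verge F n A \<longleftrightarrow>
     (\<forall>i\<in>{1..n}. card {j \<in> {1..n}. A (i, j) \<noteq> \<zero>\<^bsub>F\<^esub>} \<le> 1) \<and>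
     (\<forall>j\<in>{1..n}. card {i \<in> {1..n}. A (i, j) \<noteq> \<zero>\<^bsub>F\<^esub>} \<le> 1)"

definition fitting_sets :: "nat \<Rightarrow> nat \<Rightarrow> (nat \<times> nat) set set" where
  "fitting_sets n m = {p. main_condition_set n p \<and> completely_hook_disconnected p \<and>
     (\<exists>s\<in>RStd n m. fits p s)}"

text \<open>The multiplicity \<open>k\<close>; it does not take the field as an argument, so it is independent of \<open>q\<close>.\<close>

definition fit_mult :: "nat \<Rightarrow> nat \<Rightarrow> (nat \<times> nat) set \<Rightarrow> nat" where
  "fit_mult n m p = card {s \<in> RStd n m. fits p s}"

text \<open>
  Parabolic subgroups are the stabilizers of flags of subspaces of the natural module, which
  consists of row vectors since \<open>GL F n\<close> acts from the right.  The empty flag is allowed; its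
  stabilizer is the whole group.
\<close>

definition row_vecs :: "'f ring \<Rightarrow> nat \<Rightarrow> (nat \<Rightarrow> 'f) set" where
  "row_vecs F n = {1..n} \<rightarrow>\<^sub>E carrier F"

definition vec_mat :: "'f ring \<Rightarrow> nat \<Rightarrow> (nat \<Rightarrow> 'f) \<Rightarrow> 'f matrix \<Rightarrow> nat \<Rightarrow> 'f" where
  "vec_mat F n v g = (\<lambda>j\<in>{1..n}. \<Oplus>\<^bsub>F\<^esub>k\<in>{1..n}. v k \<otimes>\<^bsub>F\<^esub> g (k, j))"

definition row_subspace :: "'f ring \<Rightarrow> nat \<Rightarrow> (nat \<Rightarrow> 'f) set \<Rightarrow> bool" where
  "row_subspace F n W \<longleftrightarrow> W \<subseteq> row_vecs F n \<and> (\<lambda>j\<in>{1..n}. \<zero>\<^bsub>F\<^esub>) \<in> W \<and>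
     (\<forall>v\<in>W. \<forall>w\<in>W. (\<lambda>j\<in>{1..n}. v j \<oplus>\<^bsub>F\<^esub> w j) \<in> W) \<and>
     (\<forall>c\<in>carrier F. \<forall>v\<in>W. (\<lambda>j\<in>{1..n}. c \<otimes>\<^bsub>F\<^esub> v j) \<in> W)"

definition flag :: "'f ring \<Rightarrow> nat \<Rightarrow> (nat \<Rightarrow> 'f) set set \<Rightarrow> bool" where
  "flag F n Fl \<longleftrightarrow> (\<forall>W\<in>Fl. row_subspace F n W) \<and> (\<forall>V\<in>Fl. \<forall>W\<in>Fl. V \<subseteq> W \<or> W \<subseteq> V)"

definition parabolic :: "'f ring \<Rightarrow> nat \<Rightarrow> 'f matrix set \<Rightarrow> bool" where
  "parabolic F n P \<longleftrightarrow> (\<exists>Fl. flag F n Fl \<and>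
     P = {g \<in> carrier (GL F n). \<forall>W\<in>Fl. (\<lambda>v. vec_mat F n v g) ` W = W})"

definition maximal_parabolic :: "'f ring \<Rightarrow> nat \<Rightarrow> 'f matrix set \<Rightarrow> bool" where
  "maximal_parabolic F n P \<longleftrightarrow> parabolic F n P \<and> P \<noteq> carrier (GL F n) \<and>
     (\<forall>Q. parabolic F n Q \<and> P \<subseteq> Q \<and> Q \<noteq> carrier (GL F n) \<longrightarrow> Q = P)"

end

theory Submission
  imports Defs
begin

text \<open>
  The group \<open>U\<^sub>J\<close> acts on \<open>M\<^sub>s\<close> like a regular representation of an abelian group, so the \<open>e\<^sub>A\<close> are the
  simultaneous eigenvectors, with pairwise different characters.  The rest of \<open>U\<close> permutes them up to
  scalars; hence the \<open>\<complex>O\<^sub>A\<close> are irreducible, their characters on \<open>U\<^sub>J\<close> tell them apart, and every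
  decomposition of \<open>M\<^sub>s\<close> consists of them.  Row and column operations lead from \<open>A\<close> to a verge in its orbit.  For a
  verge, \<open>\<complex>O\<^sub>A\<close> contains a \<open>\<psi>\<^sub>A\<close>-eigenvector and an estimate of the stabilizer of \<open>e\<^sub>A\<close> shows that its
  dimension is at least the index of \<open>U\<^bsub>R_hat\<^esub>\<close>, so it is induced from \<open>\<psi>\<^sub>A\<close> and isomorphic to \<open>[A] \<epsilon>\<^sub>A \<complex>U\<close>.  These
  modules determine \<open>A\<close>: if two of them are isomorphic, then some \<open>[D]\<close> acts nontrivially on both, and
  \<open>D\<close> then agrees below the diagonal with both verges up to unitriangular row and column operations.  The Bruhat decomposition splits the
  restriction of \<open>M(\<lambda>)\<close> to \<open>U\<close> into the \<open>M\<^sub>s\<close>.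

  A maximal parabolic subgroup is the stabilizer of one subspace.  Subspaces of dimensions \<open>m\<close> and \<open>n - m\<close>
  give isomorphic permutation modules, because the inclusion matrix between them is invertible
  (Kantor), although the stabilizers are not conjugate.
\<close>

section \<open>Modules over group algebras\<close>

text \<open>The roots outside \<open>K\<close> (row index outside, column index inside the second
  row) shape the treatment of \<open>M_s\<close>: on a coset \<open>P d (E + X)\<close> they change
  \<open>X\<close> nonlinearly, so they need not send \<open>e_A\<close> to a multiple of some
  \<open>e_B\<close>. What survives is that their orbits on the cosets are covered by those of
  \<open>U_L\<close> (\<open>Q_L_orbits\<close>). The sum \<open>kO A\<close> over an orbit is
  therefore fixed by all of \<open>U_Q\<close>, \<open>Q = Phi - J\<close>, and since each
  \<open>e_C\<close> of the orbit is \<open>kO A\<close> times an element of \<open>CU\<close>, the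
  span of the orbit is a \<open>CU\<close>-module. Characters of \<open>U_J\<close> cannot compare
  two tableaux, because \<open>J\<close> changes with the tableau. The common measure is the family
  \<open>[D]\<close> of all of \<open>U\<close>: the functions \<open>u |-> chi_D(u - E)\<close> are
  no homomorphisms, but translation changes \<open>D\<close> only by a unitriangular factor, up to a
  scalar and entries on or above the diagonal. Dimensions are squeezed: the index of
  \<open>HH\<close> in \<open>U\<close> bounds \<open>epsilon CU\<close> from above, counting the
  free entries of a stabilizer bounds the orbit from below, and an explicit map of modules forces
  equality.\<close>

lemma fsum_apply: "(\<Sum>i\<in>I. f i) x = (\<Sum>i\<in>I. f i x)" for f :: "'i => 'x => complex"
  by (induction I rule: infinite_finite_induct) auto

lemma fsum_eq: "(\<Sum>i\<in>I. f i) = (\<lambda>x. \<Sum>i\<in>I. f i x)" for f :: "'i => 'x => complex"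
  by (rule ext) (rule fsum_apply)

lemma csubspace_iff: "cfun.subspace W \<longleftrightarrow> (\<lambda>x. 0) \<in> W \<and> (\<forall>v\<in>W. \<forall>w\<in>W. v + w \<in> W) \<and>
    (\<forall>c. \<forall>v\<in>W. (\<lambda>x. c * v x) \<in> W)"
  by (simp add: cfun.subspace_def zero_fun_def)

lemma csubspace_comb: "cfun.subspace W ==> (\<And>i. i \<in> I ==> f i \<in> W) ==> (\<lambda>x. \<Sum>i\<in>I. c i * f i x) \<in> W"
  using cfun.subspace_sum[of W I "\<lambda>i. (\<lambda>x. c i * f i x)"]
  by (simp add: fsum_eq cfun.subspace_scale)

lemma ga_single_alg: "h \<in> carrier G ==> ga_single h \<in> group_algebra G"
  by (auto simp: ga_single_def group_algebra_def)

lemma subspace_group_algebra: "cfun.subspace (group_algebra G)"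
  by (auto simp: csubspace_iff group_algebra_def)

lemma ga_mult_alg: "ga_mult G a b \<in> group_algebra G"
  by (auto simp: ga_mult_def group_algebra_def)

text \<open>A module record carries only the action of the whole algebra. This is its presentation
  by the action \<open>\<rho> h\<close> of single elements; in the last clause \<open>h\<close>
  comes first because modules are right modules.\<close>

definition is_rep :: "('g, 'm) monoid_scheme => ('g, 'x) cg_mod => ('g => ('x => complex) => ('x => complex)) => bool" where
  "is_rep G M \<rho> \<longleftrightarrow> cfun.subspace (mspace M) \<and>
     (\<forall>v\<in>mspace M. \<forall>a\<in>group_algebra G. mact M v a = (\<lambda>x. \<Sum>h\<in>carrier G. a h * \<rho> h v x)) \<and>
     (\<forall>v\<in>mspace M. \<forall>h\<in>carrier G. \<rho> h v \<in> mspace M) \<and>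
     (\<forall>v\<in>mspace M. \<forall>w\<in>mspace M. \<forall>h\<in>carrier G. \<rho> h (v + w) = \<rho> h v + \<rho> h w) \<and>
     (\<forall>v\<in>mspace M. \<forall>h\<in>carrier G. \<forall>c. \<rho> h (\<lambda>x. c * v x) = (\<lambda>x. c * \<rho> h v x)) \<and>
     (\<forall>v\<in>mspace M. \<rho> \<one>\<^bsub>G\<^esub> v = v) \<and>
     (\<forall>v\<in>mspace M. \<forall>h\<in>carrier G. \<forall>k\<in>carrier G. \<rho> k (\<rho> h v) = \<rho> (h \<otimes>\<^bsub>G\<^esub> k) v)"

locale fin_group = group G for G (structure) +
  assumes fin_G: "finite (carrier G)"
begin

text \<open>Substituting \<open>h = g w^-1\<close> puts the sum over the right factor, the form from
  which right translation by a single element can be read off.\<close>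

lemma ga_mult_conv: "g \<in> carrier G ==> ga_mult G a b g = (\<Sum>w\<in>carrier G. a (g \<otimes> inv w) * b w)"
  unfolding ga_mult_def
  by (auto intro!: sum.reindex_bij_witness[where i="\<lambda>w. g \<otimes> inv w" and j="\<lambda>h. inv h \<otimes> g"]
      simp: inv_mult_group m_assoc[symmetric]) (simp add: m_assoc)

lemma rt_eq: "h \<in> carrier G ==> ga_mult G a (ga_single h) = (\<lambda>g. if g \<in> carrier G then a (g \<otimes> inv h) else 0)"
proof (rule ext)
  fix g assume h: "h \<in> carrier G"
  show "ga_mult G a (ga_single h) g = (if g \<in> carrier G then a (g \<otimes> inv h) else 0)"
  proof (cases "g \<in> carrier G")
    case True
    then have "ga_mult G a (ga_single h) g = (\<Sum>w\<in>carrier G. if w = h then a (g \<otimes> inv w) else 0)"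
      by (simp only: ga_mult_conv) (auto simp: ga_single_def intro!: sum.cong)
    then show ?thesis using True h fin_G by simp
  qed (simp add: ga_mult_def)
qed

lemma ga_mult_sum: "ga_mult G a b = (\<lambda>x. \<Sum>h\<in>carrier G. b h * ga_mult G a (ga_single h) x)"
proof (rule ext)
  fix x show "ga_mult G a b x = (\<Sum>h\<in>carrier G. b h * ga_mult G a (ga_single h) x)"
    by (cases "x \<in> carrier G") (auto simp: ga_mult_conv rt_eq mult.commute intro!: sum.cong, auto simp: ga_mult_def)
qed

lemma ga_mult_assoc: "ga_mult G (ga_mult G a b) c = ga_mult G a (ga_mult G b c)"
proof (rule ext)
  fix g
  show "ga_mult G (ga_mult G a b) c g = ga_mult G a (ga_mult G b c) g"
  proof (cases "g \<in> carrier G")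
    case True
    have "ga_mult G (ga_mult G a b) c g = (\<Sum>w\<in>carrier G. (\<Sum>h\<in>carrier G. a h * b (inv h \<otimes> (g \<otimes> inv w))) * c w)"
      using True by (simp add: ga_mult_conv[of g]) (simp add: ga_mult_def)
    also have "\<dots> = (\<Sum>h\<in>carrier G. a h * (\<Sum>w\<in>carrier G. b (inv h \<otimes> g \<otimes> inv w) * c w))"
      unfolding sum_distrib_left sum_distrib_right
      by (subst sum.swap) (simp add: True m_assoc mult.assoc)
    also have "\<dots> = (\<Sum>h\<in>carrier G. a h * ga_mult G b c (inv h \<otimes> g))"
      using True by (simp add: ga_mult_conv)
    also have "\<dots> = ga_mult G a (ga_mult G b c) g" using True by (simp add: ga_mult_def)
    finally show ?thesis .
  qed (simp add: ga_mult_def)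
qed

lemma ga_mult_one: "a \<in> group_algebra G ==> ga_mult G a (ga_single \<one>) = a"
  by (auto simp: rt_eq group_algebra_def)

lemma ga_one_mult: "a \<in> group_algebra G ==> ga_mult G (ga_single \<one>) a = a"
proof (rule ext)
  fix g assume a: "a \<in> group_algebra G"
  show "ga_mult G (ga_single \<one>) a g = a g"
  proof (cases "g \<in> carrier G")
    case True
    then have "ga_mult G (ga_single \<one>) a g = (\<Sum>h\<in>carrier G. if h = \<one> then a (inv h \<otimes> g) else 0)"
      by (auto simp: ga_mult_def ga_single_def intro!: sum.cong)
    then show ?thesis using True fin_G by simp
  next
    case False then show ?thesis using a by (auto simp: ga_mult_def group_algebra_def)
  qed
qed

lemma lt_eq: "h \<in> carrier G ==> ga_mult G (ga_single h) a = (\<lambda>g. if g \<in> carrier G then a (inv h \<otimes> g) else 0)"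
proof (rule ext)
  fix g assume h: "h \<in> carrier G"
  show "ga_mult G (ga_single h) a g = (if g \<in> carrier G then a (inv h \<otimes> g) else 0)"
  proof (cases "g \<in> carrier G")
    case True
    then have "ga_mult G (ga_single h) a g = (\<Sum>k\<in>carrier G. if k = h then a (inv k \<otimes> g) else 0)"
      by (auto simp: ga_mult_def ga_single_def intro!: sum.cong)
    then show ?thesis using True h fin_G by simp
  qed (simp add: ga_mult_def)
qed

lemma ga_mult_single: "h \<in> carrier G ==> k \<in> carrier G ==> ga_mult G (ga_single h) (ga_single k) = ga_single (h \<otimes> k)"
proof (rule ext)
  fix x assume hk: "h \<in> carrier G" "k \<in> carrier G"
  then have "x \<in> carrier G ==> x \<otimes> inv k = h \<longleftrightarrow> x = h \<otimes> k" by (auto simp: inv_solve_right' m_assoc)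
  then show "ga_mult G (ga_single h) (ga_single k) x = ga_single (h \<otimes> k) x"
    using hk by (simp only: rt_eq) (auto simp: ga_single_def)
qed

lemma ga_mult_add_left: "ga_mult G (a + b) c = ga_mult G a c + ga_mult G b c"
  by (rule ext) (auto simp: ga_mult_def distrib_right sum.distrib)

lemma ga_mult_add_right: "ga_mult G a (b + c) = ga_mult G a b + ga_mult G a c"
  by (rule ext) (auto simp: ga_mult_def distrib_left sum.distrib)

lemma ga_mult_scale_left: "ga_mult G (\<lambda>x. k * a x) c = (\<lambda>x. k * ga_mult G a c x)"
  by (rule ext) (auto simp: ga_mult_def sum_distrib_left mult.assoc)

lemma ga_mult_scale_right: "ga_mult G a (\<lambda>x. k * c x) = (\<lambda>x. k * ga_mult G a c x)"
  by (rule ext) (auto simp: ga_mult_def sum_distrib_left mult.left_commute)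

lemma ga_mult_zero_left: "ga_mult G (\<lambda>x. 0) c = (\<lambda>x. 0)"
  by (rule ext) (auto simp: ga_mult_def)

lemma ga_mult_zero_right: "ga_mult G c (\<lambda>x. 0) = (\<lambda>x. 0)"
  by (rule ext) (auto simp: ga_mult_def)

lemma ga_mult_comb_left: "ga_mult G (\<lambda>x. \<Sum>i\<in>I. k i * f i x) c = (\<lambda>x. \<Sum>i\<in>I. k i * ga_mult G (f i) c x)"
proof (rule ext)
  fix g show "ga_mult G (\<lambda>x. \<Sum>i\<in>I. k i * f i x) c g = (\<Sum>i\<in>I. k i * ga_mult G (f i) c g)"
    unfolding ga_mult_def
    by (auto simp: sum_distrib_left sum_distrib_right mult.assoc intro: sum.swap)
qed

lemma ga_mult_comb_right: "ga_mult G c (\<lambda>x. \<Sum>i\<in>I. k i * f i x) = (\<lambda>x. \<Sum>i\<in>I. k i * ga_mult G c (f i) x)"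
proof (rule ext)
  fix g show "ga_mult G c (\<lambda>x. \<Sum>i\<in>I. k i * f i x) g = (\<Sum>i\<in>I. k i * ga_mult G c (f i) g)"
    unfolding ga_mult_def
    by (auto simp: sum_distrib_left sum_distrib_right mult.left_commute intro: sum.swap)
qed

lemma ga_mult_linear_right: "Vector_Spaces.linear (\<lambda>(c::complex) f x. c * f x) (\<lambda>(c::complex) f x. c * f x) (ga_mult G a)"
  by unfold_locales (auto simp: ga_mult_add_right ga_mult_scale_right)

lemma group_algebra_sum: "a \<in> group_algebra G ==> a = (\<lambda>x. \<Sum>h\<in>carrier G. a h * ga_single h x)"
  using fin_G by (auto simp: group_algebra_def ga_single_def if_distrib[of "\<lambda>x. _ * x"] cong: if_cong)

text \<open>All clauses follow from those for single elements by linearity. Associativity is the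
  substitution \<open>g = h k\<close> in a double sum, which turns the coefficients into the
  convolution of \<open>ga_mult_conv\<close>.\<close>

lemma is_rep_module:
  assumes r: "is_rep G M \<rho>" shows "cg_module G M"
proof -
  note r' = r[unfolded is_rep_def]
  have sub: "cfun.subspace (mspace M)" using r' by blast
  have act: "mact M v a = (\<lambda>x. \<Sum>h\<in>carrier G. a h * \<rho> h v x)" if "v \<in> mspace M" "a \<in> group_algebra G" for v a
    using r' that by blast
  have cl: "\<rho> h v \<in> mspace M" if "v \<in> mspace M" "h \<in> carrier G" for v h using r' that by blast
  have add: "\<rho> h (v + w) = \<rho> h v + \<rho> h w" if "v \<in> mspace M" "w \<in> mspace M" "h \<in> carrier G" for v w h
    using r' that by blast
  have sc: "\<rho> h (\<lambda>x. c * v x) = (\<lambda>x. c * \<rho> h v x)" if "v \<in> mspace M" "h \<in> carrier G" for v h c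
    using r' that by blast
  have mm: "\<rho> k (\<rho> h v) = \<rho> (h \<otimes> k) v" if "v \<in> mspace M" "h \<in> carrier G" "k \<in> carrier G" for v h k
    using r' that by blast
  have cl': "mact M v a \<in> mspace M" if "v \<in> mspace M" "a \<in> group_algebra G" for v a
    unfolding act[OF that] by (rule csubspace_comb[OF sub]) (use that cl in auto)
  have lin: "\<rho> k (\<lambda>x. \<Sum>h\<in>I. a h * f h x) = (\<lambda>x. \<Sum>h\<in>I. a h * \<rho> k (f h) x)"
    if "finite I" "\<And>h. h \<in> I ==> f h \<in> mspace M" "k \<in> carrier G" for I :: "'a set" and a f k
    using that(1,2)
  proof (induction I rule: finite_induct)
    case empty
    have "\<rho> k (\<lambda>x. 0 * 0) = (\<lambda>x. 0 * \<rho> k (\<lambda>x. 0) x)" using sc[of "\<lambda>x. 0" k 0] that sub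
      by (auto simp: csubspace_iff)
    then show ?case by simp
  next
    case (insert i I)
    have 1: "(\<lambda>x. a i * f i x) \<in> mspace M" using insert sub by (auto simp: csubspace_iff)
    have 2: "(\<lambda>x. \<Sum>h\<in>I. a h * f h x) \<in> mspace M" by (rule csubspace_comb[OF sub]) (use insert in auto)
    have "\<rho> k ((\<lambda>x. a i * f i x) + (\<lambda>x. \<Sum>h\<in>I. a h * f h x)) = (\<lambda>x. a i * \<rho> k (f i) x) + (\<lambda>x. \<Sum>h\<in>I. a h * \<rho> k (f h) x)"
      using add[OF 1 2 that(3)] insert sc that(3) by simp
    then show ?case using insert by (simp add: plus_fun_def)
  qed
  have assoc: "mact M (mact M v a) b = mact M v (ga_mult G a b)"
    if v: "v \<in> mspace M" and a: "a \<in> group_algebra G" and b: "b \<in> group_algebra G" for v a b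
  proof (rule ext)
    fix x
    have "mact M (mact M v a) b x = (\<Sum>k\<in>carrier G. b k * \<rho> k (mact M v a) x)"
      using act[OF cl'[OF v a] b] by simp
    also have "\<dots> = (\<Sum>k\<in>carrier G. b k * (\<Sum>h\<in>carrier G. a h * \<rho> (h \<otimes> k) v x))"
      by (rule sum.cong) (use v a cl mm fin_G in \<open>simp_all add: act[OF v a] lin\<close>)
    also have "\<dots> = (\<Sum>k\<in>carrier G. b k * (\<Sum>g\<in>carrier G. a (g \<otimes> inv k) * \<rho> g v x))"
    proof (rule sum.cong[OF refl])
      fix k assume k: "k \<in> carrier G"
      have "(\<Sum>h\<in>carrier G. a h * \<rho> (h \<otimes> k) v x) = (\<Sum>g\<in>carrier G. a (g \<otimes> inv k) * \<rho> g v x)"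
        by (rule sum.reindex_bij_witness[where i="\<lambda>g. g \<otimes> inv k" and j="\<lambda>h. h \<otimes> k"])
          (use k in \<open>auto simp: m_assoc\<close>)
      then show "b k * (\<Sum>h\<in>carrier G. a h * \<rho> (h \<otimes> k) v x) = b k * (\<Sum>g\<in>carrier G. a (g \<otimes> inv k) * \<rho> g v x)" by simp
    qed
    also have "\<dots> = (\<Sum>g\<in>carrier G. (\<Sum>k\<in>carrier G. a (g \<otimes> inv k) * b k) * \<rho> g v x)"
      unfolding sum_distrib_left sum_distrib_right
      by (subst sum.swap) (simp add: mult_ac)
    also have "\<dots> = mact M v (ga_mult G a b) x"
      using act[OF v ga_mult_alg] by (simp add: ga_mult_conv)
    finally show "mact M (mact M v a) b x = mact M v (ga_mult G a b) x" .
  qed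
  have one: "mact M v (ga_single \<one>) = v" if v: "v \<in> mspace M" for v
  proof -
    have "mact M v (ga_single \<one>) = (\<lambda>x. \<Sum>h\<in>carrier G. if h = \<one> then \<rho> h v x else 0)"
      using act[OF v ga_single_alg[of \<one>]] by (auto simp: ga_single_def fun_eq_iff intro!: sum.cong)
    also have "\<dots> = \<rho> \<one> v" using fin_G by simp
    also have "\<dots> = v" using r' v by blast
    finally show ?thesis .
  qed
  have ga_add: "a + b \<in> group_algebra G" if "a \<in> group_algebra G" "b \<in> group_algebra G" for a b :: "'a => complex"
    using subspace_group_algebra[of G] that by (auto simp: csubspace_iff)
  have ga_sc: "(\<lambda>x. c * a x) \<in> group_algebra G" if "a \<in> group_algebra G" for a :: "'a => complex" and c
    using subspace_group_algebra[of G] that by (auto simp: csubspace_iff)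
  show ?thesis unfolding cg_module_def
  proof (intro conjI ballI allI)
    fix v w a assume "v \<in> mspace M" "w \<in> mspace M" "a \<in> group_algebra G"
    then show "mact M (v + w) a = mact M v a + mact M w a"
      using act add sub by (auto simp: cfun.subspace_add fun_eq_iff distrib_left sum.distrib)
  next
    fix v a b assume "v \<in> mspace M" "a \<in> group_algebra G" "b \<in> group_algebra G"
    then show "mact M v (a + b) = mact M v a + mact M v b"
      using act ga_add by (auto simp: fun_eq_iff distrib_right sum.distrib)
  next
    fix v a c assume v: "v \<in> mspace M" "a \<in> group_algebra G"
    have "(\<lambda>x. c * v x) \<in> mspace M" using v sub by (auto simp: csubspace_iff)
    then show "mact M (\<lambda>x. c * v x) a = (\<lambda>x. c * mact M v a x)"
      using act sc v by (auto simp: fun_eq_iff sum_distrib_left mult.left_commute)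
    show "mact M v (\<lambda>g. c * a g) = (\<lambda>x. c * mact M v a x)"
      using act v ga_sc by (auto simp: fun_eq_iff sum_distrib_left mult.assoc)
  qed (use sub cl' assoc one in auto)
qed

lemma sum_lin:
  assumes add: "\<And>v w. v \<in> X ==> w \<in> X ==> \<phi> (v + w) = \<phi> v + \<phi> w"
    and sc: "\<And>v c. v \<in> X ==> \<phi> (\<lambda>x. c * v x) = (\<lambda>x. c * \<phi> v x)"
    and X: "cfun.subspace X" and fin: "finite I" and f: "\<And>i. i \<in> I ==> f i \<in> X"
  shows "\<phi> (\<lambda>x. \<Sum>i\<in>I. a i * f i x) = (\<lambda>x. \<Sum>i\<in>I. a i * \<phi> (f i) x)"
  using fin f
proof (induction I rule: finite_induct)
  case empty
  have "\<phi> (\<lambda>x. 0 * 0) = (\<lambda>x. 0 * \<phi> (\<lambda>x. 0) x)" using sc[of "\<lambda>x. 0" 0] X by (auto simp: csubspace_iff)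
  then show ?case by simp
next
  case (insert i I)
  have 1: "(\<lambda>x. a i * f i x) \<in> X" using insert X by (auto simp: csubspace_iff)
  have 2: "(\<lambda>x. \<Sum>h\<in>I. a h * f h x) \<in> X" by (rule csubspace_comb[OF X]) (use insert in auto)
  have "\<phi> ((\<lambda>x. a i * f i x) + (\<lambda>x. \<Sum>h\<in>I. a h * f h x)) = (\<lambda>x. a i * \<phi> (f i) x) + (\<lambda>x. \<Sum>h\<in>I. a h * \<phi> (f h) x)"
    using add[OF 1 2] insert sc by simp
  then show ?case using insert by (simp add: plus_fun_def)
qed

text \<open>The algebra acts by linear extension, so equivariance under single group elements
  suffices.\<close>

lemma mod_iso_rep:
  assumes M: "is_rep G M \<rho>" and N: "is_rep G N \<sigma>"
    and bij: "bij_betw \<phi> (mspace M) (mspace N)"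
    and add: "\<And>v w. v \<in> mspace M ==> w \<in> mspace M ==> \<phi> (v + w) = \<phi> v + \<phi> w"
    and sc: "\<And>v c. v \<in> mspace M ==> \<phi> (\<lambda>x. c * v x) = (\<lambda>x. c * \<phi> v x)"
    and eq: "\<And>v h. v \<in> mspace M ==> h \<in> carrier G ==> \<phi> (\<rho> h v) = \<sigma> h (\<phi> v)"
  shows "mod_iso G M N"
  unfolding mod_iso_def
proof (intro conjI exI[of _ \<phi>] ballI allI)
  fix v a assume v: "v \<in> mspace M" and a: "a \<in> group_algebra G"
  have X: "cfun.subspace (mspace M)" using M by (simp add: is_rep_def)
  have "\<phi> (mact M v a) = \<phi> (\<lambda>x. \<Sum>h\<in>carrier G. a h * \<rho> h v x)" using M v a by (simp add: is_rep_def)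
  also have "\<dots> = (\<lambda>x. \<Sum>h\<in>carrier G. a h * \<phi> (\<rho> h v) x)"
    by (rule sum_lin[OF add sc X fin_G]) (use M v in \<open>auto simp: is_rep_def\<close>)
  also have "\<dots> = (\<lambda>x. \<Sum>h\<in>carrier G. a h * \<sigma> h (\<phi> v) x)" using eq v by simp
  also have "\<dots> = mact N (\<phi> v) a" using N a bij_betwE[OF bij] v by (simp add: is_rep_def)
  finally show "\<phi> (mact M v a) = mact N (\<phi> v) a" .
qed (use is_rep_module[OF M] is_rep_module[OF N] bij add sc in auto)

end

subsection \<open>Isomorphisms\<close>

lemma mod_iso_sym: assumes "mod_iso G M N" shows "mod_iso G N M"
proof -
  obtain \<phi> where M: "cg_module G M" "cg_module G N" and bij: "bij_betw \<phi> (mspace M) (mspace N)"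
    and add: "\<And>v w. v\<in>mspace M ==> w\<in>mspace M ==> \<phi> (v + w) = \<phi> v + \<phi> w"
    and sc: "\<And>v c. v\<in>mspace M ==> \<phi> (\<lambda>x. c * v x) = (\<lambda>y. c * \<phi> v y)"
    and act: "\<And>v a. v\<in>mspace M ==> a\<in>group_algebra G ==> \<phi> (mact M v a) = mact N (\<phi> v) a"
    using assms unfolding mod_iso_def by blast
  define \<psi> where "\<psi> = inv_into (mspace M) \<phi>"
  have bij': "bij_betw \<psi> (mspace N) (mspace M)" unfolding \<psi>_def by (rule bij_betw_inv_into[OF bij])
  have in': "\<psi> w \<in> mspace M" if "w \<in> mspace N" for w using bij' that by (auto simp: bij_betw_def)
  have r: "\<phi> (\<psi> w) = w" if "w \<in> mspace N" for w unfolding \<psi>_def using bij that by (simp add: bij_betw_inv_into_right)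
  have l: "\<psi> (\<phi> v) = v" if "v \<in> mspace M" for v unfolding \<psi>_def using bij that by (simp add: bij_betw_inv_into_left)
  show ?thesis unfolding mod_iso_def
  proof (intro conjI exI[of _ \<psi>] ballI allI)
    fix v w assume vw: "v \<in> mspace N" "w \<in> mspace N"
    have "\<psi> (v + w) = \<psi> (\<phi> (\<psi> v + \<psi> w))" using add[OF in'[OF vw(1)] in'[OF vw(2)]] r vw by simp
    then show "\<psi> (v + w) = \<psi> v + \<psi> w" using in' vw M(1) by (simp add: l cg_module_def cfun.subspace_add)
  next
    fix v c assume v: "v \<in> mspace N"
    have "\<psi> (\<lambda>x. c * v x) = \<psi> (\<phi> (\<lambda>x. c * \<psi> v x))" using sc[OF in'[OF v]] r v by simp
    moreover have "(\<lambda>x. c * \<psi> v x) \<in> mspace M" using in'[OF v] M(1) by (auto simp: cg_module_def csubspace_iff)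
    ultimately show "\<psi> (\<lambda>x. c * v x) = (\<lambda>x. c * \<psi> v x)" by (simp add: l)
  next
    fix v a assume v: "v \<in> mspace N" "a \<in> group_algebra G"
    have "\<psi> (mact N v a) = \<psi> (\<phi> (mact M (\<psi> v) a))" using act[OF in'[OF v(1)] v(2)] r v by simp
    moreover have "mact M (\<psi> v) a \<in> mspace M" using in'[OF v(1)] v M(1) by (auto simp: cg_module_def)
    ultimately show "\<psi> (mact N v a) = mact M (\<psi> v) a" by (simp add: l)
  qed (use M bij' in auto)
qed

lemma mod_iso_trans: assumes "mod_iso G M N" "mod_iso G N K" shows "mod_iso G M K"
proof -
  obtain \<phi> where M: "cg_module G M" "cg_module G N" and bij: "bij_betw \<phi> (mspace M) (mspace N)"
    and 1: "(\<forall>v\<in>mspace M. \<forall>w\<in>mspace M. \<phi> (v + w) = \<phi> v + \<phi> w)"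
        "(\<forall>v\<in>mspace M. \<forall>c. \<phi> (\<lambda>x. c * v x) = (\<lambda>y. c * \<phi> v y))"
        "(\<forall>v\<in>mspace M. \<forall>a\<in>group_algebra G. \<phi> (mact M v a) = mact N (\<phi> v) a)"
    using assms(1) unfolding mod_iso_def by auto
  obtain \<psi> where N: "cg_module G K" and bij': "bij_betw \<psi> (mspace N) (mspace K)"
    and 2: "(\<forall>v\<in>mspace N. \<forall>w\<in>mspace N. \<psi> (v + w) = \<psi> v + \<psi> w)"
        "(\<forall>v\<in>mspace N. \<forall>c. \<psi> (\<lambda>x. c * v x) = (\<lambda>y. c * \<psi> v y))"
        "(\<forall>v\<in>mspace N. \<forall>a\<in>group_algebra G. \<psi> (mact N v a) = mact K (\<psi> v) a)"
    using assms(2) unfolding mod_iso_def by auto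
  have in': "\<And>v. v \<in> mspace M ==> \<phi> v \<in> mspace N" using bij by (auto simp: bij_betw_def)
  show ?thesis unfolding mod_iso_def
    by (intro conjI exI[of _ "\<psi> \<circ> \<phi>"] ballI allI bij_betw_trans[OF bij bij'])
      (use M N 1 2 in' in auto)
qed

subsection \<open>Right ideals\<close>

locale subgroup_alg = fin_group + fixes H assumes subgroup_H: "subgroup H G"
begin

abbreviation GH where "GH \<equiv> G\<lparr>carrier := H\<rparr>"

lemma H_sub: "h \<in> H ==> h \<in> carrier G" using subgroup.subset[OF subgroup_H] by auto
lemma H_closed: "h \<in> H ==> k \<in> H ==> h \<otimes> k \<in> H" using subgroup.m_closed[OF subgroup_H] by auto
lemma H_inv: "h \<in> H ==> inv h \<in> H" using subgroup.m_inv_closed[OF subgroup_H] by auto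
lemma H_one: "\<one> \<in> H" using subgroup.one_closed[OF subgroup_H] by auto
lemma fin_H: "finite H" using fin_G H_sub by (auto intro: finite_subset)

lemma fin_group_GH: "fin_group GH"
proof -
  interpret K: group GH by (rule subgroup_imp_group[OF subgroup_H])
  show ?thesis by unfold_locales (simp add: fin_H)
qed

lemma alg_sub: "a \<in> group_algebra GH ==> a \<in> group_algebra G"
  using H_sub by (auto simp: group_algebra_def)

text \<open>For \<open>g\<close> outside \<open>H\<close> every summand vanishes, since
  \<open>h\<close> and \<open>h^-1 g\<close> cannot both lie in \<open>H\<close>. Modules over a
  subgroup can therefore be computed with the one product of the ambient group.\<close>

lemma ga_mult_sub_eq:
  assumes a: "a \<in> group_algebra GH" and b: "b \<in> group_algebra GH"
  shows "ga_mult GH a b = ga_mult G a b"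
proof (rule ext)
  fix g
  have z: "a h * b (inv h \<otimes> g) = 0" if "g \<notin> H" "h \<in> carrier G" "g \<in> carrier G" for h
  proof (rule ccontr)
    assume "a h * b (inv h \<otimes> g) \<noteq> 0"
    then have "h \<in> H" "inv h \<otimes> g \<in> H" using a b by (auto simp: group_algebra_def)
    then have "h \<otimes> (inv h \<otimes> g) \<in> H" by (rule H_closed)
    then show False using that by (simp add: m_assoc[symmetric])
  qed
  show "ga_mult GH a b g = ga_mult G a b g"
  proof (cases "g \<in> H")
    case True
    have "(\<Sum>h\<in>H. a h * b (inv\<^bsub>GH\<^esub> h \<otimes> g)) = (\<Sum>h\<in>H. a h * b (inv h \<otimes> g))"
      by (rule sum.cong) (auto simp: m_inv_consistent[OF subgroup_H])
    also have "\<dots> = (\<Sum>h\<in>carrier G. a h * b (inv h \<otimes> g))"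
      by (rule sum.mono_neutral_left) (use fin_G H_sub a in \<open>auto simp: group_algebra_def\<close>)
    finally show ?thesis using True H_sub by (simp add: ga_mult_def)
  next
    case False
    then have "g \<in> carrier G ==> (\<Sum>h\<in>carrier G. a h * b (inv h \<otimes> g)) = 0"
      by (intro sum.neutral ballI) (rule z)
    then show ?thesis using False by (simp add: ga_mult_def)
  qed
qed

lemma ga_mult_GH_alg: "a \<in> group_algebra GH ==> b \<in> group_algebra GH ==> ga_mult G a b \<in> group_algebra GH"
  using ga_mult_alg[of GH] by (simp add: ga_mult_sub_eq[symmetric])

lemma ga_mult_sum_H: "b \<in> group_algebra GH ==> ga_mult G a b = (\<lambda>x. \<Sum>h\<in>H. b h * ga_mult G a (ga_single h) x)"
proof -
  assume b: "b \<in> group_algebra GH"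
  have "(\<Sum>h\<in>carrier G. b h * ga_mult G a (ga_single h) x) = (\<Sum>h\<in>H. b h * ga_mult G a (ga_single h) x)" for x
    by (rule sum.mono_neutral_right) (use fin_G H_sub b in \<open>auto simp: group_algebra_def\<close>)
  then show ?thesis by (subst ga_mult_sum) simp
qed

lemma single_GH: "h \<in> H ==> ga_single h \<in> group_algebra GH"
  by (rule ga_single_alg) simp

lemma rt_rep:
  assumes X: "cfun.subspace X" "X \<subseteq> group_algebra G"
    and cl: "\<And>v h. v \<in> X ==> h \<in> H ==> ga_mult G v (ga_single h) \<in> X"
  shows "is_rep GH \<lparr>mspace = X, mact = ga_mult G\<rparr> (\<lambda>h v. ga_mult G v (ga_single h))"
  unfolding is_rep_def
  using X cl ga_mult_one H_sub
  by (auto simp: ga_mult_sum_H ga_mult_add_left ga_mult_scale_left ga_mult_assoc ga_mult_single)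

lemmas rt_module = fin_group.is_rep_module[OF fin_group_GH rt_rep]

text \<open>The generator may lie outside \<open>CH\<close>: \<open>P_bar d\<close> lies in
  \<open>CGL\<close>, while the algebra that acts is \<open>CU\<close>.\<close>

definition rid :: "('a => complex) => ('a => complex) set" where
  "rid x = ga_mult G x ` group_algebra GH"

lemma rid_subspace: "cfun.subspace (rid x)"
  unfolding csubspace_iff rid_def
proof (intro conjI ballI allI)
  show "(\<lambda>x. 0) \<in> ga_mult G x ` group_algebra GH"
    by (rule image_eqI[of _ _ "\<lambda>x. 0"]) (auto simp: ga_mult_zero_right group_algebra_def)
next
  fix v w assume "v \<in> ga_mult G x ` group_algebra GH" "w \<in> ga_mult G x ` group_algebra GH"
  then obtain a b where "a \<in> group_algebra GH" "b \<in> group_algebra GH" "v = ga_mult G x a" "w = ga_mult G x b" by auto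
  then show "v + w \<in> ga_mult G x ` group_algebra GH"
    by (intro image_eqI[of _ _ "a + b"]) (auto simp: ga_mult_add_right group_algebra_def)
next
  fix c v assume "v \<in> ga_mult G x ` group_algebra GH"
  then obtain a where "a \<in> group_algebra GH" "v = ga_mult G x a" by auto
  then show "(\<lambda>y. c * v y) \<in> ga_mult G x ` group_algebra GH"
    by (intro image_eqI[of _ _ "\<lambda>y. c * a y"]) (auto simp: ga_mult_scale_right group_algebra_def)
qed

lemma rid_alg: "rid x \<subseteq> group_algebra G"
  by (auto simp: rid_def ga_mult_alg)

lemma rid_closed: "v \<in> rid x ==> a \<in> group_algebra GH ==> ga_mult G v a \<in> rid x"
  by (auto simp: rid_def ga_mult_assoc ga_mult_GH_alg)

lemma rid_self: "x \<in> group_algebra G ==> x \<in> rid x"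
  unfolding rid_def by (rule image_eqI[of _ _ "ga_single \<one>"]) (auto simp: ga_mult_one single_GH H_one)

lemma cyclic_mod_eq: "cyclic_mod G GH x = \<lparr>mspace = rid x, mact = ga_mult G\<rparr>"
  by (simp add: cyclic_mod_def rid_def)

lemma rid_rep: "is_rep GH \<lparr>mspace = rid x, mact = ga_mult G\<rparr> (\<lambda>h v. ga_mult G v (ga_single h))"
  by (rule rt_rep[OF rid_subspace rid_alg rid_closed]) (auto simp: single_GH)

lemmas rid_module = fin_group.is_rep_module[OF fin_group_GH rid_rep]

text \<open>Both sides are quotients of \<open>CH\<close> by the annihilator of the generator, and
  the assumption says that the annihilators coincide.\<close>

lemma rid_iso:
  assumes eq: "\<And>a. a \<in> group_algebra GH ==> ga_mult G x a = (\<lambda>_. 0) \<longleftrightarrow> ga_mult G y a = (\<lambda>_. 0)"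
  shows "mod_iso GH \<lparr>mspace = rid x, mact = ga_mult G\<rparr> \<lparr>mspace = rid y, mact = ga_mult G\<rparr>"
proof -
  \<comment> \<open>Any preimage under \<open>a |-> x a\<close> may be chosen: by \<open>eq2\<close>
    below, its image \<open>y a\<close> depends on \<open>v\<close> only.\<close>
  define \<phi> where "\<phi> v = ga_mult G y (SOME a. a \<in> group_algebra GH \<and> v = ga_mult G x a)" for v
  have eq2: "ga_mult G x a = ga_mult G x b \<longleftrightarrow> ga_mult G y a = ga_mult G y b"
    if a: "a \<in> group_algebra GH" and b: "b \<in> group_algebra GH" for a b
  proof -
    have m: "a + (\<lambda>g. -1 * b g) \<in> group_algebra GH" using a b by (auto simp: group_algebra_def)
    have *: "ga_mult G z (a + (\<lambda>g. -1 * b g)) = (\<lambda>_. 0) \<longleftrightarrow> ga_mult G z a = ga_mult G z b" for z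
      unfolding ga_mult_add_right ga_mult_scale_right by (auto simp: fun_eq_iff)
    show ?thesis using eq[OF m] * by simp
  qed
  have \<phi>: "\<phi> (ga_mult G x a) = ga_mult G y a" if a: "a \<in> group_algebra GH" for a
  proof -
    have "\<exists>b. b \<in> group_algebra GH \<and> ga_mult G x a = ga_mult G x b" using a by auto
    from someI_ex[OF this] show ?thesis unfolding \<phi>_def using eq2[OF a] by auto
  qed
  show ?thesis unfolding mod_iso_def
  proof (intro conjI exI[of _ \<phi>] ballI allI)
    show "bij_betw \<phi> (mspace \<lparr>mspace = rid x, mact = ga_mult G\<rparr>) (mspace \<lparr>mspace = rid y, mact = ga_mult G\<rparr>)"
      unfolding bij_betw_def by (auto simp: rid_def inj_on_def \<phi> eq2 image_image)
  next
    fix v w assume "v \<in> mspace \<lparr>mspace = rid x, mact = ga_mult G\<rparr>" "w \<in> mspace \<lparr>mspace = rid x, mact = ga_mult G\<rparr>"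
    then obtain a b where ab: "a \<in> group_algebra GH" "b \<in> group_algebra GH" "v = ga_mult G x a" "w = ga_mult G x b"
      by (auto simp: rid_def)
    have "a + b \<in> group_algebra GH" using ab by (auto simp: group_algebra_def)
    from \<phi>[OF this] show "\<phi> (v + w) = \<phi> v + \<phi> w" using ab by (simp add: ga_mult_add_right \<phi>)
  next
    fix v c assume "v \<in> mspace \<lparr>mspace = rid x, mact = ga_mult G\<rparr>"
    then obtain a where ab: "a \<in> group_algebra GH" "v = ga_mult G x a" by (auto simp: rid_def)
    have "(\<lambda>g. c * a g) \<in> group_algebra GH" using ab by (auto simp: group_algebra_def)
    from \<phi>[OF this] show "\<phi> (\<lambda>x. c * v x) = (\<lambda>y. c * \<phi> v y)" using ab by (simp add: ga_mult_scale_right \<phi>)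
  next
    fix v a assume "v \<in> mspace \<lparr>mspace = rid x, mact = ga_mult G\<rparr>" and a: "a \<in> group_algebra GH"
    then obtain b where b: "b \<in> group_algebra GH" "v = ga_mult G x b" by (auto simp: rid_def)
    show "\<phi> (mact \<lparr>mspace = rid x, mact = ga_mult G\<rparr> v a) = mact \<lparr>mspace = rid y, mact = ga_mult G\<rparr> (\<phi> v) a"
      using \<phi>[OF ga_mult_GH_alg[OF b(1) a]] b by (simp add: ga_mult_assoc \<phi>)
  qed (auto intro: rid_module)
qed

end

subsection \<open>Linear algebra\<close>

interpretation cpair: vector_space_pair
  "\<lambda>(c::complex) (f::'x => complex). (\<lambda>x. c * f x)" "\<lambda>(c::complex) (f::'y => complex). (\<lambda>x. c * f x)"
  by unfold_locales

lemma independent_if_card_le_dim: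
  assumes "finite B" "card B \<le> cfun.dim B" shows "cfun.independent B"
proof -
  obtain B' where B': "B' \<subseteq> B" "cfun.independent B'" "B \<subseteq> cfun.span B'"
    using cfun.maximal_independent_subset[of B] by blast
  have "cfun.dim B = card B'" using cfun.basis_card_eq_dim[OF B'(1,3,2)] by simp
  then have "B' = B" using assms B'(1) by (metis card_seteq)
  then show ?thesis using B' by simp
qed

text \<open>The span of \<open>S\<close> has dimension at most \<open>card S\<close>, so a linear
  image of at least that dimension leaves no room for a kernel.\<close>

lemma inj_on_span_if_dim:
  assumes lin: "Vector_Spaces.linear (\<lambda>(c::complex) (f::'x => complex). (\<lambda>x. c * f x)) (\<lambda>(c::complex) (f::'y => complex). (\<lambda>x. c * f x)) \<phi>"
    and S: "finite S" and d: "card S \<le> cfun.dim (\<phi> ` cfun.span S)"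
  shows "inj_on \<phi> (cfun.span S)" "cfun.dim (\<phi> ` cfun.span S) = card S"
proof -
  have sp: "\<phi> ` cfun.span S = cfun.span (\<phi> ` S)" by (rule cpair.linear_span_image[OF lin, symmetric])
  have d': "card S \<le> cfun.dim (\<phi> ` S)" using d unfolding sp by (simp add: cfun.dim_span)
  have c: "card (\<phi> ` S) \<le> card S" by (rule card_image_le[OF S])
  have i: "cfun.independent (\<phi> ` S)" by (rule independent_if_card_le_dim) (use S c d' in auto)
  then have dc: "cfun.dim (\<phi> ` S) = card (\<phi> ` S)" by (rule cfun.dim_eq_card_independent)
  have inj: "inj_on \<phi> S" by (rule eq_card_imp_inj_on[OF S]) (use c d' dc in auto)
  show "inj_on \<phi> (cfun.span S)" by (rule cpair.linear_inj_on_span_independent_image[OF lin i inj])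
  show "cfun.dim (\<phi> ` cfun.span S) = card S" unfolding sp cfun.dim_span using c d' dc by simp
qed

text \<open>A vector of \<open>S\<close> outside the span of \<open>B\<close> would extend
  \<open>B\<close> to an independent set with more elements than the spanning set
  \<open>S\<close>.\<close>

lemma span_eq_if_card:
  assumes B: "cfun.independent B" "B \<subseteq> cfun.span S" and S: "finite S" "card B = card S"
  shows "cfun.span B = cfun.span S"
proof -
  have "x \<in> cfun.span B" if x: "x \<in> S" for x
  proof (rule ccontr)
    assume nx: "x \<notin> cfun.span B"
    then have i: "cfun.independent (insert x B)" and xB: "x \<notin> B"
      using cfun.independent_insertI[OF nx B(1)] cfun.span_base by auto
    have "finite (insert x B) \<and> card (insert x B) \<le> card S"
      by (rule cfun.independent_span_bound[OF S(1) i]) (use B x cfun.span_base in auto)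
    then show False using S(2) xB by (metis card_insert_disjoint finite_insert Suc_n_not_le_n)
  qed
  then have "cfun.span S \<subseteq> cfun.span B" by (intro cfun.span_minimal[OF _ cfun.subspace_span]) auto
  moreover have "cfun.span B \<subseteq> cfun.span S" by (rule cfun.span_minimal[OF B(2) cfun.subspace_span])
  ultimately show ?thesis by auto
qed

section \<open>The Hermitian form on functions and orthogonal decompositions\<close>

definition ip :: "'x set => ('x => complex) => ('x => complex) => complex" where
  "ip S f g = (\<Sum>x\<in>S. f x * cnj (g x))"

lemma ip_add: "ip S (f + g) h = ip S f h + ip S g h" "ip S h (f + g) = ip S h f + ip S h g"
  by (auto simp: ip_def distrib_left distrib_right sum.distrib)

lemma ip_add': "ip S (\<lambda>x. f x + g x) h = ip S f h + ip S g h" "ip S h (\<lambda>x. f x + g x) = ip S h f + ip S h g"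
  by (auto simp: ip_def distrib_left distrib_right sum.distrib)

lemma ip_scale: "ip S (\<lambda>x. c * f x) h = c * ip S f h" "ip S h (\<lambda>x. c * f x) = cnj c * ip S h f"
  by (auto simp: ip_def sum_distrib_left mult_ac)

lemma ip_zero: "ip S (\<lambda>x. 0) h = 0" "ip S h (\<lambda>x. 0) = 0" "ip S 0 h = 0" "ip S h 0 = 0"
  by (auto simp: ip_def)

lemma ip_sum: "ip S (\<Sum>i\<in>I. f i) h = (\<Sum>i\<in>I. ip S (f i) h)"
  by (induction I rule: infinite_finite_induct) (auto simp: ip_add ip_add' ip_zero)

lemma ip_self_zero:
  assumes "finite S" "\<And>x. x \<notin> S ==> f x = 0" "ip S f f = 0" shows "f = (\<lambda>x. 0)"
proof -
  have "f x * cnj (f x) = of_real ((cmod (f x))\<^sup>2)" for x by (rule complex_norm_square[symmetric])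
  then have "ip S f f = of_real (\<Sum>x\<in>S. (cmod (f x))\<^sup>2)" by (simp add: ip_def)
  then have "(\<Sum>x\<in>S. (cmod (f x))\<^sup>2) = 0" using assms(3) of_real_eq_0_iff by metis
  then have "\<forall>x\<in>S. (cmod (f x))\<^sup>2 = 0" using assms(1) by (subst (asm) sum_nonneg_eq_0_iff) auto
  then show ?thesis using assms(2) by fastforce
qed

lemma ip_span_zero:
  assumes "\<And>f. f \<in> A ==> ip S f h = 0" "f \<in> cfun.span A" shows "ip S f h = 0"
  using assms(2)
  by (induction rule: cfun.span_induct_alt) (auto simp: ip_zero ip_add ip_add' ip_scale assms(1))

lemma ip_span_zero2:
  assumes "\<And>h. h \<in> A ==> ip S f h = 0" "h \<in> cfun.span A" shows "ip S f h = 0"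
  using assms(2)
  by (induction rule: cfun.span_induct_alt) (auto simp: ip_zero ip_add ip_add' ip_scale assms(1))

lemma ip_spans_zero:
  assumes "\<And>f h. f \<in> A ==> h \<in> B ==> ip S f h = 0" "f \<in> cfun.span A" "h \<in> cfun.span B"
  shows "ip S f h = 0"
  using ip_span_zero[of A S h f] ip_span_zero2[of B S] assms by blast

lemma orth_independent:
  assumes nz: "\<And>f. f \<in> B ==> ip S f f \<noteq> 0"
    and orth: "\<And>f g. f \<in> B ==> g \<in> B ==> f \<noteq> g ==> ip S f g = 0"
  shows "cfun.independent B"
proof
  assume "cfun.dependent B"
  then obtain f where f: "f \<in> B" "f \<in> cfun.span (B - {f})" by (auto simp: cfun.dependent_def)
  have "ip S f f = 0" by (rule ip_span_zero[OF _ f(2)]) (use orth f in auto)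
  then show False using nz f by auto
qed

text \<open>The components of the difference of two decompositions are orthogonal and sum to zero,
  so pairing the sum with one of them shows that it has norm zero.\<close>

lemma orth_decomp:
  assumes I: "finite I" and S: "finite S"
    and sub: "\<And>i. i \<in> I ==> cfun.subspace (W i)"
    and out: "\<And>i f x. i \<in> I ==> f \<in> W i ==> x \<notin> S ==> f x = 0"
    and orth: "\<And>i j f g. i \<in> I ==> j \<in> I ==> i \<noteq> j ==> f \<in> W i ==> g \<in> W j ==> ip S f g = 0"
    and ex: "\<exists>f. (\<forall>i\<in>I. f i \<in> W i) \<and> v = (\<Sum>i\<in>I. f i)"
  shows "\<exists>!f. f \<in> (\<Pi>\<^sub>E i\<in>I. W i) \<and> v = (\<Sum>i\<in>I. f i)"
proof (rule ex_ex1I)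
  obtain f where f: "\<forall>i\<in>I. f i \<in> W i" "v = (\<Sum>i\<in>I. f i)" using ex by blast
  show "\<exists>f. f \<in> (\<Pi>\<^sub>E i\<in>I. W i) \<and> v = (\<Sum>i\<in>I. f i)"
    by (rule exI[of _ "restrict f I"]) (use f in auto)
next
  fix f g assume f: "f \<in> (\<Pi>\<^sub>E i\<in>I. W i) \<and> v = (\<Sum>i\<in>I. f i)" and g: "g \<in> (\<Pi>\<^sub>E i\<in>I. W i) \<and> v = (\<Sum>i\<in>I. g i)"
  have "f i = g i" if i: "i \<in> I" for i
  proof -
    define h where "h j = f j - g j" for j
    have h: "h j \<in> W j" if "j \<in> I" for j unfolding h_def by (rule cfun.subspace_diff[OF sub[OF that]]) (use f g that in auto)
    have "(\<Sum>j\<in>I. h j) = 0" unfolding h_def sum_subtractf using f g by simp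
    then have "0 = ip S (\<Sum>j\<in>I. h j) (h i)" by (simp add: ip_zero)
    also have "\<dots> = (\<Sum>j\<in>I. if j = i then ip S (h i) (h i) else 0)"
      unfolding ip_sum by (rule sum.cong) (use orth h i in auto)
    also have "\<dots> = ip S (h i) (h i)" using I i by simp
    finally have e: "ip S (h i) (h i) = 0" by simp
    have "h i = (\<lambda>x. 0)" by (rule ip_self_zero[OF S out[OF i h[OF i]] e])
    then show "f i = g i" by (auto simp: h_def fun_eq_iff)
  qed
  then show "f = g" using f g by (auto intro: PiE_ext)
qed

subsection \<open>Direct sums\<close>

lemma cg_moduleD:
  assumes "cg_module G M"
  shows "cfun.subspace (mspace M)"
    "v \<in> mspace M ==> a \<in> group_algebra G ==> mact M v a \<in> mspace M"
    "v \<in> mspace M ==> w \<in> mspace M ==> a \<in> group_algebra G ==> mact M (v + w) a = mact M v a + mact M w a"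
    "v \<in> mspace M ==> a \<in> group_algebra G ==> b \<in> group_algebra G ==> mact M v (a + b) = mact M v a + mact M v b"
    "v \<in> mspace M ==> a \<in> group_algebra G ==> mact M (\<lambda>x. c * v x) a = (\<lambda>x. c * mact M v a x)"
    "v \<in> mspace M ==> a \<in> group_algebra G ==> mact M v (\<lambda>g. c * a g) = (\<lambda>x. c * mact M v a x)"
    "v \<in> mspace M ==> mact M v (ga_single \<one>\<^bsub>G\<^esub>) = v"
    "v \<in> mspace M ==> a \<in> group_algebra G ==> b \<in> group_algebra G ==> mact M (mact M v a) b = mact M v (ga_mult G a b)"
  using assms unfolding cg_module_def by blast+

lemma csubspaceD:
  assumes "cfun.subspace W"
  shows "(\<lambda>x. 0) \<in> W" "v \<in> W ==> w \<in> W ==> v + w \<in> W" "v \<in> W ==> (\<lambda>x. c * v x) \<in> W"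
  using assms unfolding csubspace_iff by blast+

lemma cg_mact_zero: "cg_module G M ==> a \<in> group_algebra G ==> mact M (\<lambda>x. 0) a = (\<lambda>x. 0)"
  using cg_moduleD(5)[of G M "\<lambda>x. 0" a 0] csubspaceD(1)[OF cg_moduleD(1), of G M] by simp

lemma cg_mact_sum:
  assumes M: "cg_module G M" and a: "a \<in> group_algebra G" and f: "\<And>i. i \<in> I ==> f i \<in> mspace M"
  shows "mact M (\<Sum>i\<in>I. f i) a = (\<Sum>i\<in>I. mact M (f i) a)"
  using f
proof (induction I rule: infinite_finite_induct)
  case (insert i I)
  have "(\<Sum>i\<in>I. f i) \<in> mspace M" by (rule cfun.subspace_sum[OF cg_moduleD(1)[OF M]]) (use insert in auto)
  then have "mact M (f i + (\<Sum>i\<in>I. f i)) a = mact M (f i) a + mact M (\<Sum>i\<in>I. f i) a"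
    using insert by (intro cg_moduleD(3)[OF M _ _ a]) auto
  moreover have "mact M (\<Sum>i\<in>I. f i) a = (\<Sum>i\<in>I. mact M (f i) a)"
    by (rule insert(3)) (rule insert(4), simp)
  ultimately show ?case by (simp only: sum.insert[OF insert(1,2)])
qed (use cg_mact_zero[OF M a] in \<open>auto simp: zero_fun_def\<close>)

lemma mspace_direct_sum: "mspace (direct_sum I M) =
    {f. (\<forall>i\<in>I. (\<lambda>x. f (i, x)) \<in> mspace (M i)) \<and> (\<forall>i x. i \<notin> I \<longrightarrow> f (i, x) = 0)}"
  by (simp add: direct_sum_def)

lemma mact_direct_sum: "mact (direct_sum I M) f a (i, x) = (if i \<in> I then mact (M i) (\<lambda>y. f (i, y)) a x else 0)"
  by (simp add: direct_sum_def)

lemma direct_sum_in: "v \<in> mspace (direct_sum I M) ==> i \<in> I ==> (\<lambda>x. v (i, x)) \<in> mspace (M i)"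
  by (simp add: direct_sum_def)

lemma direct_sum_out: "v \<in> mspace (direct_sum I M) ==> i \<notin> I ==> v (i, x) = 0"
  by (simp add: direct_sum_def)

lemma direct_sum_module:
  assumes M: "\<And>i. i \<in> I ==> cg_module G (M i)"
  shows "cg_module G (direct_sum I M)"
proof -
  let ?D = "direct_sum I M"
  have sub: "cfun.subspace (mspace (M i))" if "i \<in> I" for i by (rule cg_moduleD(1)[OF M[OF that]])
  have ps: "(\<lambda>y. (v + w) (i, y)) = (\<lambda>y. v (i, y)) + (\<lambda>y. w (i, y))" for v w :: "'a \<times> 'd => complex" and i by auto
  show ?thesis unfolding cg_module_def
  proof (intro conjI ballI allI)
    show "cfun.subspace (mspace ?D)"
      unfolding csubspace_iff
    proof (intro conjI ballI allI)
      show "(\<lambda>x. 0) \<in> mspace ?D" using csubspaceD(1)[OF sub] by (simp add: mspace_direct_sum)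
      show "v + w \<in> mspace ?D" if "v \<in> mspace ?D" "w \<in> mspace ?D" for v w
        using that csubspaceD(2)[OF sub] unfolding mspace_direct_sum mem_Collect_eq ps by simp
      show "(\<lambda>x. c * v x) \<in> mspace ?D" if "v \<in> mspace ?D" for v c
        using that csubspaceD(3)[OF sub] by (simp add: mspace_direct_sum)
    qed
  next
    fix v w a assume v: "v \<in> mspace ?D" and w: "w \<in> mspace ?D" and a: "a \<in> group_algebra G"
    have "mact ?D (v + w) a (i, x) = mact ?D v a (i, x) + mact ?D w a (i, x)" for i x
      using cg_moduleD(3)[OF M direct_sum_in[OF v] direct_sum_in[OF w] a] unfolding mact_direct_sum ps by simp
    then show "mact ?D (v + w) a = mact ?D v a + mact ?D w a" by auto
  next
    fix v a b assume v: "v \<in> mspace ?D" and a: "a \<in> group_algebra G" "b \<in> group_algebra G"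
    have "mact ?D v (a + b) (i, x) = mact ?D v a (i, x) + mact ?D v b (i, x)" for i x
      using cg_moduleD(4)[OF M direct_sum_in[OF v] a] unfolding mact_direct_sum by simp
    then show "mact ?D v (a + b) = mact ?D v a + mact ?D v b" by auto
  next
    fix v a assume v: "v \<in> mspace ?D" and a: "a \<in> group_algebra G"
    show "mact ?D v a \<in> mspace ?D"
      using cg_moduleD(2)[OF M direct_sum_in[OF v] a] by (simp add: mspace_direct_sum mact_direct_sum)
  next
    fix v a c assume v: "v \<in> mspace ?D" and a: "a \<in> group_algebra G"
    have "mact ?D (\<lambda>x. c * v x) a (i, x) = c * mact ?D v a (i, x)" for i x
      using cg_moduleD(5)[OF M direct_sum_in[OF v] a] unfolding mact_direct_sum by simp
    then show "mact ?D (\<lambda>x. c * v x) a = (\<lambda>x. c * mact ?D v a x)" by auto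
    have "mact ?D v (\<lambda>g. c * a g) (i, x) = c * mact ?D v a (i, x)" for i x
      using cg_moduleD(6)[OF M direct_sum_in[OF v] a] unfolding mact_direct_sum by simp
    then show "mact ?D v (\<lambda>g. c * a g) = (\<lambda>x. c * mact ?D v a x)" by auto
  next
    fix v assume v: "v \<in> mspace ?D"
    have "mact ?D v (ga_single \<one>\<^bsub>G\<^esub>) (i, x) = v (i, x)" for i x
      using cg_moduleD(7)[OF M direct_sum_in[OF v]] direct_sum_out[OF v] unfolding mact_direct_sum by simp
    then show "mact ?D v (ga_single \<one>\<^bsub>G\<^esub>) = v" by auto
  next
    fix v a b assume v: "v \<in> mspace ?D" and a: "a \<in> group_algebra G" "b \<in> group_algebra G"
    have "mact ?D (mact ?D v a) b (i, x) = mact ?D v (ga_mult G a b) (i, x)" for i x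
      using cg_moduleD(8)[OF M direct_sum_in[OF v] a] unfolding mact_direct_sum by (simp add: mact_direct_sum)
    then show "mact ?D (mact ?D v a) b = mact ?D v (ga_mult G a b)" by auto
  qed
qed

lemma direct_sum_cong:
  assumes iso: "\<And>i. i \<in> I ==> mod_iso G (M i) (N i)"
  shows "mod_iso G (direct_sum I M) (direct_sum I N)"
proof -
  define P where "P i \<phi> \<longleftrightarrow> bij_betw \<phi> (mspace (M i)) (mspace (N i)) \<and>
        (\<forall>v\<in>mspace (M i). \<forall>w\<in>mspace (M i). \<phi> (v + w) = \<phi> v + \<phi> w) \<and>
        (\<forall>v\<in>mspace (M i). \<forall>c. \<phi> (\<lambda>x. c * v x) = (\<lambda>y. c * \<phi> v y)) \<and>
        (\<forall>v\<in>mspace (M i). \<forall>a\<in>group_algebra G. \<phi> (mact (M i) v a) = mact (N i) (\<phi> v) a)" for i \<phi>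
  have "\<forall>i\<in>I. \<exists>\<phi>. P i \<phi>" using iso unfolding mod_iso_def P_def by blast
  then obtain \<phi> where P: "\<And>i. i \<in> I ==> P i (\<phi> i)" using bchoice[of I P] by blast
  have bij: "\<And>i. i \<in> I ==> bij_betw (\<phi> i) (mspace (M i)) (mspace (N i))"
    and add: "\<And>i v w. i \<in> I ==> v\<in>mspace (M i) ==> w\<in>mspace (M i) ==> \<phi> i (v + w) = \<phi> i v + \<phi> i w"
    and sc: "\<And>i v c. i \<in> I ==> v\<in>mspace (M i) ==> \<phi> i (\<lambda>x. c * v x) = (\<lambda>y. c * \<phi> i v y)"
    and act: "\<And>i v a. i \<in> I ==> v\<in>mspace (M i) ==> a\<in>group_algebra G ==> \<phi> i (mact (M i) v a) = mact (N i) (\<phi> i v) a"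
    using P unfolding P_def by blast+
  have in': "\<phi> i v \<in> mspace (N i)" if "i \<in> I" "v \<in> mspace (M i)" for i v using bij that by (auto simp: bij_betw_def)
  define \<Phi> where "\<Phi> f = (\<lambda>(i, y). if i \<in> I then \<phi> i (\<lambda>x. f (i, x)) y else 0)" for f
  define \<Psi> where "\<Psi> f = (\<lambda>(i, y). if i \<in> I then inv_into (mspace (M i)) (\<phi> i) (\<lambda>x. f (i, x)) y else 0)" for f
  have inv': "inv_into (mspace (M i)) (\<phi> i) v \<in> mspace (M i)" if "i \<in> I" "v \<in> mspace (N i)" for i v
    using bij_betw_inv_into[OF bij[OF that(1)]] that by (auto simp: bij_betw_def)
  have l: "inv_into (mspace (M i)) (\<phi> i) (\<phi> i v) = v" if "i \<in> I" "v \<in> mspace (M i)" for i v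
    by (rule bij_betw_inv_into_left[OF bij[OF that(1)] that(2)])
  have r: "\<phi> i (inv_into (mspace (M i)) (\<phi> i) v) = v" if "i \<in> I" "v \<in> mspace (N i)" for i v
    by (rule bij_betw_inv_into_right[OF bij[OF that(1)] that(2)])
  show ?thesis unfolding mod_iso_def
  proof (intro conjI exI[of _ \<Phi>] ballI allI)
    show "bij_betw \<Phi> (mspace (direct_sum I M)) (mspace (direct_sum I N))"
    proof (rule bij_betw_byWitness[where f'=\<Psi>])
      show "\<forall>f\<in>mspace (direct_sum I M). \<Psi> (\<Phi> f) = f"
        by (auto simp: \<Phi>_def \<Psi>_def direct_sum_def fun_eq_iff l)
      show "\<forall>f\<in>mspace (direct_sum I N). \<Phi> (\<Psi> f) = f"
        by (auto simp: \<Phi>_def \<Psi>_def direct_sum_def fun_eq_iff r)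
      show "\<Phi> ` mspace (direct_sum I M) \<subseteq> mspace (direct_sum I N)"
        using in' by (auto simp: \<Phi>_def direct_sum_def)
      show "\<Psi> ` mspace (direct_sum I N) \<subseteq> mspace (direct_sum I M)"
        using inv' by (auto simp: \<Psi>_def direct_sum_def)
    qed
  next
    fix v w assume vw: "v \<in> mspace (direct_sum I M)" "w \<in> mspace (direct_sum I M)"
    have "\<phi> i (\<lambda>x. (v + w) (i, x)) = \<phi> i (\<lambda>x. v (i, x)) + \<phi> i (\<lambda>x. w (i, x))" if "i \<in> I" for i
      using add[OF that, of "\<lambda>x. v (i, x)" "\<lambda>x. w (i, x)"] vw that by (auto simp: direct_sum_def plus_fun_def)
    then show "\<Phi> (v + w) = \<Phi> v + \<Phi> w" by (auto simp: \<Phi>_def fun_eq_iff)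
  next
    fix v c assume "v \<in> mspace (direct_sum I M)"
    then show "\<Phi> (\<lambda>x. c * v x) = (\<lambda>y. c * \<Phi> v y)" using sc by (auto simp: \<Phi>_def fun_eq_iff direct_sum_def)
  next
    fix v a assume "v \<in> mspace (direct_sum I M)" "a \<in> group_algebra G"
    then show "\<Phi> (mact (direct_sum I M) v a) = mact (direct_sum I N) (\<Phi> v) a"
      using act by (auto simp: \<Phi>_def fun_eq_iff direct_sum_def)
  qed (use iso in \<open>auto intro!: direct_sum_module simp: mod_iso_def\<close>)
qed

text \<open>Nested sums carry nested index types; regrouping \<open>(i, (j, x))\<close> as
  \<open>((i, j), x)\<close> is the whole isomorphism.\<close>

lemma direct_sum_Sigma:
  fixes N :: "'i => 'j => ('g, 'x) cg_mod"
  assumes N: "\<And>i j. i \<in> I ==> j \<in> J i ==> cg_module G (N i j)"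
  shows "mod_iso G (direct_sum I (\<lambda>i. direct_sum (J i) (N i))) (direct_sum (Sigma I J) (\<lambda>k. N (fst k) (snd k)))"
proof -
  define \<Phi> :: "('i \<times> 'j \<times> 'x => complex) => (('i \<times> 'j) \<times> 'x => complex)" where "\<Phi> f = (\<lambda>((i, j), x). f (i, (j, x)))" for f
  show ?thesis unfolding mod_iso_def
  proof (intro conjI exI[of _ \<Phi>] ballI allI)
    show "bij_betw \<Phi> (mspace (direct_sum I (\<lambda>i. direct_sum (J i) (N i)))) (mspace (direct_sum (Sigma I J) (\<lambda>k. N (fst k) (snd k))))"
      by (rule bij_betw_byWitness[where f'="\<lambda>f (i, (j, x)). f ((i, j), x)"])
        (auto simp: \<Phi>_def direct_sum_def fun_eq_iff)
  next
    fix v a assume "v \<in> mspace (direct_sum I (\<lambda>i. direct_sum (J i) (N i)))" "a \<in> group_algebra G"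
    then show "\<Phi> (mact (direct_sum I (\<lambda>i. direct_sum (J i) (N i))) v a) = mact (direct_sum (Sigma I J) (\<lambda>k. N (fst k) (snd k))) (\<Phi> v) a"
      by (auto simp: \<Phi>_def fun_eq_iff direct_sum_def)
  qed (use N in \<open>auto intro!: direct_sum_module simp: \<Phi>_def fun_eq_iff\<close>)
qed

text \<open>The isomorphism adds up the components, and unique decomposability makes it bijective.
  This is the passage from a decomposition inside one function space to an external sum.\<close>

lemma direct_sum_internal:
  assumes fin: "finite I" and N: "cg_module G N"
    and W: "\<And>i. i \<in> I ==> W i \<subseteq> mspace N"
    and iso: "\<And>i. i \<in> I ==> mod_iso G (M i) (N\<lparr>mspace := W i\<rparr>)"
    and dec: "\<And>v. v \<in> mspace N ==> \<exists>!f. f \<in> (\<Pi>\<^sub>E i\<in>I. W i) \<and> v = (\<Sum>i\<in>I. f i)"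
  shows "mod_iso G (direct_sum I M) N"
proof -
  define N' where "N' i = N\<lparr>mspace := W i\<rparr>" for i
  have subN: "cfun.subspace (mspace N)" using N by (simp add: cg_module_def)
  have mN: "\<And>i. i \<in> I ==> cg_module G (N' i)" using iso by (auto simp: mod_iso_def N'_def)
  have "mod_iso G (direct_sum I N') N" unfolding mod_iso_def
  proof (intro conjI exI[of _ "\<lambda>f. \<Sum>i\<in>I. (\<lambda>x. f (i, x))"] ballI allI)
    show "bij_betw (\<lambda>f. \<Sum>i\<in>I. (\<lambda>x. f (i, x))) (mspace (direct_sum I N')) (mspace N)"
      unfolding bij_betw_def
    proof
      show "inj_on (\<lambda>f. \<Sum>i\<in>I. (\<lambda>x. f (i, x))) (mspace (direct_sum I N'))"
      proof (rule inj_onI)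
        fix f g assume f: "f \<in> mspace (direct_sum I N')" and g: "g \<in> mspace (direct_sum I N')"
          and e: "(\<Sum>i\<in>I. (\<lambda>x. f (i, x))) = (\<Sum>i\<in>I. (\<lambda>x. g (i, x)))"
        let ?r = "\<lambda>f. \<lambda>i\<in>I. (\<lambda>x. f (i, x))"
        have fW: "?r f \<in> (\<Pi>\<^sub>E i\<in>I. W i)" "?r g \<in> (\<Pi>\<^sub>E i\<in>I. W i)" using f g by (auto simp: direct_sum_def N'_def)
        have v: "(\<Sum>i\<in>I. (\<lambda>x. f (i, x))) \<in> mspace N"
          by (rule cfun.subspace_sum[OF subN]) (use f W in \<open>auto simp: direct_sum_def N'_def\<close>)
        have s: "(\<Sum>i\<in>I. ?r f i) = (\<Sum>i\<in>I. (\<lambda>x. f (i, x)))" for f :: "_ => complex" by (rule sum.cong) auto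
        have "?r f = ?r g" using dec[OF v] fW e s by metis
        then have "\<forall>i\<in>I. (\<lambda>x. f (i, x)) = (\<lambda>x. g (i, x))" by (metis restrict_apply')
        then show "f = g" using f g by (auto simp: direct_sum_def fun_eq_iff)
      qed
      show "(\<lambda>f. \<Sum>i\<in>I. (\<lambda>x. f (i, x))) ` mspace (direct_sum I N') = mspace N"
      proof (intro equalityI subsetI)
        fix v assume "v \<in> (\<lambda>f. \<Sum>i\<in>I. (\<lambda>x. f (i, x))) ` mspace (direct_sum I N')"
        then show "v \<in> mspace N" using W
          by (auto simp: direct_sum_def N'_def intro!: cfun.subspace_sum[OF subN])
      next
        fix v assume "v \<in> mspace N"
        then obtain f where f: "f \<in> (\<Pi>\<^sub>E i\<in>I. W i)" "v = (\<Sum>i\<in>I. f i)" using dec by blast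
        show "v \<in> (\<lambda>f. \<Sum>i\<in>I. (\<lambda>x. f (i, x))) ` mspace (direct_sum I N')"
          by (rule image_eqI[of _ _ "\<lambda>(i, x). if i \<in> I then f i x else 0"])
            (use f in \<open>auto simp: direct_sum_def N'_def PiE_def Pi_def\<close>)
      qed
    qed
  next
    fix v w :: "_ => complex" show "(\<Sum>i\<in>I. (\<lambda>x. (v + w) (i, x))) = (\<Sum>i\<in>I. (\<lambda>x. v (i, x))) + (\<Sum>i\<in>I. (\<lambda>x. w (i, x)))"
      by (rule ext) (simp add: fsum_apply sum.distrib)
  next
    fix v :: "_ => complex" and c :: complex show "(\<Sum>i\<in>I. (\<lambda>x. c * v (i, x))) = (\<lambda>y. c * (\<Sum>i\<in>I. (\<lambda>x. v (i, x))) y)"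
      by (rule ext) (simp add: fsum_apply sum_distrib_left)
  next
    fix v a assume v: "v \<in> mspace (direct_sum I N')" and a: "a \<in> group_algebra G"
    have "mact N (\<Sum>i\<in>I. (\<lambda>x. v (i, x))) a = (\<Sum>i\<in>I. mact N (\<lambda>x. v (i, x)) a)"
      by (rule cg_mact_sum[OF N a]) (use v W in \<open>auto simp: direct_sum_def N'_def\<close>)
    then show "(\<Sum>i\<in>I. (\<lambda>x. mact (direct_sum I N') v a (i, x))) = mact N (\<Sum>i\<in>I. (\<lambda>x. v (i, x))) a"
      by (auto simp: direct_sum_def N'_def intro!: sum.cong)
  qed (use N mN in \<open>auto intro: direct_sum_module\<close>)
  moreover have "mod_iso G (direct_sum I M) (direct_sum I N')"
    by (rule direct_sum_cong) (use iso in \<open>simp add: N'_def\<close>)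
  ultimately show ?thesis by (rule mod_iso_trans[rotated])
qed

section \<open>Matrices over a finite field\<close>

declare One_nat_def [simp del]

locale ffield = field F for F :: "'f ring" (structure) +
  assumes fin_F: "finite (carrier F)"
begin

lemma fs_closed: "(\<And>x. x \<in> A ==> f x \<in> carrier F) ==> finsum F f A \<in> carrier F"
  by (rule finsum_closed) auto

lemma fs_cong: "(\<And>x. x \<in> A ==> f x = g x) ==> (\<And>x. x \<in> A ==> g x \<in> carrier F) ==> finsum F f A = finsum F g A"
  by (rule finsum_cong') auto

lemma fs_zero: "(\<And>x. x \<in> A ==> f x = \<zero>) ==> finsum F f A = \<zero>"
  by (rule add.finprod_one_eqI)

lemma fs_add: "(\<And>x. x \<in> A ==> f x \<in> carrier F) ==> (\<And>x. x \<in> A ==> g x \<in> carrier F) ==>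
    (\<Oplus>x\<in>A. f x \<oplus> g x) = finsum F f A \<oplus> finsum F g A"
  by (rule finsum_addf) auto

lemma fs_ldistr: "finite A ==> a \<in> carrier F ==> (\<And>x. x \<in> A ==> f x \<in> carrier F) ==>
    finsum F f A \<otimes> a = (\<Oplus>x\<in>A. f x \<otimes> a)"
  by (rule finsum_ldistr) auto

lemma fs_rdistr: "finite A ==> a \<in> carrier F ==> (\<And>x. x \<in> A ==> f x \<in> carrier F) ==>
    a \<otimes> finsum F f A = (\<Oplus>x\<in>A. a \<otimes> f x)"
  by (rule finsum_rdistr) auto

lemma fs_mono: "finite B ==> A \<subseteq> B ==> (\<And>x. x \<in> B - A ==> f x = \<zero>) ==> (\<And>x. x \<in> A ==> f x \<in> carrier F) ==>
    finsum F f A = finsum F f B"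
proof -
  assume a: "finite B" "A \<subseteq> B" "\<And>x. x \<in> B - A ==> f x = \<zero>" "\<And>x. x \<in> A ==> f x \<in> carrier F"
  have "f x \<in> carrier F" if "x \<in> B" for x using a(3,4)[of x] that by (cases "x \<in> A") auto
  then show ?thesis by (intro add.finprod_mono_neutral_cong_left) (use a in auto)
qed

lemma fs_single: 
  assumes "finite A" "a \<in> A" "f a \<in> carrier F" "\<And>x. x \<in> A ==> x \<noteq> a ==> f x = \<zero>"
  shows "finsum F f A = f a"
proof -
  have "finsum F f {a} = finsum F f A" by (rule fs_mono) (use assms in auto)
  moreover have "finsum F f {a} = f a" using assms by simp
  ultimately show ?thesis by simp
qed

lemma fs_insert: "finite A ==> a \<notin> A ==> (\<And>x. x \<in> insert a A ==> f x \<in> carrier F) ==>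
    finsum F f (insert a A) = f a \<oplus> finsum F f A"
  by (rule finsum_insert) auto

lemma fs_swap:
  assumes "finite A" "finite B" "\<And>a b. a \<in> A ==> b \<in> B ==> f a b \<in> carrier F"
  shows "(\<Oplus>a\<in>A. \<Oplus>b\<in>B. f a b) = (\<Oplus>b\<in>B. \<Oplus>a\<in>A. f a b)"
  using assms(1,3)
proof (induction A rule: finite_induct)
  case empty show ?case by (simp add: fs_zero)
next
  case (insert x A)
  have "(\<Oplus>a\<in>insert x A. \<Oplus>b\<in>B. f a b) = (\<Oplus>b\<in>B. f x b) \<oplus> (\<Oplus>a\<in>A. \<Oplus>b\<in>B. f a b)"
    by (rule fs_insert) (use insert in \<open>auto intro!: fs_closed\<close>)
  also have "\<dots> = (\<Oplus>b\<in>B. f x b) \<oplus> (\<Oplus>b\<in>B. \<Oplus>a\<in>A. f a b)" using insert by simp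
  also have "\<dots> = (\<Oplus>b\<in>B. f x b \<oplus> (\<Oplus>a\<in>A. f a b))"
    by (rule fs_add[symmetric]) (use insert in \<open>auto intro!: fs_closed\<close>)
  also have "\<dots> = (\<Oplus>b\<in>B. \<Oplus>a\<in>insert x A. f a b)"
    by (rule fs_cong) (use insert in \<open>auto intro!: fs_closed fs_insert[symmetric]\<close>)
  finally show ?case .
qed

lemma fs_Sigma:
  assumes "finite A" "finite B" "\<And>a b. a \<in> A ==> b \<in> B ==> f (a, b) \<in> carrier F"
  shows "(\<Oplus>e\<in>A \<times> B. f e) = (\<Oplus>a\<in>A. \<Oplus>b\<in>B. f (a, b))"
  using assms(1,3)
proof (induction A rule: finite_induct)
  case (insert x A)
  have e: "insert x A \<times> B = ({x} \<times> B) \<union> (A \<times> B)" by auto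
  have "(\<Oplus>e\<in>insert x A \<times> B. f e) = (\<Oplus>e\<in>{x} \<times> B. f e) \<oplus> (\<Oplus>e\<in>A \<times> B. f e)"
    unfolding e by (rule finsum_Un_disjoint) (use insert assms(2) in auto)
  also have "(\<Oplus>e\<in>{x} \<times> B. f e) = (\<Oplus>b\<in>B. f (x, b))"
  proof -
    have "{x} \<times> B = Pair x ` B" by auto
    moreover have "(\<Oplus>e\<in>Pair x ` B. f e) = (\<Oplus>b\<in>B. f (x, b))"
      by (rule finsum_reindex) (use insert in \<open>auto intro: inj_onI\<close>)
    ultimately show ?thesis by simp
  qed
  also have "(\<Oplus>b\<in>B. f (x, b)) \<oplus> (\<Oplus>e\<in>A \<times> B. f e) = (\<Oplus>b\<in>B. f (x, b)) \<oplus> (\<Oplus>a\<in>A. \<Oplus>b\<in>B. f (a, b))" using insert by simp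
  also have "\<dots> = (\<Oplus>a\<in>insert x A. \<Oplus>b\<in>B. f (a, b))"
    by (rule fs_insert[symmetric]) (use insert in \<open>auto intro!: fs_closed\<close>)
  finally show ?case .
qed simp

lemma q_ge2: "card (carrier F) \<ge> 2"
proof -
  have "card {\<zero>, \<one>} \<le> card (carrier F)" by (rule card_mono[OF fin_F]) auto
  then show ?thesis by simp
qed

end

section \<open>The matrix ring, the general linear group and pattern subgroups\<close>

locale fmat = ffield F for F :: "'f ring" (structure) + fixes n :: nat
begin

abbreviation "N \<equiv> {1..n}"
abbreviation "R \<equiv> mat_ring F n"
abbreviation "MM \<equiv> carrier (mat_ring F n)"
abbreviation "G \<equiv> GL F n"
abbreviation "E \<equiv> one (mat_ring F n)"
abbreviation "q \<equiv> card (carrier F)"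
abbreviation vm (infixl "\<star>" 70) where "v \<star> A \<equiv> vec_mat F n v A"
abbreviation mat_times (infixl "**" 70) where "A ** B \<equiv> A \<otimes>\<^bsub>mat_ring F n\<^esub> B"
abbreviation mat_plus (infixl "+\<^sub>R" 65) where "A +\<^sub>R B \<equiv> A \<oplus>\<^bsub>mat_ring F n\<^esub> B"
abbreviation mat_minus (infixl "-\<^sub>R" 65) where "A -\<^sub>R B \<equiv> A \<ominus>\<^bsub>mat_ring F n\<^esub> B"
abbreviation gl_times (infixl "\<bullet>" 70) where "g \<bullet> h \<equiv> g \<otimes>\<^bsub>GL F n\<^esub> h"
abbreviation gl_inv ("ginv _" [81] 80) where "ginv g \<equiv> inv\<^bsub>GL F n\<^esub> g"

lemma MM_iff: "A \<in> MM \<longleftrightarrow> A \<in> extensional (N \<times> N) \<and> (\<forall>i\<in>N. \<forall>j\<in>N. A (i, j) \<in> carrier F)"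
  by (auto simp: mat_ring_def PiE_def Pi_def)

lemma MM_entry: "A \<in> MM ==> i \<in> N ==> j \<in> N ==> A (i, j) \<in> carrier F"
  by (auto simp: MM_iff)

lemma mat_eqI: "A \<in> MM ==> B \<in> MM ==> (\<And>i j. i \<in> N ==> j \<in> N ==> A (i, j) = B (i, j)) ==> A = B"
  by (rule extensionalityI[of A "N \<times> N" B]) (auto simp: MM_iff)

lemma finite_MM: "finite MM"
  unfolding mat_ring_def using fin_F by (simp add: finite_PiE)

lemma MM_restrict: "(\<And>i j. i \<in> N ==> j \<in> N ==> f (i, j) \<in> carrier F) ==> restrict f (N \<times> N) \<in> MM"
  by (auto simp: MM_iff)

lemma mult_entry': "i \<in> N ==> j \<in> N ==> (A ** B) (i, j) = (\<Oplus>k\<in>N. A (i, k) \<otimes> B (k, j))"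
  by (simp add: mat_ring_def)

lemma mult_row: "i \<in> N ==> j \<in> N ==> (A ** B) (i, j) = ((\<lambda>k. A (i, k)) \<star> B) j"
  by (simp add: mat_ring_def vec_mat_def)

lemma add_entry: "i \<in> N ==> j \<in> N ==> (A +\<^sub>R B) (i, j) = A (i, j) \<oplus> B (i, j)"
  by (simp add: mat_ring_def)

lemma one_entry: "i \<in> N ==> j \<in> N ==> E (i, j) = (if i = j then \<one> else \<zero>)"
  by (simp add: mat_ring_def)

lemma zero_entry: "i \<in> N ==> j \<in> N ==> \<zero>\<^bsub>R\<^esub> (i, j) = \<zero>"
  by (simp add: mat_ring_def)

lemma R_mult_closed: "A \<in> MM ==> B \<in> MM ==> A ** B \<in> MM"
  unfolding MM_iff by (auto simp: mult_entry' intro!: fs_closed) (auto simp: mat_ring_def)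
lemma R_add_closed: "A \<in> MM ==> B \<in> MM ==> A +\<^sub>R B \<in> MM"
  unfolding MM_iff by (auto simp: add_entry) (auto simp: mat_ring_def)
lemma R_one_closed: "E \<in> MM" unfolding MM_iff by (auto simp: one_entry) (auto simp: mat_ring_def)
lemma R_zero_closed: "\<zero>\<^bsub>R\<^esub> \<in> MM" unfolding MM_iff by (auto simp: zero_entry) (auto simp: mat_ring_def)

lemma vm_entry: "j \<in> N ==> (v \<star> A) j = (\<Oplus>k\<in>N. v k \<otimes> A (k, j))"
  by (simp add: vec_mat_def)

lemma vm_closed: "(\<And>k. k \<in> N ==> v k \<in> carrier F) ==> A \<in> MM ==> j \<in> N ==> (v \<star> A) j \<in> carrier F"
  by (auto simp: vm_entry MM_entry intro!: fs_closed)

text \<open>A row of a matrix product is a row vector times a matrix, so this is associativity of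
  the matrix product one row at a time. The same operation later acts on subspaces.\<close>

lemma vm_assoc:
  assumes v: "\<And>k. k \<in> N ==> v k \<in> carrier F" and A: "A \<in> MM" and B: "B \<in> MM"
  shows "v \<star> A \<star> B = v \<star> (A ** B)"
proof -
  have "(v \<star> A \<star> B) j = (v \<star> (A ** B)) j" if j: "j \<in> N" for j
  proof -
    note [simp] = MM_entry[OF A] MM_entry[OF B] v
    have "(v \<star> A \<star> B) j = (\<Oplus>k\<in>N. (\<Oplus>l\<in>N. v l \<otimes> A (l, k)) \<otimes> B (k, j))"
      unfolding vm_entry[OF j] by (rule fs_cong) (use j in \<open>auto simp: vm_entry intro!: fs_closed\<close>)
    also have "\<dots> = (\<Oplus>k\<in>N. \<Oplus>l\<in>N. v l \<otimes> A (l, k) \<otimes> B (k, j))"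
      by (rule fs_cong, rule fs_ldistr) (use j in \<open>auto intro!: fs_closed\<close>)
    also have "\<dots> = (\<Oplus>l\<in>N. \<Oplus>k\<in>N. v l \<otimes> A (l, k) \<otimes> B (k, j))"
      by (rule fs_swap) (use j in auto)
    also have "\<dots> = (\<Oplus>l\<in>N. v l \<otimes> (\<Oplus>k\<in>N. A (l, k) \<otimes> B (k, j)))"
      by (rule fs_cong, subst fs_rdistr) (use j in \<open>auto simp: m_assoc intro!: fs_closed fs_cong\<close>)
    also have "\<dots> = (v \<star> (A ** B)) j"
      unfolding vm_entry[OF j] by (rule fs_cong) (use j in \<open>auto simp: mult_entry' intro!: fs_closed\<close>)
    finally show ?thesis .
  qed
  then show ?thesis by (auto simp: vec_mat_def fun_eq_iff)
qed

lemma vm_one: assumes v: "\<And>k. k \<in> N ==> v k \<in> carrier F" and j: "j \<in> N" shows "(v \<star> E) j = v j"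
proof -
  have "(\<Oplus>k\<in>N. v k \<otimes> E (k, j)) = v j \<otimes> E (j, j)"
    by (rule fs_single) (use v j in \<open>auto simp: one_entry\<close>)
  then show ?thesis using v j by (simp add: vm_entry one_entry)
qed

lemma vm_cong: "(\<And>k. k \<in> N ==> v k = w k) ==> (\<And>k. k \<in> N ==> w k \<in> carrier F) ==> A \<in> MM ==> v \<star> A = w \<star> A"
  unfolding vec_mat_def by (rule restrict_ext, rule fs_cong) (auto simp: MM_entry)

lemma ring_R: "ring R"
proof (rule ringI)
  show "abelian_group R"
  proof (rule abelian_groupI)
    fix x assume x: "x \<in> MM"
    have m: "(\<lambda>e\<in>N\<times>N. \<ominus> x e) \<in> MM" by (rule MM_restrict) (simp add: MM_entry[OF x])
    show "\<exists>y\<in>MM. y +\<^sub>R x = \<zero>\<^bsub>R\<^esub>"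
      by (rule bexI[OF _ m], rule mat_eqI)
        (use x m in \<open>auto simp: add_entry zero_entry MM_entry l_neg intro!: R_add_closed R_zero_closed\<close>)
  qed (auto intro!: R_add_closed R_zero_closed mat_eqI simp: add_entry zero_entry MM_entry a_ac)
  show "monoid R"
  proof (rule monoidI)
    fix x y z assume xyz: "x \<in> MM" "y \<in> MM" "z \<in> MM"
    show "x ** y ** z = x ** (y ** z)"
    proof (rule mat_eqI)
      fix i j assume ij: "i \<in> N" "j \<in> N"
      have "(x ** y ** z) (i, j) = ((\<lambda>k. x (i, k)) \<star> y \<star> z) j"
        unfolding mult_row[OF ij]
        by (rule fun_cong[where x=j], rule vm_cong) (use xyz ij in \<open>auto simp: mult_row MM_entry intro!: vm_closed\<close>)
      also have "\<dots> = (x ** (y ** z)) (i, j)"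
        unfolding mult_row[OF ij]
        by (rule fun_cong[where x=j], rule vm_assoc) (use ij xyz in \<open>auto simp: MM_entry\<close>)
      finally show "(x ** y ** z) (i, j) = (x ** (y ** z)) (i, j)" .
    qed (use xyz in \<open>auto intro!: R_mult_closed\<close>)
  next
    fix x assume x: "x \<in> MM"
    show "E ** x = x"
    proof (rule mat_eqI)
      fix i j assume ij: "i \<in> N" "j \<in> N"
      have "(\<Oplus>k\<in>N. E (i, k) \<otimes> x (k, j)) = E (i, i) \<otimes> x (i, j)"
        by (rule fs_single) (use x ij in \<open>auto simp: one_entry MM_entry\<close>)
      then show "(E ** x) (i, j) = x (i, j)" using ij x by (simp add: mult_entry' one_entry MM_entry)
    qed (use x in \<open>auto intro!: R_mult_closed R_one_closed\<close>)
    show "x ** E = x"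
    proof (rule mat_eqI)
      fix i j assume ij: "i \<in> N" "j \<in> N"
      show "(x ** E) (i, j) = x (i, j)"
        unfolding mult_row[OF ij] by (rule vm_one) (use x ij MM_entry in auto)
    qed (use x in \<open>auto intro!: R_mult_closed R_one_closed\<close>)
  qed (auto intro: R_mult_closed R_one_closed)
next
  fix x y z assume xyz: "x \<in> MM" "y \<in> MM" "z \<in> MM"
  show "(x +\<^sub>R y) ** z = x ** z +\<^sub>R y ** z"
  proof (rule mat_eqI)
    fix i j assume ij: "i \<in> N" "j \<in> N"
    have "(\<Oplus>k\<in>N. (x +\<^sub>R y) (i, k) \<otimes> z (k, j)) = (\<Oplus>k\<in>N. x (i, k) \<otimes> z (k, j) \<oplus> y (i, k) \<otimes> z (k, j))"
      by (rule fs_cong) (use xyz ij in \<open>auto simp: MM_entry add_entry l_distr\<close>)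
    also have "\<dots> = (\<Oplus>k\<in>N. x (i, k) \<otimes> z (k, j)) \<oplus> (\<Oplus>k\<in>N. y (i, k) \<otimes> z (k, j))"
      by (rule fs_add) (use xyz ij in \<open>auto simp: MM_entry\<close>)
    finally show "((x +\<^sub>R y) ** z) (i, j) = (x ** z +\<^sub>R y ** z) (i, j)"
      using ij by (simp add: mult_entry' add_entry)
  qed (use xyz in \<open>auto intro!: R_mult_closed R_add_closed\<close>)
  show "z ** (x +\<^sub>R y) = z ** x +\<^sub>R z ** y"
  proof (rule mat_eqI)
    fix i j assume ij: "i \<in> N" "j \<in> N"
    have "(\<Oplus>k\<in>N. z (i, k) \<otimes> (x +\<^sub>R y) (k, j)) = (\<Oplus>k\<in>N. z (i, k) \<otimes> x (k, j) \<oplus> z (i, k) \<otimes> y (k, j))"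
      by (rule fs_cong) (use xyz ij in \<open>auto simp: MM_entry add_entry r_distr\<close>)
    also have "\<dots> = (\<Oplus>k\<in>N. z (i, k) \<otimes> x (k, j)) \<oplus> (\<Oplus>k\<in>N. z (i, k) \<otimes> y (k, j))"
      by (rule fs_add) (use xyz ij in \<open>auto simp: MM_entry\<close>)
    finally show "(z ** (x +\<^sub>R y)) (i, j) = (z ** x +\<^sub>R z ** y) (i, j)"
      using ij by (simp add: mult_entry' add_entry)
  qed (use xyz in \<open>auto intro!: R_mult_closed R_add_closed\<close>)
qed

sublocale R: ring R by (rule ring_R)

lemma uminus_entry: assumes x: "x \<in> MM" and ij: "i \<in> N" "j \<in> N" shows "(\<ominus>\<^bsub>R\<^esub> x) (i, j) = \<ominus> x (i, j)"
proof -
  have m: "(\<lambda>e\<in>N\<times>N. \<ominus> x e) \<in> MM" by (rule MM_restrict) (simp add: MM_entry[OF x])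
  have "(\<lambda>e\<in>N\<times>N. \<ominus> x e) +\<^sub>R x = \<zero>\<^bsub>R\<^esub>"
    by (rule mat_eqI) (use x m in \<open>auto simp: add_entry zero_entry MM_entry l_neg\<close>)
  then have "\<ominus>\<^bsub>R\<^esub> x = (\<lambda>e\<in>N\<times>N. \<ominus> x e)" using x m by (intro R.minus_equality) auto
  then show ?thesis using ij by simp
qed

lemma minus_entry: "x \<in> MM ==> y \<in> MM ==> i \<in> N ==> j \<in> N ==> (x -\<^sub>R y) (i, j) = x (i, j) \<ominus> y (i, j)"
  by (simp add: a_minus_def add_entry uminus_entry)

lemma G_carrier: "carrier G = Units R" by (simp add: GL_def units_of_carrier)
lemma G_mult: "x \<bullet> y = x ** y" by (simp add: GL_def units_of_mult)
lemma G_one: "\<one>\<^bsub>G\<^esub> = E" by (simp add: GL_def units_of_one)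
lemma G_MM: "x \<in> carrier G ==> x \<in> MM" by (simp add: G_carrier R.Units_closed)

sublocale G: fin_group G
proof -
  interpret g: group G unfolding GL_def by (rule R.units_group)
  show "fin_group G" by unfold_locales (rule finite_subset[OF _ finite_MM], auto intro: G_MM)
qed

lemma mult_entry: "i \<in> N ==> j \<in> N ==> (A \<bullet> B) (i, j) = (\<Oplus>k\<in>N. A (i, k) \<otimes> B (k, j))"
  by (simp add: G_mult mult_entry')

lemma row_cong:
  assumes "\<And>k. k \<in> N ==> A (i, k) = A' (i, k)" "A' \<in> MM" "B \<in> MM" "i \<in> N" "j \<in> N"
  shows "(A ** B) (i, j) = (A' ** B) (i, j)"
  unfolding mult_entry'[OF assms(4,5)] by (rule fs_cong) (use assms in \<open>auto simp: MM_entry\<close>)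

subsection \<open>Pattern subgroups\<close>

abbreviation "Phi \<equiv> neg_roots n"

definition closed_pat :: "(nat \<times> nat) set => bool" where
  "closed_pat S \<longleftrightarrow> S \<subseteq> Phi \<and> (\<forall>i j k. (i, j) \<in> S \<longrightarrow> (j, k) \<in> S \<longrightarrow> (i, k) \<in> S)"

lemma Phi_iff: "(i, j) \<in> Phi \<longleftrightarrow> 1 \<le> j \<and> j < i \<and> i \<le> n" by (simp add: neg_roots_def)
lemma Phi_NN: "Phi \<subseteq> N \<times> N" by (auto simp: Phi_iff)
lemma finite_Phi: "finite Phi" by (rule finite_subset[OF Phi_NN]) auto
lemma finite_sub_Phi: "S \<subseteq> Phi ==> finite S" using finite_Phi finite_subset by blast
lemma closed_Phi: "closed_pat Phi" by (auto simp: closed_pat_def Phi_iff)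

lemma VS_iff: "A \<in> VS F n S \<longleftrightarrow> A \<in> MM \<and> (\<forall>i\<in>N. \<forall>j\<in>N. (i, j) \<notin> S \<longrightarrow> A (i, j) = \<zero>)"
  by (auto simp: VS_def supp_def)

lemma VS_MM: "A \<in> VS F n S ==> A \<in> MM" by (simp add: VS_iff)

lemma US_iff:
  assumes S: "S \<subseteq> Phi"
  shows "u \<in> US F n S \<longleftrightarrow> u \<in> MM \<and> (\<forall>i\<in>N. u (i, i) = \<one>) \<and> (\<forall>i\<in>N. \<forall>j\<in>N. i \<noteq> j \<longrightarrow> (i, j) \<notin> S \<longrightarrow> u (i, j) = \<zero>)"
proof
  assume "u \<in> US F n S"
  then obtain A where A: "A \<in> VS F n S" "u = E +\<^sub>R A" by (auto simp: US_def)
  have "A (i, i) = \<zero>" if "i \<in> N" for i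
  proof -
    have "(i, i) \<notin> S" using S by (auto simp: Phi_iff)
    then show ?thesis using A that by (simp add: VS_iff)
  qed
  then show "u \<in> MM \<and> (\<forall>i\<in>N. u (i, i) = \<one>) \<and> (\<forall>i\<in>N. \<forall>j\<in>N. i \<noteq> j \<longrightarrow> (i, j) \<notin> S \<longrightarrow> u (i, j) = \<zero>)"
    using A by (auto simp: VS_iff add_entry one_entry)
next
  assume u: "u \<in> MM \<and> (\<forall>i\<in>N. u (i, i) = \<one>) \<and> (\<forall>i\<in>N. \<forall>j\<in>N. i \<noteq> j \<longrightarrow> (i, j) \<notin> S \<longrightarrow> u (i, j) = \<zero>)"
  have "u -\<^sub>R E \<in> VS F n S"
    unfolding VS_iff
  proof (intro conjI ballI impI)
    show "u -\<^sub>R E \<in> MM" using u by auto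
    fix i j assume "i \<in> N" "j \<in> N" "(i, j) \<notin> S"
    moreover have "u (i, j) = (if i = j then \<one> else \<zero>)" using u calculation by auto
    ultimately show "(u -\<^sub>R E) (i, j) = \<zero>" using u by (simp add: minus_entry one_entry r_neg minus_eq)
  qed
  moreover have "u = E +\<^sub>R (u -\<^sub>R E)" using u by (simp add: a_minus_def R.a_ac R.r_neg)
  ultimately show "u \<in> US F n S" by (auto simp: US_def)
qed

lemma US_minus: "S \<subseteq> Phi ==> u \<in> US F n S ==> u -\<^sub>R E \<in> VS F n S"
  unfolding US_def by (auto simp: VS_MM a_minus_def R.a_ac R.r_neg)

lemma US_plus: "A \<in> VS F n S ==> E +\<^sub>R A \<in> US F n S" by (auto simp: US_def)

lemma plus_minus: "A \<in> MM ==> (E +\<^sub>R A) -\<^sub>R E = A" by (simp add: a_minus_def R.a_ac R.r_neg)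
lemma minus_plus: "A \<in> MM ==> E +\<^sub>R (A -\<^sub>R E) = A" by (simp add: a_minus_def R.a_ac R.r_neg)

lemma US_mono: "S \<subseteq> T ==> US F n S \<subseteq> US F n T"
  by (auto simp: US_def VS_def)

lemma US_MM: "u \<in> US F n S ==> u \<in> MM"
  by (auto simp: US_def VS_MM)

lemma US_one: "E \<in> US F n S"
  by (auto simp: US_def VS_iff zero_entry intro!: exI[of _ "\<zero>\<^bsub>R\<^esub>"])

lemma US_mult:
  assumes S: "closed_pat S" and u: "u \<in> US F n S" and v: "v \<in> US F n S"
  shows "u ** v \<in> US F n S"
proof -
  have SP: "S \<subseteq> Phi" using S by (simp add: closed_pat_def)
  have um: "u \<in> MM" and vm: "v \<in> MM" using u v US_MM by auto
  have ud: "u (i, i) = \<one>" "v (i, i) = \<one>" if "i \<in> N" for i using u v that by (auto simp: US_iff[OF SP])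
  have uz: "u (i, k) = \<zero>" if "i \<in> N" "k \<in> N" "i \<noteq> k" "(i, k) \<notin> S" for i k using u that by (auto simp: US_iff[OF SP])
  have vz: "v (i, k) = \<zero>" if "i \<in> N" "k \<in> N" "i \<noteq> k" "(i, k) \<notin> S" for i k using v that by (auto simp: US_iff[OF SP])
  have ge: "k < i" if "(i, k) \<in> S" for i k using that SP by (auto simp: Phi_iff)
  show ?thesis unfolding US_iff[OF SP]
  proof (intro conjI ballI impI)
    show "u ** v \<in> MM" using um vm by auto
  next
    fix i assume i: "i \<in> N"
    have "(\<Oplus>k\<in>N. u (i, k) \<otimes> v (k, i)) = u (i, i) \<otimes> v (i, i)"
    proof (rule fs_single)
      fix k assume k: "k \<in> N" "k \<noteq> i"
      have "(i, k) \<notin> S \<or> (k, i) \<notin> S" using ge[of i k] ge[of k i] by linarith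
      then show "u (i, k) \<otimes> v (k, i) = \<zero>" using uz[of i k] vz[of k i] i k um vm MM_entry by auto
    qed (use i um vm MM_entry in auto)
    then show "(u ** v) (i, i) = \<one>" using i ud by (simp add: mult_entry')
  next
    fix i j assume ij: "i \<in> N" "j \<in> N" "i \<noteq> j" "(i, j) \<notin> S"
    have "(\<Oplus>k\<in>N. u (i, k) \<otimes> v (k, j)) = \<zero>"
    proof (rule fs_zero)
      fix k assume k: "k \<in> N"
      have "(i \<noteq> k \<and> (i, k) \<notin> S) \<or> (k \<noteq> j \<and> (k, j) \<notin> S)"
        using ij S unfolding closed_pat_def by metis
      then show "u (i, k) \<otimes> v (k, j) = \<zero>" using uz[of i k] vz[of k j] ij k um vm MM_entry by auto
    qed
    then show "(u ** v) (i, j) = \<zero>" using ij by (simp add: mult_entry')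
  qed
qed

lemma US_lower: "u \<in> US F n Phi ==> i \<in> N ==> j \<in> N ==> i < j ==> u (i, j) = \<zero>"
  by (auto simp: US_iff Phi_iff)

lemma US_diag: "S \<subseteq> Phi ==> u \<in> US F n S ==> i \<in> N ==> u (i, i) = \<one>"
  by (auto simp: US_iff)

lemma US_zero: "S \<subseteq> Phi ==> u \<in> US F n S ==> i \<in> N ==> j \<in> N ==> i \<noteq> j ==> (i, j) \<notin> S ==> u (i, j) = \<zero>"
  by (auto simp: US_iff)

text \<open>Forward substitution: row \<open>i\<close> of \<open>u ** z\<close> is row
  \<open>i\<close> of \<open>z\<close> plus a combination of earlier rows of \<open>z\<close>.
  Cancellation in a finite set will yield inverses without determinants.\<close>

lemma US_cancel:
  assumes u: "u \<in> US F n Phi" and x: "x \<in> MM" and y: "y \<in> MM" and eq: "u ** x = u ** y"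
  shows "x = y"
proof -
  have um: "u \<in> MM" by (rule US_MM[OF u])
  have split: "(u ** z) (i, j) = z (i, j) \<oplus> (\<Oplus>k\<in>N - {i}. u (i, k) \<otimes> z (k, j))"
    if "i \<in> N" "j \<in> N" "z \<in> MM" for i j z
  proof -
    have e: "N = insert i (N - {i})" using that by auto
    have "(u ** z) (i, j) = (\<Oplus>k\<in>insert i (N - {i}). u (i, k) \<otimes> z (k, j))" using that e by (simp add: mult_entry')
    also have "\<dots> = u (i, i) \<otimes> z (i, j) \<oplus> (\<Oplus>k\<in>N - {i}. u (i, k) \<otimes> z (k, j))"
      by (rule fs_insert) (use that um MM_entry in auto)
    finally show ?thesis using US_diag[OF _ u] that MM_entry by simp
  qed
  have "\<forall>j\<in>N. x (i, j) = y (i, j)" if "i \<in> N" for i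
    using that
  proof (induction i rule: less_induct)
    case (less i)
    show ?case
    proof
      fix j assume j: "j \<in> N"
      have "(\<Oplus>k\<in>N - {i}. u (i, k) \<otimes> x (k, j)) = (\<Oplus>k\<in>N - {i}. u (i, k) \<otimes> y (k, j))"
      proof (rule fs_cong)
        fix k assume k: "k \<in> N - {i}"
        show "u (i, k) \<otimes> x (k, j) = u (i, k) \<otimes> y (k, j)"
        proof (cases "k < i")
          case True then show ?thesis using less(1)[of k] k j by auto
        next
          case False then show ?thesis using US_lower[OF u less(2), of k] k j x y MM_entry by auto
        qed
      qed (use um y less j MM_entry in auto)
      moreover have "(u ** x) (i, j) = (u ** y) (i, j)" using eq by simp
      moreover have "(\<Oplus>k\<in>N - {i}. u (i, k) \<otimes> y (k, j)) \<in> carrier F"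
        by (rule fs_closed) (use um y less j MM_entry in auto)
      ultimately show "x (i, j) = y (i, j)"
        using split[OF less(2) j x] split[OF less(2) j y] MM_entry[OF x less(2) j] MM_entry[OF y less(2) j] by simp
    qed
  qed
  then show ?thesis by (intro mat_eqI[OF x y]) auto
qed

lemma finite_US: "finite (US F n S)"
  by (rule finite_subset[OF _ finite_MM]) (auto intro: US_MM)

text \<open>By cancellation, left multiplication by \<open>u\<close> is an injective self-map of the
  finite set \<open>US F n S\<close>, so it reaches \<open>E\<close>. The inverse found in this way
  stays inside the pattern.\<close>

lemma US_right_inv:
  assumes S: "closed_pat S" and u: "u \<in> US F n S"
  shows "\<exists>v\<in>US F n S. u ** v = E"
proof -
  have uP: "u \<in> US F n Phi" using u US_mono[of S Phi] S by (auto simp: closed_pat_def)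
  have "inj_on (\<lambda>v. u ** v) (US F n S)"
    by (rule inj_onI) (rule US_cancel[OF uP US_MM US_MM])
  then have "(\<lambda>v. u ** v) ` US F n S = US F n S"
    by (intro endo_inj_surj[OF finite_US]) (auto intro: US_mult[OF S u])
  then show ?thesis using US_one[of S] by (metis imageE)
qed

lemma US_Units:
  assumes S: "S \<subseteq> Phi" and u: "u \<in> US F n S" shows "u \<in> carrier G"
proof -
  have uP: "u \<in> US F n Phi" using u US_mono[OF S] by auto
  obtain v where v: "v \<in> US F n Phi" "u ** v = E" using US_right_inv[OF closed_Phi uP] by blast
  \<comment> \<open>\<open>v\<close> has a right inverse too; evaluating \<open>u v w\<close> in two
    ways gives \<open>w = u\<close>, so the right inverse is two-sided.\<close>
  obtain w where w: "w \<in> US F n Phi" "v ** w = E" using US_right_inv[OF closed_Phi v(1)] by blast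
  note m = US_MM[OF uP] US_MM[OF v(1)] US_MM[OF w(1)]
  have "u = u ** (v ** w)" using w m by simp
  also have "\<dots> = w" using m v by (simp add: R.m_assoc[symmetric])
  finally have "v ** u = E" using w by simp
  then show ?thesis using v m unfolding G_carrier Units_def by blast
qed

lemma US_subgroup: assumes S: "closed_pat S" shows "subgroup (US F n S) G"
proof -
  have SP: "S \<subseteq> Phi" using S by (simp add: closed_pat_def)
  show ?thesis
  proof (rule G.subgroupI)
    show "US F n S \<subseteq> carrier G" using US_Units[OF SP] by auto
    show "US F n S \<noteq> {}" using US_one by auto
    fix u assume u: "u \<in> US F n S"
    obtain v where v: "v \<in> US F n S" "u ** v = E" using US_right_inv[OF S u] by blast
    have "ginv u = v"
      using v u US_Units[OF SP] by (metis G.inv_equality G.inv_comm G_mult G_one)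
    then show "ginv u \<in> US F n S" using v by simp
  next
    fix u v assume "u \<in> US F n S" "v \<in> US F n S"
    then show "u \<bullet> v \<in> US F n S" using US_mult[OF S] by (simp add: G_mult)
  qed
qed

lemma VS_finite: "finite (VS F n S)"
  by (rule finite_subset[OF _ finite_MM]) (auto intro: VS_MM)

lemma bij_VS: assumes S: "S \<subseteq> N \<times> N"
  shows "bij_betw (\<lambda>A. restrict A S) (VS F n S) (S \<rightarrow>\<^sub>E carrier F)"
proof (rule bij_betw_byWitness[where f'="\<lambda>f. \<lambda>e\<in>N\<times>N. if e \<in> S then f e else \<zero>"])
  show "\<forall>A\<in>VS F n S. (\<lambda>e\<in>N\<times>N. if e \<in> S then restrict A S e else \<zero>) = A"
  proof
    fix A assume A: "A \<in> VS F n S"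
    show "(\<lambda>e\<in>N\<times>N. if e \<in> S then restrict A S e else \<zero>) = A"
      by (rule mat_eqI) (use A in \<open>auto simp: VS_iff MM_entry intro!: MM_restrict\<close>)
  qed
  show "\<forall>f\<in>S \<rightarrow>\<^sub>E carrier F. restrict (\<lambda>e\<in>N\<times>N. if e \<in> S then f e else \<zero>) S = f"
    using S by (fastforce simp: fun_eq_iff PiE_def extensional_def)
  show "(\<lambda>A. restrict A S) ` VS F n S \<subseteq> S \<rightarrow>\<^sub>E carrier F"
    using S by (auto simp: VS_iff MM_entry)
  show "(\<lambda>f. \<lambda>e\<in>N\<times>N. if e \<in> S then f e else \<zero>) ` (S \<rightarrow>\<^sub>E carrier F) \<subseteq> VS F n S"
    by (auto simp: VS_iff PiE_iff intro!: MM_restrict)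
qed

lemma card_VS: assumes S: "S \<subseteq> N \<times> N" shows "card (VS F n S) = q ^ card S"
proof -
  have "finite S" using S finite_subset by blast
  then show ?thesis using bij_betw_same_card[OF bij_VS[OF S]] by (simp add: card_PiE)
qed

lemma card_US: assumes S: "S \<subseteq> Phi" shows "card (US F n S) = q ^ card S"
proof -
  have "bij_betw (\<lambda>A. E +\<^sub>R A) (VS F n S) (US F n S)"
    by (rule bij_betw_byWitness[where f'="\<lambda>u. u -\<^sub>R E"])
      (auto simp: plus_minus minus_plus VS_MM US_MM US_plus US_minus[OF S])
  then show ?thesis using card_VS[of S] S Phi_NN by (simp add: bij_betw_same_card)
qed

end

section \<open>Transposition, the trace form, and the rigidity of verges\<close>

context fmat
begin

definition tr :: "'f matrix => 'f matrix" where
  "tr A = (\<lambda>e\<in>N\<times>N. A (snd e, fst e))"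

definition trunc :: "(nat \<times> nat) set => 'f matrix => 'f matrix" where
  "trunc S A = (\<lambda>e\<in>N\<times>N. if e \<in> S then A e else \<zero>)"

text \<open>The trace form \<open>tr (A^T B)\<close>. It is summed over all positions and not over a
  pattern, so that matrix factors can be moved across it.\<close>

definition pair :: "'f matrix => 'f matrix => 'f" where
  "pair A B = (\<Oplus>e\<in>N\<times>N. A e \<otimes> B e)"

lemma tr_entry: "i \<in> N ==> j \<in> N ==> tr A (i, j) = A (j, i)" by (simp add: tr_def)
lemma tr_MM: "A \<in> MM ==> tr A \<in> MM" unfolding tr_def by (rule MM_restrict) (simp add: MM_entry)
lemma trunc_entry: "i \<in> N ==> j \<in> N ==> trunc S A (i, j) = (if (i, j) \<in> S then A (i, j) else \<zero>)"
  by (simp add: trunc_def)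
lemma trunc_VS: "A \<in> MM ==> trunc S A \<in> VS F n S"
  unfolding VS_iff by (auto simp: trunc_entry) (auto simp: trunc_def MM_entry intro!: MM_restrict)
lemma tr_mult: assumes A: "A \<in> MM" and B: "B \<in> MM" shows "tr (A ** B) = tr B ** tr A"
proof (rule mat_eqI)
  fix i j assume ij: "i \<in> N" "j \<in> N"
  show "tr (A ** B) (i, j) = (tr B ** tr A) (i, j)"
    unfolding mult_entry'[OF ij] tr_entry[OF ij] mult_entry'[OF ij(2,1)]
    by (rule fs_cong) (use ij A B MM_entry in \<open>auto simp: tr_entry m_comm\<close>)
qed (use A B tr_MM in auto)

lemma tr_E: "tr E = E"
  by (rule mat_eqI) (auto simp: tr_entry one_entry intro!: tr_MM)

lemma pair_closed: "A \<in> MM ==> B \<in> MM ==> pair A B \<in> carrier F"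
  unfolding pair_def by (rule fs_closed) (auto simp: MM_entry)

lemma pair_comm: "A \<in> MM ==> B \<in> MM ==> pair A B = pair B A"
  unfolding pair_def by (rule fs_cong) (auto simp: MM_entry m_comm)

lemma pair_add: "A \<in> MM ==> B \<in> MM ==> C \<in> MM ==> pair A (B +\<^sub>R C) = pair A B \<oplus> pair A C"
proof -
  assume m: "A \<in> MM" "B \<in> MM" "C \<in> MM"
  have "pair A (B +\<^sub>R C) = (\<Oplus>e\<in>N\<times>N. A e \<otimes> B e \<oplus> A e \<otimes> C e)"
    unfolding pair_def by (rule fs_cong) (use m MM_entry in \<open>auto simp: add_entry r_distr\<close>)
  also have "\<dots> = pair A B \<oplus> pair A C"
    unfolding pair_def by (rule fs_add) (use m MM_entry in auto)
  finally show ?thesis .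
qed

lemma pair_uminus: "A \<in> MM ==> B \<in> MM ==> pair A (\<ominus>\<^bsub>R\<^esub> B) = \<ominus> pair A B"
proof -
  assume m: "A \<in> MM" "B \<in> MM"
  have "pair A (\<ominus>\<^bsub>R\<^esub> B) \<oplus> pair A B = pair A (\<ominus>\<^bsub>R\<^esub> B +\<^sub>R B)" using m by (simp add: pair_add)
  also have "\<dots> = \<zero>" using m by (simp add: R.l_neg) (auto simp: pair_def zero_entry MM_entry intro!: fs_zero)
  finally show ?thesis using m by (metis pair_closed R.a_inv_closed minus_equality)
qed

lemma pair_minus: "A \<in> MM ==> B \<in> MM ==> C \<in> MM ==> pair A (B -\<^sub>R C) = pair A B \<ominus> pair A C"
  by (simp add: a_minus_def pair_add pair_uminus)

lemma pair_row: assumes "A \<in> MM" "B \<in> MM" shows "pair A B = (\<Oplus>i\<in>N. \<Oplus>j\<in>N. A (i, j) \<otimes> B (i, j))"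
  unfolding pair_def by (rule fs_Sigma) (use assms MM_entry in auto)

text \<open>Adjointness of the trace form: a left factor moves across as its transpose. This turns
  translations of group elements into row operations on the index matrix of a character.\<close>

lemma pair_mult_left:
  assumes D: "D \<in> MM" and l: "l \<in> MM" and X: "X \<in> MM"
  shows "pair D (l ** X) = pair (tr l ** D) X"
proof -
  note [simp] = MM_entry[OF D] MM_entry[OF l] MM_entry[OF X]
  have "pair D (l ** X) = (\<Oplus>i\<in>N. \<Oplus>j\<in>N. \<Oplus>k\<in>N. l (i, k) \<otimes> D (i, j) \<otimes> X (k, j))"
    unfolding pair_row[OF D R_mult_closed[OF l X]]
  proof (intro fs_cong)
    fix i j assume ij: "i \<in> N" "j \<in> N"
    show "D (i, j) \<otimes> (l ** X) (i, j) = (\<Oplus>k\<in>N. l (i, k) \<otimes> D (i, j) \<otimes> X (k, j))"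
      unfolding mult_entry'[OF ij] using ij
      by (subst fs_rdistr) (auto intro!: fs_cong simp: m_ac)
  qed (auto intro!: fs_closed)
  also have "\<dots> = (\<Oplus>i\<in>N. \<Oplus>k\<in>N. \<Oplus>j\<in>N. l (i, k) \<otimes> D (i, j) \<otimes> X (k, j))"
    by (rule fs_cong, rule fs_swap) (auto intro!: fs_closed)
  also have "\<dots> = (\<Oplus>k\<in>N. \<Oplus>i\<in>N. \<Oplus>j\<in>N. l (i, k) \<otimes> D (i, j) \<otimes> X (k, j))"
    by (rule fs_swap) (auto intro!: fs_closed)
  also have "\<dots> = (\<Oplus>k\<in>N. \<Oplus>j\<in>N. \<Oplus>i\<in>N. l (i, k) \<otimes> D (i, j) \<otimes> X (k, j))"
    by (rule fs_cong, rule fs_swap) (auto intro!: fs_closed)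
  also have "\<dots> = pair (tr l ** D) X"
    unfolding pair_row[OF R_mult_closed[OF tr_MM[OF l] D] X]
  proof (intro fs_cong)
    fix k j assume kj: "k \<in> N" "j \<in> N"
    have "(\<Oplus>i\<in>N. l (i, k) \<otimes> D (i, j)) = (tr l ** D) (k, j)"
      unfolding mult_entry'[OF kj] by (rule fs_cong) (use kj in \<open>auto simp: tr_entry\<close>)
    then show "(\<Oplus>i\<in>N. l (i, k) \<otimes> D (i, j) \<otimes> X (k, j)) = (tr l ** D) (k, j) \<otimes> X (k, j)"
      using kj by (subst fs_ldistr[symmetric]) auto
  qed (use MM_entry[OF R_mult_closed[OF tr_MM[OF l] D]] in \<open>auto intro!: fs_closed\<close>)
  finally show ?thesis .
qed

lemma tr_tr: "A \<in> MM ==> tr (tr A) = A"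
  by (rule mat_eqI) (auto simp: tr_entry intro!: tr_MM)

lemma pair_tr: assumes A: "A \<in> MM" and B: "B \<in> MM" shows "pair (tr A) (tr B) = pair A B"
proof -
  have "pair (tr A) (tr B) = (\<Oplus>i\<in>N. \<Oplus>j\<in>N. A (j, i) \<otimes> B (j, i))"
    unfolding pair_row[OF tr_MM[OF A] tr_MM[OF B]]
    by (intro fs_cong) (auto simp: tr_entry MM_entry A B intro!: fs_closed)
  also have "\<dots> = pair A B"
    unfolding pair_row[OF A B] by (rule fs_swap) (auto simp: MM_entry A B)
  finally show ?thesis .
qed

lemma pair_mult_right:
  assumes D: "D \<in> MM" and l: "l \<in> MM" and X: "X \<in> MM"
  shows "pair D (X ** l) = pair (D ** tr l) X"
proof -
  have "pair D (X ** l) = pair (tr D) (tr l ** tr X)"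
    using pair_tr[OF D, of "X ** l"] X l by (simp add: tr_mult)
  also have "\<dots> = pair (l ** tr D) (tr X)"
    using D l X by (simp add: pair_mult_left tr_MM tr_tr)
  also have "\<dots> = pair (D ** tr l) X"
    using pair_tr[of "D ** tr l" X] D l X by (simp add: tr_mult tr_MM tr_tr)
  finally show ?thesis .
qed

lemma pair_trunc: "M \<in> MM ==> X \<in> VS F n S ==> pair (trunc S M) X = pair M X"
  unfolding pair_def by (rule fs_cong) (auto simp: trunc_entry VS_iff MM_entry)

lemma pair_VS: 
  assumes "A \<in> MM" "B \<in> MM" "A \<in> VS F n S \<or> B \<in> VS F n S" "S \<subseteq> N \<times> N"
  shows "(\<Oplus>e\<in>S. A e \<otimes> B e) = pair A B"
  unfolding pair_def by (rule fs_mono) (use assms in \<open>auto simp: VS_iff MM_entry\<close>)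

subsection \<open>Verges\<close>

text \<open>On \<open>U\<close> the function \<open>u |-> \<theta> (pair M u)\<close> depends on the
  entries of \<open>M\<close> on and above the diagonal only by a constant factor, so index matrices
  are compared below the diagonal.\<close>

definition agree :: "'f matrix => 'f matrix => bool" where
  "agree A B \<longleftrightarrow> (\<forall>(i, j)\<in>Phi. A (i, j) = B (i, j))"

lemma agree_sym: "agree A B ==> agree B A" by (auto simp: agree_def)
lemma agree_trans: "agree A B ==> agree B C ==> agree A C" by (auto simp: agree_def)
lemma agree_trunc: "agree (trunc Phi A) A"
  using Phi_NN by (auto simp: agree_def trunc_entry trunc_def)

text \<open>\<open>tr w\<close> is upper unitriangular: row \<open>i\<close> of the product uses
  only rows \<open>k \<ge> i\<close>, and a position \<open>(k, j)\<close> with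
  \<open>j < i \<le> k\<close> is again below the diagonal.\<close>

lemma agree_left:
  assumes w: "w \<in> US F n Phi" and A: "A \<in> MM" and B: "B \<in> MM" and AB: "agree A B"
  shows "agree (tr w ** A) (tr w ** B)"
  unfolding agree_def
proof clarify
  fix i j assume p: "(i, j) \<in> Phi"
  then have ij: "i \<in> N" "j \<in> N" "j < i" by (auto simp: Phi_iff)
  note wm = US_MM[OF w]
  show "(tr w ** A) (i, j) = (tr w ** B) (i, j)"
    unfolding mult_entry'[OF ij(1,2)]
  proof (rule fs_cong)
    fix k assume k: "k \<in> N"
    show "tr w (i, k) \<otimes> A (k, j) = tr w (i, k) \<otimes> B (k, j)"
    proof (cases "k < i")
      case True then show ?thesis using US_lower[OF w k ij(1)] ij k A B by (simp add: tr_entry MM_entry)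
    next
      case False then have "(k, j) \<in> Phi" using ij k by (auto simp: Phi_iff)
      then show ?thesis using AB by (auto simp: agree_def)
    qed
  qed (use ij wm A B MM_entry tr_MM in auto)
qed

lemma agree_right:
  assumes w: "w \<in> US F n Phi" and A: "A \<in> MM" and B: "B \<in> MM" and AB: "agree A B"
  shows "agree (A ** tr w) (B ** tr w)"
  unfolding agree_def
proof clarify
  fix i j assume p: "(i, j) \<in> Phi"
  then have ij: "i \<in> N" "j \<in> N" "j < i" by (auto simp: Phi_iff)
  note wm = US_MM[OF w]
  show "(A ** tr w) (i, j) = (B ** tr w) (i, j)"
    unfolding mult_entry'[OF ij(1,2)]
  proof (rule fs_cong)
    fix k assume k: "k \<in> N"
    show "A (i, k) \<otimes> tr w (k, j) = B (i, k) \<otimes> tr w (k, j)"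
    proof (cases "j < k")
      case True then show ?thesis using US_lower[OF w ij(2) k] ij k A B by (simp add: tr_entry MM_entry)
    next
      case False then have "(i, k) \<in> Phi" using ij k by (auto simp: Phi_iff)
      then show ?thesis using AB by (auto simp: agree_def)
    qed
  qed (use ij wm A B MM_entry tr_MM in auto)
qed

lemma verge_row: "verge F n A ==> i \<in> N ==> j \<in> N ==> j' \<in> N ==> A (i, j) \<noteq> \<zero> ==> A (i, j') \<noteq> \<zero> ==> j = j'"
proof -
  assume v: "verge F n A" and a: "i \<in> N" "j \<in> N" "j' \<in> N" "A (i, j) \<noteq> \<zero>" "A (i, j') \<noteq> \<zero>"
  have "card {j \<in> N. A (i, j) \<noteq> \<zero>} \<le> Suc 0" using v a by (auto simp: verge_def One_nat_def)
  then show ?thesis using a by (subst (asm) card_le_Suc0_iff_eq) auto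
qed

lemma verge_col: "verge F n A ==> i \<in> N ==> i' \<in> N ==> j \<in> N ==> A (i, j) \<noteq> \<zero> ==> A (i', j) \<noteq> \<zero> ==> i = i'"
proof -
  assume v: "verge F n A" and a: "i \<in> N" "i' \<in> N" "j \<in> N" "A (i, j) \<noteq> \<zero>" "A (i', j) \<noteq> \<zero>"
  have "card {i \<in> N. A (i, j) \<noteq> \<zero>} \<le> Suc 0" using v a by (auto simp: verge_def One_nat_def)
  then show ?thesis using a by (subst (asm) card_le_Suc0_iff_eq) auto
qed

lemma vergeI:
  assumes "\<And>i j j'. i \<in> N ==> j \<in> N ==> j' \<in> N ==> A (i, j) \<noteq> \<zero> ==> A (i, j') \<noteq> \<zero> ==> j = j'"
    and "\<And>i i' j. i \<in> N ==> i' \<in> N ==> j \<in> N ==> A (i, j) \<noteq> \<zero> ==> A (i', j) \<noteq> \<zero> ==> i = i'"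
  shows "verge F n A"
  unfolding verge_def
proof (intro conjI ballI)
  fix i assume "i \<in> N"
  then have "card {j \<in> N. A (i, j) \<noteq> \<zero>} \<le> Suc 0" by (subst card_le_Suc0_iff_eq) (use assms(1) in auto)
  then show "card {j \<in> N. A (i, j) \<noteq> \<zero>} \<le> 1" by (simp only: One_nat_def)
next
  fix j assume "j \<in> N"
  then have "card {i \<in> N. A (i, j) \<noteq> \<zero>} \<le> Suc 0" by (subst card_le_Suc0_iff_eq) (use assms(2) in auto)
  then show "card {i \<in> N. A (i, j) \<noteq> \<zero>} \<le> 1" by (simp only: One_nat_def)
qed

text \<open>A column of a verge has at most one nonzero entry, so at most one summand of the matrix
  product survives.\<close>

lemma verge_left_eval:
  assumes A: "A \<in> MM" "verge F n A" and x: "x \<in> MM" and ij: "i \<in> N" "j \<in> N"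
  shows "k \<in> N ==> A (k, j) \<noteq> \<zero> ==> (tr x ** A) (i, j) = x (k, i) \<otimes> A (k, j)"
    and "(\<And>k. k \<in> N ==> A (k, j) = \<zero>) ==> (tr x ** A) (i, j) = \<zero>"
proof -
  assume k: "k \<in> N" "A (k, j) \<noteq> \<zero>"
  have "(\<Oplus>k\<in>N. tr x (i, k) \<otimes> A (k, j)) = tr x (i, k) \<otimes> A (k, j)"
  proof (rule fs_single)
    fix l assume "l \<in> N" "l \<noteq> k"
    then have "A (l, j) = \<zero>" using verge_col[OF A(2) _ _ ij(2), of l k] k by auto
    then show "tr x (i, l) \<otimes> A (l, j) = \<zero>" using \<open>l \<in> N\<close> ij x by (simp add: MM_entry tr_entry)
  qed (use k ij A x MM_entry tr_MM in auto)
  then show "(tr x ** A) (i, j) = x (k, i) \<otimes> A (k, j)" using ij k by (simp add: mult_entry' tr_entry)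
next
  assume "\<And>k. k \<in> N ==> A (k, j) = \<zero>"
  then show "(tr x ** A) (i, j) = \<zero>"
    unfolding mult_entry'[OF ij] by (intro fs_zero) (use ij x in \<open>simp add: tr_entry MM_entry\<close>)
qed

lemma verge_right_eval:
  assumes A: "A \<in> MM" "verge F n A" and x: "x \<in> MM" and ij: "i \<in> N" "j \<in> N"
  shows "l \<in> N ==> A (i, l) \<noteq> \<zero> ==> (A ** tr x) (i, j) = A (i, l) \<otimes> x (j, l)"
    and "(\<And>l. l \<in> N ==> A (i, l) = \<zero>) ==> (A ** tr x) (i, j) = \<zero>"
proof -
  assume k: "l \<in> N" "A (i, l) \<noteq> \<zero>"
  have "(\<Oplus>k\<in>N. A (i, k) \<otimes> tr x (k, j)) = A (i, l) \<otimes> tr x (l, j)"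
  proof (rule fs_single)
    fix k assume "k \<in> N" "k \<noteq> l"
    then have "A (i, k) = \<zero>" using verge_row[OF A(2) ij(1), of k l] k by auto
    then show "A (i, k) \<otimes> tr x (k, j) = \<zero>" using \<open>k \<in> N\<close> ij x by (simp add: MM_entry tr_entry)
  qed (use k ij A x MM_entry tr_MM in auto)
  then show "(A ** tr x) (i, j) = A (i, l) \<otimes> x (j, l)" using ij k by (simp add: mult_entry' tr_entry)
next
  assume "\<And>l. l \<in> N ==> A (i, l) = \<zero>"
  then show "(A ** tr x) (i, j) = \<zero>"
    unfolding mult_entry'[OF ij] by (intro fs_zero) (use ij x in \<open>simp add: tr_entry MM_entry\<close>)
qed

text \<open>A nonzero entry of \<open>A\<close> at \<open>(i, j)\<close> forces one of
  \<open>B\<close> in row \<open>i\<close> at some \<open>l \<le> j\<close>, and a nonzero entry of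
  \<open>B\<close> at \<open>(i, l)\<close> forces one of \<open>A\<close> in column
  \<open>l\<close> at some \<open>k \<ge> i\<close>. Both moves lead away from the diagonal, so the
  chase between the two supports ends. At a common position both products reduce to the entry
  itself.\<close>

lemma verge_unique:
  assumes A: "A \<in> VS F n Phi" "verge F n A" and B: "B \<in> VS F n Phi" "verge F n B"
    and x: "x \<in> US F n Phi" and y: "y \<in> US F n Phi"
    and eq: "agree (tr x ** A) (B ** tr y)"
  shows "A = B"
proof -
  have Am: "A \<in> MM" and Bm: "B \<in> MM" using A B VS_MM by auto
  note xm = US_MM[OF x] and ym = US_MM[OF y]
  have PA: "(i, j) \<in> Phi" if "i \<in> N" "j \<in> N" "A (i, j) \<noteq> \<zero>" for i j using A(1) that unfolding VS_iff by blast
  have PB: "(i, j) \<in> Phi" if "i \<in> N" "j \<in> N" "B (i, j) \<noteq> \<zero>" for i j using B(1) that unfolding VS_iff by blast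
  have eq': "(tr x ** A) (i, j) = (B ** tr y) (i, j)" if "(i, j) \<in> Phi" for i j using eq that by (auto simp: agree_def)
  have AtoB: "\<exists>l\<in>N. l \<le> j \<and> B (i, l) \<noteq> \<zero>" if ij: "i \<in> N" "j \<in> N" and nz: "A (i, j) \<noteq> \<zero>" for i j
  proof -
    have "(tr x ** A) (i, j) = A (i, j)"
      using verge_left_eval(1)[OF Am A(2) xm ij ij(1) nz] US_diag[OF _ x ij(1)] MM_entry[OF Am ij] by simp
    then have ne: "(B ** tr y) (i, j) \<noteq> \<zero>" using eq'[OF PA[OF ij nz]] nz by simp
    then obtain l where l: "l \<in> N" "B (i, l) \<noteq> \<zero>" using verge_right_eval(2)[OF Bm B(2) ym ij] by blast
    have "y (j, l) \<noteq> \<zero>" using ne verge_right_eval(1)[OF Bm B(2) ym ij l] MM_entry[OF Bm ij(1) l(1)] by auto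
    then have "l \<le> j" using US_lower[OF y ij(2) l(1)] by force
    then show ?thesis using l by blast
  qed
  have BtoA: "\<exists>k\<in>N. i \<le> k \<and> A (k, l) \<noteq> \<zero>" if ij: "i \<in> N" "l \<in> N" and nz: "B (i, l) \<noteq> \<zero>" for i l
  proof -
    have "(B ** tr y) (i, l) = B (i, l)"
      using verge_right_eval(1)[OF Bm B(2) ym ij ij(2) nz] US_diag[OF _ y ij(2)] MM_entry[OF Bm ij] by simp
    then have ne: "(tr x ** A) (i, l) \<noteq> \<zero>" using eq'[OF PB[OF ij nz]] nz by simp
    then obtain k where k: "k \<in> N" "A (k, l) \<noteq> \<zero>" using verge_left_eval(2)[OF Am A(2) xm ij] by blast
    have "x (k, i) \<noteq> \<zero>" using ne verge_left_eval(1)[OF Am A(2) xm ij k] MM_entry[OF Am k(1) ij(2)] by auto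
    then have "i \<le> k" using US_lower[OF x k(1) ij(1)] by force
    then show ?thesis using k by blast
  qed
  have AB: "B (i, j) \<noteq> \<zero>" if "i \<in> N" "j \<in> N" "A (i, j) \<noteq> \<zero>" for i j
    using that
  \<comment> \<open>The measure drops as \<open>i - j\<close> grows. If \<open>l < j\<close>, then
    \<open>(k, l)\<close> is farther from the diagonal, so \<open>B\<close> is nonzero there by
    induction; column \<open>l\<close> of \<open>B\<close> gives \<open>k = i\<close>, and then row
    \<open>i\<close> of \<open>A\<close> gives \<open>l = j\<close>, a contradiction.\<close>
  proof (induction "n - (i - j)" arbitrary: i j rule: less_induct)
    case less
    obtain l where l: "l \<in> N" "l \<le> j" "B (i, l) \<noteq> \<zero>" using AtoB[OF less(2-4)] by blast
    obtain k where k: "k \<in> N" "i \<le> k" "A (k, l) \<noteq> \<zero>" using BtoA[OF less(2) l(1,3)] by blast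
    show ?case
    proof (cases "l = j")
      case False
      have "n - (k - l) < n - (i - j)" using False l k PA[OF less(2-4)] PA[OF k(1) l(1) k(3)] by (auto simp: Phi_iff)
      then have "B (k, l) \<noteq> \<zero>" using less(1)[OF _ k(1) l(1) k(3)] by blast
      then have "k = i" using verge_col[OF B(2) k(1) less(2) l(1)] l by auto
      then have "l = j" using verge_row[OF A(2) less(2) l(1) less(3)] k less by auto
      then show ?thesis using False by simp
    qed (use l in simp)
  qed
  have BA: "A (i, j) \<noteq> \<zero>" if ij: "i \<in> N" "j \<in> N" and nz: "B (i, j) \<noteq> \<zero>" for i j
  proof -
    obtain k where k: "k \<in> N" "i \<le> k" "A (k, j) \<noteq> \<zero>" using BtoA[OF ij nz] by blast
    have "k = i" using verge_col[OF B(2) k(1) ij AB[OF k(1) ij(2) k(3)] nz] .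
    then show ?thesis using k by simp
  qed
  show ?thesis
  proof (rule mat_eqI[OF Am Bm])
    fix i j assume ij: "i \<in> N" "j \<in> N"
    show "A (i, j) = B (i, j)"
    proof (cases "A (i, j) = \<zero>")
      case True then show ?thesis using BA[OF ij] by (cases "B (i, j) = \<zero>") auto
    next
      case False
      note nzB = AB[OF ij False]
      have "A (i, j) = (tr x ** A) (i, j)"
        using verge_left_eval(1)[OF Am A(2) xm ij ij(1) False] US_diag[OF _ x ij(1)] MM_entry[OF Am ij] by simp
      also have "\<dots> = (B ** tr y) (i, j)" by (rule eq'[OF PA[OF ij False]])
      also have "\<dots> = B (i, j)"
        using verge_right_eval(1)[OF Bm B(2) ym ij ij(2) nzB] US_diag[OF _ y ij(2)] MM_entry[OF Bm ij] by simp
      finally show ?thesis .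
    qed
  qed
qed

end

subsection \<open>Additive characters\<close>

locale fchar = fmat F n for F :: "'f ring" (structure) and n + fixes \<theta> :: "'f => complex"
  assumes theta: "nontrivial_add_character F \<theta>"
begin

lemma th_add: "x \<in> carrier F ==> y \<in> carrier F ==> \<theta> (x \<oplus> y) = \<theta> x * \<theta> y"
  and th_nz: "x \<in> carrier F ==> \<theta> x \<noteq> 0"
  using theta by (auto simp: nontrivial_add_character_def)

lemma th_zero: "\<theta> \<zero> = 1"
  using th_add[of \<zero> \<zero>] th_nz[of \<zero>] by simp

text \<open>Translation by \<open>x\<close> permutes the field, so comparing the product of all
  values with its translate gives \<open>\<theta> x ^ q = 1\<close>.\<close>

lemma th_norm: assumes x: "x \<in> carrier F" shows "norm (\<theta> x) = 1"
proof -
  have "(\<Prod>y\<in>carrier F. \<theta> y) = (\<Prod>y\<in>carrier F. \<theta> (x \<oplus> y))"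
    by (rule prod.reindex_bij_witness[where i="\<lambda>y. x \<oplus> y" and j="\<lambda>y. \<ominus> x \<oplus> y"])
      (use x in \<open>auto simp: a_assoc[symmetric] r_neg l_neg\<close>)
  also have "\<dots> = \<theta> x ^ q * (\<Prod>y\<in>carrier F. \<theta> y)" using x by (simp add: th_add prod.distrib)
  finally have "\<theta> x ^ q = 1" using th_nz fin_F by simp
  then have "norm (\<theta> x) ^ q = 1" by (metis norm_one norm_power)
  then show ?thesis using q_ge2 by (metis norm_ge_zero power_eq_1_iff real_norm_def abs_of_nonneg not_numeral_le_zero)
qed

lemma th_minus: assumes x: "x \<in> carrier F" shows "\<theta> (\<ominus> x) = cnj (\<theta> x)"
proof -
  have "\<theta> (\<ominus> x) * \<theta> x = 1" using th_add[of "\<ominus> x" x] x th_zero by (simp add: l_neg)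
  moreover have "cnj (\<theta> x) * \<theta> x = 1" using th_norm[OF x] complex_norm_square[of "\<theta> x"] by (simp add: mult.commute)
  ultimately show ?thesis using th_nz[OF x] by (metis mult_right_cancel)
qed

lemma th_cnj: "x \<in> carrier F ==> cnj (\<theta> x) * \<theta> x = 1"
  using th_norm[of x] complex_norm_square[of "\<theta> x"] by (simp add: mult.commute)

abbreviation ch where "ch A X \<equiv> \<theta> (pair A X)"

lemma ch_add: "A \<in> MM ==> X \<in> MM ==> Y \<in> MM ==> ch A (X +\<^sub>R Y) = ch A X * ch A Y"
  by (simp add: pair_add th_add pair_closed)

lemma ch_minus: "A \<in> MM ==> X \<in> MM ==> Y \<in> MM ==> ch A (X -\<^sub>R Y) = ch A X * cnj (ch A Y)"
  by (simp add: pair_minus minus_eq th_add th_minus pair_closed)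

lemma ch_nz: "A \<in> MM ==> X \<in> MM ==> ch A X \<noteq> 0" by (simp add: th_nz pair_closed)

lemma VS_plus: "A \<in> VS F n S ==> B \<in> VS F n S ==> A +\<^sub>R B \<in> VS F n S"
  by (auto simp: VS_iff add_entry)

lemma VS_minus: "A \<in> VS F n S ==> B \<in> VS F n S ==> A -\<^sub>R B \<in> VS F n S"
  by (auto simp: VS_iff minus_entry minus_eq)

text \<open>If \<open>D\<close> has a nonzero entry, some \<open>X0\<close> supported there has a
  character value other than \<open>1\<close>, and translating the sum by \<open>X0\<close>
  multiplies it by that value.\<close>

lemma ch_sum:
  assumes D: "D \<in> VS F n S" and S: "S \<subseteq> N \<times> N"
  shows "(\<Sum>X\<in>VS F n S. ch D X) = (if D = \<zero>\<^bsub>R\<^esub> then of_nat q ^ card S else 0)"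
proof (cases "D = \<zero>\<^bsub>R\<^esub>")
  case True
  have "pair D X = \<zero>" if "X \<in> VS F n S" for X
    unfolding pair_def True by (rule fs_zero) (use VS_MM[OF that] in \<open>auto simp: zero_entry MM_entry\<close>)
  then show ?thesis using True by (simp add: th_zero card_VS[OF S])
next
  case False
  have Dm: "D \<in> MM" using D VS_MM by auto
  obtain i j where ij: "i \<in> N" "j \<in> N" "D (i, j) \<noteq> \<zero>"
    using False mat_eqI[OF Dm R_zero_closed] zero_entry by metis
  obtain x where x: "x \<in> carrier F" "\<theta> x \<noteq> 1" using theta by (auto simp: nontrivial_add_character_def)
  have dij: "D (i, j) \<in> Units F" using ij MM_entry[OF Dm] by (simp add: field_Units)
  \<comment> \<open>Chosen so that \<open>pair D X0\<close> is the element \<open>x\<close> on which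
    \<open>\<theta>\<close> is nontrivial.\<close>
  define a where "a = inv (D (i, j)) \<otimes> x"
  have a: "a \<in> carrier F" "D (i, j) \<otimes> a = x" 
    using dij x Units_r_inv[OF dij] MM_entry[OF Dm ij(1,2)] by (auto simp: a_def m_assoc[symmetric])
  define X0 where "X0 = (\<lambda>e\<in>N\<times>N. if e = (i, j) then a else \<zero>)"
  have "(i, j) \<in> S" using D ij unfolding VS_iff by blast
  then have X0: "X0 \<in> VS F n S" unfolding VS_iff X0_def using a by (auto intro!: MM_restrict)
  have "pair D X0 = D (i, j) \<otimes> X0 (i, j)" unfolding pair_def
    by (rule fs_single) (use ij a Dm MM_entry in \<open>auto simp: X0_def\<close>)
  then have c: "ch D X0 \<noteq> 1" using a ij x by (simp add: X0_def)
  have X0m: "X0 \<in> MM" using X0 VS_MM by auto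
  have "(\<Sum>X\<in>VS F n S. ch D X) = (\<Sum>X\<in>VS F n S. ch D (X +\<^sub>R X0))"
    by (rule sum.reindex_bij_witness[where i="\<lambda>X. X +\<^sub>R X0" and j="\<lambda>X. X -\<^sub>R X0"])
      (use X0 X0m in \<open>auto simp: VS_plus VS_minus[unfolded a_minus_def] VS_MM a_minus_def R.a_assoc R.l_neg R.r_neg\<close>)
  also have "\<dots> = (\<Sum>X\<in>VS F n S. ch D X) * ch D X0"
    by (simp add: sum_distrib_right ch_add[OF Dm] VS_MM X0m)
  finally show ?thesis using c False by simp
qed

lemma ch_orth:
  assumes C: "C \<in> VS F n S" and D: "D \<in> VS F n S" and S: "S \<subseteq> N \<times> N"
  shows "(\<Sum>X\<in>VS F n S. cnj (ch C X) * ch D X) = (if C = D then of_nat q ^ card S else 0)"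
proof -
  have m: "C \<in> MM" "D \<in> MM" using C D VS_MM by auto
  have "(\<Sum>X\<in>VS F n S. cnj (ch C X) * ch D X) = (\<Sum>X\<in>VS F n S. ch (D -\<^sub>R C) X)"
  proof (rule sum.cong[OF refl])
    fix X assume "X \<in> VS F n S"
    then have X: "X \<in> MM" by (rule VS_MM)
    have "ch (D -\<^sub>R C) X = ch X D * cnj (ch X C)"
      using m X by (simp add: pair_comm[of "D -\<^sub>R C" X] ch_minus)
    then show "cnj (ch C X) * ch D X = ch (D -\<^sub>R C) X"
      using m X by (simp add: pair_comm[of X D] pair_comm[of X C])
  qed
  also have "\<dots> = (if D -\<^sub>R C = \<zero>\<^bsub>R\<^esub> then of_nat q ^ card S else 0)" by (rule ch_sum[OF VS_minus[OF D C] S])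
  also have "D -\<^sub>R C = \<zero>\<^bsub>R\<^esub> \<longleftrightarrow> C = D" 
  proof
    assume "D -\<^sub>R C = \<zero>\<^bsub>R\<^esub>"
    then have "(D -\<^sub>R C) +\<^sub>R C = C" using m by simp
    then show "C = D" using m by (simp add: a_minus_def R.a_assoc R.l_neg)
  qed (use m in \<open>simp add: a_minus_def R.r_neg\<close>)
  finally show ?thesis .
qed

lemma sum_US: 
  assumes S: "S \<subseteq> Phi" shows "(\<Sum>u\<in>US F n S. f (u -\<^sub>R E)) = (\<Sum>X\<in>VS F n S. f X)"
  by (rule sum.reindex_bij_witness[where j="\<lambda>u. u -\<^sub>R E" and i="\<lambda>X. E +\<^sub>R X"])
    (use US_minus[OF S] in \<open>auto simp: plus_minus minus_plus VS_MM US_MM US_plus\<close>)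

lemma chi_eq: "A \<in> VS F n S ==> X \<in> MM ==> S \<subseteq> N \<times> N ==> chi F \<theta> S A X = ch A X"
  unfolding chi_def by (subst pair_VS) (auto simp: VS_MM)

lemma lidem_eq: "A \<in> VS F n S ==> S \<subseteq> Phi ==> 
   lidem F \<theta> n S A = (\<lambda>u. if u \<in> US F n S then cnj (ch A (u -\<^sub>R E)) / of_nat q ^ card S else 0)"
  unfolding lidem_def using Phi_NN by (auto simp: fun_eq_iff chi_eq US_MM)

lemma q_nz: "(of_nat q :: complex) \<noteq> 0" using q_ge2 by auto

end

text \<open>The action in a module record is a function on all inputs, so records can differ off the
  module or off the algebra and still describe the same module. This is applied to the products of
  \<open>U\<close> and of \<open>GL\<close>.\<close>

lemma mod_iso_same:
  assumes M: "cg_module G M" and s: "mspace N = mspace M"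
    and a: "\<And>v a. v \<in> mspace M ==> a \<in> group_algebra G ==> mact N v a = mact M v a"
    and one: "\<one>\<^bsub>G\<^esub> \<in> carrier G"
  shows "mod_iso G M N"
proof -
  note D = cg_moduleD[OF M]
  have N: "cg_module G N" unfolding cg_module_def s
  proof (intro conjI ballI allI)
    show "cfun.subspace (mspace M)" by (rule D(1))
  next
    fix v w b assume "v \<in> mspace M" "w \<in> mspace M" "b \<in> group_algebra G"
    then show "mact N (v + w) b = mact N v b + mact N w b" using D(3) a csubspaceD(2)[OF D(1)] by simp
  next
    fix v b c assume v: "v \<in> mspace M" "b \<in> group_algebra G" "c \<in> group_algebra G"
    have "b + c \<in> group_algebra G" using v csubspaceD(2)[OF subspace_group_algebra] by blast
    then show "mact N v (b + c) = mact N v b + mact N v c" using D(4) a v by simp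
    show "mact N (mact N v b) c = mact N v (ga_mult G b c)" using D(8)[OF v] a v D(2) ga_mult_alg by metis
  next
    fix v b k assume v: "v \<in> mspace M" "b \<in> group_algebra G"
    have "(\<lambda>g. k * b g) \<in> group_algebra G" using v csubspaceD(3)[OF subspace_group_algebra] by blast
    then show "mact N v (\<lambda>g. k * b g) = (\<lambda>x. k * mact N v b x)" using D(6) a v by simp
    have "(\<lambda>x. k * v x) \<in> mspace M" using v csubspaceD(3)[OF D(1)] by blast
    then show "mact N (\<lambda>x. k * v x) b = (\<lambda>x. k * mact N v b x)" using D(5) a v by simp
  next
    fix v b assume "v \<in> mspace M" "b \<in> group_algebra G"
    then show "mact N v b \<in> mspace M" using D(2) a by simp
  next
    fix v assume v: "v \<in> mspace M"
    show "mact N v (ga_single \<one>\<^bsub>G\<^esub>) = v" using D(7) a v ga_single_alg[OF one] by simp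
  qed
  show ?thesis unfolding mod_iso_def
    by (intro conjI exI[of _ id]) (use M N s a in auto)
qed


section \<open>The group algebra of the unitriangular group\<close>

context fchar
begin

lemma subgroup_US: "closed_pat S ==> subgroup_alg G (US F n S)"
  by (intro subgroup_alg.intro subgroup_alg_axioms.intro US_subgroup G.fin_group_axioms)

sublocale UU: subgroup_alg G "US F n Phi"
  by (rule subgroup_US[OF closed_Phi])

lemma U_eq: "U F n = G\<lparr>carrier := US F n Phi\<rparr>" by (simp add: U_def)

abbreviation "CU \<equiv> group_algebra (G\<lparr>carrier := US F n Phi\<rparr>)"
abbreviation gmul (infixl "\<odot>" 70) where "a \<odot> b \<equiv> ga_mult G a b"
abbreviation sg where "sg g \<equiv> ga_single g"
abbreviation lid where "lid S A \<equiv> lidem F \<theta> n S A"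
abbreviation "UM X \<equiv> \<lparr>mspace = X, mact = ga_mult G\<rparr>"

lemma CU_iff: "a \<in> CU \<longleftrightarrow> (\<forall>g. g \<notin> US F n Phi \<longrightarrow> a g = 0)" by (simp add: group_algebra_def)

lemma US_sub_Phi: "S \<subseteq> Phi ==> u \<in> US F n S ==> u \<in> US F n Phi" using US_mono by blast

lemma lid_CU: "S \<subseteq> Phi ==> lid S A \<in> CU"
  using US_sub_Phi by (auto simp: CU_iff lidem_def)

text \<open>At \<open>u\<close> the sum is a normalized sum over all characters at
  \<open>u - E\<close>, which vanishes unless \<open>u = E\<close>. This resolution of the identity
  is what splits vectors into components.\<close>

lemma sum_lid: assumes S: "S \<subseteq> Phi" shows "(\<lambda>u. \<Sum>C\<in>VS F n S. lid S C u) = sg E"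
proof (rule ext)
  fix u
  have SN: "S \<subseteq> N \<times> N" using S Phi_NN by auto
  show "(\<Sum>C\<in>VS F n S. lid S C u) = sg E u"
  proof (cases "u \<in> US F n S")
    case True
    define X where "X = u -\<^sub>R E"
    have X: "X \<in> VS F n S" unfolding X_def by (rule US_minus[OF S True])
    have Xm: "X \<in> MM" by (rule VS_MM[OF X])
    have X0: "X = \<zero>\<^bsub>R\<^esub> \<longleftrightarrow> u = E"
    proof
      assume "X = \<zero>\<^bsub>R\<^esub>"
      then show "u = E" using minus_plus[OF US_MM[OF True]] by (simp add: X_def)
    qed (simp add: X_def a_minus_def R.r_neg)
    have "(\<Sum>C\<in>VS F n S. lid S C u) = (\<Sum>C\<in>VS F n S. cnj (ch X C)) / of_nat q ^ card S"
      using True Xm by (simp add: lidem_eq[OF _ S] sum_divide_distrib X_def[symmetric] pair_comm[of X] VS_MM)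
    also have "(\<Sum>C\<in>VS F n S. cnj (ch X C)) = cnj (\<Sum>C\<in>VS F n S. ch X C)" by simp
    also have "\<dots> = (if u = E then of_nat q ^ card S else 0)" unfolding ch_sum[OF X SN] X0 by simp
    finally show ?thesis using q_nz by (auto simp: ga_single_def)
  next
    case False
    then have "u \<noteq> E" using US_one by auto
    then show ?thesis using False by (simp add: lidem_def ga_single_def)
  qed
qed

subsection \<open>Fourier coefficients on the full unitriangular group\<close>

text \<open>The functions \<open>u |-> ch D (u - E)\<close> are not homomorphisms of
  \<open>U\<close>, but the coefficients against them still determine an element of
  \<open>CU\<close> (\<open>fc_inj\<close>) and are dual to the elements \<open>[D]\<close>
  (\<open>fc_lid\<close>).\<close>

definition fc :: "('f matrix => complex) => 'f matrix => complex" where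
  "fc f D = (\<Sum>u\<in>US F n Phi. f u * ch D (u -\<^sub>R E))"

lemma fc_comb: "fc (\<lambda>x. \<Sum>i\<in>I. c i * f i x) D = (\<Sum>i\<in>I. c i * fc (f i) D)"
  unfolding fc_def sum_distrib_right sum_distrib_left
  by (subst sum.swap) (simp add: mult_ac)

text \<open>Fourier inversion: the trace form is symmetric, so the orthogonality relation can also
  be summed over the index \<open>D\<close>.\<close>

lemma fc_inj:
  assumes f: "f \<in> CU" and z: "\<And>D. D \<in> VS F n Phi ==> fc f D = 0" shows "f = (\<lambda>_. 0)"
proof (rule ext)
  fix u0 show "f u0 = 0"
  proof (cases "u0 \<in> US F n Phi")
    case True
    define X0 where "X0 = u0 -\<^sub>R E"
    have X0: "X0 \<in> VS F n Phi" unfolding X0_def by (rule US_minus[OF subset_refl True])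
    have "0 = (\<Sum>D\<in>VS F n Phi. cnj (ch X0 D) * fc f D)" using z by simp
    also have "\<dots> = (\<Sum>u\<in>US F n Phi. f u * (\<Sum>D\<in>VS F n Phi. cnj (ch X0 D) * ch (u -\<^sub>R E) D))"
      unfolding fc_def sum_distrib_left
      by (subst sum.swap) (auto intro!: sum.cong simp: mult_ac VS_MM US_MM pair_comm[of "_ -\<^sub>R E"])
    also have "\<dots> = (\<Sum>u\<in>US F n Phi. if u = u0 then f u * of_nat q ^ card Phi else 0)"
    proof (rule sum.cong[OF refl])
      fix u assume u: "u \<in> US F n Phi"
      have "X0 = u -\<^sub>R E \<longleftrightarrow> u = u0"
        using minus_plus[OF US_MM[OF u]] minus_plus[OF US_MM[OF True]] unfolding X0_def by metis
      then show "f u * (\<Sum>D\<in>VS F n Phi. cnj (ch X0 D) * ch (u -\<^sub>R E) D) = (if u = u0 then f u * of_nat q ^ card Phi else 0)"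
        using ch_orth[OF X0 US_minus[OF subset_refl u] Phi_NN] by simp
    qed
    also have "\<dots> = f u0 * of_nat q ^ card Phi" using True finite_US by simp
    finally show ?thesis using q_nz by simp
  qed (use f in \<open>simp add: CU_iff\<close>)
qed

lemma fc_lid: assumes A: "A \<in> VS F n Phi" and D: "D \<in> VS F n Phi"
  shows "fc (lid Phi A) D = (if A = D then 1 else 0)"
proof -
  have "fc (lid Phi A) D = (\<Sum>u\<in>US F n Phi. cnj (ch A (u -\<^sub>R E)) * ch D (u -\<^sub>R E)) / of_nat q ^ card Phi"
    unfolding fc_def sum_divide_distrib by (rule sum.cong) (auto simp: lidem_eq[OF A])
  also have "\<dots> = (\<Sum>X\<in>VS F n Phi. cnj (ch A X) * ch D X) / of_nat q ^ card Phi"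
    by (subst sum_US[symmetric]) auto
  finally show ?thesis using q_nz by (simp add: ch_orth[OF A D Phi_NN])
qed

text \<open>Since \<open>v - E\<close> is strictly lower triangular, the entries of \<open>M\<close>
  on and above the diagonal enter only through the constant \<open>ch M E\<close>.\<close>

lemma ch_shift:
  assumes M: "M \<in> MM" and v: "v \<in> US F n Phi"
  shows "ch M v = ch M E * ch (trunc Phi M) (v -\<^sub>R E)"
proof -
  have X: "v -\<^sub>R E \<in> VS F n Phi" by (rule US_minus[OF subset_refl v])
  have "ch M v = ch M (E +\<^sub>R (v -\<^sub>R E))" using minus_plus[OF US_MM[OF v]] by simp
  also have "\<dots> = ch M E * ch M (v -\<^sub>R E)" using M VS_MM[OF X] by (simp add: ch_add)
  finally show ?thesis using pair_trunc[OF M X] by simp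
qed

text \<open>Moving \<open>w\<close> across the trace form turns right translation into the index
  change from \<open>D\<close> to \<open>D ** tr w\<close>; cutting back to the strictly lower part
  costs only a constant.\<close>

lemma fc_right:
  assumes D: "D \<in> MM" and w: "w \<in> US F n Phi" and f: "f \<in> CU"
  shows "\<exists>c. fc (f \<odot> sg w) D = c * fc f (trunc Phi (D ** tr w))"
proof -
  note wm = US_MM[OF w]
  have Dw: "D ** tr w \<in> MM" using D wm tr_MM by auto
  have "fc (f \<odot> sg w) D = (\<Sum>u\<in>US F n Phi. f (u \<bullet> ginv w) * ch D (u -\<^sub>R E))"
    unfolding fc_def by (rule sum.cong) (auto simp: G.rt_eq UU.H_sub w)
  also have "\<dots> = (\<Sum>v\<in>US F n Phi. f v * ch D (v \<bullet> w -\<^sub>R E))"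
    by (rule sum.reindex_bij_witness[where i="\<lambda>v. v \<bullet> w" and j="\<lambda>u. u \<bullet> ginv w"])
      (use w UU.H_sub UU.H_closed UU.H_inv in \<open>auto simp: G.m_assoc\<close>)
  also have "\<dots> = (\<Sum>v\<in>US F n Phi. (cnj (ch D E) * ch (D ** tr w) E) * (f v * ch (trunc Phi (D ** tr w)) (v -\<^sub>R E)))"
  proof (rule sum.cong[OF refl])
    fix v assume v: "v \<in> US F n Phi"
    note vm = US_MM[OF v]
    have "ch D (v \<bullet> w -\<^sub>R E) = ch (D ** tr w) v * cnj (ch D E)"
      using D vm wm by (simp add: G_mult ch_minus pair_mult_right)
    then show "f v * ch D (v \<bullet> w -\<^sub>R E) = (cnj (ch D E) * ch (D ** tr w) E) * (f v * ch (trunc Phi (D ** tr w)) (v -\<^sub>R E))"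
      by (simp add: ch_shift[OF Dw v] mult_ac)
  qed
  finally show ?thesis unfolding sum_distrib_left[symmetric] fc_def by blast
qed

lemma fc_left:
  assumes D: "D \<in> MM" and w: "w \<in> US F n Phi" and f: "f \<in> CU"
  shows "\<exists>c. fc (sg w \<odot> f) D = c * fc f (trunc Phi (tr w ** D))"
proof -
  note wm = US_MM[OF w]
  have Dw: "tr w ** D \<in> MM" using D wm tr_MM by auto
  have "fc (sg w \<odot> f) D = (\<Sum>u\<in>US F n Phi. f (ginv w \<bullet> u) * ch D (u -\<^sub>R E))"
    unfolding fc_def by (rule sum.cong) (auto simp: G.lt_eq UU.H_sub w)
  also have "\<dots> = (\<Sum>v\<in>US F n Phi. f v * ch D (w \<bullet> v -\<^sub>R E))"
    by (rule sum.reindex_bij_witness[where i="\<lambda>v. w \<bullet> v" and j="\<lambda>u. ginv w \<bullet> u"])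
      (use w UU.H_sub UU.H_closed UU.H_inv in \<open>auto simp: G.m_assoc[symmetric]\<close>)
  also have "\<dots> = (\<Sum>v\<in>US F n Phi. (cnj (ch D E) * ch (tr w ** D) E) * (f v * ch (trunc Phi (tr w ** D)) (v -\<^sub>R E)))"
  proof (rule sum.cong[OF refl])
    fix v assume v: "v \<in> US F n Phi"
    note vm = US_MM[OF v]
    have "ch D (w \<bullet> v -\<^sub>R E) = ch (tr w ** D) v * cnj (ch D E)"
      using D vm wm by (simp add: G_mult ch_minus pair_mult_left)
    then show "f v * ch D (w \<bullet> v -\<^sub>R E) = (cnj (ch D E) * ch (tr w ** D) E) * (f v * ch (trunc Phi (tr w ** D)) (v -\<^sub>R E))"
      by (simp add: ch_shift[OF Dw v] mult_ac)
  qed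
  finally show ?thesis unfolding sum_distrib_left[symmetric] fc_def by blast
qed

lemma CU_mult: "a \<in> CU ==> b \<in> CU ==> a \<odot> b \<in> CU"
  by (rule UU.ga_mult_GH_alg)

text \<open>Expanded on the right, the element is a combination of translates \<open>[A] w\<close>;
  expanded on the left, of translates \<open>w' [C]\<close>. An index \<open>D\<close> with nonzero
  coefficient must occur in one translate of each kind.\<close>

lemma lid_mult_nonzero:
  assumes A: "A \<in> VS F n Phi" and C: "C \<in> VS F n Phi" and a: "a \<in> CU"
    and nz: "lid Phi A \<odot> a \<odot> lid Phi C \<noteq> (\<lambda>_. 0)"
  shows "\<exists>D\<in>VS F n Phi. \<exists>w\<in>US F n Phi. \<exists>w'\<in>US F n Phi. agree (D ** tr w) A \<and> agree (tr w' ** D) C"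
proof -
  let ?f = "lid Phi A \<odot> a \<odot> lid Phi C"
  have LA: "lid Phi A \<in> CU" and LC: "lid Phi C \<in> CU" using lid_CU[OF subset_refl] by auto
  have f: "?f \<in> CU" by (intro CU_mult LA LC a)
  obtain D where D: "D \<in> VS F n Phi" "fc ?f D \<noteq> 0" using fc_inj[OF f] nz by blast
  note Dm = VS_MM[OF D(1)]
  have e1: "?f = (\<lambda>x. \<Sum>h\<in>US F n Phi. (a \<odot> lid Phi C) h * (lid Phi A \<odot> sg h) x)"
    unfolding G.ga_mult_assoc by (rule UU.ga_mult_sum_H[OF CU_mult[OF a LC]])
  then obtain w where w: "w \<in> US F n Phi" "fc (lid Phi A \<odot> sg w) D \<noteq> 0"
    using D(2) fc_comb[of "\<lambda>h. (a \<odot> lid Phi C) h" "\<lambda>h. lid Phi A \<odot> sg h" "US F n Phi" D]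
    by (metis (no_types, lifting) mult_zero_right sum.neutral)
  have "agree (D ** tr w) A"
  proof -
    have m: "D ** tr w \<in> MM" using Dm US_MM[OF w(1)] tr_MM by auto
    have "fc (lid Phi A) (trunc Phi (D ** tr w)) \<noteq> 0" using fc_right[OF Dm w(1) LA] w(2) by auto
    then have "A = trunc Phi (D ** tr w)" using fc_lid[OF A trunc_VS[OF m]] by (auto split: if_splits)
    then show ?thesis using agree_trunc agree_sym by metis
  qed
  moreover
  let ?x = "lid Phi A \<odot> a"
  have x: "?x \<in> CU" by (intro CU_mult LA a)
  have xs: "?x = (\<lambda>y. \<Sum>h\<in>carrier G. ?x h * sg h y)" by (rule G.group_algebra_sum[OF UU.alg_sub[OF x]])
  have "?f = (\<lambda>y. \<Sum>h\<in>carrier G. ?x h * sg h y) \<odot> lid Phi C" using xs by simp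
  then have e2: "?f = (\<lambda>y. \<Sum>h\<in>carrier G. ?x h * (sg h \<odot> lid Phi C) y)" unfolding G.ga_mult_comb_left .
  have "fc ?f D = (\<Sum>h\<in>carrier G. ?x h * fc (sg h \<odot> lid Phi C) D)"
    by (subst e2) (rule fc_comb)
  then obtain w' where w': "?x w' * fc (sg w' \<odot> lid Phi C) D \<noteq> 0" using D(2) by (metis (no_types, lifting) sum.neutral)
  then have w'': "w' \<in> US F n Phi" using x by (auto simp: CU_iff)
  have "agree (tr w' ** D) C"
  proof -
    have m: "tr w' ** D \<in> MM" using Dm US_MM[OF w''] tr_MM by auto
    have "fc (lid Phi C) (trunc Phi (tr w' ** D)) \<noteq> 0" using fc_left[OF Dm w'' LC] w' by auto
    then have "C = trunc Phi (tr w' ** D)" using fc_lid[OF C trunc_VS[OF m]] by (auto split: if_splits)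
    then show ?thesis using agree_trunc agree_sym by metis
  qed
  ultimately show ?thesis using D(1) w(1) w'' by blast
qed

lemma tr_inv: "w \<in> US F n Phi ==> tr w ** tr (ginv w) = E" "w \<in> US F n Phi ==> tr (ginv w) ** tr w = E"
proof -
  assume w: "w \<in> US F n Phi"
  note m = US_MM[OF w] US_MM[OF UU.H_inv[OF w]]
  have "w ** ginv w = E" "ginv w ** w = E"
    using G.r_inv[OF UU.H_sub[OF w]] G.l_inv[OF UU.H_sub[OF w]] by (simp_all add: G_mult G_one)
  then show "tr w ** tr (ginv w) = E" "tr (ginv w) ** tr w = E"
    using tr_mult[OF m] tr_mult[OF m(2,1)] tr_E by simp_all
qed

text \<open>Eliminating the intermediate indices through \<open>C\<close> relates \<open>A\<close>
  and \<open>B\<close> by upper unitriangular row and column operations, and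
  \<open>verge_unique\<close> applies.\<close>

lemma lid_mult_nonzero_unique:
  assumes A: "A \<in> VS F n Phi" "verge F n A" and B: "B \<in> VS F n Phi" "verge F n B" and C: "C \<in> VS F n Phi"
    and a: "a \<in> CU" "lid Phi A \<odot> a \<odot> lid Phi C \<noteq> (\<lambda>_. 0)"
    and b: "b \<in> CU" "lid Phi B \<odot> b \<odot> lid Phi C \<noteq> (\<lambda>_. 0)"
  shows "A = B"
proof -
  obtain D w w' where D: "D \<in> VS F n Phi" and w: "w \<in> US F n Phi" "w' \<in> US F n Phi"
    and Da: "agree (D ** tr w) A" "agree (tr w' ** D) C" using lid_mult_nonzero[OF A(1) C a] by blast
  obtain D2 z z' where D2: "D2 \<in> VS F n Phi" and z: "z \<in> US F n Phi" "z' \<in> US F n Phi"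
    and D2a: "agree (D2 ** tr z) B" "agree (tr z' ** D2) C" using lid_mult_nonzero[OF B(1) C b] by blast
  note i = UU.H_inv[OF w(1)] UU.H_inv[OF z(1)] UU.H_inv[OF z(2)]
  note m = US_MM[OF w(1)] US_MM[OF w(2)] US_MM[OF z(1)] US_MM[OF z(2)] VS_MM[OF A(1)] VS_MM[OF B(1)] VS_MM[OF C] VS_MM[OF D] VS_MM[OF D2] i[THEN US_MM]
  note mt = m(1-4)[THEN tr_MM] m(10-12)[THEN tr_MM]
  \<comment> \<open>Below the diagonal \<open>D\<close> is \<open>A ** tr (ginv w)\<close>, so
    \<open>C\<close> is obtained from \<open>A\<close> directly and \<open>D\<close>
    disappears.\<close>
  have step: "agree (tr w' ** A ** tr (ginv w)) C"
    if "agree (D ** tr w) A" "agree (tr w' ** D) C" "w \<in> US F n Phi" "w' \<in> US F n Phi" "A \<in> MM" "D \<in> MM" for A D w w'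
  proof -
    note mm = US_MM[OF that(3)] US_MM[OF that(4)] UU.H_inv[OF that(3), THEN US_MM]
    note mmt = mm[THEN tr_MM]
    have "agree (D ** tr w ** tr (ginv w)) (A ** tr (ginv w))"
      by (rule agree_right[OF UU.H_inv[OF that(3)]]) (use that mmt in auto)
    then have "agree D (A ** tr (ginv w))" using that mmt by (simp add: R.m_assoc tr_inv)
    from agree_left[OF that(4) _ _ this] have "agree (tr w' ** D) (tr w' ** (A ** tr (ginv w)))" using that mmt by simp
    then have "agree (tr w' ** D) (tr w' ** A ** tr (ginv w))" using that mmt by (simp add: R.m_assoc)
    then show ?thesis by (rule agree_trans[OF agree_sym that(2)])
  qed
  have "agree (tr w' ** A ** tr (ginv w)) (tr z' ** B ** tr (ginv z))"
    by (rule agree_trans[OF step[OF Da w] agree_sym[OF step[OF D2a z]]]) (use m in auto)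
  from agree_left[OF i(3) _ _ this] have "agree (tr (ginv z') ** (tr w' ** A ** tr (ginv w)))
      (tr (ginv z') ** (tr z' ** B ** tr (ginv z)))" using m mt by simp
  from agree_right[OF w(1) _ _ this] have 1: "agree (tr (ginv z') ** (tr w' ** A ** tr (ginv w)) ** tr w)
      (tr (ginv z') ** (tr z' ** B ** tr (ginv z)) ** tr w)" using m mt by simp
  have l: "tr (ginv z') ** (tr w' ** A ** tr (ginv w)) ** tr w = tr (w' ** ginv z') ** A"
    using m mt w by (simp add: tr_mult R.m_assoc tr_inv)
  have "tr (ginv z') ** (tr z' ** B ** tr (ginv z)) ** tr w = (tr (ginv z') ** tr z') ** B ** (tr (ginv z) ** tr w)"
    using m mt by (simp add: R.m_assoc)
  also have "\<dots> = B ** tr (w ** ginv z)" using m mt z by (simp add: tr_mult tr_inv)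
  finally have r: "tr (ginv z') ** (tr z' ** B ** tr (ginv z)) ** tr w = B ** tr (w ** ginv z)" .
  show ?thesis
    by (rule verge_unique[OF A B, of "w' ** ginv z'" "w ** ginv z"])
      (use 1 l r w i US_mult[OF closed_Phi] in auto)
qed

text \<open>Since \<open>\<Sum>[C] = 1\<close>, some \<open>[C]\<close> acts nontrivially on a nonzero module.\<close>

lemma lid_separates:
  assumes A: "A \<in> VS F n Phi" "verge F n A" and B: "B \<in> VS F n Phi" "verge F n B"
    and ab: "a \<in> CU" "b \<in> CU" and nz: "lid Phi A \<odot> a \<noteq> (\<lambda>_. 0)"
    and iso: "mod_iso (U F n) (UM (UU.rid (lid Phi A \<odot> a))) (UM (UU.rid (lid Phi B \<odot> b)))"
  shows "A = B"
proof -
  let ?x = "lid Phi A \<odot> a" and ?y = "lid Phi B \<odot> b"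
  have x: "?x \<in> CU" by (intro CU_mult lid_CU ab subset_refl)
  obtain \<phi> where \<phi>: "bij_betw \<phi> (UU.rid ?x) (UU.rid ?y)"
    and sc: "\<And>v c. v \<in> UU.rid ?x ==> \<phi> (\<lambda>x. c * v x) = (\<lambda>y. c * \<phi> v y)"
    and act: "\<And>v a. v \<in> UU.rid ?x ==> a \<in> CU ==> \<phi> (v \<odot> a) = \<phi> v \<odot> a"
    using iso unfolding mod_iso_def U_eq by auto
  have xr: "?x \<in> UU.rid ?x" by (rule UU.rid_self) (rule ga_mult_alg)
  have "\<exists>C\<in>VS F n Phi. ?x \<odot> lid Phi C \<noteq> (\<lambda>_. 0)"
  proof (rule ccontr)
    assume c: "\<not> ?thesis"
    have "?x = ?x \<odot> sg \<one>\<^bsub>G\<^esub>" using G.ga_mult_one[OF UU.alg_sub[OF x]] by simp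
    also have "\<dots> = ?x \<odot> (\<lambda>u. \<Sum>C\<in>VS F n Phi. 1 * lid Phi C u)" using sum_lid[OF subset_refl] by (simp add: G_one)
    also have "\<dots> = (\<lambda>u. \<Sum>C\<in>VS F n Phi. 1 * (?x \<odot> lid Phi C) u)" by (rule G.ga_mult_comb_right)
    also have "\<dots> = (\<lambda>_. 0)" using c by auto
    finally show False using nz by simp
  qed
  then obtain C where C: "C \<in> VS F n Phi" "?x \<odot> lid Phi C \<noteq> (\<lambda>_. 0)" by blast
  have LC: "lid Phi C \<in> CU" by (rule lid_CU[OF subset_refl])
  have zr: "(\<lambda>_. 0) \<in> UU.rid ?x" using csubspaceD(1)[OF UU.rid_subspace] .
  have z0: "\<phi> (\<lambda>_. 0) = (\<lambda>_. 0)" using sc[OF zr, of 0] by simp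
  have "\<phi> (?x \<odot> lid Phi C) \<noteq> (\<lambda>_. 0)"
    using bij_betw_imp_inj_on[OF \<phi>] UU.rid_closed[OF xr LC] zr z0 C(2) by (metis inj_onD)
  then have "\<phi> ?x \<odot> lid Phi C \<noteq> (\<lambda>_. 0)" using act[OF xr LC] by simp
  moreover have "\<phi> ?x \<in> UU.rid ?y" using \<phi> xr by (auto simp: bij_betw_def)
  then obtain b' where b': "b' \<in> CU" "\<phi> ?x = ?y \<odot> b'" by (auto simp: UU.rid_def)
  ultimately have "lid Phi B \<odot> (b \<odot> b') \<odot> lid Phi C \<noteq> (\<lambda>_. 0)" by (simp add: G.ga_mult_assoc)
  then show ?thesis using lid_mult_nonzero_unique[OF A B C(1) ab(1) C(2) CU_mult[OF ab(2) b'(1)]] by simp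
qed

end

section \<open>The characters of the pattern subgroups\<close>

text \<open>The definition is a union over conditions. Reading it by the column \<open>c\<close>
  instead leaves, for a main condition set, at most one condition to consider.\<close>

lemma R_hat_iff:
  assumes p: "p \<subseteq> neg_roots n"
  shows "(a, c) \<in> R_hat n p \<longleftrightarrow> (a, c) \<in> neg_roots n \<and> ((\<forall>i. (i, c) \<notin> p) \<or>
     (\<exists>i. (i, c) \<in> p \<and> (i \<le> a \<or> (\<exists>r. (r, a) \<in> p \<and> c < a \<and> a < i \<and> i < r))))"
proof -
  have "(r, j) \<in> neg_roots n" if "(i, j) \<in> p" "i \<le> r" "r \<le> n" for i j r
    using that p by (force simp: neg_roots_def)
  then show ?thesis using p unfolding R_hat_def R_set_def by (force simp: neg_roots_def)
qed

locale hook = fchar F n \<theta> for F :: "'f ring" (structure) and n and \<theta> + 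
  fixes A :: "'f matrix"
  assumes A_MM: "A \<in> carrier (mat_ring F n)"
    and mcs: "main_condition_set n (supp F n A)"
    and chd: "completely_hook_disconnected (supp F n A)"
begin

definition "p = supp F n A"
definition "Rh = R_hat n p"
definition "HH = US F n Rh"

lemma p_iff: "(i, j) \<in> p \<longleftrightarrow> i \<in> N \<and> j \<in> N \<and> A (i, j) \<noteq> \<zero>" by (auto simp: p_def supp_def)
lemma p_Phi: "p \<subseteq> Phi" using mcs by (simp add: main_condition_set_def p_def)
lemma finite_p: "finite p" by (rule finite_sub_Phi[OF p_Phi])
lemma p_row: "(i, j) \<in> p ==> (i, l) \<in> p ==> j = l"
  using mcs unfolding main_condition_set_def p_def inj_on_def by force
lemma p_col: "(i, j) \<in> p ==> (k, j) \<in> p ==> i = k"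
  using mcs unfolding main_condition_set_def p_def inj_on_def by force
lemma p_disc: "(i, j) \<in> p ==> (k, i) \<in> p ==> False"
  using chd unfolding completely_hook_disconnected_def p_def by force

lemma A_VS: "A \<in> VS F n Phi" using p_Phi A_MM unfolding VS_iff using p_iff by blast

lemma A_verge: "verge F n A"
proof (rule vergeI)
  fix i j j' assume "i \<in> N" "j \<in> N" "j' \<in> N" "A (i, j) \<noteq> \<zero>" "A (i, j') \<noteq> \<zero>"
  then have "(i, j) \<in> p" "(i, j') \<in> p" by (simp_all add: p_iff)
  then show "j = j'" by (rule p_row)
next
  fix i i' j assume "i \<in> N" "i' \<in> N" "j \<in> N" "A (i, j) \<noteq> \<zero>" "A (i', j) \<noteq> \<zero>"
  then have "(i, j) \<in> p" "(i', j) \<in> p" by (simp_all add: p_iff)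
  then show "i = i'" by (rule p_col)
qed

lemmas Rh_iff = R_hat_iff[OF p_Phi, folded Rh_def]

lemma Rh_Phi: "Rh \<subseteq> Phi" by (auto simp: Rh_iff)

lemma p_Rh: "p \<subseteq> Rh" using p_Phi by (auto simp: Rh_iff)

text \<open>The only doubtful case is a condition \<open>(i, c)\<close> with \<open>a < i\<close>.
  Then \<open>(b, c)\<close> must come from a condition \<open>(r, b)\<close> with
  \<open>i < r\<close>, and \<open>(a, b)\<close> in turn from a condition \<open>(r', a)\<close>
  with \<open>r < r'\<close>; this last condition puts \<open>(a, c)\<close> into
  \<open>Rh\<close>.\<close>

lemma closed_Rh: "closed_pat Rh"
  unfolding closed_pat_def
proof (intro conjI allI impI)
  fix a b c assume ab: "(a, b) \<in> Rh" and bc: "(b, c) \<in> Rh"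
  have P: "(a, c) \<in> Phi" "b < a" "c < b" using ab bc by (auto simp: Rh_iff Phi_iff)
  show "(a, c) \<in> Rh"
  proof (cases "\<exists>i. (i, c) \<in> p \<and> a < i")
    case True
    then obtain i where i: "(i, c) \<in> p" "a < i" by blast
    obtain i' where i': "(i', c) \<in> p" "i' \<le> b \<or> (\<exists>r. (r, b) \<in> p \<and> c < b \<and> b < i' \<and> i' < r)"
      using bc i(1) unfolding Rh_iff by blast
    then obtain r where r: "(r, b) \<in> p" "i < r" using p_col[OF i(1) i'(1)] i P by auto
    obtain k where k: "(k, b) \<in> p" "k \<le> a \<or> (\<exists>r. (r, a) \<in> p \<and> b < a \<and> a < k \<and> k < r)"
      using ab r(1) unfolding Rh_iff by blast
    then obtain r' where r': "(r', a) \<in> p" "r < r'" using p_col[OF r(1) k(1)] r i by auto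
    have "c < a \<and> a < i \<and> i < r'" using P i r r' by auto
    then show ?thesis using P(1) i(1) r'(1) unfolding Rh_iff by blast
  next
    case False
    then show ?thesis using P(1) unfolding Rh_iff using not_le by blast
  qed
qed (use Rh_Phi in auto)

text \<open>No product of two roots of \<open>Rh\<close> lies in \<open>p\<close>, so the entries at \<open>p\<close> are additive on \<open>HH\<close>.\<close>

lemma Rh_indecomposable:
  assumes ij: "(i, j) \<in> p" and ik: "(i, k) \<in> Rh" and kj: "(k, j) \<in> Rh" shows False
proof -
  have lt: "j < k" "k < i" using ik kj by (auto simp: Rh_iff Phi_iff)
  obtain i' where i': "(i', j) \<in> p" "i' \<le> k \<or> (\<exists>r. (r, k) \<in> p \<and> j < k \<and> k < i' \<and> i' < r)"
    using kj ij unfolding Rh_iff by blast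
  then obtain r where r: "(r, k) \<in> p" "i < r" using p_col[OF ij i'(1)] lt by auto
  obtain l where l: "(l, k) \<in> p" "l \<le> i \<or> (\<exists>r. (r, i) \<in> p \<and> k < i \<and> i < l \<and> l < r)"
    using ik r(1) unfolding Rh_iff by blast
  then obtain r' where "(r', i) \<in> p" using p_col[OF r(1) l(1)] r by auto
  then show False using p_disc[OF ij] by blast
qed

sublocale HS: subgroup_alg G HH
  unfolding HH_def by (rule subgroup_US[OF closed_Rh])

lemma HH_U: "u \<in> HH ==> u \<in> US F n Phi" unfolding HH_def by (rule US_sub_Phi[OF Rh_Phi])
lemma HH_MM: "u \<in> HH ==> u \<in> MM" using HH_U US_MM by blast

lemma HH_entry:
  assumes u: "u \<in> HH" and v: "v \<in> HH" and ij: "(i, j) \<in> p"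
  shows "(u ** v) (i, j) = u (i, j) \<oplus> v (i, j)"
proof -
  have ijN: "i \<in> N" "j \<in> N" "j < i" using ij p_Phi by (auto simp: Phi_iff)
  note m = HH_MM[OF u] HH_MM[OF v]
  note mu = MM_entry[OF m(1)] and mv = MM_entry[OF m(2)]
  have "(u ** v) (i, j) = (\<Oplus>k\<in>N. u (i, k) \<otimes> v (k, j))" using ijN by (simp add: mult_entry')
  also have "\<dots> = (\<Oplus>k\<in>{i, j}. u (i, k) \<otimes> v (k, j))"
  proof (rule fs_mono[symmetric])
    fix k assume k: "k \<in> N - {i, j}"
    have "(i, k) \<notin> Rh \<or> (k, j) \<notin> Rh" using Rh_indecomposable[OF ij] by blast
    then show "u (i, k) \<otimes> v (k, j) = \<zero>"
      using US_zero[OF Rh_Phi u[unfolded HH_def] ijN(1), of k] US_zero[OF Rh_Phi v[unfolded HH_def] _ ijN(2), of k] k mu mv ijN by auto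
  qed (use ijN mu mv in auto)
  also have "\<dots> = u (i, i) \<otimes> v (i, j) \<oplus> (\<Oplus>k\<in>{j}. u (i, k) \<otimes> v (k, j))"
    by (rule fs_insert) (use ijN mu mv in auto)
  also have "\<dots> = u (i, i) \<otimes> v (i, j) \<oplus> u (i, j) \<otimes> v (j, j)"
    using ijN mu mv by simp
  also have "\<dots> = u (i, j) \<oplus> v (i, j)"
    using US_diag[OF Rh_Phi u[unfolded HH_def]] US_diag[OF Rh_Phi v[unfolded HH_def]] ijN mu mv by (simp add: a_comm)
  finally show ?thesis .
qed

lemma pair_cong: 
  assumes "X \<in> MM" "Y \<in> MM" "\<And>i j. (i, j) \<in> p ==> X (i, j) = Y (i, j)" shows "pair A X = pair A Y"
  unfolding pair_def
proof (rule fs_cong)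
  fix e assume e: "e \<in> N \<times> N"
  obtain i j where ij: "e = (i, j)" by (cases e)
  show "A e \<otimes> X e = A e \<otimes> Y e"
  proof (cases "e \<in> p")
    case False then have "A e = \<zero>" using e ij by (auto simp: p_iff)
    then show ?thesis using e ij assms(1,2)[THEN MM_entry] by auto
  qed (use assms ij in auto)
qed (use assms A_MM MM_entry in auto)

text \<open>\<open>psi\<close> is a definite description. This is the explicit function behind it:
  the one given by \<open>A\<close> on all of \<open>U\<close>, restricted to \<open>HH\<close>,
  where it becomes multiplicative.\<close>

definition psi0 :: "'f matrix => complex" where "psi0 = (\<lambda>u\<in>HH. ch A (u -\<^sub>R E))"

lemma psi0_mult: assumes u: "u \<in> HH" and v: "v \<in> HH" shows "psi0 (u \<bullet> v) = psi0 u * psi0 v"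
proof -
  note m = HH_MM[OF u] HH_MM[OF v]
  have uv: "u \<bullet> v \<in> HH" by (rule HS.H_closed[OF u v])
  have uvm: "u ** v \<in> MM" using m by auto
  have "pair A (u ** v -\<^sub>R E) = pair A ((u -\<^sub>R E) +\<^sub>R (v -\<^sub>R E))"
  proof (rule pair_cong)
    fix i j assume ij: "(i, j) \<in> p"
    then have "i \<in> N" "j \<in> N" "i \<noteq> j" using p_Phi by (auto simp: Phi_iff)
    then show "(u ** v -\<^sub>R E) (i, j) = ((u -\<^sub>R E) +\<^sub>R (v -\<^sub>R E)) (i, j)"
      using m uvm MM_entry[OF m(1)] MM_entry[OF m(2)] HH_entry[OF u v ij]
      by (simp add: add_entry minus_entry one_entry minus_eq)
  qed (use m in auto)
  then show ?thesis using u v uv m A_MM by (simp add: psi0_def G_mult ch_add)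
qed

lemma scaled_unit_VS: "(i, j) \<in> S ==> \<alpha> \<in> carrier F ==> scaled_unit F n (i, j) \<alpha> \<in> VS F n S"
  unfolding VS_iff scaled_unit_def by (auto intro!: MM_restrict)

lemma scaled_unit_MM: "\<alpha> \<in> carrier F ==> scaled_unit F n e \<alpha> \<in> MM"
  unfolding scaled_unit_def by (auto intro!: MM_restrict)

lemma root_US: "(i, j) \<in> S ==> \<alpha> \<in> carrier F ==> root_elem F n (i, j) \<alpha> \<in> US F n S"
  unfolding root_elem_def by (rule US_plus[OF scaled_unit_VS])

lemma root_minus: "\<alpha> \<in> carrier F ==> root_elem F n e \<alpha> -\<^sub>R E = scaled_unit F n e \<alpha>"
  unfolding root_elem_def by (rule plus_minus[OF scaled_unit_MM])

lemma pair_scaled: "M \<in> MM ==> i \<in> N ==> j \<in> N ==> \<alpha> \<in> carrier F ==> pair M (scaled_unit F n (i, j) \<alpha>) = M (i, j) \<otimes> \<alpha>"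
proof -
  assume a: "M \<in> MM" "i \<in> N" "j \<in> N" "\<alpha> \<in> carrier F"
  have "pair M (scaled_unit F n (i, j) \<alpha>) = M (i, j) \<otimes> scaled_unit F n (i, j) \<alpha> (i, j)"
    unfolding pair_def by (rule fs_single) (use a MM_entry in \<open>auto simp: scaled_unit_def\<close>)
  then show ?thesis using a by (simp add: scaled_unit_def)
qed

lemma psi0_trivial: assumes u: "u \<in> US F n S" "S \<subseteq> Phi" "S \<inter> p = {}" shows "ch A (u -\<^sub>R E) = 1"
proof -
  have "pair A (u -\<^sub>R E) = \<zero>" unfolding pair_def
  proof (rule fs_zero)
    fix e assume e: "e \<in> N \<times> N"
    obtain i j where ij: "e = (i, j)" by (cases e)
    have X: "u -\<^sub>R E \<in> VS F n S" by (rule US_minus[OF u(2,1)])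
    have "A (i, j) = \<zero> \<or> (u -\<^sub>R E) (i, j) = \<zero>"
    proof (cases "(i, j) \<in> p")
      case True then have "(i, j) \<notin> S" using u(3) by auto
      then show ?thesis using X e ij unfolding VS_iff by blast
    qed (use e ij in \<open>auto simp: p_iff\<close>)
    then show "A e \<otimes> (u -\<^sub>R E) e = \<zero>" using e ij MM_entry[OF A_MM] MM_entry[OF VS_MM[OF X]] by auto
  qed
  then show ?thesis by (simp add: th_zero)
qed

lemma is_psi_psi0: "is_psi F \<theta> n A psi0"
  unfolding is_psi_def Let_def p_def[symmetric] Rh_def[symmetric] HH_def[symmetric]
proof (intro conjI ballI)
  show "psi0 \<in> HH \<rightarrow>\<^sub>E UNIV - {0}"
    using A_MM HH_MM by (auto simp: psi0_def ch_nz)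
  fix u v assume "u \<in> HH" "v \<in> HH" then show "psi0 (u \<bullet> v) = psi0 u * psi0 v" by (rule psi0_mult)
next
  fix u assume u: "u \<in> US F n (Rh - p)"
  have "u \<in> HH" unfolding HH_def using u US_mono[of "Rh - p" Rh] by auto
  then show "psi0 u = 1" using psi0_trivial[OF u] Rh_Phi by (auto simp: psi0_def)
next
  fix e \<alpha> assume e: "e \<in> p" and \<alpha>: "\<alpha> \<in> carrier F"
  obtain i j where ij: "e = (i, j)" by (cases e)
  have N: "i \<in> N" "j \<in> N" using e ij p_Phi by (auto simp: Phi_iff)
  have "root_elem F n e \<alpha> \<in> HH" unfolding HH_def ij using root_US e ij p_Rh \<alpha> by blast
  then show "psi0 (root_elem F n e \<alpha>) = \<theta> (\<alpha> \<otimes> A e)"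
    using ij N \<alpha> MM_entry[OF A_MM N] by (simp add: psi0_def root_minus pair_scaled A_MM m_comm)
qed

text \<open>Root elements at the conditions clear the entries of \<open>u\<close> at
  \<open>p\<close> one after another, until \<open>u\<close> lies where every such character is
  trivial; on the root elements the values are prescribed.\<close>

lemma is_psi_unique: assumes ps: "is_psi F \<theta> n A \<psi>" shows "\<psi> = psi0"
proof -
  note ps' = ps[unfolded is_psi_def Let_def p_def[symmetric] Rh_def[symmetric] HH_def[symmetric]]
  have hom: "\<psi> (u \<bullet> v) = \<psi> u * \<psi> v" if "u \<in> HH" "v \<in> HH" for u v using ps' that by blast
  have eq: "\<psi> u = psi0 u" if "finite T" "T \<subseteq> p" "u \<in> US F n ((Rh - p) \<union> T)" for T u
    using that
  proof (induction T arbitrary: u rule: finite_induct)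
    case empty
    then have "\<psi> u = 1" using ps' by auto
    moreover have "psi0 u = 1" using is_psi_psi0[unfolded is_psi_def Let_def p_def[symmetric] Rh_def[symmetric]] empty by auto
    ultimately show ?case by simp
  next
    case (insert e T)
    obtain i j where ij: "e = (i, j)" by (cases e)
    have ep: "(i, j) \<in> p" using insert ij by auto
    have N: "i \<in> N" "j \<in> N" "i \<noteq> j" using ep p_Phi by (auto simp: Phi_iff)
    have sub: "Rh - p \<union> insert e T \<subseteq> Rh" using insert p_Rh by auto
    have uH: "u \<in> HH" unfolding HH_def using insert US_mono[OF sub] by auto
    note um = HH_MM[OF uH]
    \<comment> \<open>By \<open>HH_entry\<close> the entries at \<open>p\<close> add up, so this
      root element kills the entry at \<open>(i, j)\<close> and leaves those at the other conditions
      alone.\<close>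
    define \<alpha> where "\<alpha> = \<ominus> u (i, j)"
    have \<alpha>: "\<alpha> \<in> carrier F" using MM_entry[OF um] N by (simp add: \<alpha>_def)
    let ?r = "root_elem F n (i, j) \<alpha>"
    have rH: "?r \<in> HH" unfolding HH_def using root_US ep p_Rh \<alpha> by blast
    have re: "?r (k, l) = (if (k, l) = (i, j) then \<alpha> else \<zero>)" if "k \<in> N" "l \<in> N" "k \<noteq> l" for k l
      using that \<alpha> by (auto simp: root_elem_def add_entry one_entry scaled_unit_def)
    let ?v = "u \<bullet> ?r"
    have vH: "?v \<in> HH" by (rule HS.H_closed[OF uH rH])
    have v: "?v \<in> US F n (Rh - p \<union> T)"
    proof -
      have sub': "Rh - p \<union> T \<subseteq> Phi" "Rh - p \<union> insert e T \<subseteq> Phi" using Rh_Phi sub by auto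
      have "?v (k, l) = \<zero>" if kl: "k \<in> N" "l \<in> N" "k \<noteq> l" "(k, l) \<notin> Rh - p \<union> T" for k l
      proof (cases "(k, l) \<in> p")
        case True
        have "?v (k, l) = u (k, l) \<oplus> ?r (k, l)" using HH_entry[OF uH rH True] by (simp add: G_mult)
        also have "\<dots> = \<zero>"
        proof (cases "(k, l) = (i, j)")
          case True then show ?thesis using re[OF kl(1-3)] MM_entry[OF um] kl by (simp add: \<alpha>_def r_neg)
        next
          case False
          then have "u (k, l) = \<zero>" using US_zero[OF sub'(2) insert(5) kl(1-3)] kl(4) True ij by auto
          then show ?thesis using re[OF kl(1-3)] False by auto
        qed
        finally show ?thesis .
      next
        case False
        then show ?thesis using US_zero[OF Rh_Phi vH[unfolded HH_def] kl(1-3)] kl(4) by auto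
      qed
      then show ?thesis unfolding US_iff[OF sub'(1)]
        using HH_MM[OF vH] US_diag[OF Rh_Phi vH[unfolded HH_def]] by blast
    qed
    have "\<psi> u * \<psi> ?r = psi0 u * psi0 ?r"
      using insert(3)[OF _ v] insert(4) hom[OF uH rH] psi0_mult[OF uH rH] by auto
    moreover have "\<psi> ?r = psi0 ?r"
      using ps' is_psi_psi0[unfolded is_psi_def Let_def p_def[symmetric] Rh_def[symmetric] HH_def[symmetric]] ep \<alpha> by metis
    moreover have "psi0 ?r \<noteq> 0" using rH HH_MM[OF rH] A_MM by (simp add: psi0_def ch_nz)
    ultimately show ?case by simp
  qed
  have e: "Rh - p \<union> p = Rh" using p_Rh by auto
  show ?thesis
  proof (rule extensionalityI[of _ HH])
    show "\<psi> \<in> extensional HH" using ps' by (auto simp: PiE_def)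
    show "psi0 \<in> extensional HH" by (simp add: psi0_def)
    fix u assume "u \<in> HH" then show "\<psi> u = psi0 u" using eq[OF finite_p subset_refl] e by (simp add: HH_def)
  qed
qed

lemma psi_eq: "psi F \<theta> n A = psi0"
  unfolding psi_def by (rule the_equality, rule is_psi_psi0, rule is_psi_unique)

definition "ep = eps F \<theta> n A"

lemma ep_eq: "ep = (\<lambda>u. if u \<in> HH then psi0 (ginv u) / of_nat (card HH) else 0)"
  unfolding ep_def eps_def Let_def psi_eq p_def[symmetric] Rh_def[symmetric] HH_def[symmetric] ..

lemma ep_CU: "ep \<in> CU" using HH_U by (auto simp: ep_eq CU_iff)

lemma card_HH_nz: "(of_nat (card HH) :: complex) \<noteq> 0"
  using HS.fin_H HS.H_one by (simp add: card_gt_0_iff) blast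

lemma psi0_nz: "u \<in> HH ==> psi0 u \<noteq> 0" using A_MM HH_MM by (simp add: psi0_def ch_nz)
lemma psi0_one: "psi0 \<one>\<^bsub>G\<^esub> = 1" using psi0_mult[OF HS.H_one HS.H_one] psi0_nz[OF HS.H_one] by simp

lemma ep_right: assumes h: "h \<in> HH" shows "ep \<odot> sg h = (\<lambda>u. psi0 h * ep u)"
proof (rule ext)
  fix u
  note hG = HS.H_sub[OF h]
  show "(ep \<odot> sg h) u = psi0 h * ep u"
  proof (cases "u \<in> HH")
    case True
    note uG = HS.H_sub[OF True]
    have 1: "u \<bullet> ginv h \<in> HH" by (intro HS.H_closed HS.H_inv True h)
    have 2: "ginv (u \<bullet> ginv h) = h \<bullet> ginv u" using uG hG by (simp add: G.inv_mult_group)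
    show ?thesis using 1 2 True uG hG h by (simp add: G.rt_eq ep_eq psi0_mult HS.H_inv)
  next
    case False
    have "u \<bullet> ginv h \<notin> HH" if u: "u \<in> carrier G"
    proof
      assume "u \<bullet> ginv h \<in> HH"
      then have "u \<bullet> ginv h \<bullet> h \<in> HH" using h by (rule HS.H_closed)
      then show False using False u hG by (simp add: G.m_assoc)
    qed
    then show ?thesis using False hG by (auto simp: G.rt_eq ep_eq)
  qed
qed

text \<open>\<open>ep\<close> is the average of \<open>psi0 (h^-1) h\<close> over \<open>HH\<close>,
  and every single term fixes such a \<open>v\<close>.\<close>

lemma eigen_ep:
  assumes v: "v \<in> group_algebra G" and e: "\<And>h. h \<in> HH ==> v \<odot> sg h = (\<lambda>x. psi0 h * v x)"
  shows "v \<odot> ep = v"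
proof -
  have epH: "ep \<in> group_algebra (G\<lparr>carrier := HH\<rparr>)" by (simp add: group_algebra_def ep_eq)
  have "v \<odot> ep = (\<lambda>x. \<Sum>h\<in>HH. ep h * (v \<odot> sg h) x)" by (rule HS.ga_mult_sum_H[OF epH])
  also have "\<dots> = (\<lambda>x. \<Sum>h\<in>HH. v x / of_nat (card HH))"
  proof (rule ext, rule sum.cong[OF refl])
    fix x h assume h: "h \<in> HH"
    have "psi0 (ginv h) * psi0 h = 1"
      using psi0_mult[OF HS.H_inv[OF h] h] psi0_one HS.H_sub[OF h] by simp
    then show "ep h * (v \<odot> sg h) x = v x / of_nat (card HH)"
      using h by (simp add: e ep_eq field_simps)
  qed
  also have "\<dots> = v" using card_HH_nz by simp
  finally show ?thesis .
qed

text \<open>In the coefficient at the identity only \<open>h\<close> in \<open>HH\<close>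
  contribute, and there \<open>psi0 h\<close> cancels the conjugate character value in
  \<open>[A]\<close>; all terms are equal and positive.\<close>

lemma lid_ep_nz: "lid Phi A \<odot> ep \<noteq> (\<lambda>_. 0)"
proof
  assume "lid Phi A \<odot> ep = (\<lambda>_. 0)"
  then have "(lid Phi A \<odot> ep) \<one>\<^bsub>G\<^esub> = 0" by simp
  moreover have "(lid Phi A \<odot> ep) \<one>\<^bsub>G\<^esub> = (\<Sum>h\<in>carrier G. lid Phi A h * ep (ginv h))"
    by (simp add: ga_mult_def)
  moreover have "\<dots> = (\<Sum>h\<in>HH. 1 / (of_nat q ^ card Phi * of_nat (card HH)))"
  proof (rule sum.mono_neutral_cong_right)
    show "finite (carrier G)" by (rule G.fin_G)
    show "HH \<subseteq> carrier G" using HS.H_sub by auto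
    have "ginv h \<notin> HH" if "h \<in> carrier G - HH" for h
      using that HS.H_inv[of "ginv h"] by auto
    then show "\<forall>h\<in>carrier G - HH. lid Phi A h * ep (ginv h) = 0" by (simp add: ep_eq)
    fix h assume h: "h \<in> HH"
    have "cnj (ch A (h -\<^sub>R E)) * ch A (h -\<^sub>R E) = 1"
      by (rule th_cnj) (use A_MM HH_MM[OF h] pair_closed in auto)
    then show "lid Phi A h * ep (ginv h) = 1 / (of_nat q ^ card Phi * of_nat (card HH))"
      using h HS.H_inv[OF h] HS.H_sub[OF h] HH_U[OF h] by (simp add: ep_eq lidem_eq[OF A_VS] psi0_def)
  qed
  ultimately show False using q_nz card_HH_nz by simp
qed

subsection \<open>The induced module\<close>

text \<open>Right multiplication by \<open>HH\<close> only scales \<open>ep\<close> when it is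
  applied first, so one translate for each right coset of \<open>HH\<close> suffices. The matching
  lower bound comes from the size of an orbit.\<close>

lemma rid_ep_span: "\<exists>S. finite S \<and> card S \<le> q ^ card (Phi - Rh) \<and> UU.rid ep = cfun.span S"
proof -
  let ?K = "G\<lparr>carrier := US F n Phi\<rparr>"
  interpret K: fin_group ?K by (rule UU.fin_group_GH)
  have sub: "subgroup HH ?K" by (rule G.subgroup_incl[OF HS.subgroup_H UU.subgroup_H]) (use HH_U in auto)
  define S where "S = (\<lambda>X. ep \<odot> sg (SOME u. u \<in> X)) ` (rcosets\<^bsub>?K\<^esub> HH)"
  have fin: "finite (rcosets\<^bsub>?K\<^esub> HH)"
    unfolding RCOSETS_def using finite_US by simp
  have "card (rcosets\<^bsub>?K\<^esub> HH) * card HH = Coset.order ?K" by (rule K.lagrange[OF sub])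
  then have "card (rcosets\<^bsub>?K\<^esub> HH) * q ^ card Rh = q ^ card Phi"
    using card_US[OF Rh_Phi] card_US[OF subset_refl] by (simp add: Coset.order_def HH_def)
  also have "card Phi = card (Phi - Rh) + card Rh"
    using card_Diff_subset[OF finite_sub_Phi[OF Rh_Phi] Rh_Phi] card_mono[OF finite_Phi Rh_Phi] by simp
  finally have cr: "card (rcosets\<^bsub>?K\<^esub> HH) = q ^ card (Phi - Rh)" using q_ge2 by (simp add: power_add)
  have "UU.rid ep = cfun.span S"
  proof
    have "ep \<odot> sg u \<in> cfun.span S" if u: "u \<in> US F n Phi" for u
    proof -
      let ?X = "HH #>\<^bsub>?K\<^esub> u"
      have X: "?X \<in> rcosets\<^bsub>?K\<^esub> HH" using u by (auto simp: RCOSETS_def)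
      have "u \<in> ?X" using HS.H_one UU.H_sub[OF u] by (auto simp: r_coset_def intro!: bexI[of _ "\<one>\<^bsub>G\<^esub>"])
      then have "(SOME v. v \<in> ?X) \<in> ?X" using someI[of "\<lambda>v. v \<in> ?X" u] by blast
      then obtain h where h: "h \<in> HH" "(SOME v. v \<in> ?X) = h \<bullet> u" by (auto simp: r_coset_def)
      have "ep \<odot> sg (h \<bullet> u) = ep \<odot> sg h \<odot> sg u"
        using HS.H_sub[OF h(1)] UU.H_sub[OF u] by (simp add: G.ga_mult_assoc G.ga_mult_single)
      also have "\<dots> = (\<lambda>x. psi0 h * (ep \<odot> sg u) x)" by (simp add: ep_right[OF h(1)] G.ga_mult_scale_left)
      finally have e: "(\<lambda>x. psi0 h * (ep \<odot> sg u) x) \<in> S" unfolding S_def using X h(2) by force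
      have "(\<lambda>x. inverse (psi0 h) * (psi0 h * (ep \<odot> sg u) x)) \<in> cfun.span S"
        using cfun.span_scale[OF cfun.span_base[OF e]] .
      then show ?thesis using psi0_nz[OF h(1)] by (simp add: mult.assoc[symmetric])
    qed
    then have "ep \<odot> a \<in> cfun.span S" if "a \<in> CU" for a
      unfolding UU.ga_mult_sum_H[OF that] by (rule csubspace_comb[OF cfun.subspace_span])
    then show "UU.rid ep \<subseteq> cfun.span S" by (auto simp: UU.rid_def)
    have "S \<subseteq> UU.rid ep"
    proof (clarsimp simp: S_def)
      fix X assume "X \<in> rcosets\<^bsub>?K\<^esub> HH"
      then obtain u where u: "u \<in> US F n Phi" "X = HH #>\<^bsub>?K\<^esub> u" by (auto simp: RCOSETS_def)
      have "u \<in> X" using u HS.H_one UU.H_sub[OF u(1)] by (auto simp: r_coset_def intro!: bexI[of _ "\<one>\<^bsub>G\<^esub>"])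
      then have "(SOME v. v \<in> X) \<in> X" using someI[of "\<lambda>v. v \<in> X" u] by blast
      then have "(SOME v. v \<in> X) \<in> US F n Phi" using u HH_U UU.H_closed by (auto simp: r_coset_def)
      then show "ep \<odot> sg (SOME v. v \<in> X) \<in> UU.rid ep" by (auto simp: UU.rid_def UU.single_GH)
    qed
    then show "cfun.span S \<subseteq> UU.rid ep" by (rule cfun.span_minimal[OF _ UU.rid_subspace])
  qed
  moreover have "finite S" "card S \<le> q ^ card (Phi - Rh)"
    using fin card_image_le[OF fin] cr by (auto simp: S_def)
  ultimately show ?thesis by blast
qed

text \<open>\<open>hook_mod\<close> multiplies inside \<open>CU\<close>, the tableau modules inside
  \<open>CGL\<close>; on \<open>CU\<close> the two products agree.\<close>

lemma hook_mod_iso: "mod_iso (U F n) (UM (UU.rid (lid Phi A \<odot> ep))) (hook_mod F \<theta> n A)"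
proof -
  let ?K = "G\<lparr>carrier := US F n Phi\<rparr>"
  have LA: "lid Phi A \<in> CU" by (rule lid_CU[OF subset_refl])
  have x: "ga_mult ?K (lid Phi A) ep = lid Phi A \<odot> ep" by (rule UU.ga_mult_sub_eq[OF LA ep_CU])
  have xc: "lid Phi A \<odot> ep \<in> CU" by (intro CU_mult LA ep_CU)
  show ?thesis unfolding U_eq
  proof (rule mod_iso_same[OF UU.rid_module])
    show "mspace (hook_mod F \<theta> n A) = mspace (UM (UU.rid (lid Phi A \<odot> ep)))"
      by (auto simp: hook_mod_def cyclic_mod_def U_eq ep_def[symmetric] x UU.rid_def UU.ga_mult_sub_eq[OF xc] image_def)
    fix v a assume v: "v \<in> mspace (UM (UU.rid (lid Phi A \<odot> ep)))" and a: "a \<in> CU"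
    have "v \<in> CU" using v CU_mult[OF xc] by (auto simp: UU.rid_def)
    then show "mact (hook_mod F \<theta> n A) v a = mact (UM (UU.rid (lid Phi A \<odot> ep))) v a"
      using UU.ga_mult_sub_eq a by (simp add: hook_mod_def cyclic_mod_def U_eq)
  qed (use UU.H_one in simp)
qed

text \<open>\<open>\<epsilon> \<complex>U\<close> maps onto \<open>M\<close> by \<open>\<epsilon> \<mapsto> v\<close> and has dimension at most \<open>|U : HH|\<close>, so the dimension bound makes
  this map bijective; then \<open>\<epsilon> \<complex>U\<close> is irreducible and maps isomorphically onto \<open>[A] \<epsilon> \<complex>U \<noteq> 0\<close>.\<close>

lemma eigenvector_iso:
  assumes M: "cfun.subspace M" "M \<subseteq> group_algebra G"
    and cl: "\<And>v a. v \<in> M ==> a \<in> CU ==> v \<odot> a \<in> M"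
    and irr: "\<And>W. cfun.subspace W ==> W \<subseteq> M ==> (\<And>v a. v \<in> W ==> a \<in> CU ==> v \<odot> a \<in> W) ==> W \<noteq> {\<lambda>_. 0} ==> W = M"
    and v: "v \<in> M" "v \<noteq> (\<lambda>_. 0)" "v \<odot> ep = v"
    and dim: "q ^ card (Phi - Rh) \<le> cfun.dim M"
  shows "mod_iso (U F n) (hook_mod F \<theta> n A) (UM M)" "cfun.dim M = q ^ card (Phi - Rh)"
proof -
  have rid_M: "UU.rid w = M" if w: "w \<in> M" "w \<noteq> (\<lambda>_. 0)" for w
  proof (rule irr)
    show "cfun.subspace (UU.rid w)" by (rule UU.rid_subspace)
    show "UU.rid w \<subseteq> M" using cl w by (auto simp: UU.rid_def)
    show "UU.rid w \<noteq> {\<lambda>_. 0}" using UU.rid_self[of w] w M by auto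
  qed (rule UU.rid_closed)
  obtain S where S: "finite S" "card S \<le> q ^ card (Phi - Rh)" "UU.rid ep = cfun.span S" using rid_ep_span by blast
  have im: "(\<lambda>a. v \<odot> a) ` cfun.span S = M"
  proof -
    have "(\<lambda>a. v \<odot> a) ` UU.rid ep = UU.rid v"
      by (auto simp: UU.rid_def image_image G.ga_mult_assoc[symmetric] v(3))
    then show ?thesis using S(3) rid_M[OF v(1,2)] by simp
  qed
  have d: "card S \<le> cfun.dim ((\<lambda>a. v \<odot> a) ` cfun.span S)" using im S dim by simp
  note inj = inj_on_span_if_dim[OF G.ga_mult_linear_right S(1) d]
  show "cfun.dim M = q ^ card (Phi - Rh)" using inj(2) im S(2) dim by simp
  have inj': "inj_on (\<lambda>a. v \<odot> a) (UU.rid ep)" using inj(1) S(3) by simp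
  have ep_alg: "ep \<in> group_algebra G" by (rule UU.alg_sub[OF ep_CU])
  have e1: "v \<odot> a = (\<lambda>_. 0) \<longleftrightarrow> ep \<odot> a = (\<lambda>_. 0)" if a: "a \<in> CU" for a
  proof
    assume "ep \<odot> a = (\<lambda>_. 0)"
    then have "v \<odot> (ep \<odot> a) = (\<lambda>_. 0)" by (simp add: G.ga_mult_zero_right)
    then show "v \<odot> a = (\<lambda>_. 0)" by (simp add: G.ga_mult_assoc[symmetric] v(3))
  next
    assume "v \<odot> a = (\<lambda>_. 0)"
    then have "v \<odot> (ep \<odot> a) = v \<odot> (\<lambda>_. 0)" by (simp add: G.ga_mult_assoc[symmetric] v(3) G.ga_mult_zero_right)
    moreover have "ep \<odot> a \<in> UU.rid ep" using a by (auto simp: UU.rid_def)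
    ultimately show "ep \<odot> a = (\<lambda>_. 0)" using inj' csubspaceD(1)[OF UU.rid_subspace] by (metis inj_onD)
  qed
  have e2: "lid Phi A \<odot> ep \<odot> a = (\<lambda>_. 0) \<longleftrightarrow> v \<odot> a = (\<lambda>_. 0)" if a: "a \<in> CU" for a
  proof
    assume "v \<odot> a = (\<lambda>_. 0)"
    then show "lid Phi A \<odot> ep \<odot> a = (\<lambda>_. 0)" using e1[OF a] by (simp add: G.ga_mult_assoc G.ga_mult_zero_right)
  next
    assume z: "lid Phi A \<odot> ep \<odot> a = (\<lambda>_. 0)"
    \<comment> \<open>If \<open>v a\<close> were nonzero, irreducibility would give \<open>b\<close>
      with \<open>v a b = v\<close>. Injectivity turns this into \<open>ep a b = ep\<close>, and
      then the assumption \<open>z\<close> would annihilate \<open>[A] ep\<close> itself.\<close>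
    show "v \<odot> a = (\<lambda>_. 0)"
    proof (rule ccontr)
      assume "v \<odot> a \<noteq> (\<lambda>_. 0)"
      then have "UU.rid (v \<odot> a) = M" using rid_M cl[OF v(1) a] by blast
      then obtain b where b: "b \<in> CU" "v = v \<odot> a \<odot> b" using v(1) by (auto simp: UU.rid_def)
      have "v \<odot> ep = v \<odot> (ep \<odot> (a \<odot> b))"
        using b(2) by (simp add: G.ga_mult_assoc[symmetric] v(3))
      moreover have "ep \<in> UU.rid ep" by (rule UU.rid_self[OF ep_alg])
      moreover have "ep \<odot> (a \<odot> b) \<in> UU.rid ep" using CU_mult[OF a b(1)] by (auto simp: UU.rid_def)
      ultimately have "ep = ep \<odot> (a \<odot> b)" using inj' by (metis inj_onD)
      then have "lid Phi A \<odot> ep = lid Phi A \<odot> ep \<odot> a \<odot> b" by (simp add: G.ga_mult_assoc)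
      then show False using z lid_ep_nz by (simp add: G.ga_mult_zero_left)
    qed
  qed
  have "mod_iso (U F n) (UM (UU.rid (lid Phi A \<odot> ep))) (UM (UU.rid v))"
    unfolding U_eq by (rule UU.rid_iso[OF e2])
  then show "mod_iso (U F n) (hook_mod F \<theta> n A) (UM M)"
    using rid_M[OF v(1,2)] mod_iso_trans[OF mod_iso_sym[OF hook_mod_iso]] by simp
qed

end

lemma (in fchar) hook_mod_inj:
  assumes "hook F n \<theta> A" "hook F n \<theta> B" and iso: "mod_iso (U F n) (hook_mod F \<theta> n A) (hook_mod F \<theta> n B)"
  shows "A = B"
proof -
  interpret a: hook F n \<theta> A by fact
  interpret b: hook F n \<theta> B by fact
  show ?thesis
    by (rule lid_separates[OF a.A_VS a.A_verge b.A_VS b.A_verge a.ep_CU b.ep_CU a.lid_ep_nz])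
      (rule mod_iso_trans[OF mod_iso_trans[OF a.hook_mod_iso iso] mod_iso_sym[OF b.hook_mod_iso]])
qed

section \<open>The modules of a tableau\<close>

lemma (in fin_group) closed_subgroupI:
  assumes "S \<subseteq> carrier G" "S \<noteq> {}" "\<And>x y. x \<in> S ==> y \<in> S ==> x \<otimes> y \<in> S"
  shows "subgroup S G"
proof (rule subgroupI)
  fix x assume x: "x \<in> S"
  have fin: "finite S" by (rule finite_subset[OF assms(1) fin_G])
  have "inj_on (\<lambda>y. x \<otimes> y) S" using assms(1) x by (intro inj_onI) (metis Units_l_cancel Units_eq subsetD)
  then have img: "(\<lambda>y. x \<otimes> y) ` S = S" using assms(3) x by (intro endo_inj_surj[OF fin]) auto
  then obtain e where e: "e \<in> S" "x \<otimes> e = x" using x by (metis imageE)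
  then have "e = \<one>" using assms(1) x by (metis l_cancel_one subsetD)
  then obtain y where "y \<in> S" "x \<otimes> y = \<one>" using img e by (metis imageE)
  then show "inv x \<in> S" using assms(1) x by (metis inv_equality inv_comm subsetD)
qed (use assms in auto)

context fmat
begin

definition PP :: "nat => 'f matrix set" where "PP m = P_lam F n m"

lemma PP_iff: "g \<in> PP m \<longleftrightarrow> g \<in> carrier G \<and> (\<forall>a\<in>N. \<forall>b\<in>N. n - m < a \<longrightarrow> b \<le> n - m \<longrightarrow> g (a, b) = \<zero>)"
  by (auto simp: PP_def P_lam_def)

lemma PP_subgroup: "subgroup (PP m) G"
proof (rule G.closed_subgroupI)
  show "PP m \<subseteq> carrier G" by (auto simp: PP_iff)
  have "\<one>\<^bsub>G\<^esub> \<in> PP m" by (auto simp: PP_iff G_one one_entry simp del: G.one_closed) (metis G.one_closed G_one)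
  then show "PP m \<noteq> {}" by blast
  fix x y assume x: "x \<in> PP m" and y: "y \<in> PP m"
  have xG: "x \<in> carrier G" "y \<in> carrier G" using x y by (auto simp: PP_iff)
  show "x \<bullet> y \<in> PP m" unfolding PP_iff
  proof (intro conjI ballI impI)
    fix a b assume ab: "a \<in> N" "b \<in> N" "n - m < a" "b \<le> n - m"
    show "(x \<bullet> y) (a, b) = \<zero>" unfolding mult_entry[OF ab(1,2)]
    proof (rule fs_zero)
      fix k assume k: "k \<in> N"
      show "x (a, k) \<otimes> y (k, b) = \<zero>"
      proof (cases "k \<le> n - m")
        case True then have "x (a, k) = \<zero>" using x ab k by (auto simp: PP_iff)
        then show ?thesis using MM_entry[OF G_MM[OF xG(2)] k ab(2)] by simp
      next
        case False then have "y (k, b) = \<zero>" using y ab k by (auto simp: PP_iff)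
        then show ?thesis using MM_entry[OF G_MM[OF xG(1)] ab(1) k] by simp
      qed
    qed
  qed (use xG in auto)
qed

end

section \<open>Cosets of the parabolic subgroup attached to a tableau\<close>

locale tab = fchar F n \<theta> for F :: "'f ring" (structure) and n and \<theta> + 
  fixes s :: tableau and m :: nat
  assumes s_RStd: "s \<in> RStd n m"
begin

definition "I = second_row s"
text \<open>The permutation behind the matrix \<open>d\<close>. Matrix rows count from 1, list
  positions from 0.\<close>

definition sq :: "nat => nat" where "sq a = (fst s @ snd s) ! (a - 1)"
definition "d = tab_perm F n s"
definition "P = PP m"
definition "J = J_set n s"
definition "L = L_set n s"
definition "Pd = P_bar_d F n s"
definition "eb B = e_lidem F \<theta> n s B"

lemma s_facts: "length (fst s) = n - m" "length (snd s) = m" "distinct (fst s @ snd s)" "set (fst s @ snd s) = N"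
  "length (fst s @ snd s) = n"
proof -
  show *: "length (fst s) = n - m" "length (snd s) = m" "distinct (fst s @ snd s)" "set (fst s @ snd s) = N"
    using s_RStd by (auto simp: RStd_def split: prod.splits)
  show "length (fst s @ snd s) = n" using distinct_card[OF *(3)] *(4) by simp
qed

lemma m_le: "m \<le> n" using s_facts by simp

lemma sq_N: "a \<in> N ==> sq a \<in> N"
proof -
  assume a: "a \<in> N"
  then have "a - 1 < length (fst s @ snd s)" using s_facts(5) by auto
  then show "sq a \<in> N" using nth_mem[of "a - 1" "fst s @ snd s"] s_facts(4) by (simp only: sq_def)
qed

lemma sq_inj: "a \<in> N ==> b \<in> N ==> sq a = sq b ==> a = b"
proof -
  assume ab: "a \<in> N" "b \<in> N" "sq a = sq b"
  have "a - 1 < length (fst s @ snd s)" "b - 1 < length (fst s @ snd s)" using ab s_facts(5) by auto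
  then have "a - 1 = b - 1" using nth_eq_iff_index_eq[OF s_facts(3)] ab(3) unfolding sq_def by blast
  then show "a = b" using ab by auto
qed

lemma sq_surj: "sq ` N = N"
proof (rule endo_inj_surj)
  show "sq ` N \<subseteq> N" using sq_N by blast
  show "inj_on sq N" by (rule inj_onI) (rule sq_inj)
qed simp

lemma sq_I: "a \<in> N ==> sq a \<in> I \<longleftrightarrow> n - m < a"
proof -
  assume a: "a \<in> N"
  show ?thesis
  proof (cases "n - m < a")
    case True
    then have "sq a = snd s ! (a - 1 - (n - m))" using s_facts(1) by (auto simp: sq_def nth_append)
    moreover have "a - 1 - (n - m) < length (snd s)" using True a s_facts(2) by auto
    ultimately show ?thesis using True by (simp add: I_def second_row_def)
  next
    case False
    then have *: "sq a = fst s ! (a - 1)" "a - 1 < length (fst s)" using s_facts(1) a by (auto simp: sq_def nth_append)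
    then have "sq a \<in> set (fst s)" by simp
    then show ?thesis using False s_facts(3) by (auto simp: I_def second_row_def)
  qed
qed

lemma I_N: "I \<subseteq> N" using s_facts(4) by (auto simp: I_def second_row_def)

lemma J_iff: "(i, j) \<in> J \<longleftrightarrow> (i, j) \<in> Phi \<and> i \<in> I \<and> j \<notin> I" by (simp add: J_def J_set_def I_def)
lemma L_iff: "(i, j) \<in> L \<longleftrightarrow> (i, j) \<in> Phi \<and> (i \<in> I \<longleftrightarrow> j \<in> I)" by (simp add: L_def L_set_def I_def)
lemma J_Phi: "J \<subseteq> Phi" by (auto simp: J_iff)
lemma L_Phi: "L \<subseteq> Phi" by (auto simp: L_iff)
lemma J_NN: "J \<subseteq> N \<times> N" using J_Phi Phi_NN by blast

abbreviation "Qp \<equiv> Phi - J"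
abbreviation "UQ \<equiv> US F n Qp"
abbreviation "UJ \<equiv> US F n J"
abbreviation "UL \<equiv> US F n L"
abbreviation "UK \<equiv> US F n (J \<union> L)"
abbreviation "VJ \<equiv> VS F n J"

lemma closed_J: "closed_pat J" by (auto simp: closed_pat_def J_iff Phi_iff)
lemma closed_L: "closed_pat L" by (auto simp: closed_pat_def L_iff Phi_iff)
lemma closed_Q: "closed_pat Qp" by (auto simp: closed_pat_def J_iff Phi_iff)
lemma L_Q: "L \<subseteq> Qp" by (auto simp: J_iff L_iff)

sublocale SJ: subgroup_alg G UJ by (rule subgroup_US[OF closed_J])
sublocale SL: subgroup_alg G UL by (rule subgroup_US[OF closed_L])
sublocale SQ: subgroup_alg G UQ by (rule subgroup_US[OF closed_Q])
sublocale SP: subgroup_alg G P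
  unfolding P_def by (intro subgroup_alg.intro subgroup_alg_axioms.intro PP_subgroup G.fin_group_axioms)

lemma UJ_U: "u \<in> UJ ==> u \<in> US F n Phi" using US_sub_Phi J_Phi by blast
lemma UL_U: "u \<in> UL ==> u \<in> US F n Phi" using US_sub_Phi L_Phi by blast
lemma UQ_U: "u \<in> UQ ==> u \<in> US F n Phi" by (rule US_sub_Phi[rotated]) auto
lemma UL_UQ: "u \<in> UL ==> u \<in> UQ" using US_mono[OF L_Q] by blast

lemma d_MM: "d \<in> MM" unfolding d_def tab_perm_def by (auto simp: case_prod_unfold intro!: MM_restrict)
lemma d_entry: "a \<in> N ==> b \<in> N ==> d (a, b) = (if b = sq a then \<one> else \<zero>)" by (simp add: d_def tab_perm_def sq_def)

lemma d_mult: assumes "x \<in> MM" "a \<in> N" "j \<in> N" shows "(d ** x) (a, j) = x (sq a, j)"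
proof -
  have "(\<Oplus>k\<in>N. d (a, k) \<otimes> x (k, j)) = d (a, sq a) \<otimes> x (sq a, j)"
    by (rule fs_single) (use assms sq_N[OF assms(2)] MM_entry in \<open>auto simp: d_entry\<close>)
  then show ?thesis using assms sq_N[OF assms(2)] MM_entry[OF assms(1)] by (simp add: mult_entry' d_entry)
qed

lemma mult_trd: assumes "x \<in> MM" "i \<in> N" "b \<in> N" shows "(x ** tr d) (i, b) = x (i, sq b)"
proof -
  have "(\<Oplus>k\<in>N. x (i, k) \<otimes> tr d (k, b)) = x (i, sq b) \<otimes> tr d (sq b, b)"
    by (rule fs_single) (use assms sq_N[OF assms(3)] MM_entry in \<open>auto simp: d_entry tr_entry\<close>)
  then show ?thesis using assms sq_N[OF assms(3)] MM_entry[OF assms(1)] by (simp add: mult_entry' d_entry tr_entry)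
qed

lemma d_trd: "d ** tr d = E"
proof (rule mat_eqI)
  fix a b assume ab: "a \<in> N" "b \<in> N"
  have "sq b = sq a \<longleftrightarrow> a = b" using sq_inj[OF ab] by auto
  then show "(d ** tr d) (a, b) = E (a, b)"
    using mult_trd[OF d_MM ab] d_entry[OF ab(1) sq_N[OF ab(2)]] one_entry[OF ab] by simp
qed (use d_MM tr_MM in auto)

lemma trd_d: "tr d ** d = E"
proof (rule mat_eqI)
  fix i j assume ij: "i \<in> N" "j \<in> N"
  obtain a where a: "a \<in> N" "sq a = i" using sq_surj ij by (metis imageE)
  have "(\<Oplus>k\<in>N. tr d (i, k) \<otimes> d (k, j)) = tr d (i, a) \<otimes> d (a, j)"
  proof (rule fs_single)
    fix k assume k: "k \<in> N" "k \<noteq> a"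
    have "sq k \<noteq> i" using sq_inj[OF k(1) a(1)] k(2) unfolding a(2)[symmetric] by blast
    then show "tr d (i, k) \<otimes> d (k, j) = \<zero>"
      using d_entry[OF k(1) ij(1)] tr_entry[OF ij(1) k(1), of d] MM_entry[OF d_MM k(1) ij(2)] by auto
  qed (use a MM_entry[OF d_MM a(1) ij(2)] MM_entry[OF tr_MM[OF d_MM] ij(1) a(1)] in auto)
  then show "(tr d ** d) (i, j) = E (i, j)" using ij a by (simp add: mult_entry' d_entry tr_entry one_entry)
qed (use d_MM tr_MM in auto)

lemma d_G: "d \<in> carrier G" unfolding G_carrier Units_def using d_MM tr_MM d_trd trd_d by blast
lemma d_inv: "ginv d = tr d"
proof (rule G.inv_equality)
  show "tr d \<in> carrier G" unfolding G_carrier Units_def using d_MM tr_MM d_trd trd_d by blast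
  show "tr d \<bullet> d = \<one>\<^bsub>G\<^esub>" by (simp only: G_mult G_one trd_d)
qed (rule d_G)

text \<open>Conjugation by \<open>d\<close> renames indices by \<open>sq\<close>, which carries the
  last \<open>m\<close> positions to the second row of the tableau (\<open>sq_I\<close>).\<close>

lemma conj_P: assumes x: "x \<in> carrier G"
  shows "d \<bullet> x \<bullet> ginv d \<in> P \<longleftrightarrow> (\<forall>i\<in>I. \<forall>j\<in>N - I. x (i, j) = \<zero>)"
proof -
  have xm: "x \<in> MM" by (rule G_MM[OF x])
  have e: "(d \<bullet> x \<bullet> ginv d) (a, b) = x (sq a, sq b)" if "a \<in> N" "b \<in> N" for a b
    using mult_trd[OF R_mult_closed[OF d_MM xm] that] d_mult[OF xm that(1) sq_N[OF that(2)]] by (simp only: G_mult d_inv)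
  have "d \<bullet> x \<bullet> ginv d \<in> P \<longleftrightarrow> (\<forall>a\<in>N. \<forall>b\<in>N. sq a \<in> I \<longrightarrow> sq b \<notin> I \<longrightarrow> x (sq a, sq b) = \<zero>)"
  proof -
    have "d \<bullet> x \<bullet> ginv d \<in> carrier G" using x d_G by simp
    then have "d \<bullet> x \<bullet> ginv d \<in> P \<longleftrightarrow> (\<forall>a\<in>N. \<forall>b\<in>N. n - m < a \<longrightarrow> b \<le> n - m \<longrightarrow> (d \<bullet> x \<bullet> ginv d) (a, b) = \<zero>)"
      unfolding P_def PP_iff by blast
    also have "\<dots> \<longleftrightarrow> (\<forall>a\<in>N. \<forall>b\<in>N. sq a \<in> I \<longrightarrow> sq b \<notin> I \<longrightarrow> x (sq a, sq b) = \<zero>)"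
      by (intro ball_cong refl) (simp only: e sq_I not_less)
    finally show ?thesis .
  qed
  also have "\<dots> \<longleftrightarrow> (\<forall>i\<in>sq ` N. \<forall>j\<in>sq ` N. i \<in> I \<longrightarrow> j \<notin> I \<longrightarrow> x (i, j) = \<zero>)" by blast
  finally show ?thesis using I_N unfolding sq_surj by blast
qed

text \<open>Lower triangular matrices vanish at the positions of \<open>I x (N - I)\<close> outside
  \<open>J\<close>, so only the entries at \<open>J\<close> are tested. Thus \<open>UQ\<close> is
  the stabilizer in \<open>U\<close> of the coset \<open>P d\<close>.\<close>

lemma conj_P_U: assumes u: "u \<in> US F n Phi"
  shows "d \<bullet> u \<bullet> ginv d \<in> P \<longleftrightarrow> u \<in> UQ"
proof -
  have "u \<in> UQ \<longleftrightarrow> (\<forall>i\<in>N. \<forall>j\<in>N. (i, j) \<in> J \<longrightarrow> u (i, j) = \<zero>)"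
  proof
    assume uQ: "u \<in> UQ"
    show "\<forall>i\<in>N. \<forall>j\<in>N. (i, j) \<in> J \<longrightarrow> u (i, j) = \<zero>"
    proof (intro ballI impI)
      fix i j assume "i \<in> N" "j \<in> N" "(i, j) \<in> J"
      moreover then have "i \<noteq> j" by (auto simp: J_iff Phi_iff)
      ultimately show "u (i, j) = \<zero>" using US_zero[OF Diff_subset uQ] by blast
    qed
  next
    assume a: "\<forall>i\<in>N. \<forall>j\<in>N. (i, j) \<in> J \<longrightarrow> u (i, j) = \<zero>"
    show "u \<in> UQ" unfolding US_iff[of Qp, OF Diff_subset]
      using a US_MM[OF u] US_diag[OF subset_refl u] US_zero[OF subset_refl u] by blast
  qed
  also have "\<dots> \<longleftrightarrow> (\<forall>i\<in>I. \<forall>j\<in>N - I. u (i, j) = \<zero>)"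
  proof
    assume a: "\<forall>i\<in>N. \<forall>j\<in>N. (i, j) \<in> J \<longrightarrow> u (i, j) = \<zero>"
    show "\<forall>i\<in>I. \<forall>j\<in>N - I. u (i, j) = \<zero>"
    proof (intro ballI)
      fix i j assume ij: "i \<in> I" "j \<in> N - I"
      show "u (i, j) = \<zero>"
      proof (cases "(i, j) \<in> Phi")
        case True then show ?thesis using a ij I_N by (auto simp: J_iff)
      next
        case False then show ?thesis using US_zero[OF subset_refl u, of i j] ij I_N by blast
      qed
    qed
  qed (auto simp: J_iff)
  finally show ?thesis using conj_P[OF UU.H_sub[OF u]] by blast
qed

lemma Pd_eq: "Pd = (\<lambda>x. if x \<in> carrier G \<and> x \<bullet> ginv d \<in> P then 1 else 0)"
  unfolding Pd_def P_bar_d_def s_facts(2) d_def[symmetric] G.rt_eq[OF d_G] by (auto simp: P_bar_def P_def PP_def)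

lemma Pd_Q: assumes w: "w \<in> UQ" shows "Pd \<odot> sg w = Pd"
proof (rule ext)
  fix x
  have wG: "w \<in> carrier G" by (rule SQ.H_sub[OF w])
  show "(Pd \<odot> sg w) x = Pd x"
  proof (cases "x \<in> carrier G")
    case True
    have p: "d \<bullet> w \<bullet> ginv d \<in> P" using w conj_P_U[OF UQ_U[OF w]] by simp
    let ?y = "x \<bullet> ginv w \<bullet> ginv d"
    have e: "x \<bullet> ginv d = ?y \<bullet> (d \<bullet> w \<bullet> ginv d)"
    proof -
      have ww: "ginv w \<bullet> (w \<bullet> ginv d) = ginv d" using wG d_G by (simp add: G.m_assoc[symmetric])
      have "?y \<bullet> (d \<bullet> w \<bullet> ginv d) = x \<bullet> ginv w \<bullet> (ginv d \<bullet> d) \<bullet> (w \<bullet> ginv d)"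
        using True wG d_G by (simp only: G.m_assoc G.m_closed G.inv_closed)
      also have "\<dots> = x \<bullet> ginv d" using True wG d_G ww by (simp add: G.m_assoc)
      finally show ?thesis by simp
    qed
    have yG: "?y \<in> carrier G" using True wG d_G by simp
    have "?y \<in> P \<longleftrightarrow> x \<bullet> ginv d \<in> P"
    proof
      assume "?y \<in> P" then show "x \<bullet> ginv d \<in> P" unfolding e using p by (rule SP.H_closed)
    next
      assume "x \<bullet> ginv d \<in> P"
      then have "?y \<bullet> (d \<bullet> w \<bullet> ginv d) \<bullet> ginv (d \<bullet> w \<bullet> ginv d) \<in> P"
        unfolding e using SP.H_closed SP.H_inv[OF p] by blast
      then show "?y \<in> P" using yG SP.H_sub[OF p] by (simp only: G.m_assoc G.r_inv G.r_one G.inv_closed)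
    qed
    then show ?thesis using True wG by (simp add: G.rt_eq Pd_eq)
  qed (simp add: G.rt_eq wG Pd_eq)
qed

text \<open>In the rows of \<open>I\<close>, \<open>u g^-1\<close> agrees with
  \<open>g g^-1 = E\<close>, so its block \<open>I x (N - I)\<close> vanishes. Cosets of
  \<open>UQ\<close> can thus be identified by looking at the rows in \<open>I\<close>.\<close>

lemma same_rows_Q:
  assumes u: "u \<in> US F n Phi" and g: "g \<in> US F n Phi" and eq: "\<And>i j. i \<in> I ==> j \<in> N ==> u (i, j) = g (i, j)"
  shows "\<exists>w\<in>UQ. u = w \<bullet> g"
proof (intro bexI)
  let ?w = "u \<bullet> ginv g"
  have gi: "ginv g \<in> US F n Phi" by (rule UU.H_inv[OF g])
  show "u = ?w \<bullet> g" using UU.H_sub[OF u] UU.H_sub[OF g] by (simp add: G.m_assoc)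
  have wU: "?w \<in> US F n Phi" by (intro UU.H_closed u gi)
  have "?w (i, j) = \<zero>" if ij: "i \<in> I" "j \<in> N - I" for i j
  proof -
    have "?w (i, j) = (g ** ginv g) (i, j)" unfolding G_mult
      by (rule row_cong) (use ij eq I_N US_MM[OF g] US_MM[OF gi] in auto)
    also have "\<dots> = E (i, j)" using G.r_inv[OF UU.H_sub[OF g]] by (simp add: G_mult G_one)
    finally show ?thesis using ij I_N by (auto simp: one_entry)
  qed
  then show "?w \<in> UQ" using conj_P_U[OF wU] conj_P[OF UU.H_sub[OF wU]] by blast
qed

lemma VJ_zero: "X \<in> VJ ==> i \<in> N ==> j \<in> N ==> i \<notin> I \<or> j \<in> I ==> X (i, j) = \<zero>"
  by (auto simp: VS_iff J_iff)

lemma UL_zero: "l \<in> UL ==> i \<in> N ==> j \<in> N ==> i \<in> I \<longleftrightarrow> j \<notin> I ==> l (i, j) = \<zero>"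
  by (rule US_zero[OF L_Phi]) (auto simp: L_iff)

lemma L_VJ_left: assumes l: "l \<in> UL" and X: "X \<in> VJ" shows "l ** X \<in> VJ"
  unfolding VS_iff
proof (intro conjI ballI impI)
  note m = US_MM[OF l] VS_MM[OF X]
  show "l ** X \<in> MM" using m by auto
  fix i j assume ij: "i \<in> N" "j \<in> N" "(i, j) \<notin> J"
  show "(l ** X) (i, j) = \<zero>" unfolding mult_entry'[OF ij(1,2)]
  proof (rule fs_zero)
    fix k assume k: "k \<in> N"
    have "l (i, k) = \<zero> \<or> X (k, j) = \<zero>"
    proof (cases "(k, j) \<in> J")
      case True
      have "(i, k) \<notin> L \<and> i \<noteq> k" using True ij by (auto simp: J_iff L_iff Phi_iff)
      then show ?thesis using US_zero[OF L_Phi l ij(1) k] by blast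
    qed (use X k ij in \<open>auto simp: VS_iff\<close>)
    then show "l (i, k) \<otimes> X (k, j) = \<zero>" using MM_entry[OF m(1) ij(1) k] MM_entry[OF m(2) k ij(2)] by auto
  qed
qed

lemma L_VJ_right: assumes l: "l \<in> UL" and X: "X \<in> VJ" shows "X ** l \<in> VJ"
  unfolding VS_iff
proof (intro conjI ballI impI)
  note m = US_MM[OF l] VS_MM[OF X]
  show "X ** l \<in> MM" using m by auto
  fix i j assume ij: "i \<in> N" "j \<in> N" "(i, j) \<notin> J"
  show "(X ** l) (i, j) = \<zero>" unfolding mult_entry'[OF ij(1,2)]
  proof (rule fs_zero)
    fix k assume k: "k \<in> N"
    have "X (i, k) = \<zero> \<or> l (k, j) = \<zero>"
    proof (cases "(i, k) \<in> J")
      case True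
      have "(k, j) \<notin> L \<and> k \<noteq> j" using True ij by (auto simp: J_iff L_iff Phi_iff)
      then show ?thesis using US_zero[OF L_Phi l k ij(2)] by blast
    qed (use X k ij in \<open>auto simp: VS_iff\<close>)
    then show "X (i, k) \<otimes> l (k, j) = \<zero>" using MM_entry[OF m(1) k ij(2)] MM_entry[OF m(2) ij(1) k] by auto
  qed
qed

text \<open>Nonzero rows of a matrix in \<open>VJ\<close> have index in \<open>I\<close> and nonzero
  columns have index outside, so no index links the two factors. Consequently \<open>UJ\<close>
  multiplies like the additive group \<open>VJ\<close>, and the \<open>ch B\<close> are its
  characters.\<close>

lemma VJ_VJ: assumes X: "X \<in> VJ" and Y: "Y \<in> VJ" shows "X ** Y = \<zero>\<^bsub>R\<^esub>"
proof (rule mat_eqI)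
  note m = VS_MM[OF X] VS_MM[OF Y]
  fix i j assume ij: "i \<in> N" "j \<in> N"
  have "(\<Oplus>k\<in>N. X (i, k) \<otimes> Y (k, j)) = \<zero>"
  proof (rule fs_zero)
    fix k assume k: "k \<in> N"
    have "X (i, k) = \<zero> \<or> Y (k, j) = \<zero>" using VJ_zero[OF X ij(1) k] VJ_zero[OF Y k ij(2)] by blast
    then show "X (i, k) \<otimes> Y (k, j) = \<zero>" using MM_entry[OF m(1) ij(1) k] MM_entry[OF m(2) k ij(2)] by auto
  qed
  then show "(X ** Y) (i, j) = \<zero>\<^bsub>R\<^esub> (i, j)" using ij by (simp add: mult_entry' zero_entry)
qed (use VS_MM[OF X] VS_MM[OF Y] in auto)

lemma UJ_mult: assumes u: "u \<in> UJ" and v: "v \<in> UJ"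
  shows "u ** v -\<^sub>R E = (u -\<^sub>R E) +\<^sub>R (v -\<^sub>R E)"
proof -
  let ?X = "u -\<^sub>R E" and ?Y = "v -\<^sub>R E"
  have X: "?X \<in> VJ" "?Y \<in> VJ" using US_minus[OF J_Phi] u v by auto
  note m = VS_MM[OF X(1)] VS_MM[OF X(2)]
  have "u ** v = (E +\<^sub>R ?X) ** (E +\<^sub>R ?Y)" using minus_plus[OF US_MM[OF u]] minus_plus[OF US_MM[OF v]] by simp
  also have "\<dots> = E +\<^sub>R (?X +\<^sub>R ?Y)"
    using m VJ_VJ[OF X] by (simp only: R.l_distr R.r_distr R.one_closed R.add.m_closed R.l_one R.r_one R_one_closed) (simp add: R.a_ac)
  finally show ?thesis using m by (simp add: plus_minus)
qed

text \<open>Removing the entries at \<open>J\<close> from \<open>g\<close> leaves \<open>l\<close>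
  in \<open>UL\<close>, and with \<open>Z\<close> for the removed part
  \<open>l^-1 g = E + l^-1 Z\<close>, which lies in \<open>UJ\<close> because \<open>UL\<close>
  preserves \<open>VJ\<close>.\<close>

lemma K_decomp: assumes g: "g \<in> UK" shows "\<exists>l\<in>UL. \<exists>v\<in>UJ. g = l \<bullet> v"
proof -
  have KP: "J \<union> L \<subseteq> Phi" using J_Phi L_Phi by auto
  note gm = US_MM[OF g]
  define Z where "Z = trunc J g"
  have Z: "Z \<in> VJ" unfolding Z_def by (rule trunc_VS[OF gm])
  define l where "l = g -\<^sub>R Z"
  have lm: "l \<in> MM" unfolding l_def using gm VS_MM[OF Z] by auto
  have l: "l \<in> UL" unfolding US_iff[OF L_Phi]
  proof (intro conjI ballI impI lm)
    fix i assume i: "i \<in> N"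
    then show "l (i, i) = \<one>" using US_diag[OF KP g i] gm VS_MM[OF Z] by (simp add: l_def minus_entry Z_def trunc_entry J_iff minus_eq)
  next
    fix i j assume ij: "i \<in> N" "j \<in> N" "i \<noteq> j" "(i, j) \<notin> L"
    show "l (i, j) = \<zero>"
    proof (cases "(i, j) \<in> J")
      case True then show ?thesis using ij gm VS_MM[OF Z] MM_entry[OF gm ij(1,2)] by (simp add: l_def minus_entry Z_def trunc_entry minus_eq r_neg)
    next
      case False then show ?thesis using US_zero[OF KP g ij(1-3)] ij gm VS_MM[OF Z] by (simp add: l_def minus_entry Z_def trunc_entry minus_eq)
    qed
  qed
  let ?li = "ginv l"
  have li: "?li \<in> UL" by (rule SL.H_inv[OF l])
  have g': "g = l +\<^sub>R Z" using gm VS_MM[OF Z] by (simp add: l_def a_minus_def R.a_assoc R.l_neg)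
  have "?li ** l = E" using G.l_inv[OF SL.H_sub[OF l]] by (simp add: G_mult G_one)
  then have "?li ** g = E +\<^sub>R ?li ** Z" using lm VS_MM[OF Z] US_MM[OF li] by (simp add: g' R.r_distr)
  then have v: "?li \<bullet> g \<in> UJ" unfolding G_mult using US_plus[OF L_VJ_left[OF li Z]] by simp
  moreover have "g = l \<bullet> (?li \<bullet> g)" using SL.H_sub[OF l] US_Units[OF KP g] by (simp add: G.m_assoc[symmetric])
  ultimately show ?thesis using l by blast
qed

text \<open>Replacing the rows outside \<open>I\<close> by those of \<open>E\<close> keeps the coset
  of \<open>UQ\<close> and lands in \<open>UK\<close>, where \<open>K_decomp\<close> applies; the
  factor from \<open>UL\<close> is then absorbed into \<open>UQ\<close>.\<close>

lemma U_decomp: assumes u: "u \<in> US F n Phi" shows "\<exists>w\<in>UQ. \<exists>v\<in>UJ. u = w \<bullet> v"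
proof -
  have KP: "J \<union> L \<subseteq> Phi" using J_Phi L_Phi by auto
  note um = US_MM[OF u]
  define g where "g = (\<lambda>e\<in>N\<times>N. if fst e \<in> I then u e else E e)"
  have gm: "g \<in> MM" unfolding g_def by (rule MM_restrict) (use MM_entry[OF um] MM_entry[OF R_one_closed] in auto)
  have g: "g \<in> UK" unfolding US_iff[OF KP]
  proof (intro conjI ballI impI gm)
    fix i assume "i \<in> N" then show "g (i, i) = \<one>" using US_diag[OF subset_refl u] by (simp add: g_def one_entry)
  next
    fix i j assume ij: "i \<in> N" "j \<in> N" "i \<noteq> j" "(i, j) \<notin> J \<union> L"
    then have "i \<in> I ==> (i, j) \<notin> Phi" by (auto simp: J_iff L_iff)
    then show "g (i, j) = \<zero>" using ij US_zero[OF subset_refl u ij(1-3)] by (simp add: g_def one_entry)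
  qed
  have gU: "g \<in> US F n Phi" by (rule US_sub_Phi[OF KP g])
  obtain w where w: "w \<in> UQ" "u = w \<bullet> g" using same_rows_Q[OF u gU] I_N unfolding g_def by force
  obtain l v where lv: "l \<in> UL" "v \<in> UJ" "g = l \<bullet> v" using K_decomp[OF g] by blast
  have "u = (w \<bullet> l) \<bullet> v" using w lv SQ.H_sub SL.H_sub SJ.H_sub by (simp add: G.m_assoc)
  then show ?thesis using SQ.H_closed[OF w(1) UL_UQ[OF lv(1)]] lv(2) by blast
qed

text \<open>\<open>UQ\<close> is larger than \<open>UL\<close>, yet it moves the coset
  \<open>UQ v\<close> no farther than \<open>UL\<close> does. Since \<open>l\<close> depends on
  \<open>v\<close> as well as on \<open>w\<close>, only the orbits are compared, and this is exactly
  what \<open>kO_Q\<close> uses.\<close>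

lemma Q_L_orbits: assumes v: "v \<in> UJ" and w: "w \<in> UQ"
  shows "\<exists>l\<in>UL. \<exists>w'\<in>UQ. v \<bullet> w = w' \<bullet> (v \<bullet> l)"
proof -
  have vU: "v \<in> US F n Phi" and wU: "w \<in> US F n Phi" using UJ_U[OF v] UQ_U[OF w] by auto
  have vwU: "v \<bullet> w \<in> US F n Phi" by (rule UU.H_closed[OF vU wU])
  note m = US_MM[OF v] US_MM[OF w] US_MM[OF vwU]
  note me = MM_entry[OF m(1)] MM_entry[OF m(2)] MM_entry[OF m(3)]
  \<comment> \<open>The block \<open>I x I\<close> is taken from \<open>v w\<close> and the
    complementary diagonal block from \<open>w\<close>. In the rows of \<open>I\<close>,
    \<open>v\<close> is the identity on columns in \<open>I\<close> and \<open>w\<close> vanishes on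
    columns outside \<open>I\<close>, so \<open>v l\<close> and \<open>v w\<close> agree
    there.\<close>
  define l where "l = (\<lambda>e\<in>N\<times>N. if fst e \<in> I \<and> snd e \<in> I then (v \<bullet> w) e else if fst e \<notin> I \<and> snd e \<notin> I then w e else \<zero>)"
  have lm: "l \<in> MM" unfolding l_def by (rule MM_restrict) (use me in auto)
  have l: "l \<in> UL" unfolding US_iff[OF L_Phi]
  proof (intro conjI ballI impI lm)
    fix i assume "i \<in> N" then show "l (i, i) = \<one>" using US_diag[OF subset_refl wU] US_diag[OF subset_refl vwU] by (simp add: l_def)
  next
    fix i j assume ij: "i \<in> N" "j \<in> N" "i \<noteq> j" "(i, j) \<notin> L"
    show "l (i, j) = \<zero>" using ij US_zero[OF subset_refl wU ij(1-3)] US_zero[OF subset_refl vwU ij(1-3)]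
      by (auto simp: l_def L_iff)
  qed
  have vz: "v (i, k) = \<zero>" if "i \<in> I" "k \<in> I" "k \<noteq> i" for i k
    using US_zero[OF J_Phi v, of i k] that I_N unfolding J_iff by blast
  have wz: "w (i, k) = \<zero>" if "i \<in> I" "k \<in> N - I" for i k
  proof -
    have "i \<noteq> k" "(i, k) \<notin> Qp" using that by (auto simp: J_iff)
    then show ?thesis using US_zero[OF Diff_subset w, of i k] that I_N by blast
  qed
  have "(v \<bullet> w) (i, j) = (v \<bullet> l) (i, j)" if i: "i \<in> I" and j: "j \<in> N" for i j
  proof -
    have iN: "i \<in> N" using i I_N by auto
    have vi: "v (i, i) = \<one>" by (rule US_diag[OF J_Phi v iN])
    show ?thesis
    proof (cases "j \<in> I")
      case True
      have "(\<Oplus>k\<in>N. v (i, k) \<otimes> l (k, j)) = v (i, i) \<otimes> l (i, j)"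
      proof (rule fs_single)
        fix k assume k: "k \<in> N" "k \<noteq> i"
        have "v (i, k) = \<zero> \<or> l (k, j) = \<zero>" using vz[OF i _ k(2)] True k j by (auto simp: l_def)
        then show "v (i, k) \<otimes> l (k, j) = \<zero>" using me iN j k MM_entry[OF lm] by auto
      qed (use iN j me MM_entry[OF lm] in auto)
      moreover have lij: "l (i, j) = (v \<bullet> w) (i, j)" using iN j i True by (simp add: l_def)
      ultimately show ?thesis using vi me(3)[OF iN j] by (simp add: mult_entry[OF iN j, of v l])
    next
      case False
      show ?thesis unfolding mult_entry[OF iN j]
      proof (rule fs_cong)
        fix k assume k: "k \<in> N"
        show "v (i, k) \<otimes> w (k, j) = v (i, k) \<otimes> l (k, j)"
        proof (cases "k \<in> I")
          case True
          then have "w (k, j) = \<zero>" "l (k, j) = \<zero>" using wz[of k j] j k False by (auto simp: l_def)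
          then show ?thesis by simp
        qed (use False j k in \<open>simp add: l_def\<close>)
      qed (use me iN j MM_entry[OF lm] in auto)
    qed
  qed
  then obtain w' where "w' \<in> UQ" "v \<bullet> w = w' \<bullet> (v \<bullet> l)"
    using same_rows_Q[OF vwU UU.H_closed[OF vU UL_U[OF l]]] by blast
  then show ?thesis using l by blast
qed

end

lemma (in fin_group) ip_translate: "h \<in> carrier G ==> ip (carrier G) (ga_mult G f (ga_single h)) (ga_mult G g (ga_single h)) = ip (carrier G) f g"
  unfolding ip_def
  by (rule sum.reindex_bij_witness[where i="\<lambda>x. x \<otimes> h" and j="\<lambda>x. x \<otimes> inv h"]) (auto simp: rt_eq m_assoc)

section \<open>Lidempotents as eigenvectors of \<open>UJ\<close> and their orbits under
  \<open>UL\<close>\<close>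

context tab
begin

text \<open>The dual of conjugation on \<open>VJ\<close>: by adjointness of the trace form,
  \<open>ch B (l X l^-1) = ch (al l B) X\<close> for \<open>X\<close> in \<open>VJ\<close>.
  Truncation selects the representative of this character in \<open>VJ\<close>.\<close>

definition al :: "'f matrix => 'f matrix => 'f matrix" where
  "al l B = trunc J (tr l ** B ** tr (ginv l))"

lemma al_VJ: "l \<in> UL ==> B \<in> VJ ==> al l B \<in> VJ"
  unfolding al_def by (rule trunc_VS) (use US_MM[of l] VS_MM US_MM[OF SL.H_inv[of l]] tr_MM in auto)

lemma eb_eq: "eb B = Pd \<odot> lid J B"
  by (simp add: eb_def e_lidem_def Pd_def J_def)

lemma lid_J_CU: "lid J B \<in> CU" by (rule lid_CU[OF J_Phi])

lemma UJ_in_iff: "x \<in> carrier G ==> v \<in> UJ ==> x \<bullet> ginv v \<in> UJ \<longleftrightarrow> x \<in> UJ"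
proof
  assume x: "x \<in> carrier G" and v: "v \<in> UJ" and a: "x \<bullet> ginv v \<in> UJ"
  have "x \<bullet> ginv v \<bullet> v \<in> UJ" using a v by (rule SJ.H_closed)
  then show "x \<in> UJ" using x SJ.H_sub[OF v] by (simp add: G.m_assoc)
qed (auto intro: SJ.H_closed SJ.H_inv)

lemma lid_right: assumes B: "B \<in> VJ" and v: "v \<in> UJ"
  shows "lid J B \<odot> sg v = (\<lambda>x. ch B (v -\<^sub>R E) * lid J B x)"
proof (rule ext)
  fix x
  have vG: "v \<in> carrier G" by (rule SJ.H_sub[OF v])
  have Bm: "B \<in> MM" by (rule VS_MM[OF B])
  show "(lid J B \<odot> sg v) x = ch B (v -\<^sub>R E) * lid J B x"
  proof (cases "x \<in> UJ")
    case True
    let ?y = "x \<bullet> ginv v"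
    have xG: "x \<in> carrier G" by (rule SJ.H_sub[OF True])
    have y: "?y \<in> UJ" using UJ_in_iff[OF xG v] True by simp
    have "x = ?y ** v" using xG vG by (simp add: G_mult[symmetric] G.m_assoc)
    then have "x -\<^sub>R E = (?y -\<^sub>R E) +\<^sub>R (v -\<^sub>R E)" using UJ_mult[OF y v] by simp
    then have "ch B (x -\<^sub>R E) = ch B (?y -\<^sub>R E) * ch B (v -\<^sub>R E)"
      using Bm US_MM[OF y] US_MM[OF v] by (simp add: ch_add)
    moreover have "cnj (ch B (v -\<^sub>R E)) * ch B (v -\<^sub>R E) = 1"
      by (rule th_cnj) (use Bm US_MM[OF v] pair_closed in auto)
    ultimately have "cnj (ch B (?y -\<^sub>R E)) = ch B (v -\<^sub>R E) * cnj (ch B (x -\<^sub>R E))"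
      by (simp add: mult_ac)
    then show ?thesis using True y xG vG by (simp add: G.rt_eq lidem_eq[OF B J_Phi])
  next
    case False
    then have "x \<in> carrier G ==> x \<bullet> ginv v \<notin> UJ" using UJ_in_iff[OF _ v] by blast
    then show ?thesis using False vG by (simp add: G.rt_eq lidem_eq[OF B J_Phi])
  qed
qed

lemma eb_alg: "eb B \<in> group_algebra G" unfolding eb_eq by (rule ga_mult_alg)

lemma eb_right: assumes B: "B \<in> VJ" and v: "v \<in> UJ"
  shows "eb B \<odot> sg v = (\<lambda>x. ch B (v -\<^sub>R E) * eb B x)"
  unfolding eb_eq G.ga_mult_assoc lid_right[OF assms] by (rule G.ga_mult_scale_right)

lemma lid_J_alg: "lid J B \<in> group_algebra (G\<lparr>carrier := UJ\<rparr>)"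
  by (simp add: group_algebra_def lidem_def)

text \<open>Right multiplication by \<open>lid J B\<close> is the projection onto the eigenvectors
  of \<open>UJ\<close> with character \<open>ch B\<close>, by orthogonality of characters.\<close>

lemma eb_lid: assumes B: "B \<in> VJ" and C: "C \<in> VJ"
  shows "eb C \<odot> lid J B = (if B = C then eb B else (\<lambda>_. 0))"
proof -
  have "eb C \<odot> lid J B = (\<lambda>x. \<Sum>v\<in>UJ. lid J B v * (eb C \<odot> sg v) x)" by (rule SJ.ga_mult_sum_H[OF lid_J_alg])
  also have "\<dots> = (\<lambda>x. (\<Sum>v\<in>UJ. cnj (ch B (v -\<^sub>R E)) * ch C (v -\<^sub>R E)) / of_nat q ^ card J * eb C x)"
    unfolding sum_divide_distrib sum_distrib_right
    by (intro ext sum.cong) (auto simp: eb_right[OF C] lidem_eq[OF B J_Phi])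
  also have "(\<Sum>v\<in>UJ. cnj (ch B (v -\<^sub>R E)) * ch C (v -\<^sub>R E)) = (\<Sum>X\<in>VJ. cnj (ch B X) * ch C X)"
    by (rule sum_US[OF J_Phi])
  finally show ?thesis using q_nz by (simp add: ch_orth[OF B C J_NN])
qed

lemma UJ_UQ: "v \<in> UJ ==> v \<in> UQ ==> v = E"
proof (rule mat_eqI)
  fix i j assume v: "v \<in> UJ" "v \<in> UQ" and ij: "i \<in> N" "j \<in> N"
  show "v (i, j) = E (i, j)"
    using US_diag[OF J_Phi v(1) ij(1)] US_zero[OF J_Phi v(1) ij] US_zero[OF Diff_subset v(2) ij] ij
    by (cases "i = j"; cases "(i, j) \<in> J") (auto simp: one_entry)
qed (auto intro: US_MM)

lemma Pd_d: assumes v: "v \<in> US F n Phi" shows "Pd (d \<bullet> v) = (if v \<in> UQ then 1 else 0)"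
  using conj_P_U[OF v] d_G UU.H_sub[OF v] by (simp add: Pd_eq)

text \<open>Evaluation at \<open>d\<close> isolates one coefficient: a translate of
  \<open>Pd\<close> by \<open>v\<close> in \<open>UJ\<close> is nonzero at \<open>d\<close> only if
  \<open>v\<close> also lies in \<open>UQ\<close>, that is \<open>v = E\<close>.\<close>

lemma eb_d: assumes B: "B \<in> VJ" shows "eb B d \<noteq> 0"
proof -
  have "eb B d = (\<Sum>v\<in>UJ. lid J B v * (Pd \<odot> sg v) d)"
    unfolding eb_eq by (subst SJ.ga_mult_sum_H[OF lid_J_alg]) simp
  also have "\<dots> = (\<Sum>v\<in>UJ. if v = E then lid J B v else 0)"
  proof (rule sum.cong[OF refl])
    fix v assume v: "v \<in> UJ"
    have vi: "ginv v \<in> UJ" by (rule SJ.H_inv[OF v])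
    have "ginv v \<in> UQ \<longleftrightarrow> v = E"
    proof
      assume "ginv v \<in> UQ"
      then have "ginv v = \<one>\<^bsub>G\<^esub>" using UJ_UQ[OF vi] by (simp add: G_one)
      then show "v = E" using SJ.H_sub[OF v] by (simp add: G_one[symmetric])
    next
      assume "v = E"
      then show "ginv v \<in> UQ" by (simp add: G_one[symmetric]) (simp add: G_one US_one)
    qed
    then show "lid J B v * (Pd \<odot> sg v) d = (if v = E then lid J B v else 0)"
      using Pd_d[OF UJ_U[OF vi]] d_G SJ.H_sub[OF v] by (simp add: G.rt_eq)
  qed
  also have "\<dots> = lid J B E" using SJ.fin_H US_one by simp
  finally show ?thesis using q_nz ch_nz[OF VS_MM[OF B], of "E -\<^sub>R E"] by (simp add: lidem_eq[OF B J_Phi] US_one)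
qed

lemma eb_nz: "B \<in> VJ ==> eb B \<noteq> (\<lambda>_. 0)" using eb_d by (metis)

lemma eb_inj: "B \<in> VJ ==> C \<in> VJ ==> eb B = eb C ==> B = C"
  using eb_lid[of B B] eb_lid[of B C] eb_nz[of B] by (metis (full_types))

text \<open>Translation by an element of \<open>UJ\<close> preserves the form and scales both
  vectors; at an element where the two characters differ, this forces the form to vanish.\<close>

lemma eb_orth: assumes B: "B \<in> VJ" and C: "C \<in> VJ" and ne: "B \<noteq> C" shows "ip (carrier G) (eb B) (eb C) = 0"
proof -
  have "\<exists>X\<in>VJ. ch B X \<noteq> ch C X"
  proof (rule ccontr)
    assume "\<not> ?thesis"
    then have "(\<Sum>X\<in>VJ. cnj (ch B X) * ch C X) = (\<Sum>X\<in>VJ. cnj (ch B X) * ch B X)" by (intro sum.cong) auto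
    then show False using ch_orth[OF B C J_NN] ch_orth[OF B B J_NN] ne q_nz by simp
  qed
  then obtain X where X: "X \<in> VJ" "ch B X \<noteq> ch C X" by blast
  define v where "v = E +\<^sub>R X"
  have v: "v \<in> UJ" unfolding v_def by (rule US_plus[OF X(1)])
  have vX: "v -\<^sub>R E = X" unfolding v_def by (rule plus_minus[OF VS_MM[OF X(1)]])
  have "ip (carrier G) (eb B) (eb C) = ip (carrier G) (eb B \<odot> sg v) (eb C \<odot> sg v)"
    by (rule G.ip_translate[OF SJ.H_sub[OF v], symmetric])
  also have "\<dots> = ch B X * cnj (ch C X) * ip (carrier G) (eb B) (eb C)"
    by (simp add: eb_right[OF B v] eb_right[OF C v] vX ip_scale)
  finally have e: "ip (carrier G) (eb B) (eb C) = ch B X * cnj (ch C X) * ip (carrier G) (eb B) (eb C)" .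
  have "ch B X * cnj (ch C X) \<noteq> 1"
  proof
    assume "ch B X * cnj (ch C X) = 1"
    then have "ch B X * (cnj (ch C X) * ch C X) = ch C X" by (simp add: mult.assoc[symmetric])
    moreover have "cnj (ch C X) * ch C X = 1" by (rule th_cnj) (use VS_MM[OF C] VS_MM[OF X(1)] pair_closed in auto)
    ultimately show False using X(2) by simp
  qed
  then show ?thesis using e by auto
qed

lemma eb_ip: assumes B: "B \<in> VJ" shows "ip (carrier G) (eb B) (eb B) \<noteq> 0"
proof
  assume "ip (carrier G) (eb B) (eb B) = 0"
  then have "eb B = (\<lambda>_. 0)" by (intro ip_self_zero[OF G.fin_G]) (use eb_alg[of B] in \<open>auto simp: group_algebra_def\<close>)
  then show False using eb_nz[OF B] by simp
qed

text \<open>\<open>Pd l = Pd\<close>, so \<open>e_B l = Pd (l^-1 [B] l)\<close>, and conjugation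
  turns the lidempotent of \<open>B\<close> into that of \<open>al l B\<close>.\<close>

lemma eb_L: assumes B: "B \<in> VJ" and l: "l \<in> UL" shows "eb B \<odot> sg l = eb (al l B)"
proof -
  let ?li = "ginv l"
  have lG: "l \<in> carrier G" by (rule SL.H_sub[OF l])
  have li: "?li \<in> UL" by (rule SL.H_inv[OF l])
  note m = US_MM[OF l] US_MM[OF li] VS_MM[OF B]
  have ll: "l ** ?li = E" "?li ** l = E" using lG by (simp_all add: G_mult[symmetric] G_one[symmetric])
  have conj: "k \<bullet> x \<bullet> k' \<in> UJ \<and> (k \<bullet> x \<bullet> k') -\<^sub>R E = k ** (x -\<^sub>R E) ** k'"
    if x: "x \<in> UJ" and kk: "k \<in> UL" "k' \<in> UL" "k ** k' = E" for x k k'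
  proof -
    let ?X = "x -\<^sub>R E"
    note mm = US_MM[OF kk(1)] US_MM[OF kk(2)]
    have X: "?X \<in> VJ" by (rule US_minus[OF J_Phi x])
    have XX: "k ** ?X ** k' \<in> VJ" by (rule L_VJ_right[OF kk(2) L_VJ_left[OF kk(1) X]])
    have "k ** (E +\<^sub>R ?X) ** k' = E +\<^sub>R k ** ?X ** k'"
      using mm VS_MM[OF X] kk(3) by (simp add: R.r_distr R.l_distr)
    then have "k \<bullet> x \<bullet> k' = E +\<^sub>R k ** ?X ** k'" using minus_plus[OF US_MM[OF x]] by (simp add: G_mult)
    then show ?thesis using XX plus_minus[OF VS_MM[OF XX]] US_plus[OF XX] by simp
  qed
  have "sg ?li \<odot> lid J B \<odot> sg l = lid J (al l B)"
  proof (rule ext)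
    fix x
    show "(sg ?li \<odot> lid J B \<odot> sg l) x = lid J (al l B) x"
    proof (cases "x \<in> carrier G")
      case True
      have "(sg ?li \<odot> lid J B \<odot> sg l) x = lid J B (l \<bullet> x \<bullet> ?li)"
        using True lG by (simp add: G.rt_eq G.lt_eq G.m_assoc)
      also have "\<dots> = lid J (al l B) x"
      proof (cases "x \<in> UJ")
        case xJ: True
        have X: "x -\<^sub>R E \<in> VJ" by (rule US_minus[OF J_Phi xJ])
        note Xm = VS_MM[OF X]
        have t: "tr l ** B ** tr ?li \<in> MM" using m tr_MM by auto
        have "pair B (l ** (x -\<^sub>R E) ** ?li) = pair (B ** tr ?li) (l ** (x -\<^sub>R E))"
          by (rule pair_mult_right) (use m Xm in auto)
        also have "\<dots> = pair (tr l ** (B ** tr ?li)) (x -\<^sub>R E)"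
          by (rule pair_mult_left) (use m Xm tr_MM in auto)
        also have "\<dots> = pair (al l B) (x -\<^sub>R E)"
          using pair_trunc[OF t X] m tr_MM by (simp add: al_def R.m_assoc)
        finally show ?thesis using conj[OF xJ l li ll(1)] xJ by (simp add: lidem_eq[OF B J_Phi] lidem_eq[OF al_VJ[OF l B] J_Phi])
      next
        case False
        have "l \<bullet> x \<bullet> ?li \<notin> UJ"
        proof
          assume a: "l \<bullet> x \<bullet> ?li \<in> UJ"
          have "?li \<bullet> (l \<bullet> x \<bullet> ?li) \<bullet> l \<in> UJ" using conj[OF a li l ll(2)] by blast
          also have "?li \<bullet> (l \<bullet> x \<bullet> ?li) \<bullet> l = ?li \<bullet> l \<bullet> x \<bullet> (?li \<bullet> l)"
            using lG True by (simp only: G.m_assoc G.m_closed G.inv_closed)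
          finally show False using False lG True by simp
        qed
        then show ?thesis using False by (simp add: lidem_eq[OF B J_Phi] lidem_eq[OF al_VJ[OF l B] J_Phi])
      qed
      finally show ?thesis .
    next
      case False
      then have "x \<notin> UJ" using SJ.H_sub by blast
      then show ?thesis using False lG by (simp add: G.rt_eq lidem_def)
    qed
  qed
  moreover have "sg l \<odot> (sg ?li \<odot> lid J B \<odot> sg l) = lid J B \<odot> sg l"
    using lG G.ga_one_mult[OF UU.alg_sub[OF lid_J_CU]] by (simp add: G.ga_mult_assoc[symmetric] G.ga_mult_single)
  ultimately have "lid J B \<odot> sg l = sg l \<odot> lid J (al l B)" by simp
  then show ?thesis by (simp add: eb_eq G.ga_mult_assoc) (simp add: G.ga_mult_assoc[symmetric] Pd_Q[OF UL_UQ[OF l]])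
qed

definition "orb A = orbit F \<theta> n s A"

text \<open>\<open>UJ\<close> only scales each \<open>e_B\<close>, so by \<open>K_decomp\<close> the
  orbit of \<open>UK\<close> up to scalars is an orbit of \<open>UL\<close> in the strict
  sense.\<close>

lemma orb_eq: assumes A: "A \<in> VJ" shows "orb A = (\<lambda>l. eb (al l A)) ` UL"
proof (intro equalityI subsetI)
  fix e assume "e \<in> orb A"
  then obtain B g c where B: "B \<in> VJ" "e = eb B" and g: "g \<in> UK" and ge: "eb A \<odot> sg g = (\<lambda>x. c * eb B x)"
    unfolding orb_def orbit_def J_def eb_def K_set_def L_def by blast
  obtain l v where lv: "l \<in> UL" "v \<in> UJ" "g = l \<bullet> v" using K_decomp[OF g] by blast
  let ?C = "al l A"
  have C: "?C \<in> VJ" by (rule al_VJ[OF lv(1) A])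
  have "eb A \<odot> sg g = eb A \<odot> sg l \<odot> sg v"
    using lv SL.H_sub SJ.H_sub by (simp add: G.ga_mult_assoc G.ga_mult_single)
  also have "\<dots> = (\<lambda>x. ch ?C (v -\<^sub>R E) * eb ?C x)" by (simp add: eb_L[OF A lv(1)] eb_right[OF C lv(2)])
  finally have e: "(\<lambda>x. ch ?C (v -\<^sub>R E) * eb ?C x) = (\<lambda>x. c * eb B x)" using ge by simp
  \<comment> \<open>A lidempotent annihilates the vectors of every other index, so a nonzero
    multiple of \<open>eb ?C\<close> can equal a multiple of \<open>eb B\<close> only for equal
    indices.\<close>
  have "?C = B"
  proof (rule ccontr)
    assume ne: "?C \<noteq> B"
    have "(\<lambda>x. ch ?C (v -\<^sub>R E) * eb ?C x) \<odot> lid J ?C = (\<lambda>x. c * eb B x) \<odot> lid J ?C" using e by simp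
    then have "(\<lambda>x. ch ?C (v -\<^sub>R E) * eb ?C x) = (\<lambda>x. 0)"
      using ne by (simp add: G.ga_mult_scale_left eb_lid[OF C C] eb_lid[OF C B(1)])
    moreover have "ch ?C (v -\<^sub>R E) \<noteq> 0" using VS_MM[OF C] US_MM[OF lv(2)] by (simp add: ch_nz)
    ultimately show False using eb_nz[OF C] by (auto simp: fun_eq_iff)
  qed
  then show "e \<in> (\<lambda>l. eb (al l A)) ` UL" using B lv by auto
next
  fix e assume "e \<in> (\<lambda>l. eb (al l A)) ` UL"
  then obtain l where l: "l \<in> UL" "e = eb (al l A)" by auto
  have "eb A \<odot> sg l = (\<lambda>x. 1 * eb (al l A) x)" using eb_L[OF A l(1)] by simp
  moreover have "l \<in> UK" using l US_mono[of L "J \<union> L"] by auto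
  ultimately show "e \<in> orb A" using l al_VJ[OF l(1) A]
    unfolding orb_def orbit_def J_def eb_def K_set_def L_def by blast
qed

lemma orb_eq': assumes A: "A \<in> VJ" shows "orb A = (\<lambda>l. eb A \<odot> sg l) ` UL"
  unfolding orb_eq[OF A] by (rule image_cong[OF refl]) (simp add: eb_L[OF A])

lemma finite_orb: "A \<in> VJ ==> finite (orb A)" by (simp add: orb_eq finite_US)

lemma orb_E: "A \<in> VJ ==> e \<in> orb A ==> \<exists>B\<in>VJ. e = eb B"
  using al_VJ by (auto simp: orb_eq)

lemma orb_self: "A \<in> VJ ==> eb A \<in> orb A"
  unfolding orb_eq' using G.ga_mult_one[OF eb_alg] US_one[of L] by (auto simp: G_one intro!: image_eqI[of _ _ E])

lemma orb_same: assumes A: "A \<in> VJ" and B: "B \<in> VJ" and AB: "eb B \<in> orb A" shows "orb B = orb A"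
proof -
  obtain l where l: "l \<in> UL" "eb B = eb A \<odot> sg l" using AB orb_eq'[OF A] by auto
  note lG = SL.H_sub[OF l(1)]
  have eA: "eb A = eb B \<odot> sg (ginv l)"
    using lG G.ga_mult_one[OF eb_alg] by (simp add: l(2) G.ga_mult_assoc G.ga_mult_single)
  have tt: "e \<odot> sg l' \<odot> sg k = e \<odot> sg (l' \<bullet> k)" if "l' \<in> UL" "k \<in> UL" for e l' k
    using that SL.H_sub by (simp add: G.ga_mult_assoc G.ga_mult_single)
  show ?thesis
  proof
    show "orb B \<subseteq> orb A" unfolding orb_eq'[OF A] orb_eq'[OF B] l(2)
      using tt[OF l(1)] SL.H_closed[OF l(1)] by auto
    show "orb A \<subseteq> orb B" unfolding orb_eq'[OF A] orb_eq'[OF B] eA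
      using tt[OF SL.H_inv[OF l(1)]] SL.H_closed[OF SL.H_inv[OF l(1)]] by auto
  qed
qed

subsection \<open>The module \<open>M\<^sub>s\<close>\<close>

abbreviation "Ms \<equiv> UU.rid Pd"
definition "CO A = cfun.span (orb A)"

lemma M_tab_eq: "M_tab F n s = UM Ms"
  unfolding M_tab_def U_eq Pd_def[symmetric] by (rule UU.cyclic_mod_eq)

lemma orbit_mod_eq: "orbit_mod F \<theta> n s A = UM (CO A)"
  by (simp add: orbit_mod_def CO_def orb_def)

lemma Ms_inv: assumes f: "f \<in> Ms" and p: "p \<in> P" and x: "x \<in> carrier G" shows "f (p \<bullet> x) = f x"
proof -
  obtain a where a: "a \<in> CU" "f = Pd \<odot> a" using f by (auto simp: UU.rid_def)
  note pG = SP.H_sub[OF p]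
  have "Pd (p \<bullet> y) = Pd y" if y: "y \<in> carrier G" for y
  proof -
    have "p \<bullet> (y \<bullet> ginv d) \<in> P \<longleftrightarrow> y \<bullet> ginv d \<in> P"
    proof
      assume "p \<bullet> (y \<bullet> ginv d) \<in> P"
      then have "ginv p \<bullet> (p \<bullet> (y \<bullet> ginv d)) \<in> P" using SP.H_inv[OF p] SP.H_closed by blast
      then show "y \<bullet> ginv d \<in> P" using pG y d_G by (simp add: G.m_assoc[symmetric])
    qed (rule SP.H_closed[OF p])
    then show ?thesis using pG y d_G by (simp add: Pd_eq G.m_assoc)
  qed
  then have "(Pd \<odot> sg u) (p \<bullet> x) = (Pd \<odot> sg u) x" if "u \<in> US F n Phi" for u
    using x pG UU.H_sub[OF that] by (simp add: G.rt_eq G.m_assoc)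
  then show ?thesis unfolding a(2) UU.ga_mult_sum_H[OF a(1)] by simp
qed

lemma Ms_supp: assumes f: "f \<in> Ms" and x: "x \<in> carrier G" and nz: "f x \<noteq> 0"
  shows "\<exists>p\<in>P. \<exists>u\<in>US F n Phi. x = p \<bullet> d \<bullet> u"
proof -
  obtain a where a: "a \<in> CU" "f = Pd \<odot> a" using f by (auto simp: UU.rid_def)
  have "(\<Sum>u\<in>US F n Phi. a u * (Pd \<odot> sg u) x) \<noteq> 0" using nz unfolding a(2) UU.ga_mult_sum_H[OF a(1)] .
  then obtain u where u: "u \<in> US F n Phi" "(Pd \<odot> sg u) x \<noteq> 0" by (metis (no_types, lifting) mult_zero_right sum.neutral)
  note uG = UU.H_sub[OF u(1)]
  have p: "x \<bullet> ginv u \<bullet> ginv d \<in> P" using u(2) x uG by (simp add: G.rt_eq Pd_eq split: if_splits)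
  have dd: "ginv d \<bullet> (d \<bullet> u) = u" using d_G uG by (simp add: G.m_assoc[symmetric])
  have "x = (x \<bullet> ginv u \<bullet> ginv d) \<bullet> d \<bullet> u" using x uG d_G dd by (simp add: G.m_assoc)
  then show ?thesis using p u(1) by blast
qed

lemma eb_Ms: "eb B \<in> Ms" unfolding eb_eq UU.rid_def using lid_J_CU by blast

text \<open>\<open>UQ\<close> fixes \<open>Pd\<close>, so only translates of \<open>Pd\<close> by
  \<open>UJ\<close> remain by \<open>U_decomp\<close>, and inserting \<open>sum_lid\<close> expands
  these in the \<open>e_C\<close>.\<close>

lemma Ms_span: "Ms = cfun.span (eb ` VJ)"
proof
  have v: "Pd \<odot> sg v \<in> cfun.span (eb ` VJ)" if v: "v \<in> UJ" for v
  proof -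
    have vC: "sg v \<in> CU" by (rule UU.single_GH[OF UJ_U[OF v]])
    have "Pd \<odot> sg v = Pd \<odot> (sg \<one>\<^bsub>G\<^esub> \<odot> sg v)" using G.ga_one_mult[OF UU.alg_sub[OF vC]] by simp
    also have "\<dots> = Pd \<odot> (\<lambda>u. \<Sum>C\<in>VJ. 1 * lid J C u) \<odot> sg v" using sum_lid[OF J_Phi] by (simp add: G_one G.ga_mult_assoc)
    also have "\<dots> = (\<lambda>u. \<Sum>C\<in>VJ. 1 * (eb C \<odot> sg v) u)" unfolding G.ga_mult_comb_right G.ga_mult_comb_left eb_eq ..
    also have "\<dots> = (\<lambda>u. \<Sum>C\<in>VJ. ch C (v -\<^sub>R E) * eb C u)" by (simp add: eb_right[OF _ v])
    also have "\<dots> \<in> cfun.span (eb ` VJ)" by (rule csubspace_comb[OF cfun.subspace_span]) (auto intro: cfun.span_base)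
    finally show ?thesis .
  qed
  have "Pd \<odot> sg u \<in> cfun.span (eb ` VJ)" if u: "u \<in> US F n Phi" for u
  proof -
    obtain w v' where wv: "w \<in> UQ" "v' \<in> UJ" "u = w \<bullet> v'" using U_decomp[OF u] by blast
    have "Pd \<odot> sg u = Pd \<odot> sg w \<odot> sg v'" using wv SQ.H_sub SJ.H_sub by (simp add: G.ga_mult_assoc G.ga_mult_single)
    then show ?thesis using v[OF wv(2)] Pd_Q[OF wv(1)] by simp
  qed
  then have "Pd \<odot> a \<in> cfun.span (eb ` VJ)" if "a \<in> CU" for a
    unfolding UU.ga_mult_sum_H[OF that] by (intro csubspace_comb[OF cfun.subspace_span]) auto
  then show "Ms \<subseteq> cfun.span (eb ` VJ)" by (auto simp: UU.rid_def)
  show "cfun.span (eb ` VJ) \<subseteq> Ms" by (rule cfun.span_minimal[OF _ UU.rid_subspace]) (use eb_Ms in auto)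
qed

text \<open>The eigenspaces of \<open>UJ\<close> in \<open>Ms\<close> are one-dimensional.
  Irreducibility and the uniqueness of decompositions both rest on this.\<close>

lemma Ms_lid: assumes f: "f \<in> Ms" and C: "C \<in> VJ" shows "\<exists>c. f \<odot> lid J C = (\<lambda>x. c * eb C x)"
  using f unfolding Ms_span
proof (induction rule: cfun.span_induct_alt)
  case base
  show ?case by (rule exI[of _ 0]) (simp add: zero_fun_def G.ga_mult_zero_left)
next
  case (step c x y)
  then obtain B where B: "B \<in> VJ" "x = eb B" by auto
  obtain k where k: "y \<odot> lid J C = (\<lambda>x. k * eb C x)" using step by blast
  have "((\<lambda>a. c * x a) + y) \<odot> lid J C = (\<lambda>a. ((if B = C then c else 0) + k) * eb C a)"
    unfolding G.ga_mult_add_left G.ga_mult_scale_left k B(2) using eb_lid[OF C B(1)] by (auto simp: distrib_right)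
  then show ?case by blast
qed

lemma lid_sum: assumes f: "f \<in> group_algebra G" shows "f = (\<Sum>C\<in>VJ. f \<odot> lid J C)"
proof -
  have "f = f \<odot> (\<lambda>u. \<Sum>C\<in>VJ. 1 * lid J C u)" using sum_lid[OF J_Phi] G.ga_mult_one[OF f] by (simp add: G_one)
  also have "\<dots> = (\<Sum>C\<in>VJ. f \<odot> lid J C)" unfolding G.ga_mult_comb_right by (simp add: fsum_eq)
  finally show ?thesis .
qed

lemma Ms_alg: "f \<in> Ms ==> f \<in> group_algebra G" using UU.rid_alg by blast

lemma sub_eb: 
  assumes W: "cfun.subspace W" "W \<subseteq> Ms" "\<And>v a. v \<in> W ==> a \<in> CU ==> v \<odot> a \<in> W"
    and v: "v \<in> W" "C \<in> VJ" "v \<odot> lid J C \<noteq> (\<lambda>_. 0)"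
  shows "eb C \<in> W"
proof -
  obtain c where c: "v \<odot> lid J C = (\<lambda>x. c * eb C x)" using Ms_lid[OF _ v(2)] v(1) W(2) by blast
  have "c \<noteq> 0" using c v(3) by auto
  moreover have "(\<lambda>x. inverse c * (c * eb C x)) \<in> W" using csubspaceD(3)[OF W(1)] W(3)[OF v(1) lid_J_CU] c by metis
  ultimately show ?thesis by (simp add: mult.assoc[symmetric])
qed

lemma ex_lid: assumes "v \<in> group_algebra G" "v \<noteq> (\<lambda>_. 0)" shows "\<exists>C\<in>VJ. v \<odot> lid J C \<noteq> (\<lambda>_. 0)"
proof (rule ccontr)
  assume "\<not> ?thesis"
  then have "(\<Sum>C\<in>VJ. v \<odot> lid J C) = 0" by (intro sum.neutral) (auto simp: zero_fun_def)
  then show False using lid_sum[OF assms(1)] assms(2) by (simp add: zero_fun_def)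
qed

subsection \<open>Orbit modules\<close>

text \<open>The sum of the orbit. It has coefficient \<open>1\<close> at every \<open>e_C\<close> of
  the orbit, so each of them is recovered from it by a projection.\<close>

definition "kO A = (\<lambda>x. \<Sum>e\<in>orb A. 1 * e x)"

lemma CO_subspace: "cfun.subspace (CO A)" unfolding CO_def by (rule cfun.subspace_span)
lemma orb_CO: "e \<in> orb A ==> e \<in> CO A" unfolding CO_def by (rule cfun.span_base)
lemma CO_Ms: "A \<in> VJ ==> CO A \<subseteq> Ms"
  unfolding CO_def by (rule cfun.span_minimal[OF _ UU.rid_subspace]) (use orb_E eb_Ms in blast)
lemma kO_CO: "kO A \<in> CO A" unfolding kO_def by (rule csubspace_comb[OF CO_subspace]) (rule orb_CO)

lemma kO_L: assumes A: "A \<in> VJ" and l: "l \<in> UL" shows "kO A \<odot> sg l = kO A"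
proof -
  note lG = SL.H_sub[OF l]
  have tt: "e \<odot> sg l' \<odot> sg k = e \<odot> sg (l' \<bullet> k)" if "l' \<in> UL" "k \<in> UL" for e l' k
    using that SL.H_sub by (simp add: G.ga_mult_assoc G.ga_mult_single)
  have cl: "e \<odot> sg k \<in> orb A" if "e \<in> orb A" "k \<in> UL" for e k
    using that tt SL.H_closed unfolding orb_eq'[OF A] by fastforce
  have alg: "e \<in> group_algebra G" if "e \<in> orb A" for e using orb_E[OF A that] eb_alg by blast
  have one: "e \<odot> sg \<one>\<^bsub>G\<^esub> = e" if "e \<in> orb A" for e using G.ga_mult_one[OF alg[OF that]] .
  have "kO A \<odot> sg l = (\<lambda>x. \<Sum>e\<in>orb A. 1 * (e \<odot> sg l) x)" unfolding kO_def by (rule G.ga_mult_comb_left)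
  also have "\<dots> = kO A" unfolding kO_def
  proof (rule ext)
    fix x
    show "(\<Sum>e\<in>orb A. 1 * (e \<odot> sg l) x) = (\<Sum>e\<in>orb A. 1 * e x)"
      by (rule sum.reindex_bij_witness[where i="\<lambda>e. e \<odot> sg (ginv l)" and j="\<lambda>e. e \<odot> sg l"])
        (use tt[OF l SL.H_inv[OF l]] tt[OF SL.H_inv[OF l] l] cl l SL.H_inv[OF l] lG one in auto)
  qed
  finally show ?thesis .
qed

lemma kO_Ms: "A \<in> VJ ==> kO A \<in> Ms" using kO_CO CO_Ms by blast

text \<open>An element of \<open>Ms\<close> is determined by its values at the points
  \<open>d v\<close> with \<open>v\<close> in \<open>UJ\<close>. By \<open>Q_L_orbits\<close>,
  \<open>d v w = p d v l\<close> with \<open>p\<close> in \<open>P\<close> and \<open>l\<close> in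
  \<open>UL\<close>; invariance under \<open>P\<close> from the left and under \<open>UL\<close>
  from the right gives the same value.\<close>

lemma kO_Q: assumes A: "A \<in> VJ" and w: "w \<in> UQ" shows "kO A \<odot> sg w = kO A"
proof -
  have key: "kO A (x \<bullet> w) = kO A x" if w: "w \<in> UQ" and p: "p \<in> P" and u: "u \<in> US F n Phi" and x: "x = p \<bullet> d \<bullet> u" for x p u w
  proof -
    have pull: "kO A (p \<bullet> (d \<bullet> (w \<bullet> y))) = kO A (d \<bullet> y)" if p: "p \<in> P" and w: "w \<in> UQ" and y: "y \<in> carrier G" for p w y
    proof -
      let ?p = "p \<bullet> (d \<bullet> w \<bullet> ginv d)"
      have p': "?p \<in> P" using SP.H_closed[OF p] conj_P_U[OF UQ_U[OF w]] w by blast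
      have dd: "ginv d \<bullet> (d \<bullet> y) = y" using d_G y by (simp add: G.m_assoc[symmetric])
      have "?p \<bullet> (d \<bullet> y) = p \<bullet> (d \<bullet> (w \<bullet> y))"
        using SP.H_sub[OF p] SQ.H_sub[OF w] d_G y dd by (simp add: G.m_assoc)
      then show ?thesis using Ms_inv[OF kO_Ms[OF A] p', of "d \<bullet> y"] d_G y by simp
    qed
    obtain w0 v where wv: "w0 \<in> UQ" "v \<in> UJ" "u = w0 \<bullet> v" using U_decomp[OF u] by blast
    note g = SP.H_sub[OF p] SQ.H_sub[OF wv(1)] SJ.H_sub[OF wv(2)] SQ.H_sub[OF w] d_G
    obtain l w' where lw: "l \<in> UL" "w' \<in> UQ" "v \<bullet> w = w' \<bullet> (v \<bullet> l)" using Q_L_orbits[OF wv(2) w] by blast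
    note g2 = SL.H_sub[OF lw(1)] SQ.H_sub[OF lw(2)]
    have "kO A x = kO A (p \<bullet> (d \<bullet> (w0 \<bullet> v)))" using g by (simp add: x wv(3) G.m_assoc)
    also have "\<dots> = kO A (d \<bullet> v)" by (rule pull[OF p wv(1) g(3)])
    finally have 1: "kO A x = kO A (d \<bullet> v)" .
    have "kO A (x \<bullet> w) = kO A (p \<bullet> (d \<bullet> (w0 \<bullet> (v \<bullet> w))))" using g by (simp add: x wv(3) G.m_assoc)
    also have "\<dots> = kO A (d \<bullet> (v \<bullet> w))" by (rule pull[OF p wv(1)]) (use g in simp)
    also have "\<dots> = kO A (\<one>\<^bsub>G\<^esub> \<bullet> (d \<bullet> (w' \<bullet> (v \<bullet> l))))" using g g2 lw(3) by simp
    also have "\<dots> = kO A (d \<bullet> (v \<bullet> l))" by (rule pull[OF SP.H_one lw(2)]) (use g g2 in simp)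
    also have "\<dots> = (kO A \<odot> sg (ginv l)) (d \<bullet> v)" using g g2 by (simp add: G.rt_eq G.m_assoc)
    also have "\<dots> = kO A (d \<bullet> v)" by (simp add: kO_L[OF A SL.H_inv[OF lw(1)]])
    finally show ?thesis using 1 by simp
  qed
  note wG = SQ.H_sub[OF w]
  show ?thesis
  proof (rule ext)
    fix x
    show "(kO A \<odot> sg w) x = kO A x"
    proof (cases "x \<in> carrier G")
      case True
      let ?y = "x \<bullet> ginv w"
      have e: "(kO A \<odot> sg w) x = kO A ?y" using True wG by (simp add: G.rt_eq)
      have xy: "x = ?y \<bullet> w" using True wG by (simp add: G.m_assoc)
      show ?thesis
      \<comment> \<open>If one of the values is nonzero, its point lies in \<open>P d U\<close> by
        \<open>Ms_supp\<close>, and \<open>key\<close> is applied there with \<open>w\<close> or its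
        inverse.\<close>
      proof (cases "kO A x = 0 \<and> kO A ?y = 0")
        case False
        then consider "kO A x \<noteq> 0" | "kO A ?y \<noteq> 0" by blast
        then show ?thesis
        proof cases
          case 1
          then obtain p u where "p \<in> P" "u \<in> US F n Phi" "x = p \<bullet> d \<bullet> u" using Ms_supp[OF kO_Ms[OF A] True] by blast
          then have "kO A ?y = kO A x" using key[OF SQ.H_inv[OF w]] by blast
          then show ?thesis using e by simp
        next
          case 2
          then obtain p u where "p \<in> P" "u \<in> US F n Phi" "?y = p \<bullet> d \<bullet> u"
            using Ms_supp[OF kO_Ms[OF A], of ?y] True wG by auto
          then have "kO A (?y \<bullet> w) = kO A ?y" using key[OF w] by blast
          then show ?thesis using e xy by simp
        qed
      qed (use e in simp)
    next
      case False
      then show ?thesis using wG Ms_alg[OF kO_Ms[OF A]] by (simp add: G.rt_eq group_algebra_def)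
    qed
  qed
qed

lemma orb_lid: assumes A: "A \<in> VJ" and B: "B \<in> VJ" and f: "f \<in> CO A" and nz: "f \<odot> lid J B \<noteq> (\<lambda>_. 0)"
  shows "eb B \<in> orb A"
proof (rule ccontr)
  assume nB: "eb B \<notin> orb A"
  have "f \<odot> lid J B = (\<lambda>_. 0)"
    using f unfolding CO_def
  proof (induction rule: cfun.span_induct_alt)
    case base
    show ?case by (simp add: zero_fun_def G.ga_mult_zero_left)
  next
    case (step c x y)
    obtain C where C: "C \<in> VJ" "x = eb C" using orb_E[OF A step(1)] by blast
    have "B \<noteq> C" using nB C step(1) by auto
    then show ?case using step C by (simp only: G.ga_mult_add_left G.ga_mult_scale_left) (use \<open>B \<noteq> C\<close> in \<open>simp add: eb_lid[OF B C(1)] plus_fun_def\<close>)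
  qed
  then show False using nz by simp
qed

lemma kO_lid: assumes A: "A \<in> VJ" and B: "B \<in> VJ" and AB: "eb B \<in> orb A" shows "kO A \<odot> lid J B = eb B"
proof -
  have "kO A \<odot> lid J B = (\<lambda>x. \<Sum>e\<in>orb A. 1 * (e \<odot> lid J B) x)" unfolding kO_def by (rule G.ga_mult_comb_left)
  also have "\<dots> = (\<lambda>x. \<Sum>e\<in>orb A. if e = eb B then eb B x else 0)"
  proof (intro ext sum.cong refl)
    fix x e assume "e \<in> orb A"
    then obtain C where C: "C \<in> VJ" "e = eb C" using orb_E[OF A] by blast
    have "B = C \<longleftrightarrow> e = eb B" using C eb_inj[OF B C(1)] by auto
    then show "1 * (e \<odot> lid J B) x = (if e = eb B then eb B x else 0)" using C eb_lid[OF B C(1)] by auto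
  qed
  also have "\<dots> = eb B" using AB finite_orb[OF A] by simp
  finally show ?thesis .
qed

text \<open>By invariance under \<open>UQ\<close> only \<open>UJ\<close> moves \<open>kO A\<close>,
  and there each summand is merely scaled; so \<open>kO A CU\<close> stays in the span. Every
  \<open>e_C\<close> of the orbit is \<open>kO A\<close> times a lidempotent, which extends this to
  all of \<open>CO A\<close>.\<close>

lemma CO_closed: assumes A: "A \<in> VJ" and f: "f \<in> CO A" and a: "a \<in> CU" shows "f \<odot> a \<in> CO A"
proof -
  have v: "kO A \<odot> sg v \<in> CO A" if v: "v \<in> UJ" for v
  proof -
    have "kO A \<odot> sg v = (\<lambda>x. \<Sum>e\<in>orb A. 1 * (e \<odot> sg v) x)" unfolding kO_def by (rule G.ga_mult_comb_left)
    also have "\<dots> \<in> CO A"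
    proof (rule csubspace_comb[OF CO_subspace])
      fix e assume e: "e \<in> orb A"
      then obtain C where C: "C \<in> VJ" "e = eb C" using orb_E[OF A] by blast
      show "e \<odot> sg v \<in> CO A" using csubspaceD(3)[OF CO_subspace orb_CO[OF e]] C by (simp add: eb_right[OF C(1) v])
    qed
    finally show ?thesis .
  qed
  have u: "kO A \<odot> sg u \<in> CO A" if u: "u \<in> US F n Phi" for u
  proof -
    obtain w v' where wv: "w \<in> UQ" "v' \<in> UJ" "u = w \<bullet> v'" using U_decomp[OF u] by blast
    have "kO A \<odot> sg u = kO A \<odot> sg w \<odot> sg v'" using wv SQ.H_sub SJ.H_sub by (simp add: G.ga_mult_assoc G.ga_mult_single)
    then show ?thesis using v[OF wv(2)] kO_Q[OF A wv(1)] by simp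
  qed
  have kU: "kO A \<odot> b \<in> CO A" if "b \<in> CU" for b
    unfolding UU.ga_mult_sum_H[OF that] by (rule csubspace_comb[OF CO_subspace]) (rule u)
  show ?thesis using f unfolding CO_def[of A, THEN eq_reflection, symmetric]
  proof -
    assume f: "f \<in> CO A"
    then have "f \<in> cfun.span (orb A)" by (simp add: CO_def)
    then show "f \<odot> a \<in> CO A"
    proof (induction rule: cfun.span_induct_alt)
      case base
      show ?case using csubspaceD(1)[OF CO_subspace] by (simp add: zero_fun_def G.ga_mult_zero_left)
    next
      case (step c x y)
      obtain C where C: "C \<in> VJ" "x = eb C" using orb_E[OF A step(1)] by blast
      have "x \<odot> a = kO A \<odot> (lid J C \<odot> a)" using kO_lid[OF A C(1)] step(1) C(2) by (simp add: G.ga_mult_assoc[symmetric])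
      then have "x \<odot> a \<in> CO A" using kU[OF CU_mult[OF lid_J_CU a]] by simp
      then have "(\<lambda>z. c * (x \<odot> a) z) + y \<odot> a \<in> CO A" using step csubspaceD[OF CO_subspace] by blast
      then show ?case by (simp only: G.ga_mult_add_left G.ga_mult_scale_left)
    qed
  qed
qed

text \<open>A nonzero submodule contains some \<open>e_B\<close>, as a nonvanishing eigencomponent
  of one of its vectors, and \<open>UL\<close> carries it to the whole orbit.\<close>

lemma CO_irr:
  assumes A: "A \<in> VJ" and W: "cfun.subspace W" "W \<subseteq> CO A" "\<And>v a. v \<in> W ==> a \<in> CU ==> v \<odot> a \<in> W" and nz: "W \<noteq> {\<lambda>_. 0}"
  shows "W = CO A"
proof -
  obtain v where v: "v \<in> W" "v \<noteq> (\<lambda>_. 0)" using nz csubspaceD(1)[OF W(1)] by blast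
  have WM: "W \<subseteq> Ms" using W(2) CO_Ms[OF A] by blast
  obtain B where B: "B \<in> VJ" "v \<odot> lid J B \<noteq> (\<lambda>_. 0)" using ex_lid[OF Ms_alg v(2)] v(1) WM by blast
  have eW: "eb B \<in> W" by (rule sub_eb[OF W(1) WM W(3) v(1) B])
  have "eb B \<in> orb A" by (rule orb_lid[OF A B(1) _ B(2)]) (use v W in auto)
  then have oB: "orb B = orb A" by (rule orb_same[OF A B(1)])
  have "orb B \<subseteq> W" unfolding orb_eq'[OF B(1)] using W(3)[OF eW] UU.single_GH UL_U by blast
  then have "CO A \<subseteq> W" unfolding CO_def oB by (rule cfun.span_minimal[OF _ W(1)])
  then show ?thesis using W(2) by blast
qed

lemma CO_dim: assumes A: "A \<in> VJ" shows "cfun.dim (CO A) = card (orb A)"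
  unfolding CO_def
proof (rule cfun.dim_span_eq_card_independent, rule orth_independent[of _ "carrier G"])
  fix f assume "f \<in> orb A" then show "ip (carrier G) f f \<noteq> 0" using orb_E[OF A] eb_ip by blast
next
  fix f g assume "f \<in> orb A" "g \<in> orb A" "f \<noteq> g" then show "ip (carrier G) f g = 0" using orb_E[OF A] eb_orth by metis
qed

lemma CO_eq_iff: assumes A: "A \<in> VJ" and B: "B \<in> VJ" shows "CO A = CO B \<longleftrightarrow> orb A = orb B"
proof
  assume "CO A = CO B"
  then have "eb A \<in> CO B" using orb_CO[OF orb_self[OF A]] by simp
  then have "eb A \<in> orb B" using orb_lid[OF B A] eb_lid[OF A A] eb_nz[OF A] by simp
  then show "orb A = orb B" by (rule orb_same[OF B A])
qed (simp add: CO_def)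

lemma CO_orth: assumes A: "A \<in> VJ" and B: "B \<in> VJ" and ne: "orb A \<noteq> orb B" and f: "f \<in> CO A" "g \<in> CO B"
  shows "ip (carrier G) f g = 0"
proof (rule ip_spans_zero[OF _ f[unfolded CO_def]])
  fix e e' assume e: "e \<in> orb A" and e': "e' \<in> orb B"
  obtain C D where C: "C \<in> VJ" "e = eb C" and D: "D \<in> VJ" "e' = eb D" using orb_E[OF A e] orb_E[OF B e'] by blast
  have "C \<noteq> D" using orb_same[OF A C(1)] orb_same[OF B D(1)] e e' C D ne by auto
  then show "ip (carrier G) e e' = 0" using eb_orth C D by simp
qed

lemma CO_module: "A \<in> VJ ==> cg_module (U F n) (UM (CO A))"
  unfolding U_eq by (rule UU.rt_module[OF CO_subspace]) (use CO_Ms Ms_alg CO_closed UU.single_GH in blast)+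

lemma Ms_module: "cg_module (U F n) (UM Ms)"
  unfolding U_eq by (rule UU.rid_module)

lemma CO_nz: "A \<in> VJ ==> CO A \<noteq> {0}"
  using orb_CO[OF orb_self] eb_nz by (auto simp: zero_fun_def)

lemma CO_irreducible: assumes A: "A \<in> VJ" shows "irreducible_mod (U F n) (UM (CO A))"
  unfolding irreducible_mod_def
proof (intro conjI allI impI)
  show "cg_module (U F n) (UM (CO A))" by (rule CO_module[OF A])
  show "mspace (UM (CO A)) \<noteq> {0}" using CO_nz[OF A] by simp
  fix W assume "submod (U F n) (UM (CO A)) W"
  then have W: "W \<subseteq> CO A" "cfun.subspace W" "\<And>v a. v \<in> W ==> a \<in> CU ==> v \<odot> a \<in> W" by (auto simp: submod_def U_eq)
  then show "W = {0} \<or> W = mspace (UM (CO A))" using CO_irr[OF A W(2,1,3)] by (auto simp: zero_fun_def)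
qed

text \<open>Since the eigenspaces of \<open>UJ\<close> are one-dimensional, every summand of a
  decomposition contains some \<open>e_B\<close> and hence equals \<open>CO B\<close>. The
  decomposition is unique as a set of subspaces, not only up to isomorphism.\<close>

lemma decomposition_iff: "irreducible_decomposition (U F n) (UM Ms) D \<longleftrightarrow> D = CO ` VJ"
proof
  assume D: "irreducible_decomposition (U F n) (UM Ms) D"
  have sub: "W \<subseteq> Ms" "cfun.subspace W" "v \<in> W ==> a \<in> CU ==> v \<odot> a \<in> W" "irreducible_mod (U F n) (UM W)" if "W \<in> D" for W v a
    using D that by (auto simp: irreducible_decomposition_def submod_def U_eq)
  have WC: "W = CO B" if W: "W \<in> D" and v: "v \<in> W" and B: "B \<in> VJ" "v \<odot> lid J B \<noteq> (\<lambda>_. 0)" for W v B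
  proof -
    have e: "eb B \<in> W" by (rule sub_eb[OF sub(2)[OF W] sub(1)[OF W] sub(3)[OF W] v B])
    have "orb B \<subseteq> W" unfolding orb_eq'[OF B(1)] using sub(3)[OF W e] UU.single_GH UL_U by blast
    then have "CO B \<subseteq> W" unfolding CO_def by (rule cfun.span_minimal[OF _ sub(2)[OF W]])
    then have "submod (U F n) (UM W) (CO B)" using CO_closed[OF B(1)] CO_subspace by (auto simp: submod_def U_eq)
    then have "CO B = {0} \<or> CO B = W" using sub(4)[OF W] by (auto simp: irreducible_mod_def)
    then show ?thesis using CO_nz[OF B(1)] by simp
  qed
  show "D = CO ` VJ"
  proof (intro equalityI subsetI)
    fix W assume W: "W \<in> D"
    then have "W \<noteq> {0}" using sub(4) by (auto simp: irreducible_mod_def)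
    then obtain v where v: "v \<in> W" "v \<noteq> (\<lambda>_. 0)" using csubspaceD(1)[OF sub(2)[OF W]] by (auto simp: zero_fun_def)
    obtain B where B: "B \<in> VJ" "v \<odot> lid J B \<noteq> (\<lambda>_. 0)" using ex_lid[OF Ms_alg v(2)] v(1) sub(1)[OF W] by blast
    then show "W \<in> CO ` VJ" using WC[OF W v(1) B] by blast
  next
    fix W assume "W \<in> CO ` VJ"
    then obtain A where A: "A \<in> VJ" "W = CO A" by blast
    obtain f where f: "f \<in> (\<Pi>\<^sub>E W\<in>D. W)" "eb A = (\<Sum>W\<in>D. f W)"
      using D eb_Ms[of A] unfolding irreducible_decomposition_def by auto
    have "\<exists>W\<in>D. f W \<odot> lid J A \<noteq> (\<lambda>_. 0)"
    proof (rule ccontr)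
      assume n: "\<not> ?thesis"
      have "eb A = (\<Sum>W\<in>D. f W) \<odot> lid J A" using eb_lid[OF A(1) A(1)] f(2) by simp
      also have "\<dots> = (\<lambda>x. \<Sum>W\<in>D. 1 * f W x) \<odot> lid J A" by (simp add: fsum_eq)
      also have "\<dots> = (\<lambda>x. \<Sum>W\<in>D. 1 * (f W \<odot> lid J A) x)" by (rule G.ga_mult_comb_left)
      also have "\<dots> = (\<lambda>_. 0)" using n by auto
      finally show False using eb_nz[OF A(1)] by simp
    qed
    then obtain W' where W': "W' \<in> D" "f W' \<odot> lid J A \<noteq> (\<lambda>_. 0)" by blast
    have "f W' \<in> W'" using f(1) W'(1) by auto
    then show "W \<in> D" using WC[OF W'(1) _ A(1) W'(2)] W'(1) A(2) by simp
  qed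
next
  assume D: "D = CO ` VJ"
  show "irreducible_decomposition (U F n) (UM Ms) D" unfolding irreducible_decomposition_def
  proof (intro conjI ballI)
    show "cg_module (U F n) (UM Ms)" by (rule Ms_module)
    show fin: "finite D" unfolding D by (rule finite_imageI[OF VS_finite])
    fix W assume "W \<in> D"
    then obtain A where A: "A \<in> VJ" "W = CO A" unfolding D by blast
    show "submod (U F n) (UM Ms) W" using CO_Ms[OF A(1)] CO_subspace CO_closed[OF A(1)] by (auto simp: A(2) submod_def U_eq)
    show "irreducible_mod (U F n) (UM Ms\<lparr>mspace := W\<rparr>)" using CO_irreducible[OF A(1)] A(2) by simp
  next
    fix v assume "v \<in> mspace (UM Ms)"
    then have v: "v \<in> Ms" by simp
    have fin: "finite D" unfolding D by (rule finite_imageI[OF VS_finite])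
    show "\<exists>!f. f \<in> (\<Pi>\<^sub>E W\<in>D. W) \<and> v = (\<Sum>W\<in>D. f W)"
    proof (rule orth_decomp[OF fin G.fin_G])
      fix W assume "W \<in> D" then show "cfun.subspace W" using CO_subspace D by auto
    next
      fix W f x assume "W \<in> D" "f \<in> W" "x \<notin> carrier G"
      then have "f \<in> group_algebra G" using CO_Ms Ms_alg D by blast
      then show "f x = 0" using \<open>x \<notin> carrier G\<close> by (simp add: group_algebra_def)
    next
      fix W W' f g assume "W \<in> D" "W' \<in> D" "W \<noteq> W'" "f \<in> W" "g \<in> W'"
      then show "ip (carrier G) f g = 0" using CO_orth CO_eq_iff unfolding D by blast
    next
      have "v = (\<Sum>C\<in>VJ. v \<odot> lid J C)" by (rule lid_sum[OF Ms_alg[OF v]])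
      also have "\<dots> = (\<Sum>W\<in>CO ` VJ. \<Sum>C\<in>{C\<in>VJ. CO C = W}. v \<odot> lid J C)" by (rule sum.image_gen[OF VS_finite])
      finally have e: "v = (\<Sum>W\<in>D. \<Sum>C\<in>{C\<in>VJ. CO C = W}. v \<odot> lid J C)" unfolding D .
      have "(\<Sum>C\<in>{C\<in>VJ. CO C = W}. v \<odot> lid J C) \<in> W" if "W \<in> D" for W
      proof (rule cfun.subspace_sum)
        show "cfun.subspace W" using that CO_subspace D by auto
        fix C assume C: "C \<in> {C\<in>VJ. CO C = W}"
        then obtain c where "v \<odot> lid J C = (\<lambda>x. c * eb C x)" using Ms_lid[OF v] by blast
        then show "v \<odot> lid J C \<in> W" using C csubspaceD(3)[OF CO_subspace orb_CO[OF orb_self]] by auto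
      qed
      then show "\<exists>f. (\<forall>W\<in>D. f W \<in> W) \<and> v = (\<Sum>W\<in>D. f W)" using e by (intro exI[of _ "\<lambda>W. \<Sum>C\<in>{C\<in>VJ. CO C = W}. v \<odot> lid J C"]) blast
    qed
  qed
qed

end

subsection \<open>Verges in orbits\<close>

context fchar
begin

lemma root_entry: "\<alpha> \<in> carrier F ==> i \<in> N ==> j \<in> N ==> i \<noteq> j ==> root_elem F n e \<alpha> (i, j) = (if (i, j) = e then \<alpha> else \<zero>)"
  by (simp add: root_elem_def add_entry one_entry scaled_unit_def)

lemma root_US1: "(i, j) \<in> S ==> \<alpha> \<in> carrier F ==> root_elem F n (i, j) \<alpha> \<in> US F n S"
  unfolding root_elem_def by (rule US_plus) (auto simp: VS_iff scaled_unit_def intro!: MM_restrict)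

text \<open>Weights double from a column to the one on its left, so removing one entry of column
  \<open>l\<close> outweighs all new entries of the same row to the right of
  \<open>l\<close>.\<close>

definition pot :: "'f matrix => nat" where
  "pot B = (\<Sum>e\<in>supp F n B. 2 ^ (n - snd e))"

lemma pot_less:
  assumes a: "a \<in> N" "l \<in> N" "B (a, l) \<noteq> \<zero>" "B' (a, l) = \<zero>"
    and new: "\<And>i j. i \<in> N ==> j \<in> N ==> B' (i, j) \<noteq> \<zero> ==> B (i, j) = \<zero> ==> i = a \<and> l < j"
  shows "pot B' < pot B"
proof -
  let ?w = "\<lambda>e::nat \<times> nat. (2::nat) ^ (n - snd e)"
  have fin: "finite (supp F n B)" for B by (rule finite_subset[of _ "N \<times> N"]) (auto simp: supp_def)
  have sub: "supp F n B' \<subseteq> (supp F n B - {(a, l)}) \<union> Pair a ` {l<..n}"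
  proof
    fix e assume e: "e \<in> supp F n B'"
    obtain i j where ij: "e = (i, j)" by (cases e)
    have N: "i \<in> N" "j \<in> N" "B' (i, j) \<noteq> \<zero>" using e by (simp_all add: supp_def ij)
    show "e \<in> (supp F n B - {(a, l)}) \<union> Pair a ` {l<..n}"
    proof (cases "B (i, j) = \<zero>")
      case True then show ?thesis using new[OF N] N ij by auto
    next
      case False
      then have "e \<in> supp F n B" using N ij by (simp add: supp_def)
      moreover have "e \<noteq> (a, l)" using N(3) a(4) ij by blast
      ultimately show ?thesis by blast
    qed
  qed
  have geo: "(\<Sum>j\<in>{l<..n}. (2::nat) ^ (n - j)) < 2 ^ (n - l)"
  proof -
    have "(\<Sum>j\<in>{l<..n}. (2::nat) ^ (n - j)) = (\<Sum>k\<in>{..<n - l}. 2 ^ k)"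
      by (rule sum.reindex_bij_witness[where i="\<lambda>k. n - k" and j="\<lambda>j. n - j"]) (use a in auto)
    moreover have "(\<Sum>k<r. (2::nat) ^ k) < 2 ^ r" for r by (induction r) auto
    ultimately show ?thesis by simp
  qed
  have "pot B' \<le> sum ?w ((supp F n B - {(a, l)}) \<union> Pair a ` {l<..n})"
    unfolding pot_def by (rule sum_mono2[OF _ sub]) (use fin in auto)
  also have "\<dots> \<le> sum ?w (supp F n B - {(a, l)}) + sum ?w (Pair a ` {l<..n})"
    using sum.union_inter[of "supp F n B - {(a, l)}" "Pair a ` {l<..n}" ?w] fin by simp
  also have "sum ?w (Pair a ` {l<..n}) = (\<Sum>j\<in>{l<..n}. 2 ^ (n - j))"
    by (subst sum.reindex) (auto intro: inj_onI)
  also have "sum ?w (supp F n B - {(a, l)}) + (\<Sum>j\<in>{l<..n}. 2 ^ (n - j)) < sum ?w (supp F n B - {(a, l)}) + 2 ^ (n - l)"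
    using geo by simp
  also have "\<dots> = pot B" unfolding pot_def
    using sum.remove[OF fin, of "(a, l)" B ?w] a by (simp add: supp_def)
  finally show ?thesis .
qed

end

context tab
begin

lemma VJ_Phi: "B \<in> VJ ==> B \<in> VS F n Phi" using J_Phi by (auto simp: VS_def)

lemma VJ_supp: "B \<in> VJ ==> i \<in> N ==> j \<in> N ==> B (i, j) \<noteq> \<zero> ==> (i, j) \<in> J" unfolding VS_iff by blast

text \<open>Row indices occurring in \<open>J\<close> belong to the second row and column indices do
  not, so no index occurs as both.\<close>

lemma J_disconnected: assumes "S \<subseteq> J" shows "completely_hook_disconnected S"
  unfolding completely_hook_disconnected_def
proof (rule equals0I)
  fix x assume "x \<in> fst ` S \<inter> snd ` S"
  then obtain i j where "(x, j) \<in> S" "(i, x) \<in> S" by force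
  then have "(x, j) \<in> J" "(i, x) \<in> J" using assms by auto
  then show False by (simp add: J_iff)
qed

lemma verge_hook: assumes B: "B \<in> VJ" and v: "verge F n B" shows "hook F n \<theta> B"
proof (unfold_locales)
  show "B \<in> MM" by (rule VS_MM[OF B])
  have s: "supp F n B \<subseteq> J" using B by (simp add: VS_def)
  have sn: "i \<in> N \<and> j \<in> N \<and> B (i, j) \<noteq> \<zero>" if "(i, j) \<in> supp F n B" for i j using that by (simp add: supp_def)
  show "main_condition_set n (supp F n B)" unfolding main_condition_set_def
  proof (intro conjI)
    show "supp F n B \<subseteq> Phi" using s J_Phi by blast
    show "inj_on fst (supp F n B)"
    proof (rule inj_onI, clarify)
      fix i j i' j' assume a: "(i, j) \<in> supp F n B" "(i', j') \<in> supp F n B" "fst (i, j) = fst (i', j')"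
      then have "(i, j') \<in> supp F n B" by simp
      then show "i = i' \<and> j = j'" using verge_row[OF v, of i j j'] sn a by auto
    qed
    show "inj_on snd (supp F n B)"
    proof (rule inj_onI, clarify)
      fix i j i' j' assume a: "(i, j) \<in> supp F n B" "(i', j') \<in> supp F n B" "snd (i, j) = snd (i', j')"
      then have "(i', j) \<in> supp F n B" by simp
      then show "i = i' \<and> j = j'" using verge_col[OF v, of i i' j] sn a by auto
    qed
  qed
  show "completely_hook_disconnected (supp F n B)" by (rule J_disconnected[OF s])
qed

lemma hook_verge: "B \<in> VJ ==> main_condition_set n (supp F n B) ==> verge F n B"
proof -
  assume B: "B \<in> VJ" and m: "main_condition_set n (supp F n B)"
  have "supp F n B \<subseteq> J" using B by (simp add: VS_def)
  then have "completely_hook_disconnected (supp F n B)" by (rule J_disconnected)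
  then interpret hook F n \<theta> B using VS_MM[OF B] m by unfold_locales auto
  show ?thesis by (rule A_verge)
qed

text \<open>Support in the full block \<open>I x (N - I)\<close>, without the order condition of
  \<open>J\<close>. This is stable under the factors \<open>tr l\<close>, and truncating such a
  matrix to \<open>J\<close> changes nothing below the diagonal.\<close>

definition bl :: "'f matrix => bool" where
  "bl X \<longleftrightarrow> X \<in> MM \<and> (\<forall>i\<in>N. \<forall>j\<in>N. i \<notin> I \<or> j \<in> I \<longrightarrow> X (i, j) = \<zero>)"

lemma bl_VJ: "B \<in> VJ ==> bl B" unfolding bl_def using VJ_zero VS_MM by blast

lemma bl_left: assumes l: "l \<in> UL" and X: "bl X" shows "bl (tr l ** X)"
  unfolding bl_def
proof (intro conjI ballI impI)
  have Xm: "X \<in> MM" using X by (simp add: bl_def)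
  note lm = US_MM[OF l]
  show "tr l ** X \<in> MM" using Xm lm tr_MM by auto
  fix i j assume ij: "i \<in> N" "j \<in> N" "i \<notin> I \<or> j \<in> I"
  show "(tr l ** X) (i, j) = \<zero>" unfolding mult_entry'[OF ij(1,2)]
  proof (rule fs_zero)
    fix k assume k: "k \<in> N"
    have "tr l (i, k) = \<zero> \<or> X (k, j) = \<zero>"
      using X UL_zero[OF l k ij(1)] tr_entry[OF ij(1) k, of l] ij k unfolding bl_def by metis
    then show "tr l (i, k) \<otimes> X (k, j) = \<zero>"
      using MM_entry[OF Xm k ij(2)] MM_entry[OF tr_MM[OF lm] ij(1) k] by auto
  qed
qed

lemma bl_right: assumes l: "l \<in> UL" and X: "bl X" shows "bl (X ** tr l)"
  unfolding bl_def
proof (intro conjI ballI impI)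
  have Xm: "X \<in> MM" using X by (simp add: bl_def)
  note lm = US_MM[OF l]
  show "X ** tr l \<in> MM" using Xm lm tr_MM by auto
  fix i j assume ij: "i \<in> N" "j \<in> N" "i \<notin> I \<or> j \<in> I"
  show "(X ** tr l) (i, j) = \<zero>" unfolding mult_entry'[OF ij(1,2)]
  proof (rule fs_zero)
    fix k assume k: "k \<in> N"
    have "X (i, k) = \<zero> \<or> tr l (k, j) = \<zero>"
      using X UL_zero[OF l ij(2) k] tr_entry[OF k ij(2), of l] ij k unfolding bl_def by metis
    then show "X (i, k) \<otimes> tr l (k, j) = \<zero>"
      using MM_entry[OF Xm ij(1) k] MM_entry[OF tr_MM[OF lm] k ij(2)] by auto
  qed
qed

text \<open>Multiplying by \<open>tr l\<close> removes the inverse from \<open>al\<close> and brings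
  the relation into the form that \<open>verge_unique\<close> requires.\<close>

lemma al_agree: assumes l: "l \<in> UL" and B: "B \<in> VJ" shows "agree (tr l ** B) (al l B ** tr l)"
proof -
  let ?M = "tr l ** B ** tr (ginv l)"
  note m = US_MM[OF l] US_MM[OF SL.H_inv[OF l]] VS_MM[OF B]
  have M: "bl ?M" by (rule bl_right[OF SL.H_inv[OF l] bl_left[OF l bl_VJ[OF B]]])
  have "agree ?M (trunc J ?M)" unfolding agree_def
  proof clarify
    fix i j assume "(i, j) \<in> Phi"
    then show "?M (i, j) = trunc J ?M (i, j)" using M by (auto simp: trunc_entry bl_def J_iff Phi_iff)
  qed
  then have "agree ?M (al l B)" by (simp add: al_def)
  then have "agree (?M ** tr l) (al l B ** tr l)"
    by (rule agree_right[OF UL_U[OF l], rotated 2]) (use M VS_MM[OF al_VJ[OF l B]] in \<open>auto simp: bl_def\<close>)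
  moreover have "?M ** tr l = tr l ** B"
    using m tr_MM tr_inv(2)[OF UL_U[OF l]] by (simp add: R.m_assoc)
  ultimately show ?thesis by simp
qed

lemma orb_verge_unique:
  assumes A: "A \<in> VJ" "verge F n A" and B: "B \<in> VJ" "verge F n B" and AB: "eb B \<in> orb A" shows "A = B"
proof -
  obtain l where l: "l \<in> UL" "eb B = eb (al l A)" using AB by (auto simp: orb_eq[OF A(1)])
  have "B = al l A" by (rule eb_inj[OF B(1) al_VJ[OF l(1) A(1)] l(2)])
  then show ?thesis using verge_unique[OF VJ_Phi[OF A(1)] A(2) VJ_Phi[OF B(1)] B(2) UL_U[OF l(1)] UL_U[OF l(1)]] al_agree[OF l(1) A(1)]
    by simp
qed

lemma pat1: assumes ka: "(k, a) \<in> L" and l: "l \<in> US F n {(k, a)}"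
  shows "l \<in> UL" "ginv l \<in> US F n {(k, a)}"
proof -
  show "l \<in> UL" using l ka US_mono[of "{(k, a)}" L] by blast
  have "closed_pat {(k, a)}" using ka by (auto simp: closed_pat_def L_iff Phi_iff)
  then show "ginv l \<in> US F n {(k, a)}" using subgroup.m_inv_closed[OF US_subgroup l] by blast
qed

lemma pat1_entry: assumes ka: "(k, a) \<in> L" and l: "l \<in> US F n {(k, a)}" and ij: "i \<in> N" "j \<in> N" "(i, j) \<noteq> (k, a)"
  shows "l (i, j) = (if i = j then \<one> else \<zero>)"
proof -
  have s: "{(k, a)} \<subseteq> Phi" using ka L_Phi by auto
  show ?thesis using US_diag[OF s l ij(1)] US_zero[OF s l ij(1,2)] ij(3) by auto
qed

text \<open>Transposition reverses the root \<open>(k, a)\<close>, so row \<open>k\<close> is added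
  to the earlier row \<open>a\<close>; the right factor of \<open>al\<close> acts as the identity on
  columns outside \<open>I\<close>.\<close>

lemma row_op:
  assumes B: "B \<in> VJ" and ka: "(k, a) \<in> L" "a \<in> I" and \<alpha>: "\<alpha> \<in> carrier F" and ij: "(i, j) \<in> J"
  shows "al (root_elem F n (k, a) \<alpha>) B (i, j) = B (i, j) \<oplus> (if i = a then \<alpha> \<otimes> B (k, j) else \<zero>)"
proof -
  let ?l = "root_elem F n (k, a) \<alpha>"
  have l: "?l \<in> US F n {(k, a)}" by (rule root_US1) (use \<alpha> in auto)
  note li = pat1[OF ka(1) l]
  have N: "i \<in> N" "j \<in> N" "k \<in> N" "a \<in> N" "k \<noteq> a" "k \<in> I" "j \<notin> I" using ij ka by (auto simp: J_iff L_iff Phi_iff)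
  note m = VS_MM[OF B] US_MM[OF l] US_MM[OF li(2)]
  note mB = MM_entry[OF m(1)] and ml = MM_entry[OF m(2)]
  let ?X = "tr ?l ** B"
  have X: "?X (i, j) = B (i, j) \<oplus> (if i = a then \<alpha> \<otimes> B (k, j) else \<zero>)"
  proof (cases "i = a")
    case True
    have "?X (i, j) = (\<Oplus>c\<in>N. tr ?l (i, c) \<otimes> B (c, j))" using N by (simp add: mult_entry')
    also have "\<dots> = (\<Oplus>c\<in>insert a {k}. tr ?l (i, c) \<otimes> B (c, j))"
    proof (rule fs_mono[symmetric])
      fix c assume c: "c \<in> N - {a, k}"
      then have "tr ?l (i, c) = \<zero>" using N True pat1_entry[OF ka(1) l, of c a] by (auto simp: tr_entry)
      then show "tr ?l (i, c) \<otimes> B (c, j) = \<zero>" using c N mB by auto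
    qed (use N mB ml in \<open>auto simp: tr_entry\<close>)
    also have "\<dots> = tr ?l (i, a) \<otimes> B (a, j) \<oplus> (\<Oplus>c\<in>{k}. tr ?l (i, c) \<otimes> B (c, j))"
      by (rule fs_insert) (use N mB ml in \<open>auto simp: tr_entry\<close>)
    also have "\<dots> = B (i, j) \<oplus> \<alpha> \<otimes> B (k, j)"
      using N mB ml True pat1_entry[OF ka(1) l, of a a] root_entry[OF \<alpha>, of k a "(k, a)"] \<alpha> by (simp add: tr_entry)
    finally show ?thesis using True by simp
  next
    case False
    have "(\<Oplus>c\<in>N. tr ?l (i, c) \<otimes> B (c, j)) = tr ?l (i, i) \<otimes> B (i, j)"
      by (rule fs_single) (use N mB ml False pat1_entry[OF ka(1) l, of _ i] in \<open>auto simp: tr_entry\<close>)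
    then show ?thesis using N mB False pat1_entry[OF ka(1) l, of i i] by (simp add: mult_entry' tr_entry)
  qed
  have Xm: "?X \<in> MM" using m tr_MM by auto
  have "(?X ** tr (ginv ?l)) (i, j) = ?X (i, j)"
  proof -
    have jk: "j \<noteq> k" using N by auto
    have "(\<Oplus>c\<in>N. ?X (i, c) \<otimes> tr (ginv ?l) (c, j)) = ?X (i, j) \<otimes> tr (ginv ?l) (j, j)"
      by (rule fs_single) (use N jk MM_entry[OF Xm] MM_entry[OF m(3)] pat1_entry[OF ka(1) li(2), of j] in \<open>auto simp: tr_entry\<close>)
    then show ?thesis using N jk MM_entry[OF Xm] pat1_entry[OF ka(1) li(2), of j j] by (simp add: mult_entry' tr_entry)
  qed
  then show ?thesis using X N ij by (simp add: al_def trunc_entry)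
qed

text \<open>The inverse compensates the one in \<open>al\<close>, whose right factor is
  \<open>tr (ginv l)\<close>; here column \<open>a\<close> is added to the later column
  \<open>k\<close>.\<close>

lemma col_op:
  assumes B: "B \<in> VJ" and ka: "(k, a) \<in> L" "a \<notin> I" and \<alpha>: "\<alpha> \<in> carrier F" and ij: "(i, j) \<in> J"
  shows "al (ginv root_elem F n (k, a) \<alpha>) B (i, j) = B (i, j) \<oplus> (if j = k then B (i, a) \<otimes> \<alpha> else \<zero>)"
proof -
  let ?k = "root_elem F n (k, a) \<alpha>"
  let ?l = "ginv ?k"
  have k: "?k \<in> US F n {(k, a)}" by (rule root_US1) (use \<alpha> in auto)
  note li = pat1[OF ka(1) k]
  have N: "i \<in> N" "j \<in> N" "k \<in> N" "a \<in> N" "k \<noteq> a" "k \<notin> I" "j \<notin> I" "i \<in> I" using ij ka by (auto simp: J_iff L_iff Phi_iff)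
  note m = VS_MM[OF B] US_MM[OF k] US_MM[OF li(2)]
  note mB = MM_entry[OF m(1)] and mk = MM_entry[OF m(2)] and ml = MM_entry[OF m(3)]
  let ?X = "tr ?l ** B"
  have XB: "?X (i, c) = B (i, c)" if c: "c \<in> N" for c
  proof -
    have "(\<Oplus>e\<in>N. tr ?l (i, e) \<otimes> B (e, c)) = tr ?l (i, i) \<otimes> B (i, c)"
    proof (rule fs_single)
      fix e assume e: "e \<in> N" "e \<noteq> i"
      have "tr ?l (i, e) = \<zero> \<or> B (e, c) = \<zero>"
        using VJ_zero[OF B e(1) c] N e pat1_entry[OF ka(1) li(2) e(1) N(1)] by (cases "e \<in> I") (auto simp: tr_entry)
      then show "tr ?l (i, e) \<otimes> B (e, c) = \<zero>" using mB ml e N c by (auto simp: tr_entry)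
    qed (use N c mB ml in \<open>auto simp: tr_entry\<close>)
    moreover have "i \<noteq> k" using N by auto
    ultimately show ?thesis using N c mB pat1_entry[OF ka(1) li(2), of i i] by (simp add: mult_entry' tr_entry)
  qed
  have Xm: "?X \<in> MM" using m tr_MM by auto
  have ll: "ginv ?l = ?k" using SL.H_sub[OF li(1)] by simp
  have "(?X ** tr ?k) (i, j) = B (i, j) \<oplus> (if j = k then B (i, a) \<otimes> \<alpha> else \<zero>)"
  proof (cases "j = k")
    case True
    have "(?X ** tr ?k) (i, j) = (\<Oplus>c\<in>N. ?X (i, c) \<otimes> tr ?k (c, j))" using N by (simp add: mult_entry')
    also have "\<dots> = (\<Oplus>c\<in>insert k {a}. ?X (i, c) \<otimes> tr ?k (c, j))"
    proof (rule fs_mono[symmetric])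
      fix c assume c: "c \<in> N - {k, a}"
      then have "tr ?k (c, j) = \<zero>" using N True pat1_entry[OF ka(1) k, of k c] by (auto simp: tr_entry)
      then show "?X (i, c) \<otimes> tr ?k (c, j) = \<zero>" using c N MM_entry[OF Xm] by auto
    qed (use N MM_entry[OF Xm] mk in \<open>auto simp: tr_entry\<close>)
    also have "\<dots> = ?X (i, k) \<otimes> tr ?k (k, j) \<oplus> (\<Oplus>c\<in>{a}. ?X (i, c) \<otimes> tr ?k (c, j))"
      by (rule fs_insert) (use N MM_entry[OF Xm] mk in \<open>auto simp: tr_entry\<close>)
    also have "\<dots> = B (i, j) \<oplus> B (i, a) \<otimes> \<alpha>"
      using N mB True XB pat1_entry[OF ka(1) k, of k k] root_entry[OF \<alpha>, of k a "(k, a)"] \<alpha> by (simp add: tr_entry)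
    finally show ?thesis using True by simp
  next
    case False
    have "(\<Oplus>c\<in>N. ?X (i, c) \<otimes> tr ?k (c, j)) = ?X (i, j) \<otimes> tr ?k (j, j)"
      by (rule fs_single) (use N False MM_entry[OF Xm] mk pat1_entry[OF ka(1) k, of j] in \<open>auto simp: tr_entry\<close>)
    then show ?thesis using N False mB XB pat1_entry[OF ka(1) k, of j j] by (simp add: mult_entry' tr_entry)
  qed
  then show ?thesis using N ij ll by (simp add: al_def trunc_entry)
qed

lemma cancel_F: assumes "x \<in> carrier F" "y \<in> carrier F" "y \<noteq> \<zero>"
  shows "\<ominus> (x \<otimes> inv y) \<in> carrier F" "x \<oplus> \<ominus> (x \<otimes> inv y) \<otimes> y = \<zero>" "x \<oplus> y \<otimes> \<ominus> (x \<otimes> inv y) = \<zero>"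
proof -
  have y: "y \<in> Units F" using assms by (simp add: field_Units)
  then have e: "x \<otimes> inv y \<otimes> y = x" using assms by (simp add: m_assoc)
  show 1: "\<ominus> (x \<otimes> inv y) \<in> carrier F" using assms y by simp
  show 2: "x \<oplus> \<ominus> (x \<otimes> inv y) \<otimes> y = \<zero>" using assms y e by (simp add: l_minus r_neg)
  show "x \<oplus> y \<otimes> \<ominus> (x \<otimes> inv y) = \<zero>" using 2 m_comm[OF 1 assms(2)] by simp
qed

text \<open>An orbit element of least \<open>pot\<close> is a verge, because two nonzero entries in
  one row or column allow an operation that lowers \<open>pot\<close>.\<close>

lemma verge_exists: assumes A: "A \<in> VJ" shows "\<exists>B\<in>VJ. verge F n B \<and> eb B \<in> orb A"
proof -
  have "\<exists>B. (B \<in> VJ \<and> eb B \<in> orb A) \<and> (\<forall>C. C \<in> VJ \<and> eb C \<in> orb A \<longrightarrow> pot B \<le> pot C)"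
    by (rule ex_has_least_nat[of _ A]) (use A orb_self[OF A] in blast)
  then obtain B where B: "B \<in> VJ" "eb B \<in> orb A" and min: "\<And>C. C \<in> VJ ==> eb C \<in> orb A ==> pot B \<le> pot C" by blast
  have nlt: "\<not> pot (al l B) < pot B" if l: "l \<in> UL" for l
  proof -
    have "eb (al l B) \<in> orb B" using l by (auto simp: orb_eq[OF B(1)])
    then have "eb (al l B) \<in> orb A" using orb_same[OF A B] by simp
    then show ?thesis using min[OF al_VJ[OF l B(1)]] by auto
  qed
  note mB = MM_entry[OF VS_MM[OF B(1)]]
  define cv where "cv l \<longleftrightarrow> (\<exists>k\<in>N. \<exists>a\<in>N. a < k \<and> B (k, l) \<noteq> \<zero> \<and> B (a, l) \<noteq> \<zero>)" for l
  define rv where "rv l \<longleftrightarrow> (\<exists>k\<in>N. \<exists>c\<in>N. l < c \<and> B (k, l) \<noteq> \<zero> \<and> B (k, c) \<noteq> \<zero>)" for l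
  \<comment> \<open>Columns are treated from left to right. Clearing \<open>(a, l)\<close> by row
    \<open>k\<close> creates entries only to the right of column \<open>l\<close>, since an earlier
    nonzero entry of row \<open>k\<close> would make \<open>rv\<close> true for an earlier
    column.\<close>
  have nv: "\<not> (cv l \<or> rv l)" if "l \<in> N" for l
    using that
  proof (induction l rule: less_induct)
    case (less l)
    have ncv: "\<not> cv l"
    proof
      assume "cv l"
      then obtain k a where k: "k \<in> N" "a \<in> N" "a < k" "B (k, l) \<noteq> \<zero>" "B (a, l) \<noteq> \<zero>" by (auto simp: cv_def)
      have J: "(k, l) \<in> J" "(a, l) \<in> J" using VJ_supp[OF B(1)] k less(2) by blast+
      have L: "(k, a) \<in> L" "a \<in> I" using J k by (auto simp: J_iff L_iff Phi_iff)
      let ?\<alpha> = "\<ominus> (B (a, l) \<otimes> inv (B (k, l)))"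
      note c = cancel_F[OF mB[OF k(2) less(2)] mB[OF k(1) less(2)] k(4)]
      let ?r = "root_elem F n (k, a) ?\<alpha>"
      have r: "?r \<in> UL" by (rule root_US1[OF L(1) c(1)])
      note op = row_op[OF B(1) L c(1)]
      have "pot (al ?r B) < pot B"
      proof (rule pot_less[where B=B and B'="al ?r B", OF k(2) less(2) k(5)])
        show "al ?r B (a, l) = \<zero>" using op[OF J(2)] c(2) by simp
        fix i j assume ij: "i \<in> N" "j \<in> N" "al ?r B (i, j) \<noteq> \<zero>" "B (i, j) = \<zero>"
        have ijJ: "(i, j) \<in> J" by (rule VJ_supp[OF al_VJ[OF r B(1)] ij(1-3)])
        have ia: "i = a" "B (k, j) \<noteq> \<zero>" using op[OF ijJ] ij c(1) by (auto split: if_splits)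
        have "\<not> j < l"
        proof
          assume "j < l"
          moreover then have "rv j" unfolding rv_def using ia k ij less(2) by blast
          ultimately show False using less(1) ij by blast
        qed
        moreover have "j \<noteq> l" using ij ia k by auto
        ultimately show "i = a \<and> l < j" using ia by auto
      qed
      then show False using nlt[OF r] by simp
    qed
    moreover have "\<not> rv l"
    proof
      assume "rv l"
      then obtain k c where k: "k \<in> N" "c \<in> N" "l < c" "B (k, l) \<noteq> \<zero>" "B (k, c) \<noteq> \<zero>" by (auto simp: rv_def)
      have J: "(k, l) \<in> J" "(k, c) \<in> J" using VJ_supp[OF B(1)] k less(2) by blast+
      have L: "(c, l) \<in> L" "l \<notin> I" using J k by (auto simp: J_iff L_iff Phi_iff)
      let ?\<alpha> = "\<ominus> (B (k, c) \<otimes> inv (B (k, l)))"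
      note can = cancel_F[OF mB[OF k(1) k(2)] mB[OF k(1) less(2)] k(4)]
      let ?r = "ginv root_elem F n (c, l) ?\<alpha>"
      have r: "?r \<in> UL" by (rule SL.H_inv[OF root_US1[OF L(1) can(1)]])
      note op = col_op[OF B(1) L can(1)]
      have "pot (al ?r B) < pot B"
      proof (rule pot_less[where B=B and B'="al ?r B", OF k(1) k(2) k(5)])
        show "al ?r B (k, c) = \<zero>" using op[OF J(2)] can(3) by simp
        fix i j assume ij: "i \<in> N" "j \<in> N" "al ?r B (i, j) \<noteq> \<zero>" "B (i, j) = \<zero>"
        have ijJ: "(i, j) \<in> J" by (rule VJ_supp[OF al_VJ[OF r B(1)] ij(1-3)])
        have ia: "j = c" "B (i, l) \<noteq> \<zero>" using op[OF ijJ] ij can(1) by (auto split: if_splits)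
        \<comment> \<open>By \<open>ncv\<close>, column \<open>l\<close> has its only nonzero entry
          in row \<open>k\<close>, so adding it to column \<open>c\<close> changes no other
          row.\<close>
        have "i = k"
        proof (rule ccontr)
          assume "i \<noteq> k"
          then have "cv l" unfolding cv_def using ia k ij by (metis nat_neq_iff)
          then show False using ncv by simp
        qed
        then show "i = k \<and> c < j" using ij ia k by auto
      qed
      then show False using nlt[OF r] by simp
    qed
    ultimately show ?case by simp
  qed
  have "verge F n B"
  proof (intro vergeI)
    fix i j j' assume a: "i \<in> N" "j \<in> N" "j' \<in> N" "B (i, j) \<noteq> \<zero>" "B (i, j') \<noteq> \<zero>"
    have "\<not> j < j'" "\<not> j' < j" using nv[OF a(2)] nv[OF a(3)] a unfolding rv_def by blast+
    then show "j = j'" by simp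
  next
    fix i i' j assume a: "i \<in> N" "i' \<in> N" "j \<in> N" "B (i, j) \<noteq> \<zero>" "B (i', j) \<noteq> \<zero>"
    have "\<not> i < i'" "\<not> i' < i" using nv[OF a(3)] a unfolding cv_def by blast+
    then show "i = i'" by simp
  qed
  then show ?thesis using B by blast
qed

end

subsection \<open>Orbit modules are induced\<close>

locale tabverge = tab F n \<theta> s m + hook F n \<theta> A for F :: "'f ring" (structure) and n and \<theta> and s and m and A +
  assumes A_J: "A \<in> VS F n (J_set n s)"
begin

lemma AJ: "A \<in> VJ" using A_J by (simp add: J_def)
lemma p_J: "p \<subseteq> J" using AJ by (simp add: VS_def p_def)

text \<open>The index of \<open>HH\<close> in \<open>U\<close> is \<open>q\<close> to the number of
  these roots; each of them will be matched with a constraint on the stabilizer of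
  \<open>e_A\<close>.\<close>

lemma Phi_Rh_iff: "(b, j) \<in> Phi - Rh \<longleftrightarrow> (\<exists>i. (i, j) \<in> p \<and> j < b \<and> b < i \<and> \<not> (\<exists>r. (r, b) \<in> p \<and> i < r))"
proof
  assume a: "(b, j) \<in> Phi - Rh"
  then have P: "(b, j) \<in> Phi" by simp
  have na: "\<not> ((\<forall>i. (i, j) \<notin> p) \<or> (\<exists>i. (i, j) \<in> p \<and> (i \<le> b \<or> (\<exists>r. (r, b) \<in> p \<and> j < b \<and> b < i \<and> i < r))))"
    using a Rh_iff by blast
  then obtain i where i: "(i, j) \<in> p" by blast
  have "j < b" using P by (simp add: Phi_iff)
  then show "\<exists>i. (i, j) \<in> p \<and> j < b \<and> b < i \<and> \<not> (\<exists>r. (r, b) \<in> p \<and> i < r)" proof -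
    have "\<not> i \<le> b" "\<not> (\<exists>r. (r, b) \<in> p \<and> j < b \<and> b < i \<and> i < r)" using na i by blast+
    then show ?thesis using i \<open>j < b\<close> by (meson not_le)
  qed
next
  assume "\<exists>i. (i, j) \<in> p \<and> j < b \<and> b < i \<and> \<not> (\<exists>r. (r, b) \<in> p \<and> i < r)"
  then obtain i where i: "(i, j) \<in> p" "j < b" "b < i" "\<not> (\<exists>r. (r, b) \<in> p \<and> i < r)" by blast
  have "(b, j) \<in> Phi" using i p_Phi by (auto simp: Phi_iff)
  moreover have "(b, j) \<notin> Rh"
  proof
    assume "(b, j) \<in> Rh"
    then obtain i' where i': "(i', j) \<in> p" "i' \<le> b \<or> (\<exists>r. (r, b) \<in> p \<and> j < b \<and> b < i' \<and> i' < r)" using i(1) unfolding Rh_iff by blast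
    have "i' = i" by (rule p_col[OF i'(1) i(1)])
    then show False using i i' by auto
  qed
  ultimately show "(b, j) \<in> Phi - Rh" by simp
qed

text \<open>An element of the stabilizer of \<open>A\<close> in \<open>UL\<close> is determined by its entries outside the image \<open>T\<close> of the
  roots outside \<open>R_hat\<close>; hence the orbit of \<open>A\<close> has at least \<open>q\<^bsup>|Phi - R_hat|\<^esup>\<close> elements.\<close>

definition "kj j = (THE i. (i, j) \<in> p)"
lemma kj_eq: "(i, j) \<in> p ==> kj j = i" unfolding kj_def using p_col by blast

text \<open>Sends \<open>(b, j)\<close>, which lies above the condition \<open>(k, j)\<close>, to
  the position of \<open>L\<close> that the stabilizer equations fix: \<open>(b, j)\<close> itself
  if \<open>b\<close> is outside \<open>I\<close>, and \<open>(k, b)\<close> if \<open>b\<close> is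
  in \<open>I\<close>.\<close>

definition "tau e = (if fst e \<in> I then (kj (snd e), fst e) else e)"
definition "T = tau ` (Phi - Rh)"

lemma tau1: assumes "(b, j) \<in> Phi - Rh" "b \<in> I" shows "\<exists>k. tau (b, j) = (k, b) \<and> (k, j) \<in> p \<and> j < b \<and> b < k"
proof -
  obtain i where i: "(i, j) \<in> p" "j < b" "b < i" using assms(1)[unfolded Phi_Rh_iff] by blast
  then show ?thesis using assms(2) kj_eq[OF i(1)] by (simp add: tau_def)
qed

lemma tau_inj: "inj_on tau (Phi - Rh)"
proof (rule inj_onI)
  fix x y assume x: "x \<in> Phi - Rh" and y: "y \<in> Phi - Rh" and e: "tau x = tau y"
  obtain b j c l where xy: "x = (b, j)" "y = (c, l)" by (cases x; cases y)
  obtain i i' where ii: "(i, j) \<in> p" "(i', l) \<in> p" 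
    using x[unfolded xy Phi_Rh_iff] y[unfolded xy Phi_Rh_iff] by blast
  have jI: "j \<notin> I" "l \<notin> I" "i \<in> I" "i' \<in> I" using ii p_J by (auto simp: J_iff)
  have k: "kj j = i" "kj l = i'" using kj_eq ii by auto
  show "x = y"
  proof (cases "b \<in> I"; cases "c \<in> I")
    assume "b \<in> I" "c \<in> I"
    then have "i = i'" "b = c" using e k by (auto simp: tau_def xy)
    then show ?thesis using ii p_row xy by blast
  qed (use e k jI in \<open>auto simp: tau_def xy\<close>)
qed

lemma T_L: "T \<subseteq> L"
proof
  fix e assume "e \<in> T"
  then obtain b j where bj: "(b, j) \<in> Phi - Rh" "e = tau (b, j)" unfolding T_def by auto
  obtain i where i: "(i, j) \<in> p" "j < b" "b < i" using bj(1)[unfolded Phi_Rh_iff] by blast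
  have "(i, j) \<in> J" using i p_J by auto
  then show "e \<in> L" using i bj kj_eq[OF i(1)] by (auto simp: tau_def L_iff J_iff Phi_iff)
qed

lemma card_T: "card T = card (Phi - Rh)" unfolding T_def by (rule card_image[OF tau_inj])

definition "stab = {l \<in> UL. al l A = A}"

lemma stab_eq: assumes l: "l \<in> stab" and ij: "(i, j) \<in> Phi"
  shows "(tr l ** A) (i, j) = (A ** tr l) (i, j)"
  using al_agree[of l A] AJ l ij by (auto simp: stab_def agree_def)

text \<open>At \<open>(i, b)\<close> the right side of \<open>stab_eq\<close> is
  \<open>A (i, j)\<close> times \<open>l (b, j)\<close>. The left side could be nonzero only through
  a condition \<open>(r, b)\<close> with \<open>i < r\<close>, and such a condition would put
  \<open>(b, j)\<close> into \<open>Rh\<close>.\<close>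

lemma stab_T2: assumes l: "l \<in> stab" and bj: "(b, j) \<in> Phi - Rh" and b: "b \<notin> I" shows "l (b, j) = \<zero>"
proof -
  have lU: "l \<in> UL" using l by (simp add: stab_def)
  note lm = US_MM[OF lU]
  obtain i where i: "(i, j) \<in> p" "j < b" "b < i" "\<not> (\<exists>r. (r, b) \<in> p \<and> i < r)" using bj[unfolded Phi_Rh_iff] by blast
  have N: "i \<in> N" "j \<in> N" "b \<in> N" "A (i, j) \<noteq> \<zero>" using i bj by (auto simp: p_iff Phi_iff)
  have P: "(i, b) \<in> Phi" using N i by (auto simp: Phi_iff)
  have "(tr l ** A) (i, b) = \<zero>"
  proof (cases "\<exists>r. (r, b) \<in> p")
    case True
    then obtain r where r: "(r, b) \<in> p" by blast
    have rN: "r \<in> N" "A (r, b) \<noteq> \<zero>" using r by (auto simp: p_iff)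
    have "r \<noteq> i"
    proof
      assume "r = i"
      then have "j = b" using p_row[OF i(1)] r by blast
      then show False using i by simp
    qed
    then have "r < i" using i(4) r by (meson nat_neq_iff)
    then have "l (r, i) = \<zero>" using US_lower[OF UL_U[OF lU] rN(1) N(1)] by simp
    then show ?thesis using verge_left_eval(1)[OF A_MM A_verge lm N(1) N(3) rN] MM_entry[OF A_MM rN(1) N(3)] by simp
  next
    case False
    then show ?thesis using verge_left_eval(2)[OF A_MM A_verge lm N(1) N(3)] N by (auto simp: p_iff)
  qed
  then have "A (i, j) \<otimes> l (b, j) = \<zero>"
    using stab_eq[OF l P] verge_right_eval(1)[OF A_MM A_verge lm N(1) N(3) N(2) N(4)] by simp
  then show ?thesis using N MM_entry[OF A_MM N(1,2)] MM_entry[OF lm N(3,2)] integral by blast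
qed

text \<open>Entries with both indices outside \<open>I\<close> are settled first, since those in
  \<open>T\<close> vanish. The equation at \<open>(b, j)\<close> then expresses the entry at
  \<open>(k, b)\<close> in \<open>T\<close> through an entry of the first kind, or makes it
  zero.\<close>

lemma stab_inj: assumes l: "l \<in> stab" and l': "l' \<in> stab" and eq: "\<And>e. e \<in> L - T ==> l e = l' e" shows "l = l'"
proof -
  have lU: "l \<in> UL" "l' \<in> UL" using l l' by (auto simp: stab_def)
  note lm = US_MM[OF lU(1)] US_MM[OF lU(2)]
  have low: "l (j, mm) = l' (j, mm)" if N: "j \<in> N" "mm \<in> N" "j \<notin> I" "mm \<notin> I" for j mm
  proof (cases "(j, mm) \<in> L")
    case True
    show ?thesis
    proof (cases "(j, mm) \<in> T")
      case True
      then obtain b c where bc: "(b, c) \<in> Phi - Rh" "(j, mm) = tau (b, c)" unfolding T_def by auto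
      have "b \<notin> I" using bc(2) N(4) by (cases "b \<in> I") (simp_all add: tau_def)
      then have "(j, mm) = (b, c)" using bc by (simp add: tau_def)
      then show ?thesis using stab_T2[OF l] stab_T2[OF l'] bc \<open>b \<notin> I\<close> by auto
    qed (use eq True in auto)
  next
    case False
    then show ?thesis using US_diag[OF L_Phi lU(1) N(1)] US_diag[OF L_Phi lU(2) N(1)]
      US_zero[OF L_Phi lU(1) N(1,2)] US_zero[OF L_Phi lU(2) N(1,2)] by (cases "j = mm") auto
  qed
  have up: "l (k, b) = l' (k, b)" if kb: "(k, b) \<in> T" "b \<in> I" for k b
  proof -
    obtain b' j where bj: "(b', j) \<in> Phi - Rh" "(k, b) = tau (b', j)" using kb unfolding T_def by auto
    have jI: "j \<notin> I" using bj(1)[unfolded Phi_Rh_iff] p_J by (auto simp: J_iff)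
    have b'I: "b' \<in> I"
    proof (rule ccontr)
      assume "b' \<notin> I"
      then have "b = j" using bj(2) by (simp add: tau_def)
      then show False using kb(2) jI by simp
    qed
    then have bb: "b' = b" using bj by (auto simp: tau_def)
    have kj: "(k, j) \<in> p" "j < b" "b < k" using tau1[OF bj(1) b'I] bj(2) bb by auto
    have "(k, j) \<in> J" using kj p_J by blast
    then have N: "k \<in> N" "j \<in> N" "b \<in> N" "A (k, j) \<noteq> \<zero>" "j \<notin> I" using kj by (simp_all add: p_iff J_iff)
    have P: "(b, j) \<in> Phi" using bj bb by simp
    have R: "(A ** tr l) (b, j) = (A ** tr l') (b, j)"
    proof (cases "\<exists>mm. (b, mm) \<in> p")
      case True
      then obtain mm where mm: "(b, mm) \<in> p" by blast
      have "(b, mm) \<in> J" using mm p_J by blast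
      then have mN: "mm \<in> N" "A (b, mm) \<noteq> \<zero>" "mm \<notin> I" using mm by (simp_all add: p_iff J_iff)
      show ?thesis using verge_right_eval(1)[OF A_MM A_verge lm(1) N(3,2) mN(1,2)] verge_right_eval(1)[OF A_MM A_verge lm(2) N(3,2) mN(1,2)]
          low[OF N(2) mN(1) N(5) mN(3)] by simp
    next
      case False
      then have "A (b, c) = \<zero>" if "c \<in> N" for c using that N by (auto simp: p_iff)
      then show ?thesis using verge_right_eval(2)[OF A_MM A_verge lm(1) N(3,2)] verge_right_eval(2)[OF A_MM A_verge lm(2) N(3,2)] by simp
    qed
    have "l (k, b) \<otimes> A (k, j) = l' (k, b) \<otimes> A (k, j)"
      using stab_eq[OF l P] stab_eq[OF l' P] R verge_left_eval(1)[OF A_MM A_verge lm(1) N(3,2) N(1,4)]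
        verge_left_eval(1)[OF A_MM A_verge lm(2) N(3,2) N(1,4)] by simp
    then show ?thesis using N MM_entry[OF A_MM N(1,2)] MM_entry[OF lm(1) N(1,3)] MM_entry[OF lm(2) N(1,3)] m_rcancel by blast
  qed
  show ?thesis
  proof (rule mat_eqI[OF lm])
    fix i j assume ij: "i \<in> N" "j \<in> N"
    show "l (i, j) = l' (i, j)"
    proof (cases "(i, j) \<in> L")
      case True
      show ?thesis
      proof (cases "(i, j) \<in> T")
        case T: True
        show ?thesis
        proof (cases "j \<in> I")
          case True then show ?thesis using up[OF T] by simp
        next
          case False then show ?thesis using low[OF ij] \<open>(i, j) \<in> L\<close> by (auto simp: L_iff)
        qed
      qed (use eq True in auto)
    next
      case False
      then show ?thesis using US_diag[OF L_Phi lU(1) ij(1)] US_diag[OF L_Phi lU(2) ij(1)]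
        US_zero[OF L_Phi lU(1) ij] US_zero[OF L_Phi lU(2) ij] by (cases "i = j") auto
    qed
  qed
qed

lemma card_stab: "card stab \<le> q ^ (card L - card T)"
proof -
  have fL: "finite L" by (rule finite_sub_Phi[OF L_Phi])
  have "card stab \<le> card ((L - T) \<rightarrow>\<^sub>E carrier F)"
  proof (rule card_inj_on_le[where f="\<lambda>l. restrict l (L - T)"])
    show "inj_on (\<lambda>l. restrict l (L - T)) stab"
    proof (rule inj_onI)
      fix l l' assume a: "l \<in> stab" "l' \<in> stab" "restrict l (L - T) = restrict l' (L - T)"
      then have "l e = l' e" if "e \<in> L - T" for e using that by (metis restrict_apply')
      then show "l = l'" by (rule stab_inj[OF a(1,2)])
    qed
    show "(\<lambda>l. restrict l (L - T)) ` stab \<subseteq> (L - T) \<rightarrow>\<^sub>E carrier F"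
    proof (clarsimp simp: PiE_iff)
      fix l i j assume "l \<in> stab" "(i, j) \<in> L"
      then show "l (i, j) \<in> carrier F" using MM_entry[OF US_MM, of l L i j] L_Phi by (auto simp: stab_def L_iff Phi_iff)
    qed
    show "finite ((L - T) \<rightarrow>\<^sub>E carrier F)" using fL fin_F by (intro finite_PiE) auto
  qed
  also have "\<dots> = q ^ (card L - card T)" using fL T_L by (simp add: card_PiE card_Diff_subset finite_subset)
  finally show ?thesis .
qed

text \<open>The fibres of \<open>l |-> e_A l\<close> are cosets of the stabilizer, whose size is
  bounded by \<open>card_stab\<close>.\<close>

lemma card_orb_ge: "q ^ card (Phi - Rh) \<le> card (orb A)"
proof -
  have fL: "finite L" by (rule finite_sub_Phi[OF L_Phi])
  let ?f = "\<lambda>l. eb A \<odot> sg l"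
  have fib: "card {l \<in> UL. ?f l = e} = card stab" if e: "e \<in> ?f ` UL" for e
  proof -
    obtain k where k: "k \<in> UL" "e = ?f k" using e by blast
    have tt: "eb A \<odot> sg x \<odot> sg y = eb A \<odot> sg (x \<bullet> y)" if "x \<in> UL" "y \<in> UL" for x y
      using that SL.H_sub by (simp add: G.ga_mult_assoc G.ga_mult_single)
    have st: "l \<in> stab \<longleftrightarrow> l \<in> UL \<and> ?f l = eb A" for l
      using eb_L[OF AJ] eb_inj[OF al_VJ AJ] AJ by (auto simp: stab_def)
    have one: "eb A \<odot> sg \<one>\<^bsub>G\<^esub> = eb A" by (rule G.ga_mult_one[OF eb_alg])
    have "bij_betw (\<lambda>l. l \<bullet> k) stab {l \<in> UL. ?f l = e}"
    proof (rule bij_betw_byWitness[where f'="\<lambda>l. l \<bullet> ginv k"])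
      show "\<forall>l\<in>stab. l \<bullet> k \<bullet> ginv k = l" using SL.H_sub k by (auto simp: stab_def G.m_assoc)
      show "\<forall>l\<in>{l \<in> UL. ?f l = e}. l \<bullet> ginv k \<bullet> k = l" using SL.H_sub k by (auto simp: G.m_assoc)
      show "(\<lambda>l. l \<bullet> k) ` stab \<subseteq> {l \<in> UL. ?f l = e}"
        using SL.H_closed[OF _ k(1)] tt[OF _ k(1)] st k(2) by force
      show "(\<lambda>l. l \<bullet> ginv k) ` {l \<in> UL. ?f l = e} \<subseteq> stab"
      proof (rule image_subsetI)
        fix l assume "l \<in> {l \<in> UL. ?f l = e}"
        then have l: "l \<in> UL" "?f l = e" by auto
        have "eb A \<odot> sg (l \<bullet> ginv k) = eb A \<odot> sg (k \<bullet> ginv k)"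
          using tt[OF l(1) SL.H_inv[OF k(1)]] tt[OF k(1) SL.H_inv[OF k(1)]] l(2) k(2) by simp
        then show "l \<bullet> ginv k \<in> stab" using st SL.H_closed[OF l(1) SL.H_inv[OF k(1)]] SL.H_sub[OF k(1)] one by simp
      qed
    qed
    then show ?thesis by (simp add: bij_betw_same_card)
  qed
  have "card UL = (\<Sum>l\<in>UL. 1)" by simp
  also have "\<dots> = (\<Sum>e\<in>?f ` UL. \<Sum>l\<in>{l \<in> UL. ?f l = e}. 1)" by (rule sum.image_gen[OF finite_US])
  also have "\<dots> = card (orb A) * card stab" using fib by (simp add: orb_eq'[OF AJ])
  finally have "q ^ card L = card (orb A) * card stab" by (simp add: card_US[OF L_Phi])
  also have "\<dots> \<le> card (orb A) * q ^ (card L - card T)" using card_stab by simp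
  finally have "q ^ card L \<le> card (orb A) * q ^ (card L - card T)" .
  moreover have "q ^ card L = q ^ card T * q ^ (card L - card T)"
    using card_mono[OF fL T_L] by (simp add: power_add[symmetric])
  moreover have "q ^ (card L - card T) > 0" using q_ge2 by simp
  ultimately show ?thesis unfolding card_T[symmetric] by (metis mult_le_cancel2)
qed

text \<open>The product map is injective because \<open>UQ\<close> and \<open>UJ\<close> meet only
  in \<open>E\<close>; the two patterns partition \<open>Rh\<close>, so it is onto by
  counting.\<close>

lemma HH_decomp: assumes u: "u \<in> HH" shows "\<exists>w\<in>US F n (Qp \<inter> Rh). \<exists>v\<in>US F n (J \<inter> Rh). u = w \<bullet> v"
proof -
  let ?W = "US F n (Qp \<inter> Rh)" and ?V = "US F n (J \<inter> Rh)"
  let ?f = "\<lambda>(w, v). w \<bullet> v"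
  have W: "w \<in> HH \<and> w \<in> UQ" if "w \<in> ?W" for w using that US_mono[of "Qp \<inter> Rh" Rh] US_mono[of "Qp \<inter> Rh" Qp] by (auto simp: HH_def)
  have V: "w \<in> HH \<and> w \<in> UJ" if "w \<in> ?V" for w using that US_mono[of "J \<inter> Rh" Rh] US_mono[of "J \<inter> Rh" J] by (auto simp: HH_def)
  have inj: "inj_on ?f (?W \<times> ?V)"
  proof (rule inj_onI, clarify)
    fix w v w' v' assume a: "w \<in> ?W" "v \<in> ?V" "w' \<in> ?W" "v' \<in> ?V" and e: "w \<bullet> v = w' \<bullet> v'"
    note g = HS.H_sub[OF W[OF a(1), THEN conjunct1]] HS.H_sub[OF V[OF a(2), THEN conjunct1]]
      HS.H_sub[OF W[OF a(3), THEN conjunct1]] HS.H_sub[OF V[OF a(4), THEN conjunct1]]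
    have "ginv w' \<bullet> (w \<bullet> v) \<bullet> ginv v = ginv w' \<bullet> (w' \<bullet> v') \<bullet> ginv v" using e by simp
    then have e2: "ginv w' \<bullet> w = v' \<bullet> ginv v" 
      using g by (simp add: G.m_assoc) (simp add: G.m_assoc[symmetric])
    have q1: "ginv w' \<bullet> w \<in> UQ" using W a SQ.H_closed SQ.H_inv by blast
    have "v' \<bullet> ginv v \<in> UJ" using V a SJ.H_closed SJ.H_inv by blast
    then have "v' \<bullet> ginv v = \<one>\<^bsub>G\<^esub>" "ginv w' \<bullet> w = \<one>\<^bsub>G\<^esub>" using UJ_UQ q1 e2 by (auto simp: G_one)
    then have "v' \<bullet> ginv v \<bullet> v = v" "w' \<bullet> (ginv w' \<bullet> w) = w'" using g by simp_all
    moreover have "v' \<bullet> ginv v \<bullet> v = v'" using g by (simp only: G.m_assoc G.l_inv G.r_one G.inv_closed)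
    moreover have "w' \<bullet> (ginv w' \<bullet> w) = w" using g by (simp only: G.m_assoc[symmetric] G.r_inv G.l_one G.inv_closed)
    ultimately show "w = w' \<and> v = v'" by simp
  qed
  have sub: "?f ` (?W \<times> ?V) \<subseteq> HH" using W V HS.H_closed by auto
  have fR: "finite Rh" by (rule finite_sub_Phi[OF Rh_Phi])
  have "card (?f ` (?W \<times> ?V)) = q ^ card (Qp \<inter> Rh) * q ^ card (J \<inter> Rh)"
    using card_US[of "Qp \<inter> Rh"] card_US[of "J \<inter> Rh"] J_Phi by (simp add: card_image[OF inj] card_cartesian_product le_infI1)
  also have "\<dots> = q ^ card Rh"
  proof -
    have "Rh = (Qp \<inter> Rh) \<union> (J \<inter> Rh)" using Rh_Phi by auto
    moreover have "card ((Qp \<inter> Rh) \<union> (J \<inter> Rh)) = card (Qp \<inter> Rh) + card (J \<inter> Rh)"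
      by (rule card_Un_disjoint) (use fR in auto)
    ultimately show ?thesis by (metis power_add)
  qed
  finally have "?f ` (?W \<times> ?V) = HH" by (intro card_subset_eq[OF HS.fin_H sub]) (simp add: HH_def card_US[OF Rh_Phi])
  then show ?thesis using u by force
qed

text \<open>The \<open>e\<^sub>A\<close>-coefficient of \<open>kO \<epsilon>\<close> is \<open>1\<close>, because \<open>\<psi>\<close> agrees with \<open>\<chi>\<^sub>A\<close> on \<open>UJ \<inter> HH\<close> and is trivial on \<open>UQ \<inter> HH\<close>.\<close>

lemma kO_ep_lid: "kO A \<odot> ep \<odot> lid J A = eb A"
proof -
  have epH: "ep \<in> group_algebra (G\<lparr>carrier := HH\<rparr>)" by (simp add: group_algebra_def ep_eq)
  have tm: "ep u * (kO A \<odot> sg u \<odot> lid J A) x = eb A x / of_nat (card HH)" if u: "u \<in> HH" for u x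
  proof -
    obtain w v where wv: "w \<in> US F n (Qp \<inter> Rh)" "v \<in> US F n (J \<inter> Rh)" "u = w \<bullet> v" using HH_decomp[OF u] by blast
    have wQ: "w \<in> UQ" "w \<in> HH" using wv(1) US_mono[of "Qp \<inter> Rh" Rh] US_mono[of "Qp \<inter> Rh" Qp] by (auto simp: HH_def)
    have vJ: "v \<in> UJ" "v \<in> HH" using wv(2) US_mono[of "J \<inter> Rh" Rh] US_mono[of "J \<inter> Rh" J] by (auto simp: HH_def)
    have "kO A \<odot> sg u = kO A \<odot> sg w \<odot> sg v" using wv(3) SQ.H_sub[OF wQ(1)] SJ.H_sub[OF vJ(1)] by (simp add: G.ga_mult_assoc G.ga_mult_single)
    then have "kO A \<odot> sg u = kO A \<odot> sg v" using kO_Q[OF AJ wQ(1)] by simp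
    also have "\<dots> = (\<lambda>x. \<Sum>e\<in>orb A. 1 * (e \<odot> sg v) x)" unfolding kO_def by (rule G.ga_mult_comb_left)
    finally have "kO A \<odot> sg u \<odot> lid J A = (\<lambda>x. \<Sum>e\<in>orb A. 1 * (e \<odot> sg v \<odot> lid J A) x)" by (simp only: G.ga_mult_comb_left)
    also have "\<dots> = (\<lambda>x. \<Sum>e\<in>orb A. if e = eb A then ch A (v -\<^sub>R E) * eb A x else 0)"
    proof (intro ext sum.cong refl)
      fix x e assume "e \<in> orb A"
      then obtain C where C: "C \<in> VJ" "e = eb C" using orb_E[OF AJ] by blast
      have "A = C \<longleftrightarrow> e = eb A" using C eb_inj[OF AJ C(1)] by auto
      then show "1 * (e \<odot> sg v \<odot> lid J A) x = (if e = eb A then ch A (v -\<^sub>R E) * eb A x else 0)"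
        using C eb_lid[OF AJ C(1)] by (auto simp: eb_right[OF C(1) vJ(1)] G.ga_mult_scale_left)
    qed
    also have "\<dots> = (\<lambda>x. ch A (v -\<^sub>R E) * eb A x)" using orb_self[OF AJ] finite_orb[OF AJ] by simp
    finally have 1: "kO A \<odot> sg u \<odot> lid J A = (\<lambda>x. ch A (v -\<^sub>R E) * eb A x)" .
    have "psi0 w = 1" using psi0_trivial[OF wv(1)] p_J Rh_Phi wQ(2) by (auto simp: psi0_def)
    then have pu: "psi0 u = ch A (v -\<^sub>R E)" using psi0_mult[OF wQ(2) vJ(2)] wv(3) vJ(2) by (simp add: psi0_def)
    have "psi0 (ginv u) * psi0 u = 1"
      using psi0_mult[OF HS.H_inv[OF u] u] psi0_one HS.H_sub[OF u] by simp
    then show ?thesis using u pu unfolding 1 by (simp add: ep_eq field_simps)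
  qed
  have "kO A \<odot> ep \<odot> lid J A = (\<lambda>x. \<Sum>u\<in>HH. ep u * (kO A \<odot> sg u \<odot> lid J A) x)"
    unfolding HS.ga_mult_sum_H[OF epH] by (rule G.ga_mult_comb_left)
  also have "\<dots> = (\<lambda>x. \<Sum>u\<in>HH. eb A x / of_nat (card HH))" by (intro ext sum.cong refl tm)
  finally show ?thesis using card_HH_nz by simp
qed

text \<open>\<open>kO A ep\<close> is an eigenvector for \<open>psi0\<close>, and nonzero since its
  \<open>e_A\<close>-component is. With the orbit count as dimension bound,
  \<open>eigenvector_iso\<close> yields the isomorphism and at the same time the exact size of the
  orbit.\<close>

lemma orbit_iso: "mod_iso (U F n) (hook_mod F \<theta> n A) (UM (CO A))"
  and card_orb: "card (orb A) = q ^ card (Phi - Rh)"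
proof -
  let ?v = "kO A \<odot> ep"
  have v: "?v \<in> CO A" by (rule CO_closed[OF AJ kO_CO ep_CU])
  have nz: "?v \<noteq> (\<lambda>_. 0)" using kO_ep_lid eb_nz[OF AJ] by (metis G.ga_mult_zero_left)
  have eig: "?v \<odot> sg h = (\<lambda>x. psi0 h * ?v x)" if "h \<in> HH" for h
    unfolding G.ga_mult_assoc ep_right[OF that] by (rule G.ga_mult_scale_right)
  have vv: "?v \<odot> ep = ?v" by (rule eigen_ep[OF ga_mult_alg eig])
  have alg: "CO A \<subseteq> group_algebra G" using CO_Ms[OF AJ] Ms_alg by blast
  have d: "q ^ card (Phi - Rh) \<le> cfun.dim (CO A)" using card_orb_ge CO_dim[OF AJ] by simp
  note i = eigenvector_iso[OF CO_subspace alg CO_closed[OF AJ] CO_irr[OF AJ] v nz vv d]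
  show "mod_iso (U F n) (hook_mod F \<theta> n A) (UM (CO A))" by (rule i(1))
  show "card (orb A) = q ^ card (Phi - Rh)" using i(2) unfolding CO_dim[OF AJ] .
qed

end

context tab
begin

lemma verge_tabverge: "A \<in> VJ ==> verge F n A ==> tabverge F n \<theta> s m A"
  by (intro tabverge.intro tabverge_axioms.intro verge_hook) (auto simp: J_def tab_axioms)

lemma verge_iso: "A \<in> VJ ==> verge F n A ==> mod_iso (U F n) (hook_mod F \<theta> n A) (UM (CO A))"
  using tabverge.orbit_iso[OF verge_tabverge] .

lemma verge_card: "A \<in> VJ ==> verge F n A ==> card (orb A) = q ^ card (Phi - R_hat n (supp F n A))"
  using tabverge.card_orb[OF verge_tabverge] hook.Rh_def[OF verge_hook] hook.p_def[OF verge_hook] by simp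

end

section \<open>Row spaces\<close>

context fmat
begin

abbreviation "RV \<equiv> row_vecs F n"
abbreviation "sub W \<equiv> row_subspace F n W"

definition img :: "(nat => 'f) set => 'f matrix => (nat => 'f) set" where "img W g = (\<lambda>v. v \<star> g) ` W"
definition vadd :: "(nat => 'f) => (nat => 'f) => nat => 'f" where "vadd v w = (\<lambda>j\<in>N. v j \<oplus> w j)"
definition vsc :: "'f => (nat => 'f) => nat => 'f" where "vsc c v = (\<lambda>j\<in>N. c \<otimes> v j)"
definition v0 :: "nat => 'f" where "v0 = (\<lambda>j\<in>N. \<zero>)"
text \<open>The subspace whose stabilizer is \<open>P_lam\<close> (\<open>PP_img\<close>): its
  images correspond to the cosets of \<open>P_lam\<close>, so coset questions become questions about
  subspaces.\<close>

definition Wst :: "nat => (nat => 'f) set" where "Wst m = {v \<in> RV. \<forall>j\<in>N. j \<le> n - m \<longrightarrow> v j = \<zero>}"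
definition VI :: "nat set => (nat => 'f) set" where "VI I = {v \<in> RV. \<forall>j\<in>N. j \<notin> I \<longrightarrow> v j = \<zero>}"
text \<open>The last nonzero coordinate and not the first, because lower unitriangular matrices
  acting from the right leave it in place.\<close>

definition piv :: "(nat => 'f) => nat => bool" where "piv v i \<longleftrightarrow> i \<in> N \<and> v i \<noteq> \<zero> \<and> (\<forall>j\<in>N. i < j \<longrightarrow> v j = \<zero>)"
definition Piv :: "(nat => 'f) set => nat set" where "Piv W = {i. \<exists>v\<in>W. piv v i}"

lemma RV_entry: "v \<in> RV ==> j \<in> N ==> v j \<in> carrier F" by (auto simp: row_vecs_def)
lemma RV_eqI: "v \<in> RV ==> w \<in> RV ==> (\<And>j. j \<in> N ==> v j = w j) ==> v = w"
  unfolding row_vecs_def by (rule PiE_ext)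
lemma RV_restrict: "(\<And>j. j \<in> N ==> f j \<in> carrier F) ==> restrict f N \<in> RV" by (auto simp: row_vecs_def)
lemma finite_RV: "finite RV" unfolding row_vecs_def by (intro finite_PiE) (use fin_F in auto)
lemma card_RV: "card RV = q ^ n" by (simp add: row_vecs_def card_PiE)

lemma sub_iff: "sub W \<longleftrightarrow> W \<subseteq> RV \<and> v0 \<in> W \<and> (\<forall>v\<in>W. \<forall>w\<in>W. vadd v w \<in> W) \<and> (\<forall>c\<in>carrier F. \<forall>v\<in>W. vsc c v \<in> W)"
  by (simp add: row_subspace_def v0_def vadd_def vsc_def)

lemma subD: "sub W ==> W \<subseteq> RV" "sub W ==> v0 \<in> W" "sub W ==> v \<in> W ==> w \<in> W ==> vadd v w \<in> W"
   "sub W ==> c \<in> carrier F ==> v \<in> W ==> vsc c v \<in> W" by (auto simp: sub_iff)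

lemma v_entry: "j \<in> N ==> vadd v w j = v j \<oplus> w j" "j \<in> N ==> vsc c v j = c \<otimes> v j" "j \<in> N ==> v0 j = \<zero>"
  by (auto simp: vadd_def vsc_def v0_def)

lemma v_RV: "v \<in> RV ==> w \<in> RV ==> vadd v w \<in> RV" "c \<in> carrier F ==> v \<in> RV ==> vsc c v \<in> RV" "v0 \<in> RV"
  unfolding vadd_def vsc_def v0_def by (auto intro!: RV_restrict simp: RV_entry)

lemma sub_RV: "sub RV" by (simp add: sub_iff v_RV)

lemma vm_RV: "v \<in> RV ==> A \<in> MM ==> v \<star> A \<in> RV"
  unfolding vec_mat_def by (rule RV_restrict) (auto intro!: fs_closed simp: RV_entry MM_entry)

lemma vm_mult: "v \<in> RV ==> A \<in> MM ==> B \<in> MM ==> v \<star> A \<star> B = v \<star> (A ** B)"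
  by (rule vm_assoc) (auto simp: RV_entry)

lemma vm_E: "v \<in> RV ==> v \<star> E = v"
proof (rule RV_eqI)
  fix j assume v: "v \<in> RV" and j: "j \<in> N"
  show "(v \<star> E) j = v j" by (rule vm_one[OF RV_entry[OF v] j])
qed (auto intro!: vm_RV)

lemma vm_add: assumes "v \<in> RV" "w \<in> RV" "A \<in> MM" shows "vadd v w \<star> A = vadd (v \<star> A) (w \<star> A)"
proof (rule RV_eqI)
  fix j assume j: "j \<in> N"
  have "(vadd v w \<star> A) j = (\<Oplus>k\<in>N. v k \<otimes> A (k, j) \<oplus> w k \<otimes> A (k, j))"
    unfolding vm_entry[OF j] by (rule fs_cong) (use assms j in \<open>auto simp: v_entry RV_entry MM_entry l_distr\<close>)
  also have "\<dots> = (\<Oplus>k\<in>N. v k \<otimes> A (k, j)) \<oplus> (\<Oplus>k\<in>N. w k \<otimes> A (k, j))"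
    by (rule fs_add) (use assms j in \<open>auto simp: RV_entry MM_entry\<close>)
  finally show "(vadd v w \<star> A) j = vadd (v \<star> A) (w \<star> A) j" using j by (simp add: v_entry vm_entry)
qed (use assms in \<open>auto intro!: vm_RV v_RV\<close>)

lemma vm_sc: assumes "v \<in> RV" "c \<in> carrier F" "A \<in> MM" shows "vsc c v \<star> A = vsc c (v \<star> A)"
proof (rule RV_eqI)
  fix j assume j: "j \<in> N"
  have "(vsc c v \<star> A) j = (\<Oplus>k\<in>N. c \<otimes> (v k \<otimes> A (k, j)))"
    unfolding vm_entry[OF j] by (rule fs_cong) (use assms j in \<open>auto simp: v_entry RV_entry MM_entry m_assoc\<close>)
  also have "\<dots> = c \<otimes> (\<Oplus>k\<in>N. v k \<otimes> A (k, j))"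
    by (rule fs_rdistr[symmetric]) (use assms j in \<open>auto simp: RV_entry MM_entry\<close>)
  finally show "(vsc c v \<star> A) j = vsc c (v \<star> A) j" using j by (simp add: v_entry vm_entry)
qed (use assms in \<open>auto intro!: vm_RV v_RV\<close>)

lemma vm_v0: assumes "A \<in> MM" shows "v0 \<star> A = v0"
proof (rule RV_eqI)
  fix j assume j: "j \<in> N"
  show "(v0 \<star> A) j = v0 j" unfolding vm_entry[OF j] v_entry(3)[OF j]
    by (rule fs_zero) (use assms j in \<open>auto simp: v_entry MM_entry\<close>)
qed (use assms in \<open>auto intro!: vm_RV v_RV\<close>)

lemma img_sub: assumes W: "sub W" and g: "g \<in> MM" shows "sub (img W g)"
  unfolding sub_iff img_def
proof (intro conjI ballI)
  note WR = subsetD[OF subD(1)[OF W]]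
  show "(\<lambda>v. v \<star> g) ` W \<subseteq> RV" using WR vm_RV g by auto
  show "v0 \<in> (\<lambda>v. v \<star> g) ` W" using subD(2)[OF W] vm_v0[OF g] by force
  fix v w assume "v \<in> (\<lambda>v. v \<star> g) ` W" "w \<in> (\<lambda>v. v \<star> g) ` W"
  then obtain x y where "x \<in> W" "y \<in> W" "v = x \<star> g" "w = y \<star> g" by auto
  then show "vadd v w \<in> (\<lambda>v. v \<star> g) ` W" using vm_add[OF WR WR g] subD(3)[OF W] by (metis imageI)
next
  note WR = subsetD[OF subD(1)[OF W]]
  fix c v assume c: "c \<in> carrier F" "v \<in> (\<lambda>v. v \<star> g) ` W"
  then obtain x where "x \<in> W" "v = x \<star> g" by auto
  then show "vsc c v \<in> (\<lambda>v. v \<star> g) ` W" using vm_sc[OF WR c(1) g] subD(4)[OF W c(1)] by (metis imageI)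
qed

lemma img_img: "W \<subseteq> RV ==> g \<in> MM ==> h \<in> MM ==> img (img W g) h = img W (g ** h)"
  unfolding img_def image_image by (rule image_cong) (auto simp: vm_mult)

lemma img_E: "W \<subseteq> RV ==> img W E = W"
proof -
  assume W: "W \<subseteq> RV"
  have "img W E = id ` W" unfolding img_def by (rule image_cong[OF refl]) (use W vm_E in auto)
  then show ?thesis by simp
qed

lemma img_G: "W \<subseteq> RV ==> g \<in> carrier G ==> h \<in> carrier G ==> img (img W g) h = img W (g \<bullet> h)"
  by (simp add: img_img G_MM G_mult)

lemma img_RV: "W \<subseteq> RV ==> g \<in> MM ==> img W g \<subseteq> RV" unfolding img_def using vm_RV by auto

lemma img_one: "W \<subseteq> RV ==> img W \<one>\<^bsub>G\<^esub> = W" by (simp add: G_one img_E)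

lemma img_inv: assumes W: "W \<subseteq> RV" and g: "g \<in> carrier G" shows "img (img W g) (ginv g) = W" "img (img W (ginv g)) g = W"
  using img_G[OF W g G.inv_closed[OF g]] img_G[OF W G.inv_closed[OF g] g] img_one[OF W] g by simp_all

lemma vm_inj: assumes g: "g \<in> carrier G" shows "inj_on (\<lambda>v. v \<star> g) RV"
proof (rule inj_onI)
  fix v w assume vw: "v \<in> RV" "w \<in> RV" "v \<star> g = w \<star> g"
  have e: "x \<star> g \<star> ginv g = x" if "x \<in> RV" for x
    using vm_mult[OF that G_MM[OF g] G_MM[OF G.inv_closed[OF g]]] vm_E[OF that] unfolding G.r_inv[OF g, unfolded G_mult G_one] by simp
  have "v = v \<star> g \<star> ginv g" by (rule e[OF vw(1), symmetric])
  also have "\<dots> = w \<star> g \<star> ginv g" unfolding vw(3) ..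
  also have "\<dots> = w" by (rule e[OF vw(2)])
  finally show "v = w" .
qed

lemma card_img: "W \<subseteq> RV ==> g \<in> carrier G ==> card (img W g) = card W"
  unfolding img_def by (rule card_image) (rule inj_on_subset[OF vm_inj])

lemma Wst_sub: "sub (Wst m)"
  unfolding sub_iff by (auto simp: Wst_def v_RV v_entry)

lemma card_VI: assumes I: "I \<subseteq> N" shows "card (VI I) = q ^ card I"
proof -
  have "bij_betw (\<lambda>v. restrict v I) (VI I) (I \<rightarrow>\<^sub>E carrier F)"
  proof (rule bij_betw_byWitness[where f'="\<lambda>f. \<lambda>j\<in>N. if j \<in> I then f j else \<zero>"])
    show "\<forall>v\<in>VI I. (\<lambda>j\<in>N. if j \<in> I then restrict v I j else \<zero>) = v"
    proof
      fix v assume v: "v \<in> VI I"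
      show "(\<lambda>j\<in>N. if j \<in> I then restrict v I j else \<zero>) = v"
        by (rule RV_eqI) (use v in \<open>auto simp: VI_def RV_entry intro!: RV_restrict\<close>)
    qed
    show "\<forall>f\<in>I \<rightarrow>\<^sub>E carrier F. restrict (\<lambda>j\<in>N. if j \<in> I then f j else \<zero>) I = f"
      using I by (fastforce simp: fun_eq_iff PiE_def extensional_def)
    show "(\<lambda>v. restrict v I) ` VI I \<subseteq> I \<rightarrow>\<^sub>E carrier F" using I by (auto simp: VI_def RV_entry)
    show "(\<lambda>f. \<lambda>j\<in>N. if j \<in> I then f j else \<zero>) ` (I \<rightarrow>\<^sub>E carrier F) \<subseteq> VI I"
      by (auto simp: VI_def PiE_iff intro!: RV_restrict)
  qed
  moreover have "finite I" using I finite_subset by blast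
  ultimately show ?thesis by (simp add: bij_betw_same_card card_PiE)
qed

lemma Wst_VI: "Wst m = VI {n - m<..n}"
  by (auto simp: Wst_def VI_def)

lemma card_Wst: "m \<le> n ==> card (Wst m) = q ^ m"
  unfolding Wst_VI by (subst card_VI) auto

lemma PP_img: assumes g: "g \<in> carrier G" shows "g \<in> PP m \<longleftrightarrow> img (Wst m) g = Wst m"
proof
  note gm = G_MM[OF g]
  assume a: "g \<in> PP m"
  have "img (Wst m) g \<subseteq> Wst m"
  proof (clarsimp simp: img_def)
    fix v assume v: "v \<in> Wst m"
    have vR: "v \<in> RV" using v by (simp add: Wst_def)
    have "(v \<star> g) j = \<zero>" if j: "j \<in> N" "j \<le> n - m" for j
      unfolding vm_entry[OF j(1)]
    proof (rule fs_zero)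
      fix k assume k: "k \<in> N"
      have "v k = \<zero> \<or> g (k, j) = \<zero>" using v a j k by (cases "k \<le> n - m") (auto simp: Wst_def PP_iff)
      then show "v k \<otimes> g (k, j) = \<zero>" using RV_entry[OF vR k] MM_entry[OF gm k j(1)] by auto
    qed
    then show "v \<star> g \<in> Wst m" using vm_RV[OF vR gm] by (simp add: Wst_def)
  qed
  moreover have "finite (Wst m)" using finite_subset[OF _ finite_RV] by (auto simp: Wst_def)
  ultimately show "img (Wst m) g = Wst m" using card_img[OF subD(1)[OF Wst_sub] g] by (intro card_subset_eq) auto
next
  note gm = G_MM[OF g]
  assume a: "img (Wst m) g = Wst m"
  show "g \<in> PP m" unfolding PP_iff
  proof (intro conjI ballI impI g)
    fix a b assume ab: "a \<in> N" "b \<in> N" "n - m < a" "b \<le> n - m"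
    define e where "e = (\<lambda>j\<in>N. if j = a then \<one> else \<zero>)"
    have eR: "e \<in> RV" unfolding e_def by (rule RV_restrict) auto
    have "e \<in> Wst m" unfolding Wst_def using eR ab by (auto simp: e_def)
    then have "e \<star> g \<in> Wst m" using a by (auto simp: img_def)
    then have "(e \<star> g) b = \<zero>" using ab by (simp add: Wst_def)
    moreover have "(\<Oplus>k\<in>N. e k \<otimes> g (k, b)) = e a \<otimes> g (a, b)"
      by (rule fs_single) (use ab MM_entry[OF gm] in \<open>auto simp: e_def\<close>)
    ultimately show "g (a, b) = \<zero>" using ab MM_entry[OF gm ab(1,2)] by (simp add: vm_entry e_def)
  qed
qed

subsection \<open>Pivots and reduced echelon form\<close>

lemma piv_ex: assumes v: "v \<in> RV" "v \<noteq> v0" shows "\<exists>i. piv v i"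
proof -
  let ?S = "{i \<in> N. v i \<noteq> \<zero>}"
  have "?S \<noteq> {}" using RV_eqI[OF v(1) v_RV(3)] v(2) v_entry(3) by auto
  then have "Max ?S \<in> ?S" by (intro Max_in) auto
  moreover have "v j = \<zero>" if "j \<in> N" "Max ?S < j" for j
  proof (rule ccontr)
    assume "v j \<noteq> \<zero>"
    then have "j \<le> Max ?S" using that by (intro Max_ge) auto
    then show False using that by simp
  qed
  ultimately show ?thesis unfolding piv_def by blast
qed

lemma piv_U: assumes u: "u \<in> US F n Phi" and v: "v \<in> RV" and p: "piv v i" shows "piv (v \<star> u) i"
proof -
  note um = US_MM[OF u]
  have iN: "i \<in> N" using p by (simp add: piv_def)
  have "(\<Oplus>k\<in>N. v k \<otimes> u (k, i)) = v i \<otimes> u (i, i)"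
  proof (rule fs_single)
    fix k assume k: "k \<in> N" "k \<noteq> i"
    have "v k = \<zero> \<or> u (k, i) = \<zero>" using p k US_lower[OF u k(1) iN] by (cases "i < k") (auto simp: piv_def)
    then show "v k \<otimes> u (k, i) = \<zero>" using RV_entry[OF v k(1)] MM_entry[OF um k(1) iN] by auto
  qed (use iN RV_entry[OF v] MM_entry[OF um] in auto)
  then have 1: "(v \<star> u) i = v i" using iN US_diag[OF _ u iN] RV_entry[OF v iN] by (simp add: vm_entry)
  have "(v \<star> u) j = \<zero>" if j: "j \<in> N" "i < j" for j
    unfolding vm_entry[OF j(1)]
  proof (rule fs_zero)
    fix k assume k: "k \<in> N"
    have "v k = \<zero> \<or> u (k, j) = \<zero>" using p k j US_lower[OF u k j(1)] by (cases "i < k") (auto simp: piv_def)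
    then show "v k \<otimes> u (k, j) = \<zero>" using RV_entry[OF v k] MM_entry[OF um k j(1)] by auto
  qed
  then show ?thesis using p 1 by (simp add: piv_def)
qed

lemma Piv_U: assumes u: "u \<in> US F n Phi" and W: "W \<subseteq> RV" shows "Piv (img W u) = Piv W"
proof -
  have ge: "Piv W \<subseteq> Piv (img W u)" if "u \<in> US F n Phi" "W \<subseteq> RV" for W u
    using piv_U[OF that(1)] that(2) by (fastforce simp: Piv_def img_def)
  have uG: "u \<in> carrier G" by (rule US_Units[OF subset_refl u])
  have ui: "ginv u \<in> US F n Phi" using subgroup.m_inv_closed[OF US_subgroup[OF closed_Phi] u] .
  have "Piv (img W u) \<subseteq> Piv (img (img W u) (ginv u))" by (rule ge[OF ui img_RV[OF W US_MM[OF u]]])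
  then show ?thesis using ge[OF u W] img_inv(1)[OF W uG] by simp
qed

lemma Piv_VI: assumes I: "I \<subseteq> N" shows "Piv (VI I) = I"
proof (intro equalityI subsetI)
  fix i assume "i \<in> Piv (VI I)" then show "i \<in> I" by (auto simp: Piv_def VI_def piv_def)
next
  fix i assume i: "i \<in> I"
  have "(\<lambda>j\<in>N. if j = i then \<one> else \<zero>) \<in> VI I" using i by (auto simp: VI_def intro!: RV_restrict)
  moreover have "piv (\<lambda>j\<in>N. if j = i then \<one> else \<zero>) i" using i I by (auto simp: piv_def)
  ultimately show "i \<in> Piv (VI I)" by (auto simp: Piv_def)
qed

lemma Piv_N: "Piv W \<subseteq> N" by (auto simp: Piv_def piv_def)

lemma piv_normal: assumes W: "sub W" and i: "i \<in> Piv W" shows "\<exists>v\<in>W. piv v i \<and> v i = \<one>"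
proof -
  obtain v where v: "v \<in> W" "piv v i" using i by (auto simp: Piv_def)
  have vR: "v \<in> RV" using subD(1)[OF W] v by auto
  have iN: "i \<in> N" "v i \<noteq> \<zero>" using v by (auto simp: piv_def)
  have iu: "v i \<in> Units F" using RV_entry[OF vR iN(1)] iN by (simp add: field_Units)
  let ?w = "vsc (inv (v i)) v"
  have "?w \<in> W" using subD(4)[OF W _ v(1)] iu by simp
  moreover have "?w i = \<one>" using iu iN by (simp add: v_entry)
  moreover have "piv ?w i" unfolding piv_def using calculation v iu iN by (auto simp: v_entry piv_def)
  ultimately show ?thesis by blast
qed

text \<open>Among the normalized vectors of \<open>W\<close> with pivot \<open>i\<close> one of
  least weight is taken. A nonzero entry at another pivot \<open>j\<close> could be cleared by a
  vector with pivot \<open>j\<close>, which changes only coordinates up to \<open>j\<close>.\<close>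

lemma rref_row: assumes W: "sub W" and i: "i \<in> Piv W"
  shows "\<exists>v\<in>W. piv v i \<and> v i = \<one> \<and> (\<forall>j\<in>Piv W. j \<noteq> i \<longrightarrow> v j = \<zero>)"
proof -
  let ?P = "\<lambda>v. v \<in> W \<and> piv v i \<and> v i = \<one>"
  \<comment> \<open>Coordinate \<open>j\<close> weighs more than all smaller coordinates together,
    so entries created below \<open>j\<close> cannot make up for clearing \<open>j\<close>.\<close>
  let ?pot = "\<lambda>v. \<Sum>j\<in>{j \<in> N. v j \<noteq> \<zero>}. (2::nat) ^ j"
  obtain v' where "?P v'" using piv_normal[OF W i] by blast
  then obtain v where v: "v \<in> W" "piv v i" "v i = \<one>" and min: "\<And>w. ?P w ==> ?pot v \<le> ?pot w"
    using ex_has_least_nat[of ?P v' ?pot] by blast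
  have vR: "v \<in> RV" using subD(1)[OF W] v by auto
  have "v j = \<zero>" if j: "j \<in> Piv W" "j \<noteq> i" for j
  proof (rule ccontr)
    assume nz: "v j \<noteq> \<zero>"
    have jN: "j \<in> N" using subsetD[OF Piv_N j(1)] .
    have iN: "i \<in> N" using subsetD[OF Piv_N i] .
    have ji: "j < i" 
    proof -
      have "\<not> i < j" using v(2) nz jN unfolding piv_def by blast
      then show ?thesis using j(2) by simp
    qed
    obtain w where w: "w \<in> W" "piv w j" "w j = \<one>" using piv_normal[OF W j(1)] by blast
    let ?c = "\<ominus> v j"
    have c: "?c \<in> carrier F" using RV_entry[OF vR jN] by simp
    let ?x = "vadd v (vsc ?c w)"
    have x: "?x \<in> W" by (rule subD(3)[OF W v(1) subD(4)[OF W c w(1)]])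
    have xe: "?x k = v k \<oplus> ?c \<otimes> w k" if "k \<in> N" for k using that by (simp add: v_entry)
    have wz: "w k = \<zero>" if "k \<in> N" "j < k" for k using w(2) that by (auto simp: piv_def)
    have xg: "?x k = v k" if "k \<in> N" "j < k" for k using xe[OF that(1)] wz[OF that] c RV_entry[OF vR that(1)] by simp
    have xj: "?x j = \<zero>" using xe[OF jN] w(3) RV_entry[OF vR jN] by (simp add: r_neg)
    have P: "?P ?x" using x xg[OF iN ji] v ji xg by (auto simp: piv_def)
    have "{k \<in> N. ?x k \<noteq> \<zero>} \<subseteq> ({k \<in> N. v k \<noteq> \<zero>} - {j}) \<union> {..<j}"
    proof
      fix k assume k: "k \<in> {k \<in> N. ?x k \<noteq> \<zero>}"
      show "k \<in> ({k \<in> N. v k \<noteq> \<zero>} - {j}) \<union> {..<j}"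
        using k xj xg[of k] by (cases k j rule: linorder_cases) auto
    qed
    then have "?pot ?x \<le> (\<Sum>j\<in>({k \<in> N. v k \<noteq> \<zero>} - {j}) \<union> {..<j}. (2::nat) ^ j)" by (rule sum_mono2[rotated]) auto
    also have "\<dots> \<le> (\<Sum>j\<in>{k \<in> N. v k \<noteq> \<zero>} - {j}. (2::nat) ^ j) + (\<Sum>j\<in>{..<j}. (2::nat) ^ j)"
      using sum.union_inter[of "{k \<in> N. v k \<noteq> \<zero>} - {j}" "{..<j}" "\<lambda>j. (2::nat) ^ j"] by simp
    also have "(\<Sum>j\<in>{..<j}. (2::nat) ^ j) < 2 ^ j" by (induction j) auto
    also have "(\<Sum>j\<in>{k \<in> N. v k \<noteq> \<zero>} - {j}. (2::nat) ^ j) + 2 ^ j = ?pot v"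
      using sum.remove[of "{k \<in> N. v k \<noteq> \<zero>}" j "\<lambda>j. (2::nat) ^ j"] nz jN by simp
    finally show False using min[OF P] by simp
  qed
  then show ?thesis using v by blast
qed

lemma sub_comb: assumes W: "sub W" and S: "finite S" and x: "\<And>i. i \<in> S ==> x i \<in> carrier F" and v: "\<And>i. i \<in> S ==> v i \<in> W"
  shows "(\<lambda>j\<in>N. \<Oplus>i\<in>S. x i \<otimes> v i j) \<in> W"
  using S x v
proof (induction S rule: finite_induct)
  case empty
  show ?case using subD(2)[OF W] unfolding v0_def by (simp only: finsum_empty)
next
  case (insert i S)
  note WR = subsetD[OF subD(1)[OF W]]
  have "vadd (vsc (x i) (v i)) (\<lambda>j\<in>N. \<Oplus>i\<in>S. x i \<otimes> v i j) \<in> W"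
  proof (rule subD(3)[OF W])
    show "vsc (x i) (v i) \<in> W" by (rule subD(4)[OF W]) (use insert in auto)
    show "(\<lambda>j\<in>N. \<Oplus>i\<in>S. x i \<otimes> v i j) \<in> W" by (rule insert.IH) (use insert in auto)
  qed
  moreover have "vadd (vsc (x i) (v i)) (\<lambda>j\<in>N. \<Oplus>i\<in>S. x i \<otimes> v i j) = (\<lambda>j\<in>N. \<Oplus>i\<in>insert i S. x i \<otimes> v i j)"
    unfolding vadd_def
  proof (rule restrict_ext)
    fix j assume j: "j \<in> N"
    have "(\<Oplus>k\<in>insert i S. x k \<otimes> v k j) = x i \<otimes> v i j \<oplus> (\<Oplus>k\<in>S. x k \<otimes> v k j)"
      by (rule fs_insert) (use insert j RV_entry[OF WR] in auto)
    then show "vsc (x i) (v i) j \<oplus> (\<lambda>j\<in>N. \<Oplus>i\<in>S. x i \<otimes> v i j) j = (\<Oplus>k\<in>insert i S. x k \<otimes> v k j)" using j by (simp add: v_entry)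
  qed
  ultimately show ?case by (simp only:)
qed

text \<open>The reduced rows, completed by rows of \<open>E\<close>, form \<open>u\<close>. A
  reduced row vanishes at the other pivots and after its own, so \<open>u\<close> lies in the
  pattern \<open>J\<close> of the tableau with second row \<open>Piv W\<close>.\<close>

lemma rref: assumes W: "sub W"
  shows "\<exists>u\<in>US F n {(i, j) \<in> Phi. i \<in> Piv W \<and> j \<notin> Piv W}. W = img (VI (Piv W)) u"
proof -
  let ?I = "Piv W"
  let ?J = "{(i, j) \<in> Phi. i \<in> ?I \<and> j \<notin> ?I}"
  note WR = subsetD[OF subD(1)[OF W]]
  have IN: "?I \<subseteq> N" by (rule Piv_N)
  obtain r where r: "\<And>i. i \<in> ?I ==> r i \<in> W \<and> piv (r i) i \<and> r i i = \<one> \<and> (\<forall>j\<in>?I. j \<noteq> i \<longrightarrow> r i j = \<zero>)"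
    using rref_row[OF W] bchoice[of ?I "\<lambda>i v. v \<in> W \<and> piv v i \<and> v i = \<one> \<and> (\<forall>j\<in>?I. j \<noteq> i \<longrightarrow> v j = \<zero>)"] by blast
  define u where "u = (\<lambda>e\<in>N\<times>N. if fst e \<in> ?I then r (fst e) (snd e) else if fst e = snd e then \<one> else \<zero>)"
  have um: "u \<in> MM" unfolding u_def by (rule MM_restrict) (use r RV_entry[OF WR] in auto)
  have JP: "?J \<subseteq> Phi" by auto
  have u: "u \<in> US F n ?J" unfolding US_iff[OF JP]
  proof (intro conjI ballI impI um)
    fix i assume i: "i \<in> N" then show "u (i, i) = \<one>" using r by (simp add: u_def)
  next
    fix i j assume ij: "i \<in> N" "j \<in> N" "i \<noteq> j" "(i, j) \<notin> ?J"
    show "u (i, j) = \<zero>"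
    proof (cases "i \<in> ?I")
      case True
      then have "j \<in> ?I \<or> i < j" using ij by (auto simp: Phi_iff)
      then have "r i j = \<zero>" using r[OF True] ij by (auto simp: piv_def)
      then show ?thesis using True ij by (simp add: u_def)
    qed (use ij in \<open>simp add: u_def\<close>)
  qed
  have uI: "u (k, i) = (if k = i then \<one> else \<zero>)" if "k \<in> ?I" "i \<in> ?I" for k i using that r IN by (auto simp: u_def)
  have xu: "(x \<star> u) j = (\<Oplus>k\<in>?I. x k \<otimes> r k j)" if x: "x \<in> VI ?I" and j: "j \<in> N" for x j
  proof -
    have xR: "x \<in> RV" using x by (simp add: VI_def)
    have "(\<Oplus>k\<in>?I. x k \<otimes> r k j) = (\<Oplus>k\<in>?I. x k \<otimes> u (k, j))"
    proof (rule fs_cong)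
      fix k assume k: "k \<in> ?I"
      have kN: "k \<in> N" using k IN by blast
      show "x k \<otimes> r k j = x k \<otimes> u (k, j)" using k kN j by (simp add: u_def)
      show "x k \<otimes> u (k, j) \<in> carrier F" using RV_entry[OF xR kN] MM_entry[OF um kN j] by simp
    qed
    also have "\<dots> = (x \<star> u) j" unfolding vm_entry[OF j]
    proof (rule fs_mono[OF _ IN])
      fix k assume k: "k \<in> N - ?I"
      then have "x k = \<zero>" using x by (auto simp: VI_def)
      then show "x k \<otimes> u (k, j) = \<zero>" using k j MM_entry[OF um] by auto
    next
      fix k assume k: "k \<in> ?I"
      have kN: "k \<in> N" using k IN by blast
      show "x k \<otimes> u (k, j) \<in> carrier F" using RV_entry[OF xR kN] MM_entry[OF um kN j] by simp
    qed simp
    finally show ?thesis by simp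
  qed
  have xuW: "x \<star> u \<in> W" if x: "x \<in> VI ?I" for x
  proof -
    have xR: "x \<in> RV" using x by (simp add: VI_def)
    have "x \<star> u = (\<lambda>j\<in>N. \<Oplus>k\<in>?I. x k \<otimes> r k j)" using xu[OF x] by (auto simp: vec_mat_def fun_eq_iff)
    also have "\<dots> \<in> W" by (rule sub_comb[OF W]) (use IN finite_subset r xR RV_entry in auto)
    finally show ?thesis .
  qed
  have "W \<subseteq> img (VI ?I) u"
  proof
    fix w assume w: "w \<in> W"
    define x where "x = (\<lambda>j\<in>N. if j \<in> ?I then w j else \<zero>)"
    have x: "x \<in> VI ?I" using RV_entry[OF WR[OF w]] by (auto simp: x_def VI_def intro!: RV_restrict)
    have xR: "x \<in> RV" using x by (simp add: VI_def)
    \<comment> \<open>Subtracting the combination with the same coordinates at the pivots leaves a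
      vector of \<open>W\<close> that vanishes at every pivot of \<open>W\<close>; it has no pivot
      of its own and must be zero.\<close>
    let ?y = "vadd w (vsc (\<ominus> \<one>) (x \<star> u))"
    have y: "?y \<in> W" by (intro subD(3)[OF W w] subD(4)[OF W]) (use xuW[OF x] in auto)
    have ye: "?y j = w j \<ominus> (x \<star> u) j" if "j \<in> N" for j
      using that RV_entry[OF vm_RV[OF xR um] that] by (simp add: v_entry l_minus minus_eq)
    have "?y i = \<zero>" if i: "i \<in> ?I" for i
    proof -
      have iN: "i \<in> N" using i IN by auto
      have "(x \<star> u) i = (\<Oplus>k\<in>N. x k \<otimes> u (k, i))" by (rule vm_entry[OF iN])
      also have "\<dots> = x i \<otimes> u (i, i)"
      proof (rule fs_single)
        fix k assume k: "k \<in> N" "k \<noteq> i"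
        have "x k = \<zero> \<or> u (k, i) = \<zero>" using uI[OF _ i, of k] k by (auto simp: x_def)
        then show "x k \<otimes> u (k, i) = \<zero>" using RV_entry[OF xR k(1)] MM_entry[OF um k(1) iN] by auto
      qed (use iN RV_entry[OF xR] MM_entry[OF um] in auto)
      also have "\<dots> = w i" using uI[OF i i] i iN RV_entry[OF WR[OF w] iN] by (simp add: x_def)
      finally show ?thesis using ye[OF iN] RV_entry[OF WR[OF w] iN] by (simp add: minus_eq r_neg)
    qed
    then have "\<not> piv ?y i" for i using y by (auto simp: Piv_def piv_def)
    then have y0: "?y = v0" using piv_ex[OF WR[OF y]] by blast
    have "w = x \<star> u"
    proof (rule RV_eqI[OF WR[OF w] vm_RV[OF xR um]])
      fix j assume j: "j \<in> N"
      have "w j \<ominus> (x \<star> u) j = \<zero>" using ye[OF j] y0 v_entry(3)[OF j] by simp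
      then have "(w j \<ominus> (x \<star> u) j) \<oplus> (x \<star> u) j = (x \<star> u) j" using RV_entry[OF vm_RV[OF xR um] j] by simp
      then show "w j = (x \<star> u) j" using RV_entry[OF WR[OF w] j] RV_entry[OF vm_RV[OF xR um] j] by (simp add: minus_eq a_assoc l_neg)
    qed
    then show "w \<in> img (VI ?I) u" using x by (auto simp: img_def)
  qed
  moreover have "img (VI ?I) u \<subseteq> W" using xuW by (auto simp: img_def)
  ultimately show ?thesis using u by blast
qed

lemma card_sub: assumes W: "sub W" shows "card W = q ^ card (Piv W)"
proof -
  obtain u where u: "u \<in> US F n {(i, j) \<in> Phi. i \<in> Piv W \<and> j \<notin> Piv W}" "W = img (VI (Piv W)) u" using rref[OF W] by blast
  have "u \<in> carrier G" by (rule US_Units[OF _ u(1)]) auto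
  then have "card (img (VI (Piv W)) u) = card (VI (Piv W))" by (intro card_img) (auto simp: VI_def)
  then show ?thesis using u(2) card_VI[OF Piv_N] by simp
qed

end

subsection \<open>Tableaux\<close>

lemma tableau_ex: assumes I: "I \<subseteq> {1..n}" shows "\<exists>s\<in>RStd n (card I). second_row s = I"
proof -
  have fin: "finite I" "finite ({1..n} - I)" using I finite_subset by auto
  let ?s = "(sorted_list_of_set ({1..n} - I), sorted_list_of_set I)"
  have "?s \<in> RStd n (card I)"
    using I fin by (auto simp: RStd_def card_Diff_subset)
  moreover have "second_row ?s = I" using fin by (simp add: second_row_def)
  ultimately show ?thesis by blast
qed

lemma tableau_unique: assumes s: "s \<in> RStd n m" and t: "t \<in> RStd n m" and e: "second_row s = second_row t" shows "s = t"
proof -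
  obtain xs ys where s': "s = (xs, ys)" by (cases s)
  obtain xs' ys' where t': "t = (xs', ys')" by (cases t)
  have a: "sorted_wrt (<) xs" "sorted_wrt (<) ys" "set xs \<inter> set ys = {}" "set xs \<union> set ys = {1..n}"
    using s by (auto simp: RStd_def s')
  have b: "sorted_wrt (<) xs'" "sorted_wrt (<) ys'" "set xs' \<inter> set ys' = {}" "set xs' \<union> set ys' = {1..n}"
    using t by (auto simp: RStd_def t')
  have y: "set ys = set ys'" using e by (simp add: second_row_def s' t')
  then have x: "set xs = set xs'" using a b by blast
  show ?thesis using strict_sorted_equal[OF a(1) b(1)] strict_sorted_equal[OF a(2) b(2)] x y s' t' by simp
qed

lemma finite_RStd: "finite (RStd n m)"
proof -
  have "RStd n m \<subseteq> {xs. set xs \<subseteq> {1..n} \<and> length xs = n - m} \<times> {ys. set ys \<subseteq> {1..n} \<and> length ys = m}"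
    by (auto simp: RStd_def)
  moreover have "finite ({xs. set xs \<subseteq> {1..n} \<and> length xs = n - m} \<times> {ys. set ys \<subseteq> {1..n} \<and> length ys = m})"
    by (intro finite_cartesian_product finite_lists_length_eq) auto
  ultimately show ?thesis by (rule finite_subset)
qed

lemma (in fchar) tab_RStd: "s \<in> RStd n m ==> tab F n \<theta> s m"
  by unfold_locales

context tab
begin

lemma img_d: "img (Wst m) d = VI I"
proof -
  have "img (Wst m) d \<subseteq> VI I"
  proof (clarsimp simp: img_def)
    fix v assume v: "v \<in> Wst m"
    have vR: "v \<in> RV" using v by (simp add: Wst_def)
    have "(v \<star> d) j = \<zero>" if j: "j \<in> N" "j \<notin> I" for j unfolding vm_entry[OF j(1)]
    proof (rule fs_zero)
      fix k assume k: "k \<in> N"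
      have "v k = \<zero> \<or> d (k, j) = \<zero>"
      proof (cases "j = sq k")
        case True then have "k \<le> n - m" using sq_I[OF k] j(2) by auto
        then show ?thesis using v k by (auto simp: Wst_def)
      qed (use d_entry[OF k j(1)] in auto)
      then show "v k \<otimes> d (k, j) = \<zero>" using RV_entry[OF vR k] MM_entry[OF d_MM k j(1)] by auto
    qed
    then show "v \<star> d \<in> VI I" using vm_RV[OF vR d_MM] by (simp add: VI_def)
  qed
  moreover have "card (img (Wst m) d) = card (VI I)"
  proof -
    have "card I = m" using distinct_card[of "snd s"] s_facts by (simp add: I_def second_row_def)
    then show ?thesis using card_img[OF subD(1)[OF Wst_sub] d_G] card_Wst[OF m_le] card_VI[OF I_N] by simp
  qed
  moreover have "finite (VI I)" using finite_subset[OF _ finite_RV] by (auto simp: VI_def)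
  ultimately show ?thesis by (intro card_subset_eq) auto
qed

text \<open>Pivots are invariant under \<open>U\<close>, so the tableau can be recovered from the
  double coset \<open>P d U\<close>.\<close>

lemma Piv_du: assumes u: "u \<in> US F n Phi" shows "Piv (img (Wst m) (d \<bullet> u)) = I"
proof -
  have W: "Wst m \<subseteq> RV" by (rule subD(1)[OF Wst_sub])
  have "img (Wst m) (d \<bullet> u) = img (VI I) u"
    using img_G[OF W d_G UU.H_sub[OF u]] img_d by simp
  then show ?thesis using Piv_U[OF u, of "VI I"] Piv_VI[OF I_N] by (simp add: VI_def)
qed

end

context fchar
begin

lemma sub_standard: assumes W: "sub W" and m: "card (Piv W) = m"
  shows "\<exists>s\<in>RStd n m. \<exists>u\<in>US F n (J_set n s). W = img (Wst m) (tab_perm F n s \<bullet> u)"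
proof -
  obtain s where s: "s \<in> RStd n m" "second_row s = Piv W" using tableau_ex[OF Piv_N[of W]] m by blast
  interpret tab F n \<theta> s m by (rule tab_RStd[OF s(1)])
  obtain u where u: "u \<in> US F n {(i, j) \<in> Phi. i \<in> Piv W \<and> j \<notin> Piv W}" "W = img (VI (Piv W)) u" using rref[OF W] by blast
  have J': "{(i, j) \<in> Phi. i \<in> Piv W \<and> j \<notin> Piv W} = J_set n s" using s(2) by (auto simp: J_set_def)
  have uJ: "u \<in> UJ" using u(1) unfolding J' J_def .
  have Ws: "Wst m \<subseteq> RV" by (rule subD(1)[OF Wst_sub])
  have "W = img (Wst m) (d \<bullet> u)"
    using u(2) img_G[OF Ws d_G SJ.H_sub[OF uJ]] img_d s(2) by (simp add: I_def)
  then show ?thesis using s(1) uJ by (auto simp: d_def J_def)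
qed

text \<open>The image of the standard subspace under \<open>g\<close> is brought to echelon form:
  its pivots give the tableau, and matrices with the same image of that subspace differ by a left
  factor from \<open>P\<close>.\<close>

lemma bruhat: assumes g: "g \<in> carrier G" and m: "m \<le> n"
  shows "\<exists>s\<in>RStd n m. \<exists>p\<in>PP m. \<exists>u\<in>US F n Phi. g = p \<bullet> (tab_perm F n s \<bullet> u)"
proof -
  have Ws: "Wst m \<subseteq> RV" by (rule subD(1)[OF Wst_sub])
  let ?W = "img (Wst m) g"
  have W: "sub ?W" by (rule img_sub[OF Wst_sub G_MM[OF g]])
  have "q ^ card (Piv ?W) = q ^ m" using card_sub[OF W] card_img[OF Ws g] card_Wst[OF m] by simp
  then have c: "card (Piv ?W) = m" using q_ge2 power_inject_exp[of q] by simp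
  obtain s u where su: "s \<in> RStd n m" "u \<in> US F n (J_set n s)" "?W = img (Wst m) (tab_perm F n s \<bullet> u)"
    using sub_standard[OF W c] by blast
  interpret tab F n \<theta> s m by (rule tab_RStd[OF su(1)])
  have uJ: "u \<in> UJ" using su(2) by (simp add: J_def)
  note uG = SJ.H_sub[OF uJ]
  let ?h = "d \<bullet> u"
  have hG: "?h \<in> carrier G" using d_G uG by simp
  let ?p = "g \<bullet> ginv ?h"
  have pG: "?p \<in> carrier G" using g hG by simp
  have "img (Wst m) ?p = img ?W (ginv ?h)" using img_G[OF Ws g G.inv_closed[OF hG]] by simp
  also have "\<dots> = Wst m" using su(3) img_inv(1)[OF Ws hG] by (simp add: d_def)
  finally have "?p \<in> PP m" using PP_img[OF pG] by simp
  moreover have "g = ?p \<bullet> ?h" using g hG by (simp add: G.m_assoc)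
  ultimately show ?thesis using su(1) UJ_U[OF uJ] unfolding d_def by blast
qed

lemma bruhat_unique:
  assumes s: "s \<in> RStd n m" and t: "t \<in> RStd n m" and p: "p \<in> PP m" "p' \<in> PP m" and u: "u \<in> US F n Phi" "u' \<in> US F n Phi"
    and e: "p \<bullet> (tab_perm F n s \<bullet> u) = p' \<bullet> (tab_perm F n t \<bullet> u')"
  shows "s = t"
proof -
  interpret s: tab F n \<theta> s m by (rule tab_RStd[OF s])
  interpret t: tab F n \<theta> t m by (rule tab_RStd[OF t])
  have Ws: "Wst m \<subseteq> RV" by (rule subD(1)[OF Wst_sub])
  have pG: "p \<in> carrier G" "p' \<in> carrier G" using p by (auto simp: PP_iff)
  have st: "img (Wst m) p = Wst m" "img (Wst m) p' = Wst m" using PP_img pG p by auto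
  have 1: "img (Wst m) (p \<bullet> (s.d \<bullet> u)) = img (Wst m) (s.d \<bullet> u)"
    using img_G[OF Ws pG(1), of "s.d \<bullet> u"] st s.d_G UU.H_sub[OF u(1)] by simp
  have 2: "img (Wst m) (p' \<bullet> (t.d \<bullet> u')) = img (Wst m) (t.d \<bullet> u')"
    using img_G[OF Ws pG(2), of "t.d \<bullet> u'"] st t.d_G UU.H_sub[OF u(2)] by simp
  have "s.I = t.I" using s.Piv_du[OF u(1)] t.Piv_du[OF u(2)] 1 2 e by (simp add: s.d_def t.d_def)
  then show ?thesis using tableau_unique[OF s t] by (simp add: s.I_def t.I_def)
qed

end

section \<open>Decompositions\<close>

lemma span_UN_ex:
  assumes K: "finite K" and W: "\<And>k. k \<in> K ==> cfun.subspace (W k)" and f: "f \<in> cfun.span (\<Union>k\<in>K. W k)"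
  shows "\<exists>w. (\<forall>k\<in>K. w k \<in> W k) \<and> f = (\<Sum>k\<in>K. w k)"
  using f
proof (induction rule: cfun.span_induct_alt)
  case base
  show ?case
    by (rule exI[of _ "\<lambda>_. 0"]) (use csubspaceD(1)[OF W] in \<open>auto simp: zero_fun_def[symmetric]\<close>)
next
  case (step c x y)
  obtain w where w: "\<forall>k\<in>K. w k \<in> W k" "y = (\<Sum>k\<in>K. w k)" using step by blast
  obtain j where j: "j \<in> K" "x \<in> W j" using step by blast
  let ?w = "\<lambda>k. if k = j then (\<lambda>z. c * x z) + w k else w k"
  have "?w k \<in> W k" if "k \<in> K" for k
    using that w(1) j csubspaceD(2,3)[OF W[OF that]] by auto
  moreover have "(\<lambda>z. c * x z) + y = (\<Sum>k\<in>K. ?w k)"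
  proof -
    have "(\<Sum>k\<in>K. ?w k) = ?w j + (\<Sum>k\<in>K - {j}. ?w k)" by (rule sum.remove[OF K j(1)])
    also have "(\<Sum>k\<in>K - {j}. ?w k) = (\<Sum>k\<in>K - {j}. w k)" by (rule sum.cong) auto
    also have "?w j + (\<Sum>k\<in>K - {j}. w k) = (\<lambda>z. c * x z) + (w j + (\<Sum>k\<in>K - {j}. w k))" by (simp only: if_True refl simp_thms add.assoc)
    also have "w j + (\<Sum>k\<in>K - {j}. w k) = y" unfolding w(2) by (rule sum.remove[OF K j(1), symmetric])
    finally show ?thesis by (rule sym)
  qed
  ultimately show ?case by (intro exI[of _ ?w]) blast
qed

context fmat
begin

lemma card_supp: assumes S: "S \<subseteq> N \<times> N" shows "card {A \<in> MM. supp F n A = S} = (q - 1) ^ card S"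
proof -
  have fin: "finite S" using S finite_subset by blast
  have "bij_betw (\<lambda>A. restrict A S) {A \<in> MM. supp F n A = S} (S \<rightarrow>\<^sub>E carrier F - {\<zero>})"
  proof (rule bij_betw_byWitness[where f'="\<lambda>f. \<lambda>e\<in>N\<times>N. if e \<in> S then f e else \<zero>"])
    show "\<forall>A\<in>{A \<in> MM. supp F n A = S}. (\<lambda>e\<in>N\<times>N. if e \<in> S then restrict A S e else \<zero>) = A"
    proof
      fix A assume A: "A \<in> {A \<in> MM. supp F n A = S}"
      show "(\<lambda>e\<in>N\<times>N. if e \<in> S then restrict A S e else \<zero>) = A"
        by (rule mat_eqI) (use A in \<open>auto simp: MM_entry supp_def intro!: MM_restrict\<close>)
    qed
    show "\<forall>f\<in>S \<rightarrow>\<^sub>E carrier F - {\<zero>}. restrict (\<lambda>e\<in>N\<times>N. if e \<in> S then f e else \<zero>) S = f"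
    proof (intro ballI extensionalityI[of _ S])
      fix f e assume "f \<in> S \<rightarrow>\<^sub>E carrier F - {\<zero>}" "e \<in> S"
      then show "restrict (\<lambda>e\<in>N\<times>N. if e \<in> S then f e else \<zero>) S e = f e" using S by auto
    qed (auto simp: PiE_def)
    show "(\<lambda>A. restrict A S) ` {A \<in> MM. supp F n A = S} \<subseteq> S \<rightarrow>\<^sub>E carrier F - {\<zero>}"
    proof (rule image_subsetI)
      fix A assume A: "A \<in> {A \<in> MM. supp F n A = S}"
      have "A e \<in> carrier F - {\<zero>}" if e: "e \<in> S" for e
      proof -
        have "e \<in> supp F n A" using A e by simp
        then show ?thesis using A MM_entry[of A "fst e" "snd e"] by (auto simp: supp_def)
      qed
      then show "restrict A S \<in> S \<rightarrow>\<^sub>E carrier F - {\<zero>}" by (simp add: restrict_PiE_iff)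
    qed
    show "(\<lambda>f. \<lambda>e\<in>N\<times>N. if e \<in> S then f e else \<zero>) ` (S \<rightarrow>\<^sub>E carrier F - {\<zero>}) \<subseteq> {A \<in> MM. supp F n A = S}"
    proof (rule image_subsetI)
      fix f assume f: "f \<in> S \<rightarrow>\<^sub>E carrier F - {\<zero>}"
      then have fe: "f e \<in> carrier F" "f e \<noteq> \<zero>" if "e \<in> S" for e using that by (auto simp: PiE_iff)
      show "(\<lambda>e\<in>N\<times>N. if e \<in> S then f e else \<zero>) \<in> {A \<in> MM. supp F n A = S}"
        using fe S by (auto simp: supp_def intro!: MM_restrict)
    qed
  qed
  then show ?thesis using fin fin_F by (simp add: bij_betw_same_card card_PiE card_Diff_subset One_nat_def)
qed

end

context tab
begin

definition "VG = {A \<in> VJ. verge F n A}"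

lemma VG_D: "A \<in> VG ==> A \<in> VJ" "A \<in> VG ==> verge F n A" by (auto simp: VG_def)

lemma orb_VG: assumes A: "A \<in> VJ" shows "\<exists>B\<in>VG. orb A = orb B"
proof -
  obtain B where B: "B \<in> VJ" "verge F n B" "eb B \<in> orb A" using verge_exists[OF A] by blast
  then have "B \<in> VG" "orb A = orb B" using orb_same[OF A B(1,3)] by (auto simp: VG_def)
  then show ?thesis by blast
qed

lemma orb_inj: "inj_on orb VG"
proof (rule inj_onI)
  fix A B assume a: "A \<in> VG" "B \<in> VG" "orb A = orb B"
  then show "A = B" using orb_verge_unique[OF VG_D[OF a(1)] VG_D[OF a(2)]] orb_self[OF VG_D(1)[OF a(2)]] by simp
qed

lemma CO_inj: "inj_on CO VG"
proof (rule inj_onI)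
  fix A B assume a: "A \<in> VG" "B \<in> VG" "CO A = CO B"
  then have "orb A = orb B" using CO_eq_iff[OF VG_D(1)[OF a(1)] VG_D(1)[OF a(2)]] by simp
  then show "A = B" using inj_onD[OF orb_inj] a by blast
qed

lemma CO_VG: "CO ` VJ = CO ` VG"
proof
  show "CO ` VJ \<subseteq> CO ` VG"
  proof (rule image_subsetI)
    fix A assume "A \<in> VJ"
    then obtain B where "B \<in> VG" "orb A = orb B" using orb_VG by blast
    then show "CO A \<in> CO ` VG" unfolding CO_def by auto
  qed
qed (auto simp: VG_def)

lemma VG_main: "A \<in> VJ ==> A \<in> VG \<longleftrightarrow> main_condition_set n (supp F n A)"
  using hook_verge[of A] hook.mcs[OF verge_hook, of A] by (auto simp: VG_def)

lemma VJ_fits: assumes A: "A \<in> VJ" shows "fst ` supp F n A \<subseteq> second_row s" "snd ` supp F n A \<inter> second_row s = {}"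
proof -
  have "supp F n A \<subseteq> J" using A by (simp add: VS_def)
  then show "fst ` supp F n A \<subseteq> second_row s" "snd ` supp F n A \<inter> second_row s = {}"
    by (auto simp: J_def J_set_def)
qed

lemma fits_J: "p \<subseteq> Phi ==> fits p s ==> p \<subseteq> J"
  by (force simp: fits_def J_def J_set_def)

lemma supp_VJ: "A \<in> MM ==> supp F n A \<subseteq> J ==> A \<in> VJ" by (simp add: VS_def)

text \<open>An isomorphism commutes with right multiplication by \<open>lid J A\<close>, so the
  image of \<open>e_A\<close> is an eigenvector of \<open>UJ\<close> with the same character; its
  target can only be the orbit module that contains \<open>e_A\<close>.\<close>

lemma M_multiplicity_free: "multiplicity_free (U F n) (M_tab F n s)"
  unfolding multiplicity_free_def M_tab_eq decomposition_iff
proof (intro conjI allI impI ballI)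
  fix D V W assume D: "D = CO ` VJ" and V: "V \<in> D" and W: "W \<in> D"
    and iso: "mod_iso (U F n) ((UM Ms)\<lparr>mspace := V\<rparr>) ((UM Ms)\<lparr>mspace := W\<rparr>)"
  obtain A B where A: "A \<in> VJ" "V = CO A" and B: "B \<in> VJ" "W = CO B" using V W unfolding D by blast
  obtain \<phi> where bij: "bij_betw \<phi> (CO A) (CO B)"
    and sc: "\<And>v c. v \<in> CO A ==> \<phi> (\<lambda>x. c * v x) = (\<lambda>y. c * \<phi> v y)"
    and act: "\<And>v a. v \<in> CO A ==> a \<in> CU ==> \<phi> (v \<odot> a) = \<phi> v \<odot> a"
    using iso unfolding mod_iso_def U_eq A(2) B(2) by auto
  have e: "eb A \<in> CO A" by (rule orb_CO[OF orb_self[OF A(1)]])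
  have z: "(\<lambda>_. 0) \<in> CO A" by (rule csubspaceD(1)[OF CO_subspace])
  have z0: "\<phi> (\<lambda>_. 0) = (\<lambda>_. 0)" using sc[OF z, of 0] by simp
  have "\<phi> (eb A) \<noteq> (\<lambda>_. 0)" using bij_betw_imp_inj_on[OF bij] e z z0 eb_nz[OF A(1)] by (metis inj_onD)
  moreover have "\<phi> (eb A) = \<phi> (eb A) \<odot> lid J A"
  proof -
    have "\<phi> (eb A) = \<phi> (eb A \<odot> lid J A)" using eb_lid[OF A(1) A(1)] by simp
    also have "\<dots> = \<phi> (eb A) \<odot> lid J A" by (rule act[OF e lid_J_CU])
    finally show ?thesis .
  qed
  ultimately have "\<phi> (eb A) \<odot> lid J A \<noteq> (\<lambda>_. 0)" by simp
  moreover have "\<phi> (eb A) \<in> CO B" using bij e by (auto simp: bij_betw_def)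
  ultimately have "eb A \<in> orb B" using orb_lid[OF B(1) A(1)] by blast
  then show "V = W" using orb_same[OF B(1) A(1)] A B by (simp add: CO_def)
qed blast

lemma M_constituents:
  "irreducible_constituent (U F n) (M_tab F n s) S \<longleftrightarrow>
     (\<exists>A\<in>VG. mod_iso (U F n) S (orbit_mod F \<theta> n s A))"
  unfolding irreducible_constituent_def M_tab_eq decomposition_iff CO_VG orbit_mod_eq by auto

lemma CO_iso: assumes A: "A \<in> VG" shows "mod_iso (U F n) (hook_mod F \<theta> n A) (orbit_mod F \<theta> n s A)"
  unfolding orbit_mod_eq by (rule verge_iso) (use A VG_D in auto)

lemma card_orb_VG: "A \<in> VG ==> card (orb A) = q ^ card (Phi - R_hat n (supp F n A))"
  by (rule verge_card) (auto dest: VG_D)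

lemma dim_CO_VG: "A \<in> VG ==> cfun.dim (CO A) = q ^ card (Phi - R_hat n (supp F n A))"
  using CO_dim[OF VG_D(1)] card_orb_VG by simp

lemma card_orbits:
  assumes p: "main_condition_set n p" "fits p s"
  shows "card {orbit F \<theta> n s A | A. A \<in> VS F n (J_set n s) \<and> supp F n A = p \<and> verge F n A} = (q - 1) ^ card p"
proof -
  have pP: "p \<subseteq> Phi" using p by (simp add: main_condition_set_def)
  have "{orbit F \<theta> n s A | A. A \<in> VS F n (J_set n s) \<and> supp F n A = p \<and> verge F n A} = orb ` {A \<in> MM. supp F n A = p}"
  proof -
    have "A \<in> VS F n (J_set n s) \<and> supp F n A = p \<and> verge F n A \<longleftrightarrow> A \<in> MM \<and> supp F n A = p" for A
      using supp_VJ[of A] fits_J[OF pP p(2)] VG_main[of A] p(1) VS_MM[of A J] unfolding J_def[symmetric] VG_def by auto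
    then show ?thesis unfolding orb_def by auto
  qed
  moreover have "inj_on orb {A \<in> MM. supp F n A = p}"
    by (rule inj_on_subset[OF orb_inj]) (use supp_VJ fits_J[OF pP p(2)] VG_main p(1) in auto)
  ultimately show ?thesis using card_supp[of p] pP Phi_NN by (simp add: card_image)
qed

text \<open>Verges index the constituents, the dimension depends on the support only, and each
  support \<open>p\<close> carries \<open>(q - 1) ^ card p\<close> matrices. The index set of the
  sum does not involve the field.\<close>

lemma card_constituents:
  assumes D: "irreducible_decomposition (U F n) (M_tab F n s) D"
  shows "card {W \<in> D. cfun.dim W = q ^ c} =
    (\<Sum>p\<in>{p. main_condition_set n p \<and> p \<subseteq> J_set n s \<and> card (Phi - R_hat n p) = c}. (q - 1) ^ card p)"
proof -
  let ?P = "{p. main_condition_set n p \<and> p \<subseteq> J_set n s \<and> card (Phi - R_hat n p) = c}"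
  let ?V = "{A \<in> VG. card (Phi - R_hat n (supp F n A)) = c}"
  have D': "D = CO ` VG" using D unfolding M_tab_eq decomposition_iff CO_VG .
  have fP: "finite ?P" by (rule finite_subset[of _ "Pow J"]) (use finite_sub_Phi[OF J_Phi] in \<open>auto simp: J_def\<close>)
  have qi: "q ^ a = q ^ b \<longleftrightarrow> a = b" for a b using q_ge2 power_inject_exp[of q] by simp
  have "{W \<in> D. cfun.dim W = q ^ c} = CO ` ?V" using dim_CO_VG qi by (auto simp: D')
  then have "card {W \<in> D. cfun.dim W = q ^ c} = card ?V" using inj_on_subset[OF CO_inj, of ?V] by (simp add: card_image)
  also have "?V = (\<Union>p\<in>?P. {A \<in> MM. supp F n A = p})"
  proof (intro equalityI subsetI)
    fix A assume A: "A \<in> ?V"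
    then have "main_condition_set n (supp F n A)" using VG_main VG_D by blast
    moreover have "supp F n A \<subseteq> J_set n s" "A \<in> MM" using A VG_D(1)[of A] by (auto simp: VS_def J_def)
    ultimately show "A \<in> (\<Union>p\<in>?P. {A \<in> MM. supp F n A = p})" using A by auto
  next
    fix A assume "A \<in> (\<Union>p\<in>?P. {A \<in> MM. supp F n A = p})"
    then have A: "A \<in> MM" "main_condition_set n (supp F n A)" "supp F n A \<subseteq> J" "card (Phi - R_hat n (supp F n A)) = c" by (auto simp: J_def)
    then show "A \<in> ?V" using VG_main[OF supp_VJ[OF A(1,3)]] by simp
  qed
  also have "card \<dots> = (\<Sum>p\<in>?P. card {A \<in> MM. supp F n A = p})"
    by (rule card_UN_disjoint[OF fP]) (use finite_MM in auto)
  also have "\<dots> = (\<Sum>p\<in>?P. (q - 1) ^ card p)"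
  proof (rule sum.cong[OF refl])
    fix p assume "p \<in> ?P"
    then have "p \<subseteq> N \<times> N" using J_NN by (auto simp: J_def)
    then show "card {A \<in> MM. supp F n A = p} = (q - 1) ^ card p" by (rule card_supp)
  qed
  finally show ?thesis .
qed

lemma eb_SO: assumes B: "B \<in> VJ" shows "\<exists>A\<in>VG. eb B \<in> CO A"
proof -
  obtain A where A: "A \<in> VG" "orb B = orb A" using orb_VG[OF B] by blast
  then show ?thesis using orb_CO[OF orb_self[OF B]] by (auto simp: CO_def)
qed

lemma Ms_VG: "Ms \<subseteq> cfun.span (\<Union>A\<in>VG. CO A)"
  unfolding Ms_span using eb_SO by (intro cfun.span_mono) blast

end

subsection \<open>The permutation module on flags with one member\<close>

context fchar
begin

abbreviation "SO s A \<equiv> cfun.span (orbit F \<theta> n s A)"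
definition "LM m = mspace (M_lam F n m)"

sublocale GG: subgroup_alg G "carrier G"
  by (intro subgroup_alg.intro subgroup_alg_axioms.intro G.subgroup_self G.fin_group_axioms)

lemma LM_eq: "LM m = GG.rid (P_bar F n m)"
  by (simp add: LM_def M_lam_def cyclic_mod_def GG.rid_def group_algebra_def)

lemma M_lam_eq: "M_lam F n m = UM (LM m)"
  by (simp add: LM_def M_lam_def cyclic_mod_def)

lemma LM_alg: "LM m \<subseteq> group_algebra G" unfolding LM_eq by (rule GG.rid_alg)

lemma LM_module: "cg_module (U F n) (UM (LM m))"
  unfolding U_eq
proof (rule UU.rt_module)
  show "cfun.subspace (LM m)" unfolding LM_eq by (rule GG.rid_subspace)
  show "LM m \<subseteq> group_algebra G" by (rule LM_alg)
  fix v h assume "v \<in> LM m" "h \<in> US F n Phi"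
  then show "v \<odot> sg h \<in> LM m" unfolding LM_eq using GG.rid_closed GG.single_GH[OF UU.H_sub] by blast
qed

lemma SO_eq: assumes s: "s \<in> RStd n m" shows "SO s A = tab.CO F n \<theta> s A"
proof -
  interpret tab F n \<theta> s m by (rule tab_RStd[OF s])
  show ?thesis by (simp add: CO_def orb_def)
qed

lemma Ms_LM: assumes s: "s \<in> RStd n m" shows "UU.rid (P_bar_d F n s) \<subseteq> LM m"
proof -
  interpret tab F n \<theta> s m by (rule tab_RStd[OF s])
  have e: "P_bar_d F n s = P_bar F n m \<odot> sg d" by (simp add: P_bar_d_def s_facts d_def)
  show ?thesis
  proof
    fix f assume "f \<in> UU.rid (P_bar_d F n s)"
    then obtain a where a: "a \<in> CU" "f = P_bar F n m \<odot> (sg d \<odot> a)" by (auto simp: UU.rid_def e G.ga_mult_assoc)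
    then show "f \<in> LM m" using ga_mult_alg[of G "sg d" a] by (auto simp: LM_eq GG.rid_def group_algebra_def)
  qed
qed

lemma P_bar_P: assumes p: "p \<in> PP m" shows "P_bar F n m \<odot> sg p = P_bar F n m"
proof (rule ext)
  fix x
  have pG: "p \<in> carrier G" using p by (simp add: PP_iff)
  show "(P_bar F n m \<odot> sg p) x = P_bar F n m x"
  proof (cases "x \<in> carrier G")
    case True
    have "x \<bullet> ginv p \<in> PP m \<longleftrightarrow> x \<in> PP m"
    proof
      assume "x \<bullet> ginv p \<in> PP m"
      then have "x \<bullet> ginv p \<bullet> p \<in> PP m" using p subgroup.m_closed[OF PP_subgroup] by blast
      then show "x \<in> PP m" using True pG by (simp add: G.m_assoc)
    next
      assume "x \<in> PP m" then show "x \<bullet> ginv p \<in> PP m"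
        using p subgroup.m_closed[OF PP_subgroup] subgroup.m_inv_closed[OF PP_subgroup] by blast
    qed
    then show ?thesis using True pG by (simp add: G.rt_eq P_bar_def PP_def)
  next
    case False
    then have "x \<notin> PP m" by (auto simp: PP_iff)
    then show ?thesis using False pG by (simp add: G.rt_eq P_bar_def PP_def)
  qed
qed

text \<open>By the Bruhat decomposition every translate of \<open>P_bar\<close> is a translate by
  \<open>U\<close> of some \<open>P_bar d\<close>.\<close>

lemma LM_span: assumes m: "m \<le> n"
  shows "LM m \<subseteq> cfun.span (\<Union>s\<in>RStd n m. UU.rid (P_bar_d F n s))" (is "_ \<subseteq> cfun.span ?X")
proof
  fix f assume "f \<in> LM m"
  then obtain a where a: "a \<in> group_algebra G" "f = P_bar F n m \<odot> a" by (auto simp: LM_eq GG.rid_def group_algebra_def)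
  have "P_bar F n m \<odot> sg g \<in> cfun.span ?X" if g: "g \<in> carrier G" for g
  proof -
    obtain s p u where s: "s \<in> RStd n m" "p \<in> PP m" "u \<in> US F n Phi" "g = p \<bullet> (tab_perm F n s \<bullet> u)" using bruhat[OF g m] by blast
    interpret tab F n \<theta> s m by (rule tab_RStd[OF s(1)])
    have e: "P_bar_d F n s = P_bar F n m \<odot> sg d" by (simp add: P_bar_d_def s_facts d_def)
    have pG: "p \<in> carrier G" using s(2) by (simp add: PP_iff)
    have "P_bar F n m \<odot> sg g = P_bar F n m \<odot> sg p \<odot> sg d \<odot> sg u"
      using pG d_G UU.H_sub[OF s(3)] s(4) by (simp add: G.ga_mult_assoc G.ga_mult_single G.m_assoc d_def)
    then have "P_bar F n m \<odot> sg g = P_bar_d F n s \<odot> sg u" by (simp add: P_bar_P[OF s(2)] e)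
    then have "P_bar F n m \<odot> sg g \<in> UU.rid (P_bar_d F n s)" using UU.single_GH[OF s(3)] by (auto simp: UU.rid_def)
    then show ?thesis using s(1) by (intro cfun.span_base) blast
  qed
  then show "f \<in> cfun.span ?X" unfolding a(2)
    by (subst G.ga_mult_sum) (rule csubspace_comb[OF cfun.subspace_span])
qed

text \<open>The index set is left abstract: any enumeration of the pairs of a tableau and a verge
  will do, so the nested sum of the final statement can be matched afterwards.\<close>

lemma LM_decomp:
  assumes m: "m \<le> n" and K: "finite K"
    and \<sigma>: "bij_betw \<sigma> K (SIGMA s:RStd n m. {A \<in> VS F n (J_set n s). verge F n A})"
  shows "mod_iso (U F n) (direct_sum K (\<lambda>k. hook_mod F \<theta> n (snd (\<sigma> k)))) (M_lam F n m)"
  unfolding M_lam_eq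
proof (rule direct_sum_internal[where W="\<lambda>k. SO (fst (\<sigma> k)) (snd (\<sigma> k))", OF K LM_module])
  have \<sigma>1: "fst (\<sigma> k) \<in> RStd n m" "snd (\<sigma> k) \<in> VS F n (J_set n (fst (\<sigma> k)))" "verge F n (snd (\<sigma> k))" if "k \<in> K" for k
    using bij_betwE[OF \<sigma>] that by force+
  have SO: "cfun.subspace (SO s A)" "SO s A \<subseteq> UU.rid (P_bar_d F n s)"
      "mod_iso (U F n) (hook_mod F \<theta> n A) (UM (SO s A))"
    if s: "s \<in> RStd n m" and A: "A \<in> VS F n (J_set n s)" "verge F n A" for s A
  proof -
    interpret tab F n \<theta> s m by (rule tab_RStd[OF s])
    have AJ: "A \<in> VJ" using A by (simp add: J_def)
    show "cfun.subspace (SO s A)" by (rule cfun.subspace_span)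
    show "SO s A \<subseteq> UU.rid (P_bar_d F n s)" using CO_Ms[OF AJ] by (simp add: SO_eq[OF s] Pd_def)
    show "mod_iso (U F n) (hook_mod F \<theta> n A) (UM (SO s A))" using verge_iso[OF AJ A(2)] by (simp add: SO_eq[OF s])
  qed
  fix k assume k: "k \<in> K"
  show "SO (fst (\<sigma> k)) (snd (\<sigma> k)) \<subseteq> mspace (UM (LM m))" using SO(2)[OF \<sigma>1[OF k]] Ms_LM[OF \<sigma>1(1)[OF k]] by simp
  show "mod_iso (U F n) (hook_mod F \<theta> n (snd (\<sigma> k))) ((UM (LM m))\<lparr>mspace := SO (fst (\<sigma> k)) (snd (\<sigma> k))\<rparr>)"
    using SO(3)[OF \<sigma>1[OF k]] by simp
next
  have \<sigma>1: "fst (\<sigma> k) \<in> RStd n m" "snd (\<sigma> k) \<in> VS F n (J_set n (fst (\<sigma> k)))" "verge F n (snd (\<sigma> k))" if "k \<in> K" for k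
    using bij_betwE[OF \<sigma>] that by force+
  fix v assume "v \<in> mspace (UM (LM m))"
  then have v: "v \<in> LM m" by simp
  let ?W = "\<lambda>k. SO (fst (\<sigma> k)) (snd (\<sigma> k))"
  show "\<exists>!f. f \<in> (\<Pi>\<^sub>E i\<in>K. ?W i) \<and> v = (\<Sum>i\<in>K. f i)"
  proof (rule orth_decomp[OF K G.fin_G])
    fix k assume "k \<in> K" show "cfun.subspace (?W k)" by (rule cfun.subspace_span)
  next
    fix k f x assume k: "k \<in> K" "f \<in> ?W k" "x \<notin> carrier G"
    interpret tab F n \<theta> "fst (\<sigma> k)" m by (rule tab_RStd[OF \<sigma>1(1)[OF k(1)]])
    have "f \<in> group_algebra G"
      using k(2) CO_Ms[of "snd (\<sigma> k)"] Ms_alg \<sigma>1[OF k(1)] by (auto simp: SO_eq[OF \<sigma>1(1)[OF k(1)]] J_def)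
    then show "f x = 0" using k(3) by (simp add: group_algebra_def)
  next
    fix k l f g assume k: "k \<in> K" and l: "l \<in> K" and ne: "k \<noteq> l" and f: "f \<in> ?W k" and g: "g \<in> ?W l"
    interpret k: tab F n \<theta> "fst (\<sigma> k)" m by (rule tab_RStd[OF \<sigma>1(1)[OF k]])
    interpret l: tab F n \<theta> "fst (\<sigma> l)" m by (rule tab_RStd[OF \<sigma>1(1)[OF l]])
    have Ak: "snd (\<sigma> k) \<in> VS F n k.J" and Al: "snd (\<sigma> l) \<in> VS F n l.J" using \<sigma>1[OF k] \<sigma>1[OF l] by (auto simp: k.J_def l.J_def)
    have f': "f \<in> k.CO (snd (\<sigma> k))" using f by (simp add: SO_eq[OF \<sigma>1(1)[OF k]])
    have g': "g \<in> l.CO (snd (\<sigma> l))" using g by (simp add: SO_eq[OF \<sigma>1(1)[OF l]])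
    have ne': "\<sigma> k \<noteq> \<sigma> l" using bij_betw_imp_inj_on[OF \<sigma>] k l ne by (auto dest: inj_onD)
    show "ip (carrier G) f g = 0"
    proof (cases "fst (\<sigma> k) = fst (\<sigma> l)")
      case True
      then have sne: "snd (\<sigma> k) \<noteq> snd (\<sigma> l)" using ne' by (simp add: prod_eq_iff)
      have Al': "snd (\<sigma> l) \<in> VS F n k.J" "g \<in> k.CO (snd (\<sigma> l))" using Al g' by (simp_all add: True k.J_def l.J_def)
      have "k.orb (snd (\<sigma> k)) \<noteq> k.orb (snd (\<sigma> l))"
        using k.orb_verge_unique[OF Ak \<sigma>1(3)[OF k] Al'(1) \<sigma>1(3)[OF l]] k.orb_self[OF Al'(1)] sne by auto
      then show ?thesis using k.CO_orth[OF Ak Al'(1) _ f' Al'(2)] by blast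
    next
      case False
      \<comment> \<open>For different tableaux the supports lie in different double cosets
        \<open>P d U\<close>, and these are disjoint by \<open>bruhat_unique\<close>.\<close>
      have "f x * cnj (g x) = 0" if x: "x \<in> carrier G" for x
      proof (rule ccontr)
        assume "f x * cnj (g x) \<noteq> 0"
        then have nz: "f x \<noteq> 0" "g x \<noteq> 0" by auto
        obtain p u where pu: "p \<in> k.P" "u \<in> US F n Phi" "x = p \<bullet> k.d \<bullet> u" using k.Ms_supp[of f x] x nz(1) f' k.CO_Ms[OF Ak] by blast
        obtain p' u' where pu': "p' \<in> l.P" "u' \<in> US F n Phi" "x = p' \<bullet> l.d \<bullet> u'" using l.Ms_supp[of g x] x nz(2) g' l.CO_Ms[OF Al] by blast
        have pG: "p \<in> carrier G" "p' \<in> carrier G" using pu(1) pu'(1) by (auto simp: k.P_def l.P_def PP_iff)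
        have "p \<bullet> (k.d \<bullet> u) = p' \<bullet> (l.d \<bullet> u')"
          using pu pu' pG k.d_G l.d_G UU.H_sub by (simp add: G.m_assoc)
        then have "fst (\<sigma> k) = fst (\<sigma> l)"
          using bruhat_unique[OF \<sigma>1(1)[OF k] \<sigma>1(1)[OF l] _ _ pu(2) pu'(2)] pu(1) pu'(1) by (simp add: k.P_def l.P_def k.d_def l.d_def)
        then show False using False by simp
      qed
      then show ?thesis unfolding ip_def by (intro sum.neutral ballI)
    qed
  next
    have "UU.rid (P_bar_d F n s) \<subseteq> cfun.span (\<Union>k\<in>K. ?W k)" if s: "s \<in> RStd n m" for s
    proof -
      interpret tab F n \<theta> s m by (rule tab_RStd[OF s])
      have "CO A \<subseteq> (\<Union>k\<in>K. ?W k)" if A: "A \<in> VG" for A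
      proof -
        have "(s, A) \<in> (SIGMA s:RStd n m. {A \<in> VS F n (J_set n s). verge F n A})" using s A by (auto simp: VG_def J_def)
        then obtain k where k: "k \<in> K" "\<sigma> k = (s, A)" unfolding bij_betw_imp_surj_on[OF \<sigma>, symmetric] by auto
        have "?W k = CO A" using k(2) SO_eq[OF s] by simp
        then show ?thesis using UN_upper[OF k(1), of ?W] by simp
      qed
      then have "(\<Union>A\<in>VG. CO A) \<subseteq> (\<Union>k\<in>K. ?W k)" by blast
      then show ?thesis using Ms_VG cfun.span_mono[of "\<Union>A\<in>VG. CO A" "\<Union>k\<in>K. ?W k"] unfolding Pd_def by (meson subset_trans)
    qed
    note S = this
    have "LM m \<subseteq> cfun.span (\<Union>k\<in>K. ?W k)"
      by (rule subset_trans[OF LM_span[OF m] cfun.span_minimal[OF _ cfun.subspace_span]]) (use S in \<open>simp add: UN_subset_iff\<close>)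
    then show "\<exists>f. (\<forall>i\<in>K. f i \<in> ?W i) \<and> v = (\<Sum>i\<in>K. f i)"
      using span_UN_ex[OF K, of ?W v] v cfun.subspace_span by blast
  qed
qed

text \<open>The pairs of a tableau and a verge are regrouped by the support \<open>p\<close> of the
  verge. For fixed \<open>p\<close> the matrix and the tableau are chosen independently, which
  produces the multiplicity \<open>fit_mult\<close>.\<close>

lemma M_lam_iso:
  assumes m: "m \<le> n"
  shows "mod_iso (U F n) (M_lam F n m)
          (direct_sum (fitting_sets n m) (\<lambda>p.
             direct_sum {A \<in> carrier (mat_ring F n). supp F n A = p} (\<lambda>A.
               mod_copies (fit_mult n m p) (hook_mod F \<theta> n A))))"
proof -
  let ?Fit = "fitting_sets n m"
  let ?AA = "\<lambda>p. {A \<in> MM. supp F n A = p}"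
  let ?J = "\<lambda>p. Sigma (?AA p) (\<lambda>_. {..<fit_mult n m p})"
  let ?K = "Sigma ?Fit ?J"
  let ?S = "\<lambda>p. {s \<in> RStd n m. fits p s}"
  have fitP: "p \<subseteq> Phi" "main_condition_set n p" if "p \<in> ?Fit" for p using that by (auto simp: fitting_sets_def main_condition_set_def)
  have finFit: "finite ?Fit" by (rule finite_subset[of _ "Pow Phi"]) (use fitP finite_Phi in auto)
  have finS: "finite (?S p)" for p using finite_RStd by auto
  have "\<exists>f. bij_betw f {..<fit_mult n m p} (?S p)" for p
    using ex_bij_betw_nat_finite[OF finS[of p]] by (simp add: fit_mult_def atLeast0LessThan)
  then obtain sp where sp: "\<And>p. bij_betw (sp p) {..<fit_mult n m p} (?S p)" by metis
  \<comment> \<open>An index has the form \<open>(p, (A, i))\<close>, where \<open>i\<close> numbers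
    the copies and \<open>sp p\<close> translates it into a tableau that \<open>p\<close>
    fits.\<close>
  define \<sigma> where "\<sigma> = (\<lambda>k. (sp (fst k) (snd (snd k)), fst (snd k)) :: tableau \<times> 'f matrix)"
  have AA: "A \<in> VS F n (J_set n s) \<and> verge F n A" if "p \<in> ?Fit" "A \<in> ?AA p" "s \<in> ?S p" for p A s
  proof -
    interpret tab F n \<theta> s m by (rule tab_RStd) (use that in auto)
    have "supp F n A \<subseteq> J" using fits_J[OF fitP(1)[OF that(1)]] that by auto
    then have "A \<in> VJ" using that by (intro supp_VJ) auto
    then show ?thesis using VG_main[of A] fitP(2)[OF that(1)] that by (auto simp: VG_def J_def)
  qed
  have bij: "bij_betw \<sigma> ?K (SIGMA s:RStd n m. {A \<in> VS F n (J_set n s). verge F n A})"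
    unfolding bij_betw_def
  proof
    show "inj_on \<sigma> ?K"
    proof (rule inj_onI)
      fix k l assume k: "k \<in> ?K" and l: "l \<in> ?K" and e: "\<sigma> k = \<sigma> l"
      obtain p A i where k': "k = (p, (A, i))" by (cases k) auto
      obtain p' A' i' where l': "l = (p', (A', i'))" by (cases l) auto
      have "A = A'" using e by (simp add: \<sigma>_def k' l')
      moreover then have pp: "p = p'" using k l by (auto simp: k' l')
      moreover have "sp p i = sp p i'" using e pp by (simp add: \<sigma>_def k' l')
      then have "i = i'" using bij_betw_imp_inj_on[OF sp[of p]] k l pp by (auto simp: k' l' dest: inj_onD)
      ultimately show "k = l" by (simp add: k' l')
    qed
    show "\<sigma> ` ?K = (SIGMA s:RStd n m. {A \<in> VS F n (J_set n s). verge F n A})"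
    proof (intro equalityI subsetI)
      fix x assume "x \<in> \<sigma> ` ?K"
      then obtain p A i where x: "p \<in> ?Fit" "A \<in> ?AA p" "i < fit_mult n m p" "x = (sp p i, A)" by (auto simp: \<sigma>_def)
      have "sp p i \<in> ?S p" using bij_betwE[OF sp[of p]] x(3) by auto
      then show "x \<in> (SIGMA s:RStd n m. {A \<in> VS F n (J_set n s). verge F n A})" using AA[OF x(1,2)] x(4) by auto
    next
      fix x assume "x \<in> (SIGMA s:RStd n m. {A \<in> VS F n (J_set n s). verge F n A})"
      then obtain s A where x: "x = (s, A)" "s \<in> RStd n m" "A \<in> VS F n (J_set n s)" "verge F n A" by auto
      interpret tab F n \<theta> s m by (rule tab_RStd[OF x(2)])
      have AJ: "A \<in> VJ" "A \<in> VG" using x by (auto simp: J_def VG_def)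
      let ?p = "supp F n A"
      have fit: "fits ?p s" using VJ_fits[OF AJ(1)] by (simp add: fits_def)
      have "main_condition_set n ?p" "completely_hook_disconnected ?p" using verge_hook[OF AJ(1) x(4)] by (auto simp: hook_def hook_axioms_def)
      then have pF: "?p \<in> ?Fit" using fit x(2) by (auto simp: fitting_sets_def)
      have "s \<in> sp ?p ` {..<fit_mult n m ?p}" using bij_betw_imp_surj_on[OF sp[of ?p]] fit x(2) by auto
      then obtain i where i: "i < fit_mult n m ?p" "s = sp ?p i" by auto
      show "x \<in> \<sigma> ` ?K"
        by (rule image_eqI[of _ _ "(?p, (A, i))"]) (use x(1) i pF VS_MM[OF AJ(1)] in \<open>auto simp: \<sigma>_def\<close>)
    qed
  qed
  have finK: "finite ?K" using finFit finite_MM by auto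
  have iso1: "mod_iso (U F n) (direct_sum ?K (\<lambda>k. hook_mod F \<theta> n (fst (snd k)))) (M_lam F n m)"
    using LM_decomp[OF m finK bij] by (simp add: \<sigma>_def)
  have hm: "cg_module (U F n) (hook_mod F \<theta> n A)" if p: "p \<in> ?Fit" and A: "A \<in> ?AA p" for p A
  proof -
    have "hook F n \<theta> A" using A p by unfold_locales (auto simp: fitting_sets_def)
    then show ?thesis using hook.hook_mod_iso by (auto simp: mod_iso_def)
  qed
  have iso2: "mod_iso (U F n) (direct_sum (?AA p) (\<lambda>A. mod_copies (fit_mult n m p) (hook_mod F \<theta> n A)))
      (direct_sum (?J p) (\<lambda>k. hook_mod F \<theta> n (fst k)))" if p: "p \<in> ?Fit" for p
    unfolding mod_copies_def using direct_sum_Sigma[of "?AA p" "\<lambda>_. {..<fit_mult n m p}" "U F n" "\<lambda>A _. hook_mod F \<theta> n A"] hm[OF p] by simp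
  have iso3: "mod_iso (U F n) (direct_sum ?Fit (\<lambda>p. direct_sum (?AA p) (\<lambda>A. mod_copies (fit_mult n m p) (hook_mod F \<theta> n A))))
      (direct_sum ?Fit (\<lambda>p. direct_sum (?J p) (\<lambda>k. hook_mod F \<theta> n (fst k))))"
    by (rule direct_sum_cong[OF iso2])
  have iso4: "mod_iso (U F n) (direct_sum ?Fit (\<lambda>p. direct_sum (?J p) (\<lambda>k. hook_mod F \<theta> n (fst k))))
      (direct_sum ?K (\<lambda>k. hook_mod F \<theta> n (fst (snd k))))"
    using direct_sum_Sigma[of ?Fit ?J "U F n" "\<lambda>_ k. hook_mod F \<theta> n (fst k)"] hm by auto
  show ?thesis by (rule mod_iso_sym[OF mod_iso_trans[OF iso3 mod_iso_trans[OF iso4 iso1]]])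
qed

end

section \<open>Existence of a nontrivial additive character\<close>

context ffield
begin

text \<open>In a finite group a set closed under addition is also closed under negation, since
  \<open>- x\<close> is a multiple of \<open>x\<close>; \<open>asub_cancel\<close> makes this
  usable.\<close>

definition asub :: "'f set => bool" where
  "asub H \<longleftrightarrow> H \<subseteq> carrier F \<and> \<zero> \<in> H \<and> (\<forall>x\<in>H. \<forall>y\<in>H. x \<oplus> y \<in> H)"

lemma ap_order: "x \<in> carrier F ==> [card (carrier F)] \<cdot> x = \<zero>"
  by (rule add.power_order_eq_one[OF fin_F])

lemma asub_pow: assumes H: "asub H" and x: "x \<in> H" shows "[(k::nat)] \<cdot> x \<in> H"
  by (induction k) (use H x in \<open>auto simp: asub_def\<close>)

lemma asub_cancel: assumes H: "asub H" and x: "x \<in> H" and y: "y \<in> carrier F" and xy: "x \<oplus> y \<in> H" shows "y \<in> H"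
proof -
  have xc: "x \<in> carrier F" using H x by (auto simp: asub_def)
  let ?z = "[(card (carrier F) - 1)] \<cdot> x"
  have z: "?z \<in> H" "?z \<in> carrier F" using asub_pow[OF H x] H by (auto simp: asub_def)
  have "?z \<oplus> x = [(Suc (card (carrier F) - 1))] \<cdot> x" by simp
  also have "\<dots> = \<zero>" using q_ge2 ap_order[OF xc] by (simp add: One_nat_def del: add.nat_pow_Suc)
  finally have "?z \<oplus> (x \<oplus> y) = y" using z xc y by (simp add: a_assoc[symmetric])
  moreover have "?z \<oplus> (x \<oplus> y) \<in> H" using H z(1) xy by (simp add: asub_def)
  ultimately show ?thesis by simp
qed

text \<open>A maximal proper subgroup \<open>H\<close> of the additive group has a cyclic quotient.\<close>

lemma character_ex: "\<exists>\<theta>. nontrivial_add_character F \<theta>"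
proof -
  let ?X = "{H. asub H \<and> H \<noteq> carrier F}"
  have "finite ?X" by (rule finite_subset[of _ "Pow (carrier F)"]) (use fin_F in \<open>auto simp: asub_def\<close>)
  moreover have "{\<zero>} \<in> ?X" using q_ge2 by (auto simp: asub_def dest!: arg_cong[of _ _ card])
  ultimately obtain H where "H \<in> ?X" and max': "\<And>K. K \<in> ?X ==> H \<subseteq> K ==> H = K"
    using finite_has_maximal[of ?X] by blast
  then have H: "asub H" "H \<noteq> carrier F" by auto
  have Hc: "h \<in> carrier F" if "h \<in> H" for h using H(1) that by (auto simp: asub_def)
  then obtain x where x: "x \<in> carrier F" "x \<notin> H" using H(2) by auto
  have Hadd: "h \<oplus> h' \<in> H" if "h \<in> H" "h' \<in> H" for h h' using H(1) that by (auto simp: asub_def)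
  let ?Y = "{h \<oplus> [(i::nat)] \<cdot> x | h i. h \<in> H}"
  have "asub ?Y" unfolding asub_def
  proof (intro conjI ballI)
    show "?Y \<subseteq> carrier F" using Hc x by auto
    show "\<zero> \<in> ?Y" using H(1) by (force simp: asub_def intro: exI[of _ "0::nat"])
    fix a b assume "a \<in> ?Y" "b \<in> ?Y"
    then obtain h i h' j where ab: "h \<in> H" "h' \<in> H" "a = h \<oplus> [(i::nat)] \<cdot> x" "b = h' \<oplus> [(j::nat)] \<cdot> x" by auto
    have "a \<oplus> b = (h \<oplus> h') \<oplus> [(i + j)] \<cdot> x" using ab Hc x by (simp add: add.nat_pow_mult[symmetric] a_ac)
    then show "a \<oplus> b \<in> ?Y" using Hadd[OF ab(1,2)] by auto
  qed
  moreover have "H \<subseteq> ?Y"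
  proof
    fix h assume h: "h \<in> H"
    then have "h = h \<oplus> [(0::nat)] \<cdot> x" using Hc by simp
    then show "h \<in> ?Y" using h by blast
  qed
  moreover have "x \<in> ?Y"
  proof -
    have "x = \<zero> \<oplus> [(1::nat)] \<cdot> x" using x by (simp add: One_nat_def)
    moreover have "\<zero> \<in> H" using H(1) by (simp add: asub_def)
    ultimately show ?thesis by blast
  qed
  ultimately have Y: "?Y = carrier F" using max'[of ?Y] x(2) by blast
  \<comment> \<open>The order of \<open>x\<close> modulo \<open>H\<close>. It differs from 1 because
    \<open>x\<close> is outside \<open>H\<close>, so the root of unity \<open>z\<close> of this
    order is nontrivial.\<close>
  define k where "k = (LEAST k. 0 < k \<and> [(k::nat)] \<cdot> x \<in> H)"
  have "0 < card (carrier F) \<and> [card (carrier F)] \<cdot> x \<in> H" using q_ge2 ap_order[OF x(1)] H(1) by (simp add: asub_def)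
  then have k: "0 < k" "[k] \<cdot> x \<in> H" using LeastI[of "\<lambda>k. 0 < k \<and> [(k::nat)] \<cdot> x \<in> H"] unfolding k_def by blast+
  have kl: "k \<le> j" if "0 < j" "[j] \<cdot> x \<in> H" for j :: nat unfolding k_def by (rule Least_le) (use that in blast)
  have k1: "k \<noteq> 1" using k(2) x by (auto simp: One_nat_def)
  have kd: "k dvd m" if m: "[m] \<cdot> x \<in> H" for m
  proof (rule ccontr)
    assume nd: "\<not> k dvd m"
    have "[(k * (m div k) + m mod k)] \<cdot> x \<in> H" using m by simp
    then have e: "[(k * (m div k))] \<cdot> x \<oplus> [(m mod k)] \<cdot> x \<in> H" using x(1) by (simp add: add.nat_pow_mult)
    have "[(k * (m div k))] \<cdot> x = [(m div k)] \<cdot> ([k] \<cdot> x)" using x(1) by (simp add: add.nat_pow_pow mult.commute)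
    then have "[(k * (m div k))] \<cdot> x \<in> H" using asub_pow[OF H(1) k(2)] by simp
    then have "[(m mod k)] \<cdot> x \<in> H" using asub_cancel[OF H(1) _ _ e] x(1) by simp
    then have "k \<le> m mod k" using kl[of "m mod k"] nd by (simp add: dvd_eq_mod_eq_0)
    then show False using mod_less_divisor[OF k(1), of m] by linarith
  qed
  define z where "z = cis (2 * pi / real k)"
  have zk: "z ^ k = 1" using k(1) by (simp add: z_def DeMoivre)
  have z1: "z \<noteq> 1"
  proof
    assume "z = 1"
    then have "cos (2 * pi / real k) = 1" by (simp add: z_def complex_eq_iff)
    then obtain a :: int where a: "2 * pi / real k = real_of_int a * 2 * pi" unfolding cos_one_2pi_int by blast
    then have "1 = real_of_int a * real k" using k(1) by (simp add: field_simps)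
    then have "int k dvd 1" by (metis dvd_triv_right of_int_1 of_int_eq_iff of_int_mult of_int_of_nat_eq)
    then show False using k1 by simp
  qed
  \<comment> \<open>Any exponent that represents \<open>y\<close> will do: two of them differ by a
    multiple of \<open>k\<close>, so \<open>z ^ r y\<close> is well defined
    (\<open>uq\<close>).\<close>
  define r where "r y = (SOME i. \<exists>h\<in>H. y = h \<oplus> [(i::nat)] \<cdot> x)" for y
  have r: "\<exists>h\<in>H. y = h \<oplus> [(r y)] \<cdot> x" if "y \<in> carrier F" for y
    unfolding r_def by (rule someI_ex) (use that Y in blast)
  have le: "z ^ i = z ^ j" if "h \<in> H" "h' \<in> H" "h \<oplus> [(i::nat)] \<cdot> x = h' \<oplus> [j] \<cdot> x" "i \<le> j" for h h' i j
  proof -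
    have "[j] \<cdot> x = [(j - i)] \<cdot> x \<oplus> [i] \<cdot> x" using x(1) that(4) by (simp add: add.nat_pow_mult)
    then have "h \<oplus> [i] \<cdot> x = (h' \<oplus> [(j - i)] \<cdot> x) \<oplus> [i] \<cdot> x" using that Hc x(1) by (simp add: a_assoc)
    then have "h = h' \<oplus> [(j - i)] \<cdot> x" using that Hc x(1) by simp
    then have "[(j - i)] \<cdot> x \<in> H" using asub_cancel[OF H(1) that(2), of "[(j - i)] \<cdot> x"] that(1) x(1) by simp
    then obtain c where "j - i = k * c" using kd by (auto simp: dvd_def)
    then have "j = i + k * c" using that(4) by simp
    then show ?thesis by (simp add: power_add power_mult zk)
  qed
  have uq: "z ^ i = z ^ j" if "h \<in> H" "h' \<in> H" "h \<oplus> [(i::nat)] \<cdot> x = h' \<oplus> [j] \<cdot> x" for h h' i j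
  proof (cases "i \<le> j")
    case False
    then show ?thesis using le[OF that(2,1) that(3)[symmetric]] by simp
  qed (rule le[OF that])
  have "nontrivial_add_character F (\<lambda>y. z ^ r y)"
    unfolding nontrivial_add_character_def
  proof (intro conjI ballI bexI[of _ x])
    show "z ^ r y \<noteq> 0" for y by (simp add: z_def)
    fix a b assume ab: "a \<in> carrier F" "b \<in> carrier F"
    obtain h where h: "h \<in> H" "a = h \<oplus> [(r a)] \<cdot> x" using r[OF ab(1)] by blast
    obtain h' where h': "h' \<in> H" "b = h' \<oplus> [(r b)] \<cdot> x" using r[OF ab(2)] by blast
    obtain g where g: "g \<in> H" "a \<oplus> b = g \<oplus> [(r (a \<oplus> b))] \<cdot> x" using r[of "a \<oplus> b"] ab by blast
    have "(h \<oplus> [(r a)] \<cdot> x) \<oplus> (h' \<oplus> [(r b)] \<cdot> x) = (h \<oplus> h') \<oplus> [(r a + r b)] \<cdot> x"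
      using Hc[OF h(1)] Hc[OF h'(1)] x(1) by (simp add: add.nat_pow_mult[symmetric] a_ac)
    then have "z ^ r (a \<oplus> b) = z ^ (r a + r b)" using uq[OF g(1) Hadd[OF h(1) h'(1)]] g(2) h(2) h'(2) by simp
    then show "z ^ r (a \<oplus> b) = z ^ r a * z ^ r b" by (simp add: power_add)
  next
    obtain h where h: "h \<in> H" "x = h \<oplus> [(r x)] \<cdot> x" using r[OF x(1)] by blast
    have z0: "\<zero> \<in> H" using H(1) by (simp add: asub_def)
    have "h \<oplus> [(r x)] \<cdot> x = \<zero> \<oplus> [(1::nat)] \<cdot> x" using h(2) x(1) by (simp add: One_nat_def)
    then have "z ^ r x = z ^ (1::nat)" by (rule uq[OF h(1) z0])
    then show "z ^ r x \<noteq> 1" using z1 by simp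
  qed (rule x(1))
  then show ?thesis by blast
qed

end

section \<open>Permutation modules\<close>

context fin_group
begin

text \<open>The common model for permutation modules on cosets, on subspaces and for
  \<open>P_bar CG\<close>: all of them are compared with the left \<open>P\<close>-invariant
  functions.\<close>

definition LI :: "'a set => ('a => complex) set" where
  "LI P = {v \<in> group_algebra G. \<forall>p\<in>P. \<forall>g\<in>carrier G. v (p \<otimes> g) = v g}"

text \<open>The inverse makes this a right action on functions: the indicator of \<open>y\<close>
  times \<open>g\<close> is the indicator of \<open>act y g\<close>.\<close>

definition perm_mod :: "'y set => ('y => 'a => 'y) => ('a, 'y) cg_mod" where
  "perm_mod Y act = \<lparr>mspace = {f. \<forall>y. y \<notin> Y \<longrightarrow> f y = 0},
     mact = (\<lambda>f a y. if y \<in> Y then \<Sum>g\<in>carrier G. a g * f (act y (inv g)) else 0)\<rparr>"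

lemma perm_rep:
  assumes "\<And>y g. y \<in> Y ==> g \<in> carrier G ==> act y g \<in> Y"
    and "\<And>y. y \<in> Y ==> act y \<one> = y"
    and "\<And>y g h. y \<in> Y ==> g \<in> carrier G ==> h \<in> carrier G ==> act (act y g) h = act y (g \<otimes> h)"
  shows "is_rep G (perm_mod Y act) (\<lambda>h f y. if y \<in> Y then f (act y (inv h)) else 0)"
  unfolding is_rep_def perm_mod_def using assms
  by (auto simp: csubspace_iff fun_eq_iff inv_mult_group)

lemma LI_rep: assumes P: "P \<subseteq> carrier G"
  shows "is_rep G \<lparr>mspace = LI P, mact = ga_mult G\<rparr> (\<lambda>h v. ga_mult G v (ga_single h))"
proof -
  interpret S: subgroup_alg G "carrier G"
    by (intro subgroup_alg.intro subgroup_alg_axioms.intro subgroup_self fin_group_axioms)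
  have "is_rep (G\<lparr>carrier := carrier G\<rparr>) \<lparr>mspace = LI P, mact = ga_mult G\<rparr> (\<lambda>h v. ga_mult G v (ga_single h))"
  proof (rule S.rt_rep)
    show "cfun.subspace (LI P)" using subspace_group_algebra[of G] by (auto simp: csubspace_iff LI_def)
    show "LI P \<subseteq> group_algebra G" by (auto simp: LI_def)
    fix v h assume v: "v \<in> LI P" and h: "h \<in> carrier G"
    have "v (p \<otimes> g \<otimes> inv h) = v (g \<otimes> inv h)" if "p \<in> P" "g \<in> carrier G" for p g
    proof -
      have pG: "p \<in> carrier G" using that P by auto
      have "v (p \<otimes> (g \<otimes> inv h)) = v (g \<otimes> inv h)" using v that h by (simp add: LI_def)
      then show ?thesis using pG that h by (simp add: m_assoc)
    qed
    then show "ga_mult G v (ga_single h) \<in> LI P" using h P ga_mult_alg[of G v "ga_single h"] by (auto simp: LI_def rt_eq)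
  qed
  then show ?thesis by simp
qed

text \<open>Pulled back along the orbit map \<open>ob\<close>, a function on the orbit becomes
  constant on the right cosets of the stabilizer \<open>P\<close>, and every such function arises in
  this way.\<close>

lemma orbit_iso:
  assumes P: "P \<subseteq> carrier G"
    and Y: "ob ` carrier G = Y"
    and st: "\<And>g h. g \<in> carrier G ==> h \<in> carrier G ==> ob g = ob h \<longleftrightarrow> g \<otimes> inv h \<in> P"
    and act: "\<And>g h. g \<in> carrier G ==> h \<in> carrier G ==> act (ob g) h = ob (g \<otimes> h)"
  shows "mod_iso G (perm_mod Y act) \<lparr>mspace = LI P, mact = ga_mult G\<rparr>"
proof (rule mod_iso_rep[OF perm_rep LI_rep[OF P]])
  have YE: "\<exists>g\<in>carrier G. y = ob g" if "y \<in> Y" for y using that Y by auto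
  have obY: "g \<in> carrier G ==> ob g \<in> Y" for g using Y by auto
  show "act y g \<in> Y" if "y \<in> Y" "g \<in> carrier G" for y g using YE[OF that(1)] that(2) act obY by fastforce
  show "act y \<one> = y" if "y \<in> Y" for y using YE[OF that] act by fastforce
  show "act (act y g) h = act y (g \<otimes> h)" if "y \<in> Y" "g \<in> carrier G" "h \<in> carrier G" for y g h
    using YE[OF that(1)] that act by (auto simp: m_assoc)
  let ?\<phi> = "\<lambda>f g. if g \<in> carrier G then f (ob g) else (0::complex)"
  show "bij_betw ?\<phi> (mspace (perm_mod Y act)) (mspace \<lparr>mspace = LI P, mact = ga_mult G\<rparr>)"
    unfolding bij_betw_def
  proof
    show "inj_on ?\<phi> (mspace (perm_mod Y act))"
    proof (rule inj_onI, rule ext)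
      fix f f' y assume f: "f \<in> mspace (perm_mod Y act)" "f' \<in> mspace (perm_mod Y act)" and e: "?\<phi> f = ?\<phi> f'"
      show "f y = f' y"
      proof (cases "y \<in> Y")
        case True
        then obtain g where g: "g \<in> carrier G" "y = ob g" using YE by blast
        show ?thesis using fun_cong[OF e, of g] g by simp
      qed (use f in \<open>simp add: perm_mod_def\<close>)
    qed
    show "?\<phi> ` mspace (perm_mod Y act) = mspace \<lparr>mspace = LI P, mact = ga_mult G\<rparr>"
    proof (intro equalityI subsetI)
      fix v assume "v \<in> ?\<phi> ` mspace (perm_mod Y act)"
      then obtain f where v: "v = ?\<phi> f" by blast
      have "ob (p \<otimes> g) = ob g" if "p \<in> P" "g \<in> carrier G" for p g
        using st[of "p \<otimes> g" g] that P by (auto simp: m_assoc)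
      then show "v \<in> mspace \<lparr>mspace = LI P, mact = ga_mult G\<rparr>" using P by (auto simp: v LI_def group_algebra_def)
    next
      fix v assume "v \<in> mspace \<lparr>mspace = LI P, mact = ga_mult G\<rparr>"
      then have v: "v \<in> group_algebra G" "\<And>p g. p \<in> P ==> g \<in> carrier G ==> v (p \<otimes> g) = v g" by (auto simp: LI_def)
      define r where "r y = (SOME g. g \<in> carrier G \<and> y = ob g)" for y
      have r: "r y \<in> carrier G \<and> y = ob (r y)" if "y \<in> Y" for y
        unfolding r_def by (rule someI_ex) (use YE[OF that] in blast)
      define f where "f = (\<lambda>y. if y \<in> Y then v (r y) else 0)"
      have "v (r (ob g)) = v g" if g: "g \<in> carrier G" for g
      proof -
        have r': "r (ob g) \<in> carrier G" "ob (r (ob g)) = ob g" using r[OF obY[OF g]] by auto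
        then have p: "r (ob g) \<otimes> inv g \<in> P" using st[OF r'(1) g] by simp
        show ?thesis using v(2)[OF p g] r'(1) g by (simp add: m_assoc)
      qed
      then have vf: "v = ?\<phi> f" using v(1) obY by (auto simp: group_algebra_def fun_eq_iff f_def)
      have "f \<in> mspace (perm_mod Y act)" by (simp add: perm_mod_def f_def)
      then show "v \<in> ?\<phi> ` mspace (perm_mod Y act)" unfolding vf by (rule imageI)
    qed
  qed
  fix f h assume f: "f \<in> mspace (perm_mod Y act)" and h: "h \<in> carrier G"
  show "?\<phi> (\<lambda>y. if y \<in> Y then f (act y (inv h)) else 0) = ga_mult G (?\<phi> f) (ga_single h)"
    using h act obY by (auto simp: rt_eq fun_eq_iff)
qed (auto simp: fun_eq_iff)

lemma coset_iso:
  assumes P: "subgroup P G"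
  shows "mod_iso G (coset_perm_mod G P) \<lparr>mspace = LI P, mact = ga_mult G\<rparr>"
proof -
  have PG: "P \<subseteq> carrier G" by (rule subgroup.subset[OF P])
  have "coset_perm_mod G P = perm_mod (rcosets P) (\<lambda>X g. X #> g)" by (simp add: coset_perm_mod_def perm_mod_def)
  moreover have "mod_iso G (perm_mod (rcosets P) (\<lambda>X g. X #> g)) \<lparr>mspace = LI P, mact = ga_mult G\<rparr>"
  proof (rule orbit_iso[OF PG])
    show "(\<lambda>g. P #> g) ` carrier G = rcosets P" by (auto simp: RCOSETS_def)
    show "P #> g = P #> h \<longleftrightarrow> g \<otimes> inv h \<in> P" if "g \<in> carrier G" "h \<in> carrier G" for g h
    proof
      assume e: "P #> g = P #> h"
      have "P #> (g \<otimes> inv h) = P" by (rule coset_mult_inv2[OF e that PG])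
      then show "g \<otimes> inv h \<in> P" by (rule coset_join1[OF _ _ P]) (use that in simp)
    next
      assume i: "g \<otimes> inv h \<in> P"
      have "P #> (g \<otimes> inv h) = P" by (rule coset_join2[OF _ P i]) (use that in simp)
      then show "P #> g = P #> h" by (rule coset_mult_inv1[OF _ that PG])
    qed
    show "P #> g #> h = P #> (g \<otimes> h)" if "g \<in> carrier G" "h \<in> carrier G" for g h
      by (rule coset_mult_assoc[OF PG that])
  qed
  ultimately show ?thesis by simp
qed

text \<open>Multiplying by the indicator of \<open>P\<close> sums over \<open>P\<close>, which
  produces invariant functions. On a function that is already invariant it is the scalar
  \<open>card P\<close>, so dividing by it gives a preimage.\<close>

lemma cyclic_LI:
  assumes P: "subgroup P G"
  shows "ga_mult G (\<lambda>g. if g \<in> P then 1 else 0) ` group_algebra G = LI P"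
proof -
  let ?i = "\<lambda>g. if g \<in> P then 1 else (0::complex)"
  have PG: "P \<subseteq> carrier G" by (rule subgroup.subset[OF P])
  have fP: "finite P" using PG fin_G finite_subset by blast
  have e: "ga_mult G ?i v g = (\<Sum>h\<in>P. v (inv h \<otimes> g))" if "g \<in> carrier G" for v g
  proof -
    have "ga_mult G ?i v g = (\<Sum>h\<in>carrier G. if h \<in> P then v (inv h \<otimes> g) else 0)"
      using that by (auto simp: ga_mult_def intro!: sum.cong)
    also have "\<dots> = (\<Sum>h\<in>carrier G \<inter> P. v (inv h \<otimes> g))" by (rule sum.inter_restrict[OF fin_G, symmetric])
    finally show ?thesis using PG by (simp add: Int_absorb1)
  qed
  show ?thesis
  proof (intro equalityI subsetI)
    fix w assume "w \<in> ga_mult G ?i ` group_algebra G"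
    then obtain v where w: "w = ga_mult G ?i v" by blast
    have "w (p \<otimes> g) = w g" if p: "p \<in> P" and g: "g \<in> carrier G" for p g
    proof -
      have pG: "p \<in> carrier G" using p PG by auto
      have "w (p \<otimes> g) = (\<Sum>h\<in>P. v (inv h \<otimes> (p \<otimes> g)))" unfolding w by (rule e) (use pG g in simp)
      also have "\<dots> = (\<Sum>h\<in>P. v (inv h \<otimes> g))"
      proof (rule sum.reindex_bij_witness[where i="\<lambda>h. p \<otimes> h" and j="\<lambda>h. inv p \<otimes> h"])
        fix h assume h: "h \<in> P"
        have hG: "h \<in> carrier G" using h PG by auto
        show "inv p \<otimes> h \<in> P" using subgroup.m_closed[OF P subgroup.m_inv_closed[OF P p] h] .
        show "p \<otimes> h \<in> P" using subgroup.m_closed[OF P p h] .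
        show "p \<otimes> (inv p \<otimes> h) = h" "inv p \<otimes> (p \<otimes> h) = h" using pG hG by (simp_all add: m_assoc[symmetric])
        show "v (inv (inv p \<otimes> h) \<otimes> g) = v (inv h \<otimes> (p \<otimes> g))" using pG hG g by (simp add: inv_mult_group m_assoc)
      qed
      also have "\<dots> = w g" unfolding w by (rule e[OF g, symmetric])
      finally show ?thesis .
    qed
    then show "w \<in> LI P" using ga_mult_alg[of G ?i v] w by (simp add: LI_def)
  next
    fix w assume w: "w \<in> LI P"
    have c: "card P \<noteq> 0" using fP subgroup.one_closed[OF P] by auto
    have "ga_mult G ?i w g = of_nat (card P) * w g" if g: "g \<in> carrier G" for g
    proof -
      have "w (inv h \<otimes> g) = w g" if "h \<in> P" for h using w g subgroup.m_inv_closed[OF P that] by (simp add: LI_def)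
      then show ?thesis by (simp add: e[OF g])
    qed
    moreover have w0: "w g = 0" if "g \<notin> carrier G" for g using w that by (simp add: LI_def group_algebra_def)
    ultimately have "ga_mult G ?i w = (\<lambda>g. of_nat (card P) * w g)" by (auto simp: fun_eq_iff ga_mult_def)
    then have "ga_mult G ?i (\<lambda>g. inverse (of_nat (card P)) * w g) = w" using c by (simp add: ga_mult_scale_right mult.assoc[symmetric])
    moreover have "(\<lambda>g. inverse (of_nat (card P)) * w g) \<in> group_algebra G" using w by (auto simp: LI_def group_algebra_def)
    ultimately show "w \<in> ga_mult G ?i ` group_algebra G" by (metis image_eqI)
  qed
qed

end

section \<open>Orthogonal complements of row spaces\<close>

context fmat
begin

definition dp :: "(nat => 'f) => (nat => 'f) => 'f" where "dp v w = (\<Oplus>k\<in>N. v k \<otimes> w k)"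
definition perp :: "(nat => 'f) set => (nat => 'f) set" where "perp X = {w \<in> RV. \<forall>v\<in>X. dp v w = \<zero>}"

lemma dp_closed: "v \<in> RV ==> w \<in> RV ==> dp v w \<in> carrier F"
  unfolding dp_def by (rule fs_closed) (simp add: RV_entry)

lemma dp_comm: "v \<in> RV ==> w \<in> RV ==> dp v w = dp w v"
  unfolding dp_def by (rule fs_cong) (simp_all add: RV_entry m_comm)

lemma dp_add: assumes "u \<in> RV" "v \<in> RV" "w \<in> RV" shows "dp (vadd u v) w = dp u w \<oplus> dp v w"
proof -
  have "dp (vadd u v) w = (\<Oplus>k\<in>N. u k \<otimes> w k \<oplus> v k \<otimes> w k)"
    unfolding dp_def by (rule fs_cong) (use assms in \<open>simp_all add: RV_entry v_entry l_distr\<close>)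
  also have "\<dots> = dp u w \<oplus> dp v w" unfolding dp_def by (rule fs_add) (use assms in \<open>simp_all add: RV_entry\<close>)
  finally show ?thesis .
qed

lemma dp_sc: assumes "c \<in> carrier F" "v \<in> RV" "w \<in> RV" shows "dp (vsc c v) w = c \<otimes> dp v w"
proof -
  have "dp (vsc c v) w = (\<Oplus>k\<in>N. c \<otimes> (v k \<otimes> w k))"
    unfolding dp_def by (rule fs_cong) (use assms in \<open>simp_all add: RV_entry v_entry m_assoc\<close>)
  also have "\<dots> = c \<otimes> dp v w" unfolding dp_def by (rule fs_rdistr[symmetric]) (use assms in \<open>simp_all add: RV_entry\<close>)
  finally show ?thesis .
qed

lemma dp_v0: "w \<in> RV ==> dp v0 w = \<zero>"
  unfolding dp_def by (rule fs_zero) (simp add: RV_entry v_entry)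

lemma dp_nonzero: assumes v: "v \<in> RV" "v \<noteq> v0" shows "\<exists>w\<in>RV. dp w v \<noteq> \<zero>"
proof -
  obtain i where i: "i \<in> N" "v i \<noteq> \<zero>" using RV_eqI[OF v(1) v_RV(3)] v(2) by (auto simp: v_entry)
  let ?w = "\<lambda>j\<in>N. if j = i then \<one> else \<zero>"
  have w: "?w \<in> RV" by (rule RV_restrict) simp
  have "dp ?w v = ?w i \<otimes> v i" unfolding dp_def by (rule fs_single) (use i v in \<open>auto simp: RV_entry\<close>)
  then have "dp ?w v = v i" using i v by (simp add: RV_entry)
  then show ?thesis by (intro bexI[OF _ w]) (use i in simp)
qed

lemma sub_ker: assumes Y: "sub Y" and p: "\<phi> \<in> RV" shows "sub {y \<in> Y. dp y \<phi> = \<zero>}"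
proof -
  have YR: "y \<in> RV" if "y \<in> Y" for y using subD(1)[OF Y] that by auto
  show ?thesis unfolding sub_iff using subD(2-4)[OF Y] YR p by (auto simp: dp_v0 dp_add dp_sc)
qed

lemma sub_perp: assumes X: "X \<subseteq> RV" shows "sub (perp X)"
proof -
  have "dp x (vadd u v) = dp x u \<oplus> dp x v" if "x \<in> RV" "u \<in> RV" "v \<in> RV" for x u v
    using dp_add[of u v x] dp_comm[of x "vadd u v"] dp_comm[of x u] dp_comm[of x v] that v_RV by simp
  moreover have "dp x (vsc c v) = c \<otimes> dp x v" if "x \<in> RV" "c \<in> carrier F" "v \<in> RV" for x c v
    using dp_sc[of c v x] dp_comm[of x "vsc c v"] dp_comm[of x v] that v_RV by simp
  moreover have "dp x v0 = \<zero>" if "x \<in> RV" for x using dp_v0[of x] dp_comm[of x v0] that v_RV by simp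
  ultimately show ?thesis unfolding sub_iff perp_def using X v_RV by (auto simp: subset_iff)
qed

lemma perp_RV: "perp X \<subseteq> RV" by (auto simp: perp_def)
lemma perp_anti: "X \<subseteq> Y ==> perp Y \<subseteq> perp X" by (auto simp: perp_def)

lemma hyperplane: assumes Y: "sub Y" and p: "\<phi> \<in> RV" and y: "y \<in> Y" "dp y \<phi> \<noteq> \<zero>"
  shows "card Y = q * card {y \<in> Y. dp y \<phi> = \<zero>}"
proof -
  let ?K = "{y \<in> Y. dp y \<phi> = \<zero>}"
  have YR: "y \<in> RV" if "y \<in> Y" for y using subD(1)[OF Y] that by auto
  have u: "dp y \<phi> \<in> Units F" using dp_closed[OF YR[OF y(1)] p] y(2) by (simp add: field_Units)
  \<comment> \<open>Normalized so that \<open>Y\<close> splits as the kernel of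
    \<open>\<phi>\<close> plus the line of \<open>z\<close>, with \<open>dp y \<phi>\<close> as the
    coordinate along \<open>z\<close>.\<close>
  define z where "z = vsc (inv (dp y \<phi>)) y"
  have z: "z \<in> Y" "z \<in> RV" "dp z \<phi> = \<one>" using subD(4)[OF Y _ y(1)] u YR[OF y(1)] p by (auto simp: z_def dp_sc v_RV)
  note zs = v_RV(2)[OF _ z(2)]
  have zd: "dp (vsc c z) \<phi> = c" if "c \<in> carrier F" for c using that z p by (simp add: dp_sc)
  have "bij_betw (\<lambda>x. vadd (fst x) (vsc (snd x) z)) (?K \<times> carrier F) Y"
  proof (rule bij_betw_byWitness[where f'="\<lambda>y. (vadd y (vsc (\<ominus> dp y \<phi>) z), dp y \<phi>)"])
    have c1: "vadd (vadd k (vsc c z)) (vsc (\<ominus> c) z) = k" if "k \<in> RV" "c \<in> carrier F" for k c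
      by (rule RV_eqI) (use that zs z in \<open>auto simp: v_RV v_entry RV_entry a_assoc l_minus r_neg\<close>)
    have c2: "vadd (vadd k (vsc (\<ominus> c) z)) (vsc c z) = k" if "k \<in> RV" "c \<in> carrier F" for k c
      by (rule RV_eqI) (use that zs z in \<open>auto simp: v_RV v_entry RV_entry a_assoc l_minus l_neg\<close>)
    have d1: "dp (vadd k (vsc c z)) \<phi> = dp k \<phi> \<oplus> c" if "k \<in> RV" "c \<in> carrier F" for k c
      using dp_add[OF that(1) zs[OF that(2)] p] zd[OF that(2)] by simp
    show "\<forall>x\<in>?K \<times> carrier F. (vadd (vadd (fst x) (vsc (snd x) z)) (vsc (\<ominus> dp (vadd (fst x) (vsc (snd x) z)) \<phi>) z), dp (vadd (fst x) (vsc (snd x) z)) \<phi>) = x"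
      using YR by (auto simp: d1 c1)
    show "\<forall>y\<in>Y. vadd (fst (vadd y (vsc (\<ominus> dp y \<phi>) z), dp y \<phi>)) (vsc (snd (vadd y (vsc (\<ominus> dp y \<phi>) z), dp y \<phi>)) z) = y"
      using YR p by (auto simp: c2 dp_closed)
    show "(\<lambda>x. vadd (fst x) (vsc (snd x) z)) ` (?K \<times> carrier F) \<subseteq> Y"
      using subD(3,4)[OF Y] z(1) by auto
    show "(\<lambda>y. (vadd y (vsc (\<ominus> dp y \<phi>) z), dp y \<phi>)) ` Y \<subseteq> ?K \<times> carrier F"
      using subD(3,4)[OF Y] z(1) YR p by (auto simp: d1 dp_closed r_neg)
  qed
  then show ?thesis by (simp add: bij_betw_same_card[symmetric] card_cartesian_product mult.commute)
qed

text \<open>Count the orthogonal pairs in \<open>X \<times> RV\<close> in two ways.\<close>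

lemma card_perp: assumes X: "sub X" shows "card X * card (perp X) = q ^ n"
proof -
  have XR: "x \<in> RV" if "x \<in> X" for x using subD(1)[OF X] that by auto
  have fX: "finite X" using subD(1)[OF X] finite_RV finite_subset by blast
  have q0: "real q \<ge> 2" using q_ge2 by linarith
  \<comment> \<open>Multiplying by \<open>q\<close> avoids a division in the case where
    \<open>w\<close> cuts out a hyperplane of \<open>X\<close>.\<close>
  have 1: "real q * card {x \<in> X. dp x w = \<zero>} = (if w \<in> perp X then real q * card X else card X)" if w: "w \<in> RV" for w
  proof (cases "w \<in> perp X")
    case True
    then have "{x \<in> X. dp x w = \<zero>} = X" by (auto simp: perp_def)
    then show ?thesis using True by simp
  next
    case False
    then obtain y where "y \<in> X" "dp y w \<noteq> \<zero>" using w by (auto simp: perp_def)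
    from hyperplane[OF X w this] show ?thesis using False by (simp flip: of_nat_mult)
  qed
  have 2: "real q * card {w \<in> RV. dp x w = \<zero>} = (if x = v0 then real q * q ^ n else q ^ n)" if x: "x \<in> X" for x
  proof (cases "x = v0")
    case True
    have "{w \<in> RV. dp v0 w = \<zero>} = RV" by (auto simp: dp_v0)
    then show ?thesis using True by (simp add: card_RV)
  next
    case False
    then obtain y where y: "y \<in> RV" "dp y x \<noteq> \<zero>" using dp_nonzero[OF XR[OF x]] by blast
    have "{w \<in> RV. dp x w = \<zero>} = {w \<in> RV. dp w x = \<zero>}" using dp_comm[OF XR[OF x]] by auto
    then show ?thesis using hyperplane[OF sub_RV XR[OF x] y] False by (simp add: card_RV flip: of_nat_mult)
  qed
  have ci: "real (card {x \<in> A. Q x}) = (\<Sum>x\<in>A. if Q x then 1 else 0)" if "finite A" for A :: "(nat => 'f) set" and Q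
    using that by (simp add: sum.If_cases Int_def)
  have "(\<Sum>w\<in>RV. real q * card {x \<in> X. dp x w = \<zero>}) = (\<Sum>w\<in>RV. \<Sum>x\<in>X. real q * (if dp x w = \<zero> then 1 else 0))"
    by (simp only: ci[OF fX] sum_distrib_left)
  also have "\<dots> = (\<Sum>x\<in>X. real q * card {w \<in> RV. dp x w = \<zero>})"
    by (subst sum.swap) (simp only: ci[OF finite_RV] sum_distrib_left)
  finally have e: "(\<Sum>w\<in>RV. if w \<in> perp X then real q * card X else card X) = (\<Sum>x\<in>X. if x = v0 then real q * q ^ n else q ^ n)"
    using 1 2 by (simp cong: sum.cong)
  have pf: "finite (perp X)" using perp_RV finite_RV finite_subset by blast
  have "(\<Sum>w\<in>RV. if w \<in> perp X then real q * card X else card X) = (\<Sum>w\<in>perp X. real q * card X) + (\<Sum>w\<in>RV - perp X. real (card X))"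
    using perp_RV finite_RV by (simp add: sum.If_cases Int_absorb1 Diff_eq)
  also have "\<dots> = real (card (perp X)) * (q * card X) + (real (q ^ n) - card (perp X)) * card X"
    using perp_RV[of X] pf finite_RV card_mono[OF finite_RV perp_RV[of X]] by (simp add: card_Diff_subset card_RV of_nat_diff)
  finally have L: "(\<Sum>w\<in>RV. if w \<in> perp X then real q * card X else card X) = real (card (perp X)) * (q * card X) + (real (q ^ n) - card (perp X)) * card X" .
  have cX: "1 \<le> card X" using fX subD(2)[OF X] card_gt_0_iff[of X] by (auto simp: Suc_le_eq One_nat_def)
  have "(\<Sum>x\<in>X. if x = v0 then real q * q ^ n else q ^ n) = real q * q ^ n + (\<Sum>x\<in>X - {v0}. real (q ^ n))"
    by (subst sum.remove[OF fX subD(2)[OF X]]) simp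
  also have "\<dots> = real q * q ^ n + (real (card X) - 1) * q ^ n"
    using fX subD(2)[OF X] cX by (simp add: card_Diff_singleton of_nat_diff)
  finally have "real (card (perp X)) * (q * card X) + (real (q ^ n) - card (perp X)) * card X = real q * q ^ n + (real (card X) - 1) * q ^ n"
    using e L by simp
  then have "(real (card X) * card (perp X)) * (real q - 1) = real q ^ n * (real q - 1)" by (simp add: algebra_simps)
  then have "real (card X) * card (perp X) = real q ^ n" using q0 by simp
  then show ?thesis by (simp flip: of_nat_mult of_nat_power)
qed

text \<open>One inclusion is immediate, and two applications of \<open>card_perp\<close> give equal
  sizes.\<close>

lemma perp_perp: assumes X: "sub X" shows "perp (perp X) = X"
proof (rule card_subset_eq[symmetric])
  have XR: "X \<subseteq> RV" by (rule subD(1)[OF X])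
  show "finite (perp (perp X))" using perp_RV finite_RV finite_subset by blast
  show "X \<subseteq> perp (perp X)" using XR dp_comm by (auto simp: perp_def subset_iff)
  have "card X * card (perp X) = card (perp X) * card (perp (perp X))"
    using card_perp[OF X] card_perp[OF sub_perp[OF XR]] by simp
  moreover have "card (perp X) \<noteq> 0" using card_perp[OF X] q_ge2 by (metis mult_is_0 not_numeral_le_zero power_eq_0_iff)
  ultimately show "card X = card (perp (perp X))" by simp
qed

definition SS :: "nat => (nat => 'f) set set" where "SS k = {W. sub W \<and> card W = q ^ k}"

lemma finite_SS: "finite (SS k)"
  by (rule finite_subset[of _ "Pow RV"]) (use finite_RV in \<open>auto simp: SS_def sub_iff\<close>)

lemma SS_D: "W \<in> SS k ==> sub W" "W \<in> SS k ==> card W = q ^ k" by (auto simp: SS_def)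

lemma q_pow_inj: "q ^ a = q ^ b ==> a = b" using q_ge2 by (simp add: power_inject_exp)

lemma SS_perp: assumes X: "X \<in> SS k" and k: "k \<le> n" shows "perp X \<in> SS (n - k)"
proof -
  have "q ^ k * card (perp X) = q ^ n" using card_perp[OF SS_D(1)[OF X]] SS_D(2)[OF X] by simp
  also have "\<dots> = q ^ k * q ^ (n - k)" using k by (simp flip: power_add)
  finally have "card (perp X) = q ^ (n - k)" using q_ge2 by simp
  then show ?thesis using sub_perp[OF subD(1)[OF SS_D(1)[OF X]]] by (simp add: SS_def)
qed

lemma card_SS: assumes m: "m \<le> n" shows "card (SS m) = card (SS (n - m))"
proof (rule bij_betw_same_card[OF bij_betw_byWitness[where f=perp and f'=perp]])
  show "perp ` SS m \<subseteq> SS (n - m)" using SS_perp m by auto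
  show "perp ` SS (n - m) \<subseteq> SS m" using SS_perp[of _ "n - m"] m by auto
qed (auto simp: perp_perp SS_D(1))

end

section \<open>Complementary dimensions give isomorphic permutation modules\<close>

lemma delta_span: assumes Y: "finite Y" shows "cfun.span (ga_single ` Y) = {f. \<forall>y. y \<notin> Y \<longrightarrow> f y = 0}"
proof (intro equalityI subsetI)
  fix f assume "f \<in> cfun.span (ga_single ` Y)"
  then show "f \<in> {f. \<forall>y. y \<notin> Y \<longrightarrow> f y = 0}"
    by (rule subsetD[OF cfun.span_minimal, rotated -1]) (auto simp: ga_single_def csubspace_iff)
next
  fix f :: "'a => complex" assume f: "f \<in> {f. \<forall>y. y \<notin> Y \<longrightarrow> f y = 0}"
  have "(\<lambda>x. \<Sum>y\<in>Y. f y * ga_single y x) \<in> cfun.span (ga_single ` Y)"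
    by (rule csubspace_comb[OF cfun.subspace_span]) (auto intro: cfun.span_base)
  also have "(\<lambda>x. \<Sum>y\<in>Y. f y * ga_single y x) = f"
  proof
    fix x
    have "(\<Sum>y\<in>Y. f y * ga_single y x) = (\<Sum>y\<in>Y. if x = y then f y else 0)" by (auto simp: ga_single_def intro: sum.cong)
    then show "(\<Sum>y\<in>Y. f y * ga_single y x) = f x" using Y f by simp
  qed
  finally show "f \<in> cfun.span (ga_single ` Y)" .
qed

lemma delta_indep: assumes Y: "finite Y" shows "cfun.independent (ga_single ` Y)" "inj_on ga_single Y"
proof -
  have ip: "ip Y (ga_single x) (ga_single y) = (if x = y then 1 else 0)" if "x \<in> Y" "y \<in> Y" for x y
  proof -
    have "ip Y (ga_single x) (ga_single y) = (\<Sum>z\<in>Y. if z = x then (if x = y then 1 else 0) else 0)"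
      unfolding ip_def by (rule sum.cong) (auto simp: ga_single_def)
    then show ?thesis using Y that by simp
  qed
  show "inj_on ga_single Y" by (rule inj_onI) (auto simp: ga_single_def fun_eq_iff split: if_splits)
  show "cfun.independent (ga_single ` Y)" by (rule orth_independent[of _ Y]) (auto simp: ip split: if_splits)
qed

text \<open>The indicator functions are a basis, so both function spaces have the same dimension and
  injectivity is enough.\<close>

lemma fun_space_surj:
  fixes T :: "('x => complex) => ('y => complex)"
  assumes lin: "Vector_Spaces.linear (\<lambda>c f x. c * f x) (\<lambda>c f x. c * f x) T"
    and X: "finite X" and Y: "finite Y" and XY: "card X = card Y"
    and T: "T ` {f. \<forall>x. x \<notin> X \<longrightarrow> f x = 0} \<subseteq> {f. \<forall>y. y \<notin> Y \<longrightarrow> f y = 0}"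
    and inj: "inj_on T {f. \<forall>x. x \<notin> X \<longrightarrow> f x = 0}"
  shows "T ` {f. \<forall>x. x \<notin> X \<longrightarrow> f x = 0} = {f. \<forall>y. y \<notin> Y \<longrightarrow> f y = 0}"
proof -
  have inj': "inj_on T (cfun.span (ga_single ` X))" using inj unfolding delta_span[OF X] .
  have i: "cfun.independent (T ` ga_single ` X)"
    by (rule cpair.linear_independent_injective_image[OF lin delta_indep(1)[OF X] inj'])
  have injs: "inj_on T (ga_single ` X)" by (rule inj_on_subset[OF inj' cfun.span_superset])
  have "cfun.span (T ` ga_single ` X) = cfun.span (ga_single ` Y)"
  proof (rule span_eq_if_card[OF i])
    show "T ` ga_single ` X \<subseteq> cfun.span (ga_single ` Y)"
      unfolding delta_span[OF Y]
      by (rule subset_trans[OF image_mono T]) (auto simp: ga_single_def)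
    show "card (T ` ga_single ` X) = card (ga_single ` Y)"
      using XY by (simp add: card_image[OF injs] card_image[OF delta_indep(2)] X Y)
  qed (use Y in simp)
  then show ?thesis unfolding cpair.linear_span_image[OF lin] delta_span[OF X] delta_span[OF Y] .
qed

section \<open>Kantor's inclusion matrix between subspaces of complementary dimensions\<close>

context fmat
begin

text \<open>Interpolates between the sum over all \<open>m\<close>-spaces inside \<open>Y\<close>
  (for \<open>S\<close> zero) and the single value \<open>f S\<close> (for \<open>S\<close> of
  dimension \<open>m\<close> inside \<open>Y\<close>).\<close>

definition hsum :: "nat => ((nat => 'f) set => complex) => (nat => 'f) set => (nat => 'f) set => complex" where
  "hsum m f S Y = (\<Sum>X\<in>{X \<in> SS m. S \<subseteq> X \<and> X \<subseteq> Y}. f X)"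

text \<open>A subspace \<open>X\<close> of \<open>Y\<close> lies in the section of \<open>Y\<close>
  cut out by \<open>\<phi>\<close> exactly if \<open>\<phi>\<close> is in \<open>perp X\<close>.
  Exchanging the sums therefore counts, for each \<open>X\<close>, the forms in
  \<open>perp X - perp Z\<close>.\<close>

lemma hsum_hyperplanes: assumes ZY: "Z \<subseteq> Y" and Y: "Y \<subseteq> RV"
  shows "(\<Sum>\<phi>\<in>perp S - perp Z. hsum m f S {y \<in> Y. dp y \<phi> = \<zero>})
    = (\<Sum>X\<in>{X \<in> SS m. S \<subseteq> X \<and> X \<subseteq> Y}. of_nat (card (perp X - perp Z)) * f X)"
proof -
  let ?XX = "{X \<in> SS m. S \<subseteq> X \<and> X \<subseteq> Y}"
  have fin: "finite ?XX" using finite_SS by auto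
  have finp: "finite (perp S - perp Z)" using perp_RV[of S] finite_RV finite_subset by blast
  have "hsum m f S {y \<in> Y. dp y \<phi> = \<zero>} = (\<Sum>X\<in>?XX. if \<phi> \<in> perp X then f X else 0)" if p: "\<phi> \<in> perp S - perp Z" for \<phi>
  proof -
    have "{X \<in> SS m. S \<subseteq> X \<and> X \<subseteq> {y \<in> Y. dp y \<phi> = \<zero>}} = {X \<in> ?XX. \<phi> \<in> perp X}"
      using p by (auto simp: perp_def)
    then show ?thesis unfolding hsum_def by (simp only: sum.inter_filter[OF fin])
  qed
  then have "(\<Sum>\<phi>\<in>perp S - perp Z. hsum m f S {y \<in> Y. dp y \<phi> = \<zero>}) = (\<Sum>\<phi>\<in>perp S - perp Z. \<Sum>X\<in>?XX. if \<phi> \<in> perp X then f X else 0)"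
    by simp
  also have "\<dots> = (\<Sum>X\<in>?XX. \<Sum>\<phi>\<in>perp S - perp Z. if \<phi> \<in> perp X then f X else 0)" by (rule sum.swap)
  also have "\<dots> = (\<Sum>X\<in>?XX. of_nat (card (perp X - perp Z)) * f X)"
  proof (rule sum.cong[OF refl])
    fix X assume X: "X \<in> ?XX"
    have "{\<phi> \<in> perp S - perp Z. \<phi> \<in> perp X} = perp X - perp Z" using perp_anti[of S X] X by auto
    then show "(\<Sum>\<phi>\<in>perp S - perp Z. if \<phi> \<in> perp X then f X else 0) = of_nat (card (perp X - perp Z)) * f X"
      by (simp only: sum.inter_filter[OF finp, symmetric]) simp
  qed
  finally show ?thesis .
qed

lemma hyperplane_SS: assumes Y: "Y \<in> SS (Suc k)" and p: "\<phi> \<in> RV" "\<phi> \<notin> perp Y"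
  shows "{y \<in> Y. dp y \<phi> = \<zero>} \<in> SS k"
proof -
  obtain y where "y \<in> Y" "dp y \<phi> \<noteq> \<zero>" using p by (auto simp: perp_def)
  from hyperplane[OF SS_D(1)[OF Y] p(1) this] have "card {y \<in> Y. dp y \<phi> = \<zero>} = q ^ k" using SS_D(2)[OF Y] q_ge2 by simp
  then show ?thesis using sub_ker[OF SS_D(1)[OF Y] p(1)] by (simp add: SS_def)
qed

text \<open>The vanishing of \<open>hsum m f S Y\<close> is propagated to larger \<open>Y\<close>, and then to larger \<open>S\<close>, by summing over the
  hyperplanes of \<open>Y\<close> that contain \<open>S\<close> (but not the space that replaces \<open>S\<close>), until \<open>S = X\<close> and \<open>Y = RV\<close>.\<close>

lemma hsum_zero_imp_zero:
  assumes m: "2 * m \<le> n" and f: "\<And>Y. Y \<in> SS (n - m) ==> hsum m f {v0} Y = 0" and X: "X \<in> SS m"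
  shows "f X = 0"
proof -
  have SR: "Y \<subseteq> RV" if "Y \<in> SS k" for Y k using SS_D(1)[OF that] by (rule subD(1))
  have fperp: "finite (perp Z)" for Z using perp_RV[of Z] finite_RV finite_subset by blast
  have pR: "\<phi> \<in> RV" if "\<phi> \<in> perp Z" for \<phi> Z using that perp_RV by auto
  have base: "hsum m f {v0} Y = 0" if "n - m + i \<le> n" "Y \<in> SS (n - m + i)" for i Y
    using that
  proof (induction i arbitrary: Y)
    case (Suc i)
    let ?y = "Suc (n - m + i)"
    have Y: "Y \<in> SS ?y" and y: "?y \<le> n" using Suc.prems by auto
    have "hsum m f {v0} {y \<in> Y. dp y \<phi> = \<zero>} = 0" if "\<phi> \<in> perp {v0} - perp Y" for \<phi>
      using Suc.IH[OF _ hyperplane_SS[OF Y]] that pR y by auto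
    then have "0 = (\<Sum>X\<in>{X \<in> SS m. {v0} \<subseteq> X \<and> X \<subseteq> Y}. of_nat (card (perp X - perp Y)) * f X)"
      using hsum_hyperplanes[OF order.refl SR[OF Y], of m f "{v0}"] by simp
    also have "\<dots> = (\<Sum>X\<in>{X \<in> SS m. {v0} \<subseteq> X \<and> X \<subseteq> Y}. of_nat (q ^ (n - m) - q ^ (n - ?y)) * f X)"
    \<comment> \<open>The number of forms that vanish on \<open>X\<close> but not on
      \<open>Y\<close> depends on the dimensions only, so it factors out; it is nonzero because
      \<open>Y\<close> has dimension greater than \<open>m\<close>.\<close>
    proof (rule sum.cong[OF refl])
      fix X assume X: "X \<in> {X \<in> SS m. {v0} \<subseteq> X \<and> X \<subseteq> Y}"
      have "card (perp X - perp Y) = q ^ (n - m) - q ^ (n - ?y)"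
        using SS_D(2)[OF SS_perp[of X m]] SS_D(2)[OF SS_perp[OF Y y]] X m perp_anti[of X Y] fperp by (simp add: card_Diff_subset)
      then show "of_nat (card (perp X - perp Y)) * f X = of_nat (q ^ (n - m) - q ^ (n - ?y)) * f X" by simp
    qed
    also have "\<dots> = of_nat (q ^ (n - m) - q ^ (n - ?y)) * hsum m f {v0} Y" by (simp add: hsum_def sum_distrib_left)
    finally have "of_nat (q ^ (n - m) - q ^ (n - ?y)) * hsum m f {v0} Y = 0" by simp
    moreover have "q ^ (n - ?y) < q ^ (n - m)" by (rule power_strict_increasing) (use m q_ge2 y in auto)
    ultimately show ?case by (simp del: of_nat_diff)
  qed (use f in simp)
  have "hsum m f S Y = 0" if "S \<in> SS j" "Y \<in> SS y" "n - m + j \<le> y" "y \<le> n" "S \<subseteq> Y" for S Y j y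
    using that
  proof (induction j arbitrary: S Y y)
    case 0
    have "card S = 1" using SS_D(2)[OF 0(1)] by simp
    then have "S = {v0}" using subD(2)[OF SS_D(1)[OF 0(1)]] by (auto simp: card_1_singleton_iff One_nat_def)
    then show ?case using "0.prems" base[of "y - (n - m)" Y] by simp
  next
    case (Suc j)
    obtain y' where y': "y = Suc y'" using Suc.prems(3) by (cases y) auto
    note Z = Suc.prems(1) and ZR = SR[OF Suc.prems(1)] and Zs = SS_D(1)[OF Suc.prems(1)]
    have "card (perp S) < card RV"
    proof -
      have "Suc j \<le> n" using Suc.prems m by simp
      then have "card (perp S) = q ^ (n - Suc j)" using SS_D(2)[OF SS_perp[OF Z]] by simp
      also have "\<dots> < q ^ n" by (rule power_strict_increasing) (use \<open>Suc j \<le> n\<close> q_ge2 in auto)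
      finally show ?thesis by (simp add: card_RV)
    qed
    then obtain \<phi>0 where p0: "\<phi>0 \<in> RV" "\<phi>0 \<notin> perp S" using perp_RV[of S] by (metis less_irrefl subsetI subset_antisym)
    then obtain x where x: "x \<in> S" "dp x \<phi>0 \<noteq> \<zero>" by (auto simp: perp_def)
    \<comment> \<open>\<open>S\<close> is split into the hyperplane \<open>S0\<close> and the line
      of \<open>x\<close>, so a space that contains \<open>S0\<close> contains \<open>S\<close>
      exactly if it contains \<open>x\<close>.\<close>
    define S0 where "S0 = {s \<in> S. dp s \<phi>0 = \<zero>}"
    have S0: "S0 \<in> SS j" unfolding S0_def by (rule hyperplane_SS[OF Z p0])
    have S0S: "S0 \<subseteq> S" by (auto simp: S0_def)
    have u: "dp x \<phi>0 \<in> Units F" using dp_closed[of x \<phi>0] x p0 ZR by (auto simp: field_Units)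
    have dec: "\<exists>k\<in>S0. \<exists>c\<in>carrier F. s = vadd k (vsc c x)" if s: "s \<in> S" for s
    proof -
      have R: "s \<in> RV" "x \<in> RV" using s x ZR by auto
      let ?c = "dp s \<phi>0 \<otimes> inv (dp x \<phi>0)"
      have c: "?c \<in> carrier F" using dp_closed[OF R(1) p0(1)] u by simp
      let ?k = "vadd s (vsc (\<ominus> ?c) x)"
      have "?k \<in> S" using subD(3)[OF Zs s subD(4)[OF Zs _ x(1)]] c by simp
      moreover have "dp ?k \<phi>0 = \<zero>"
        using R c p0 u dp_closed[OF R(1) p0(1)] dp_closed[OF R(2) p0(1)] by (simp add: dp_add dp_sc v_RV l_minus m_assoc r_neg)
      moreover have "s = vadd ?k (vsc ?c x)"
        by (rule RV_eqI) (use R c in \<open>auto simp: v_RV v_entry RV_entry a_assoc l_minus l_neg\<close>)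
      ultimately show ?thesis using c by (auto simp: S0_def)
    qed
    have S0Y: "S0 \<subseteq> Y" using S0S Suc.prems(5) by auto
    have IH: "hsum m f S0 W = 0" if "W \<in> SS w" "n - m + j \<le> w" "w \<le> n" "S0 \<subseteq> W" for W w
      by (rule Suc.IH[OF S0 that])
    \<comment> \<open>A form outside \<open>perp S\<close> is also outside \<open>perp Y\<close>, so
      the section has dimension one less than \<open>Y\<close>; the bound \<open>n - m + j\<close>
      of the induction hypothesis leaves room for this.\<close>
    have "hsum m f S0 {y \<in> Y. dp y \<phi> = \<zero>} = 0" if p: "\<phi> \<in> perp S0 - perp S" for \<phi>
    proof (rule IH)
      show "{y \<in> Y. dp y \<phi> = \<zero>} \<in> SS y'"
        by (rule hyperplane_SS) (use Suc.prems(2) y' p pR perp_anti[OF Suc.prems(5)] in auto)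
      show "S0 \<subseteq> {y \<in> Y. dp y \<phi> = \<zero>}" using S0Y p by (auto simp: perp_def)
    qed (use Suc.prems y' in auto)
    then have "0 = (\<Sum>X\<in>{X \<in> SS m. S0 \<subseteq> X \<and> X \<subseteq> Y}. of_nat (card (perp X - perp S)) * f X)"
      using hsum_hyperplanes[OF Suc.prems(5) SR[OF Suc.prems(2)], of m f S0] by simp
    \<comment> \<open>A summand \<open>X\<close> that contains \<open>S\<close> admits no such form,
      and all others admit the same number. The sum is thus a nonzero multiple of
      \<open>hsum m f S0 Y - hsum m f S Y\<close>, and the first term vanishes by induction.\<close>
    also have "\<dots> = (\<Sum>X\<in>{X \<in> SS m. S0 \<subseteq> X \<and> X \<subseteq> Y}. of_nat (q ^ (n - m) - q ^ (n - m - 1)) * (f X - (if S \<subseteq> X then f X else 0)))"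
    proof (rule sum.cong[OF refl])
      fix X assume X: "X \<in> {X \<in> SS m. S0 \<subseteq> X \<and> X \<subseteq> Y}"
      then have Xm: "X \<in> SS m" by simp
      show "of_nat (card (perp X - perp S)) * f X = of_nat (q ^ (n - m) - q ^ (n - m - 1)) * (f X - (if S \<subseteq> X then f X else 0))"
      proof (cases "S \<subseteq> X")
        case True
        then have "perp X - perp S = {}" using perp_anti[of S X] by auto
        then have "card (perp X - perp S) = 0" by (simp only: card.empty)
        then show ?thesis using True by simp
      next
        case False
        have Xs: "sub X" by (rule SS_D(1)[OF Xm])
        have "x \<notin> X"
        proof
          assume xX: "x \<in> X"
          have "s \<in> X" if sS: "s \<in> S" for s
          proof -
            obtain k c where kc: "k \<in> S0" "c \<in> carrier F" "s = vadd k (vsc c x)" using dec[OF sS] by blast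
            then show "s \<in> X" using subD(3)[OF Xs _ subD(4)[OF Xs kc(2) xX]] X by auto
          qed
          then show False using False by auto
        qed
        then obtain \<phi> where p: "\<phi> \<in> perp X" "dp \<phi> x \<noteq> \<zero>"
          using perp_perp[OF Xs] x ZR by (auto simp: perp_def[of "perp X"])
        have XP: "card (perp X) = q ^ (n - m)" using SS_D(2)[OF SS_perp[OF Xm]] m by simp
        have "perp X \<inter> perp S = {y \<in> perp X. dp y x = \<zero>}"
        proof (intro equalityI subsetI)
          fix w assume "w \<in> perp X \<inter> perp S"
          then show "w \<in> {y \<in> perp X. dp y x = \<zero>}" using x ZR dp_comm[of x w] by (auto simp: perp_def)
        next
          fix w assume w: "w \<in> {y \<in> perp X. dp y x = \<zero>}"
          then have wR: "w \<in> RV" and xR: "x \<in> RV" and xw: "dp x w = \<zero>" using pR x ZR dp_comm[of x w] by auto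
          have "dp s w = \<zero>" if s: "s \<in> S" for s
          proof -
            obtain k c where kc: "k \<in> S0" "c \<in> carrier F" "s = vadd k (vsc c x)" using dec[OF s] by blast
            have kR: "k \<in> RV" using kc(1) S0S ZR by auto
            have "dp k w = \<zero>" using w X kc(1) by (auto simp: perp_def)
            then show ?thesis using kc(2) kR wR xR xw by (simp add: kc(3) dp_add dp_sc v_RV)
          qed
          then show "w \<in> perp X \<inter> perp S" using w wR by (auto simp: perp_def)
        qed
        then have "q ^ (n - m) = q * card (perp X \<inter> perp S)"
          using hyperplane[OF sub_perp[OF SR[OF Xm]] _ p(1), of x] p(2) XP x ZR by auto
        also have "q ^ (n - m) = q * q ^ (n - m - 1)"
        proof -
          have "n - m = Suc (n - m - 1)" using Suc.prems m by linarith
          then show ?thesis by (metis power_Suc)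
        qed
        finally have "card (perp X \<inter> perp S) = q ^ (n - m - 1)" using q_ge2 by simp
        then have "card (perp X - perp S) = q ^ (n - m) - q ^ (n - m - 1)" using XP fperp by (simp add: card_Diff_subset_Int)
        then show ?thesis using False by simp
      qed
    qed
    also have "\<dots> = of_nat (q ^ (n - m) - q ^ (n - m - 1)) * (hsum m f S0 Y - (\<Sum>X\<in>{X \<in> SS m. S0 \<subseteq> X \<and> X \<subseteq> Y}. if S \<subseteq> X then f X else 0))"
      by (simp only: hsum_def sum_distrib_left[symmetric] sum_subtractf)
    also have "(\<Sum>X\<in>{X \<in> SS m. S0 \<subseteq> X \<and> X \<subseteq> Y}. if S \<subseteq> X then f X else 0) = hsum m f S Y"
    proof -
      have "finite {X \<in> SS m. S0 \<subseteq> X \<and> X \<subseteq> Y}" using finite_SS by auto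
      moreover have "{X \<in> SS m. S0 \<subseteq> X \<and> X \<subseteq> Y} \<inter> {X. S \<subseteq> X} = {X \<in> SS m. S \<subseteq> X \<and> X \<subseteq> Y}" using S0S by auto
      ultimately show ?thesis by (simp add: hsum_def sum.If_cases)
    qed
    also have "hsum m f S0 Y = 0" by (rule IH[OF Suc.prems(2)]) (use Suc.prems S0Y in auto)
    finally have "of_nat (q ^ (n - m) - q ^ (n - m - 1)) * hsum m f S Y = 0" by simp
    moreover have "q ^ (n - m - 1) < q ^ (n - m)" by (rule power_strict_increasing) (use Suc.prems m q_ge2 in linarith)+
    ultimately show ?case by (simp del: of_nat_diff)
  qed
  moreover have RVn: "RV \<in> SS n" by (simp add: SS_def sub_RV card_RV)
  ultimately have "hsum m f X RV = 0" using X SR[OF X] m by auto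
  moreover have "{X' \<in> SS m. X \<subseteq> X' \<and> X' \<subseteq> RV} = {X}"
  proof -
    have "X' = X" if "X' \<in> SS m" "X \<subseteq> X'" for X'
      by (rule card_subset_eq[symmetric]) (use that SS_D(2) X SR[OF that(1)] finite_RV finite_subset in auto)
    then show ?thesis using X SR[OF X] by auto
  qed
  ultimately show ?thesis by (simp add: hsum_def)
qed

abbreviation "PM k \<equiv> G.perm_mod (SS k) img"

lemma img_SS: assumes W: "W \<in> SS k" and g: "g \<in> carrier G" shows "img W g \<in> SS k"
  using img_sub[OF SS_D(1)[OF W] G_MM[OF g]] card_img[OF subD(1)[OF SS_D(1)[OF W]] g] SS_D(2)[OF W] by (simp add: SS_def)

lemma PM_rep: "is_rep G (PM k) (\<lambda>h f W. if W \<in> SS k then f (img W (ginv h)) else 0)"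
proof (rule G.perm_rep)
  fix W assume W: "W \<in> SS k"
  have WR: "W \<subseteq> RV" by (rule subD(1)[OF SS_D(1)[OF W]])
  show "img W \<one>\<^bsub>G\<^esub> = W" by (rule img_one[OF WR])
  show "img W g \<in> SS k" if "g \<in> carrier G" for g by (rule img_SS[OF W that])
  show "img (img W g) h = img W (g \<bullet> h)" if "g \<in> carrier G" "h \<in> carrier G" for g h by (rule img_G[OF WR that])
qed

lemma img_mono_iff: assumes "W \<subseteq> RV" "Y \<subseteq> RV" "g \<in> carrier G" shows "img W g \<subseteq> img Y g \<longleftrightarrow> W \<subseteq> Y"
proof
  assume i: "img W g \<subseteq> img Y g"
  show "W \<subseteq> Y"
  proof
    fix w assume w: "w \<in> W"
    then obtain y where y: "y \<in> Y" "w \<star> g = y \<star> g" using i by (auto simp: img_def)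
    then have "w = y" using vm_inj[OF assms(3)] y w assms(1,2) unfolding inj_on_def by blast
    then show "w \<in> Y" using y by simp
  qed
qed (auto simp: img_def)

text \<open>\<open>GL\<close> preserves inclusion of subspaces, so the inclusion map commutes with
  the action. It is injective by \<open>hsum_zero_imp_zero\<close>, and the two spaces have equal
  dimension by \<open>card_SS\<close>.\<close>

lemma PM_compl: assumes m: "2 * m \<le> n" shows "mod_iso G (PM m) (PM (n - m))"
proof -
  \<comment> \<open>Every subspace contains \<open>v0\<close>, so this sums \<open>f\<close> over
    all \<open>m\<close>-spaces inside \<open>Y\<close>.\<close>
  define T where "T = (\<lambda>f Y. if Y \<in> SS (n - m) then hsum m f {v0} Y else 0)"
  have MS: "mspace (PM k) = {f. \<forall>W. W \<notin> SS k \<longrightarrow> f W = 0}" for k by (simp add: G.perm_mod_def)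
  have add: "T (f + g) = T f + T g" for f g by (auto simp: T_def hsum_def fun_eq_iff sum.distrib)
  have sc: "T (\<lambda>x. c * f x) = (\<lambda>x. c * T f x)" for c f by (auto simp: T_def hsum_def fun_eq_iff sum_distrib_left)
  have lin: "Vector_Spaces.linear (\<lambda>c f x. c * f x) (\<lambda>c f x. c * f x) T"
    by unfold_locales (auto simp: add sc fun_eq_iff algebra_simps)
  have inj: "inj_on T (mspace (PM m))"
  proof (rule inj_onI)
    fix f g assume fg: "f \<in> mspace (PM m)" "g \<in> mspace (PM m)" "T f = T g"
    let ?h = "f + (\<lambda>x. - 1 * g x)"
    have "T ?h = (\<lambda>x. 0)" unfolding add sc fg(3) by (simp add: fun_eq_iff)
    then have "hsum m ?h {v0} Y = 0" if "Y \<in> SS (n - m)" for Y using that by (auto simp: T_def fun_eq_iff split: if_splits)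
    then have h: "?h X = 0" if "X \<in> SS m" for X using hsum_zero_imp_zero[OF m _ that] by blast
    show "f = g"
    proof
      fix X show "f X = g X" using h[of X] fg(1,2) by (cases "X \<in> SS m") (auto simp: MS)
    qed
  qed
  have TT: "T ` mspace (PM m) \<subseteq> mspace (PM (n - m))" by (auto simp: MS T_def)
  have sur: "T ` mspace (PM m) = mspace (PM (n - m))"
    using fun_space_surj[OF lin finite_SS finite_SS card_SS[of m]] TT inj m by (simp add: MS)
  show ?thesis
  proof (rule G.mod_iso_rep[OF PM_rep PM_rep, of T])
    show "bij_betw T (mspace (PM m)) (mspace (PM (n - m)))" using inj sur by (simp add: bij_betw_def)
    fix f h assume h: "h \<in> carrier G"
    have hi: "ginv h \<in> carrier G" using h by simp
    have R: "W \<subseteq> RV" if "W \<in> SS k" for W k using subD(1)[OF SS_D(1)[OF that]] .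
    have v0: "v0 \<in> W" if "W \<in> SS k" for W k using subD(2)[OF SS_D(1)[OF that]] .
    show "T (\<lambda>W. if W \<in> SS m then f (img W (ginv h)) else 0) = (\<lambda>W. if W \<in> SS (n - m) then T f (img W (ginv h)) else 0)"
    proof
      fix Y
      show "T (\<lambda>W. if W \<in> SS m then f (img W (ginv h)) else 0) Y = (if Y \<in> SS (n - m) then T f (img Y (ginv h)) else 0)"
      proof (cases "Y \<in> SS (n - m)")
        case True
        have "(\<Sum>X\<in>{X \<in> SS m. {v0} \<subseteq> X \<and> X \<subseteq> Y}. if X \<in> SS m then f (img X (ginv h)) else 0)
          = (\<Sum>X\<in>{X \<in> SS m. {v0} \<subseteq> X \<and> X \<subseteq> img Y (ginv h)}. f X)"
        proof (rule sum.reindex_bij_witness[where i="\<lambda>X. img X h" and j="\<lambda>X. img X (ginv h)"])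
          fix X assume X: "X \<in> {X \<in> SS m. {v0} \<subseteq> X \<and> X \<subseteq> Y}"
          then have Xm: "X \<in> SS m" by simp
          show "img (img X (ginv h)) h = X" by (rule img_inv(2)[OF R[OF Xm] h])
          show "img X (ginv h) \<in> {X \<in> SS m. {v0} \<subseteq> X \<and> X \<subseteq> img Y (ginv h)}"
            using X img_SS[OF Xm hi] v0[OF img_SS[OF Xm hi]] img_mono_iff[OF R[OF Xm] R[OF True] hi] by auto
        next
          fix X assume X: "X \<in> {X \<in> SS m. {v0} \<subseteq> X \<and> X \<subseteq> img Y (ginv h)}"
          then have Xm: "X \<in> SS m" by simp
          show "img (img X h) (ginv h) = X" by (rule img_inv(1)[OF R[OF Xm] h])
          then show "img X h \<in> {X \<in> SS m. {v0} \<subseteq> X \<and> X \<subseteq> Y}"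
            using X img_SS[OF Xm h] v0[OF img_SS[OF Xm h]] img_mono_iff[OF R[OF img_SS[OF Xm h]] R[OF True] hi] by auto
        qed auto
        then show ?thesis using True img_SS[OF True hi] by (simp add: T_def hsum_def)
      qed (simp add: T_def)
    qed
  qed (simp_all add: add sc)
qed

definition stab :: "(nat => 'f) set => 'f matrix set" where "stab W = {g \<in> carrier G. img W g = W}"

lemma PP_stab: "PP m = stab (Wst m)" using PP_img PP_iff by (auto simp: stab_def)

lemma stab_subgroup: assumes W: "W \<subseteq> RV" shows "subgroup (stab W) G"
proof (rule G.subgroupI)
  show "stab W \<noteq> {}" using img_one[OF W] by (auto simp: stab_def intro!: exI[of _ "\<one>\<^bsub>G\<^esub>"])
  show "ginv g \<in> stab W" if "g \<in> stab W" for g using that img_inv(1)[OF W, of g] by (simp add: stab_def)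
  show "g \<bullet> h \<in> stab W" if "g \<in> stab W" "h \<in> stab W" for g h using that img_G[OF W, of g h] by (simp add: stab_def)
qed (auto simp: stab_def)

end

context fchar
begin

text \<open>\<open>GL\<close> is transitive on the subspaces of a given dimension, since by
  \<open>sub_standard\<close> each of them is an image of the standard one.\<close>

lemma PM_iso: assumes W: "W \<in> SS k" shows "mod_iso G (PM k) \<lparr>mspace = G.LI (stab W), mact = ga_mult G\<rparr>"
proof (rule G.orbit_iso)
  have WR: "W \<subseteq> RV" by (rule subD(1)[OF SS_D(1)[OF W]])
  show "stab W \<subseteq> carrier G" by (auto simp: stab_def)
  have st: "\<exists>g\<in>carrier G. X = img (Wst k) g" if X: "X \<in> SS k" for X
  proof -
    have "card (Piv X) = k" using card_sub[OF SS_D(1)[OF X]] SS_D(2)[OF X] q_pow_inj by simp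
    then obtain s u where su: "s \<in> RStd n k" "u \<in> US F n (J_set n s)" "X = img (Wst k) (tab_perm F n s \<bullet> u)"
      using sub_standard[OF SS_D(1)[OF X]] by blast
    interpret tab F n \<theta> s k by (rule tab_RStd[OF su(1)])
    have "tab_perm F n s \<bullet> u \<in> carrier G" using d_G SJ.H_sub[of u] su(2) by (simp add: d_def J_def)
    then show ?thesis using su(3) by blast
  qed
  have Ws: "Wst k \<subseteq> RV" by (rule subD(1)[OF Wst_sub])
  obtain g0 where g0: "g0 \<in> carrier G" "W = img (Wst k) g0" using st[OF W] by blast
  show "img W ` carrier G = SS k"
  proof (intro equalityI subsetI)
    fix X assume "X \<in> SS k"
    then obtain g where g: "g \<in> carrier G" "X = img (Wst k) g" using st by blast
    have "X = img W (ginv g0 \<bullet> g)"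
      using img_G[OF WR G.inv_closed[OF g0(1)] g(1)] img_inv(1)[OF Ws g0(1)] g(2) g0(2) by simp
    then show "X \<in> img W ` carrier G" using g0 g by simp
  qed (use img_SS[OF W] in auto)
  fix g h assume gh: "g \<in> carrier G" "h \<in> carrier G"
  show "img (img W g) h = img W (g \<bullet> h)" by (rule img_G[OF WR gh])
  have "img W (g \<bullet> ginv h) = img (img W g) (ginv h)" using img_G[OF WR gh(1), of "ginv h"] gh by simp
  moreover have "img (img W g) (ginv h) = W \<longleftrightarrow> img W g = img W h"
    using img_inv(1)[OF WR gh(2)] img_inv(2)[OF img_RV[OF WR G_MM[OF gh(1)]] gh(2)] by metis
  ultimately show "img W g = img W h \<longleftrightarrow> g \<bullet> ginv h \<in> stab W" using gh by (simp add: stab_def)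
qed

lemma M_lam_PM: assumes m: "m \<le> n" shows "mod_iso G (PM m) (M_lam F n m)"
proof -
  have "P_bar F n m = (\<lambda>g. if g \<in> stab (Wst m) then 1 else 0)" by (simp add: P_bar_def PP_stab[symmetric] PP_def)
  then have "M_lam F n m = \<lparr>mspace = G.LI (stab (Wst m)), mact = ga_mult G\<rparr>"
    using G.cyclic_LI[OF stab_subgroup[OF subD(1)[OF Wst_sub]]] by (simp add: M_lam_def cyclic_mod_def)
  moreover have "Wst m \<in> SS m" using Wst_sub card_Wst[OF m] by (simp add: SS_def)
  ultimately show ?thesis using PM_iso by simp
qed

text \<open>An element outside \<open>P\<close> moves some member \<open>W\<close> of the flag. The
  stabilizer of \<open>W\<close> is then a proper parabolic subgroup containing \<open>P\<close>, so
  by maximality it equals \<open>P\<close>.\<close>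

lemma maximal_parabolic_iso:
  assumes P: "maximal_parabolic F n P"
  shows "\<exists>m. 1 \<le> m \<and> m \<le> n - m \<and> mod_iso G (coset_perm_mod G P) (M_lam F n m)"
proof -
  obtain Fl where Fl: "flag F n Fl" "P = {g \<in> carrier G. \<forall>W\<in>Fl. img W g = W}"
    using P by (auto simp: maximal_parabolic_def parabolic_def img_def)
  obtain W g where W: "W \<in> Fl" "g \<in> carrier G" "img W g \<noteq> W" using P Fl(2) unfolding maximal_parabolic_def by blast
  have sW: "sub W" using Fl(1) W(1) by (auto simp: flag_def)
  have "parabolic F n (stab W)" unfolding parabolic_def stab_def img_def
    by (rule exI[of _ "{W}"]) (use sW in \<open>auto simp: flag_def\<close>)
  moreover have "P \<subseteq> stab W" using Fl(2) W(1) by (auto simp: stab_def)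
  moreover have "stab W \<noteq> carrier G" using W(2,3) by (auto simp: stab_def)
  ultimately have Ps: "P = stab W" using P unfolding maximal_parabolic_def by blast
  define k where "k = card (Piv W)"
  have Wk: "W \<in> SS k" using card_sub[OF sW] sW by (simp add: SS_def k_def)
  have WR: "W \<subseteq> RV" by (rule subD(1)[OF sW])
  have gk: "img W g \<in> SS k" by (rule img_SS[OF Wk W(2)])
  have "k \<le> n" using card_mono[OF _ Piv_N[of W]] by (simp add: k_def)
  \<comment> \<open>\<open>W\<close> and \<open>img W g\<close> are distinct subspaces of the same
    dimension, which excludes the dimensions \<open>n\<close> and, below, \<open>0\<close>.\<close>
  moreover have "k \<noteq> n"
  proof
    assume "k = n"
    then have "X = RV" if "X \<in> SS k" for X
      by (intro card_subset_eq[OF finite_RV]) (use SS_D[OF that] subD(1) card_RV in auto)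
    then show False using Wk gk W(3) by metis
  qed
  moreover have "k \<noteq> 0"
  proof
    assume k0: "k = 0"
    have "X = {v0}" if "X \<in> SS k" for X
      using SS_D(2)[OF that] subD(2)[OF SS_D(1)[OF that]] k0 by (auto simp: card_1_singleton_iff One_nat_def)
    then show False using Wk gk W(3) by metis
  qed
  ultimately have k: "1 \<le> k" "k < n" by auto
  have PMk: "mod_iso G (coset_perm_mod G P) (PM k)"
    unfolding Ps by (rule mod_iso_trans[OF G.coset_iso[OF stab_subgroup[OF WR]] mod_iso_sym[OF PM_iso[OF Wk]]])
  show ?thesis
  proof (cases "k \<le> n - k")
    case True
    then show ?thesis using mod_iso_trans[OF PMk M_lam_PM] k by auto
  next
    case False
    \<comment> \<open>A partition has its second part at most its first, so a dimension above half
      of \<open>n\<close> is traded for the complementary one.\<close>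
    define m where "m = n - k"
    have m: "1 \<le> m" "m \<le> n - m" "2 * m \<le> n" "n - m = k" "m \<le> n" using False k by (auto simp: m_def)
    have "mod_iso G (PM k) (PM m)" using mod_iso_sym[OF PM_compl[OF m(3)]] m(4) by simp
    then have "mod_iso G (coset_perm_mod G P) (M_lam F n m)" using mod_iso_trans[OF PMk mod_iso_trans[OF _ M_lam_PM[OF m(5)]]] by blast
    then show ?thesis using m by blast
  qed
qed

end

section \<open>Isomorphism of orbit modules, structure of one tableau module, and the polynomial
  count\<close>

lemma fmatI: "finite_field F ==> fmat F"
  by (auto simp: finite_field_def fmat_def ffield_def ffield_axioms_def)

lemma fcharI: "finite_field F ==> nontrivial_add_character F \<theta> ==> fchar F \<theta>"
  by (simp add: fchar_def fchar_axioms_def fmatI)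

lemma (in tab) orbit_mod_hook:
  assumes "A \<in> VS F n (J_set n s)" "verge F n A"
  shows "hook F n \<theta> A" "mod_iso (U F n) (hook_mod F \<theta> n A) (orbit_mod F \<theta> n s A)"
  using assms verge_hook[of A] CO_iso[of A] by (auto simp: VG_def J_def)

text \<open>Two tableaux, possibly of different shapes, are compared through the ideals
  \<open>hook_mod\<close>, which depend on the matrix and not on the tableau.\<close>

lemma (in fchar) orbit_mod_iso_iff:
  assumes s: "s \<in> RStd n m" and t: "t \<in> RStd n m'"
    and A: "A \<in> VS F n (J_set n s)" "verge F n A" and B: "B \<in> VS F n (J_set n t)" "verge F n B"
  shows "mod_iso (U F n) (orbit_mod F \<theta> n s A) (orbit_mod F \<theta> n t B) \<longleftrightarrow> A = B"
proof -
  note a = tab.orbit_mod_hook[OF tab_RStd[OF s] A] and b = tab.orbit_mod_hook[OF tab_RStd[OF t] B]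
  show ?thesis
  proof
    assume "mod_iso (U F n) (orbit_mod F \<theta> n s A) (orbit_mod F \<theta> n t B)"
    then have "mod_iso (U F n) (hook_mod F \<theta> n A) (hook_mod F \<theta> n B)"
      using mod_iso_trans[OF a(2) mod_iso_trans[OF _ mod_iso_sym[OF b(2)]]] by blast
    then show "A = B" by (rule hook_mod_inj[OF a(1) b(1)])
  next
    assume "A = B"
    then show "mod_iso (U F n) (orbit_mod F \<theta> n s A) (orbit_mod F \<theta> n t B)"
      using mod_iso_trans[OF mod_iso_sym[OF a(2)]] b(2) by simp
  qed
qed

lemma (in tab) M_structure:
  "multiplicity_free (U F n) (M_tab F n s) \<and>
   (\<forall>S :: ('f matrix, 'f matrix) cg_mod.
      irreducible_constituent (U F n) (M_tab F n s) S \<longleftrightarrow>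
      (\<exists>A\<in>VS F n (J_set n s).
         main_condition_set n (supp F n A) \<and>
         fst ` supp F n A \<subseteq> second_row s \<and> snd ` supp F n A \<inter> second_row s = {} \<and>
         mod_iso (U F n) S (orbit_mod F \<theta> n s A))) \<and>
   (\<forall>A\<in>VS F n (J_set n s). main_condition_set n (supp F n A) \<longrightarrow>
      cfun.dim (mspace (orbit_mod F \<theta> n s A)) = card (orbit F \<theta> n s A)) \<and>
   (\<forall>A\<in>VS F n (J_set n s). \<forall>A'\<in>VS F n (J_set n s).
      main_condition_set n (supp F n A) \<and> supp F n A = supp F n A' \<longrightarrow>
      card (orbit F \<theta> n s A) = card (orbit F \<theta> n s A')) \<and>
   (\<forall>p. main_condition_set n p \<and> completely_hook_disconnected p \<and> fits p s \<longrightarrow>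
      card {orbit F \<theta> n s A | A. A \<in> VS F n (J_set n s) \<and> supp F n A = p \<and> verge F n A}
        = (card (carrier F) - 1) ^ card p)"
proof (intro conjI allI ballI impI)
  show "multiplicity_free (U F n) (M_tab F n s)" by (rule M_multiplicity_free)
  fix S :: "('f matrix, 'f matrix) cg_mod"
  have "A \<in> VG \<longleftrightarrow> A \<in> VS F n (J_set n s) \<and> main_condition_set n (supp F n A) \<and>
      fst ` supp F n A \<subseteq> second_row s \<and> snd ` supp F n A \<inter> second_row s = {}" for A
    using VG_main[of A] VJ_fits[of A] VG_D(1)[of A] unfolding J_def by blast
  then show "irreducible_constituent (U F n) (M_tab F n s) S \<longleftrightarrow>
      (\<exists>A\<in>VS F n (J_set n s).
         main_condition_set n (supp F n A) \<and>
         fst ` supp F n A \<subseteq> second_row s \<and> snd ` supp F n A \<inter> second_row s = {} \<and>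
         mod_iso (U F n) S (orbit_mod F \<theta> n s A))"
    unfolding M_constituents by blast
next
  fix A assume "A \<in> VS F n (J_set n s)" "main_condition_set n (supp F n A)"
  then show "cfun.dim (mspace (orbit_mod F \<theta> n s A)) = card (orbit F \<theta> n s A)"
    using CO_dim[of A] by (simp add: orbit_mod_eq orb_def J_def)
next
  fix A A' assume "A \<in> VS F n (J_set n s)" "A' \<in> VS F n (J_set n s)"
    and e: "main_condition_set n (supp F n A) \<and> supp F n A = supp F n A'"
  then have "A \<in> VG" "A' \<in> VG" using VG_main[of A] VG_main[of A'] by (auto simp: J_def)
  then show "card (orbit F \<theta> n s A) = card (orbit F \<theta> n s A')"
    using card_orb_VG[of A] card_orb_VG[of A'] e by (simp add: orb_def)
next
  fix p assume "main_condition_set n p \<and> completely_hook_disconnected p \<and> fits p s"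
  then show "card {orbit F \<theta> n s A | A. A \<in> VS F n (J_set n s) \<and> supp F n A = p \<and> verge F n A}
        = (card (carrier F) - 1) ^ card p" by (intro card_orbits) auto
qed

text \<open>The polynomial is fixed before the field is introduced, so one polynomial serves all
  finite fields on the type. The lidempotents need a character, which the statement does not supply;
  \<open>character_ex\<close> provides one.\<close>

lemma constituents_polynomial:
  assumes s: "s \<in> RStd n m"
  shows "\<exists>f :: nat poly. \<forall>F :: 'f ring. finite_field F \<longrightarrow>
         (\<forall>D. irreducible_decomposition (U F n) (M_tab F n s) D \<longrightarrow>
            card {W \<in> D. cfun.dim W = card (carrier F) ^ c} = poly f (card (carrier F) - 1))"
proof (intro exI allI impI)
  let ?f = "\<Sum>p\<in>{p. main_condition_set n p \<and> p \<subseteq> J_set n s \<and> card (neg_roots n - R_hat n p) = c}. monom 1 (card p) :: nat poly"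
  fix F :: "'f ring" and D
  assume F: "finite_field F" and D: "irreducible_decomposition (U F n) (M_tab F n s) D"
  interpret fmat F n by (rule fmatI[OF F])
  obtain \<theta> where \<theta>: "nontrivial_add_character F \<theta>" using character_ex by blast
  interpret fchar F n \<theta> by (rule fcharI[OF F \<theta>])
  interpret tab F n \<theta> s m by (rule tab_RStd[OF s])
  show "card {W \<in> D. cfun.dim W = q ^ c} = poly ?f (q - 1)"
    unfolding card_constituents[OF D] by (simp add: poly_sum poly_monom)
qed

theorem mainTheorem2:
  fixes n :: nat
  shows
   "(\<forall>(F :: 'f ring) \<theta> m m' s t A B.
        finite_field F \<and> nontrivial_add_character F \<theta> \<and>
        1 \<le> m \<and> m \<le> n - m \<and> 1 \<le> m' \<and> m' \<le> n - m' \<and>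
        s \<in> RStd n m \<and> t \<in> RStd n m' \<and>
        A \<in> VS F n (J_set n s) \<and> verge F n A \<and>
        B \<in> VS F n (J_set n t) \<and> verge F n B \<longrightarrow>
        (mod_iso (U F n) (orbit_mod F \<theta> n s A) (orbit_mod F \<theta> n t B) \<longleftrightarrow> A = B)) \<and>
    (\<forall>m s. 1 \<le> m \<and> m \<le> n - 1 \<and> s \<in> RStd n m \<longrightarrow>
      (\<forall>(F :: 'f ring) \<theta>. finite_field F \<and> nontrivial_add_character F \<theta> \<longrightarrow>
        multiplicity_free (U F n) (M_tab F n s) \<and>
        (\<forall>S :: ('f matrix, 'f matrix) cg_mod.
           irreducible_constituent (U F n) (M_tab F n s) S \<longleftrightarrow>
           (\<exists>A\<in>VS F n (J_set n s).
              main_condition_set n (supp F n A) \<and>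
              fst ` supp F n A \<subseteq> second_row s \<and> snd ` supp F n A \<inter> second_row s = {} \<and>
              mod_iso (U F n) S (orbit_mod F \<theta> n s A))) \<and>
        (\<forall>A\<in>VS F n (J_set n s). main_condition_set n (supp F n A) \<longrightarrow>
           cfun.dim (mspace (orbit_mod F \<theta> n s A)) = card (orbit F \<theta> n s A)) \<and>
        (\<forall>A\<in>VS F n (J_set n s). \<forall>A'\<in>VS F n (J_set n s).
           main_condition_set n (supp F n A) \<and> supp F n A = supp F n A' \<longrightarrow>
           card (orbit F \<theta> n s A) = card (orbit F \<theta> n s A')) \<and>
        (\<forall>p. main_condition_set n p \<and> completely_hook_disconnected p \<and> fits p s \<longrightarrow>
           card {orbit F \<theta> n s A | A. A \<in> VS F n (J_set n s) \<and> supp F n A = p \<and> verge F n A}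
             = (card (carrier F) - 1) ^ card p)) \<and>
      (\<forall>c :: nat. \<exists>f :: nat poly. \<forall>F :: 'f ring. finite_field F \<longrightarrow>
         (\<forall>D. irreducible_decomposition (U F n) (M_tab F n s) D \<longrightarrow>
            card {W \<in> D. cfun.dim W = card (carrier F) ^ c} = poly f (card (carrier F) - 1)))) \<and>
    (\<forall>F :: 'f ring. finite_field F \<longrightarrow>
      (\<forall>P. maximal_parabolic F n P \<longrightarrow>
         (\<exists>m. 1 \<le> m \<and> m \<le> n - m \<and>
            mod_iso (GL F n) (coset_perm_mod (GL F n) P) (M_lam F n m)))) \<and>
    (\<forall>(F :: 'f ring) \<theta> m. finite_field F \<and> nontrivial_add_character F \<theta> \<and>
        1 \<le> m \<and> m \<le> n - m \<longrightarrow>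
        mod_iso (U F n) (M_lam F n m)
          (direct_sum (fitting_sets n m) (\<lambda>p.
             direct_sum {A \<in> carrier (mat_ring F n). supp F n A = p} (\<lambda>A.
               mod_copies (fit_mult n m p) (hook_mod F \<theta> n A)))))"
proof (intro conjI, goal_cases)
  case 1
  show ?case
  proof (intro allI impI, elim conjE)
    fix F :: "'f ring" and \<theta> m m' s t A B
    assume h: "finite_field F" "nontrivial_add_character F \<theta>" "s \<in> RStd n m" "t \<in> RStd n m'"
      "A \<in> VS F n (J_set n s)" "verge F n A" "B \<in> VS F n (J_set n t)" "verge F n B"
    show "mod_iso (U F n) (orbit_mod F \<theta> n s A) (orbit_mod F \<theta> n t B) \<longleftrightarrow> A = B"
      by (rule fchar.orbit_mod_iso_iff[OF fcharI[OF h(1,2)] h(3-8)])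
  qed
next
  case 2
  show ?case (is "\<forall>m s. _ m s \<longrightarrow> (\<forall>F \<theta>. _ F \<theta> \<longrightarrow> ?Q m s F \<theta>) \<and> _ m s")
  proof (intro allI impI, elim conjE, intro conjI[OF _ allI[OF constituents_polynomial]] allI impI, elim conjE)
    fix m s and F :: "'f ring" and \<theta>
    assume "s \<in> RStd n m" "finite_field F" "nontrivial_add_character F \<theta>"
    then interpret tab F n \<theta> s m by (intro fchar.tab_RStd fcharI)
    show "?Q m s F \<theta>" by (rule M_structure)
  qed
next
  case 3
  show ?case
  proof (intro allI impI)
    fix F :: "'f ring" and P
    assume F: "finite_field F" and P: "maximal_parabolic F n P"
    interpret fmat F n by (rule fmatI[OF F])
    obtain \<theta> where "nontrivial_add_character F \<theta>" using character_ex by blast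
    then show "\<exists>m. 1 \<le> m \<and> m \<le> n - m \<and> mod_iso (GL F n) (coset_perm_mod (GL F n) P) (M_lam F n m)"
      using fchar.maximal_parabolic_iso[OF fcharI[OF F] P] by blast
  qed
next
  case 4
  show ?case by (intro allI impI, rule fchar.M_lam_iso, rule fcharI) auto
qed

end
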